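(* Let $m,n\ge1$, let $T$ be an $m$-linear Calderón–Zygmund operator on $\mathbb R^n$, and let $X$ be a Banach function space over $\mathbb R^n$ equipped with Lebesgue measure. Then there is a constant $c_{T,m,n}<\infty$, depending only on $T$, $m$ and $n$ (and not on $X$), such that for all $\vec f=(f_1,\dots,f_m)$ with each $f_i$ bounded and compactly supported, $$\|T(\vec f\,)\|_X\le c_{T,m,n}\sup_{\mathscr D,\mathcal S}\|\mathcal A_{\mathscr D,\mathcal S}(\vec{|f|})\|_X,$$ where $\vec{|f|}=(|f_1|,\dots,|f_m|)$ and the supremum is taken over arbitrary dyadic grids $\mathscr D$ and sparse families $\mathcal S$ of cubes from $\mathscr D$.
   Context: Banach function spaces are understood in the sense of Bennett–Sharpley; norms may take the value $+\infty$. An $m$-linear Calderón–Zygmund operator is an $m$-linear operator $T:S(\mathbb R^n)\times\dots\times S(\mathbb R^n)\to S'(\mathbb R^n)$ ($S$ = Schwartz space, $S'$ = tempered distributions) which, for some $1\le q_j<\infty$, extends to a bounded multilinear operator from $L^{q_1}\times\dots\times L^{q_m}$ to $L^q$, $\frac1q=\frac1{q_1}+\dots+\frac1{q_m}$, and for which there is a function $K$, defined off the diagonal $x=y_1=\dots=y_m$ in $(\mathbb R^n)^{m+1}$, with $$T(f_1,\dots,f_m)(x)=\int_{(\mathbb R^n)^m}K(x,y_1,\dots,y_m)f_1(y_1)\cdots f_m(y_m)\,dy_1\cdots dy_m$$ for all $x\notin\bigcap_{j=1}^m\operatorname{supp}f_j$, and, for some $A,\epsilon>0$, $$|K(y_0,y_1,\dots,y_m)|\le\frac{A}{\big(\sum_{k,l=0}^m|y_k-y_l|\big)^{mn}},$$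 $$|K(y_0,\dots,y_j,\dots,y_m)-K(y_0,\dots,y_j',\dots,y_m)|\le\frac{A|y_j-y_j'|^{\epsilon}}{\big(\sum_{k,l=0}^m|y_k-y_l|\big)^{mn+\epsilon}}$$ for all $0\le j\le m$ whenever $|y_j-y_j'|\le\frac12\max_{0\le k\le m}|y_j-y_k|$. A dyadic grid $\mathscr D$ is a collection of cubes such that: (i) every $Q\in\mathscr D$ has side length $2^k$ for some $k\in\mathbb Z$; (ii) $Q\cap R\in\{Q,R,\emptyset\}$ for all $Q,R\in\mathscr D$; (iii) for each $k\in\mathbb Z$ the cubes of side length $2^k$ in $\mathscr D$ form a partition of $\mathbb R^n$. A family of cubes $\mathcal S=\{Q_j^k\}$ is sparse if: (i) the cubes $Q_j^k$ are disjoint in $j$, with $k$ fixed; (ii) with $\Omega_k=\bigcup_jQ_j^k$ one has $\Omega_{k+1}\subset\Omega_k$; (iii) $|\Omega_{k+1}\cap Q_j^k|\le\frac12|Q_j^k|$. For a sparse family $\mathcal S=\{Q_j^k\}$ of cubes from $\mathscr D$, $\mathcal A_{\mathscr D,\mathcal S}(\vec f\,)(x)=\sum_{j,k}\Big(\prod_{i=1}^m(f_i)_{Q_j^k}\Big)\chi_{Q_j^k}(x)$, where $f_Q=\frac1{|Q|}\int_Qf$. *)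

theory Defs
  imports "HOL-Analysis.Analysis" "HOL-Library.Disjoint_Sets"
begin

section \<open>Banach function spaces\<close>

text \<open>
  The Bennett--Sharpley axioms for a Banach function norm \<open>\<rho>\<close> on a measure space \<open>M\<close>. The
  Banach function space it defines has norm \<open>\<parallel>f\<parallel> = \<rho> \<bar>f\<bar>\<close>, with value \<open>\<infinity>\<close> for measurable \<open>f\<close>
  outside the space. Only the values of \<open>\<rho>\<close> on measurable functions are constrained.
\<close>

definition banach_function_norm :: "'a measure \<Rightarrow> (('a \<Rightarrow> ennreal) \<Rightarrow> ennreal) \<Rightarrow> bool" where
  "banach_function_norm M \<rho> \<longleftrightarrow>
     (\<forall>f\<in>borel_measurable M. \<rho> f = 0 \<longleftrightarrow> (AE x in M. f x = 0)) \<and>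
     (\<forall>f\<in>borel_measurable M. \<forall>a::real. 0 \<le> a \<longrightarrow> \<rho> (\<lambda>x. ennreal a * f x) = ennreal a * \<rho> f) \<and>
     (\<forall>f\<in>borel_measurable M. \<forall>g\<in>borel_measurable M. \<rho> (\<lambda>x. f x + g x) \<le> \<rho> f + \<rho> g) \<and>
     (\<forall>f\<in>borel_measurable M. \<forall>g\<in>borel_measurable M. (AE x in M. g x \<le> f x) \<longrightarrow> \<rho> g \<le> \<rho> f) \<and>
     (\<forall>F f. (\<forall>k::nat. F k \<in> borel_measurable M) \<and> f \<in> borel_measurable M \<and>
        (AE x in M. incseq (\<lambda>k. F k x) \<and> (\<lambda>k. F k x) \<longlonglongrightarrow> f x) \<longrightarrow>
        incseq (\<lambda>k. \<rho> (F k)) \<and> (\<lambda>k. \<rho> (F k)) \<longlonglongrightarrow> \<rho> f) \<and>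
     (\<forall>E\<in>sets M. emeasure M E < \<infinity> \<longrightarrow> \<rho> (indicator E) < \<infinity>) \<and>
     (\<forall>E\<in>sets M. emeasure M E < \<infinity> \<longrightarrow>
        (\<exists>C::real. 0 < C \<and>
          (\<forall>f\<in>borel_measurable M. (\<integral>\<^sup>+x\<in>E. f x \<partial>M) \<le> ennreal C * \<rho> f)))"


section \<open>Schwartz functions and tempered distributions\<close>

definition partial_deriv :: "'n::finite \<Rightarrow> (real^'n \<Rightarrow> complex) \<Rightarrow> real^'n \<Rightarrow> complex" where
  "partial_deriv i f x = vector_derivative (\<lambda>t. f (x + t *\<^sub>R axis i 1)) (at 0)"

text \<open>
  Iterated partial derivatives are indexed by the list of coordinate directions, so
  \<open>foldr partial_deriv is f\<close> is \<open>\<partial>\<^sup>\<beta> f\<close> with \<open>\<beta> i\<close> the number of occurrences of \<open>i\<close> in \<open>is\<close>.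
  A function is smooth iff all of these are (totally) differentiable everywhere.
\<close>

definition weighted_deriv ::
    "('n::finite \<Rightarrow> nat) \<Rightarrow> 'n list \<Rightarrow> (real^'n \<Rightarrow> complex) \<Rightarrow> real^'n \<Rightarrow> complex" where
  "weighted_deriv \<alpha> is f x = (\<Prod>i\<in>UNIV. (x $ i) ^ \<alpha> i) *\<^sub>R foldr partial_deriv is f x"

definition schwartz_space :: "(real^'n::finite \<Rightarrow> complex) set" where
  "schwartz_space =
     {f. (\<forall>is x. foldr partial_deriv is f differentiable (at x)) \<and>
         (\<forall>\<alpha> is. bounded (range (weighted_deriv \<alpha> is f)))}"

definition schwartz_seminorm ::
    "('n::finite \<Rightarrow> nat) \<Rightarrow> 'n list \<Rightarrow> (real^'n \<Rightarrow> complex) \<Rightarrow> real" where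
  "schwartz_seminorm \<alpha> is f = (SUP x. norm (weighted_deriv \<alpha> is f x))"

definition schwartz_topology :: "(real^'n::finite \<Rightarrow> complex) topology" where
  "schwartz_topology = topology_generated_by
     {{\<psi>\<in>schwartz_space. schwartz_seminorm \<alpha> is (\<lambda>x. \<psi> x - \<phi> x) < e} | \<alpha> is \<phi> e.
        \<phi> \<in> schwartz_space \<and> 0 < e}"

definition tempered_distribution :: "((real^'n::finite \<Rightarrow> complex) \<Rightarrow> complex) \<Rightarrow> bool" where
  "tempered_distribution u \<longleftrightarrow>
     (\<forall>\<phi>\<in>schwartz_space. \<forall>\<psi>\<in>schwartz_space. \<forall>a b.
        u (\<lambda>x. a * \<phi> x + b * \<psi> x) = a * u \<phi> + b * u \<psi>) \<and>
     continuous_map schwartz_topology euclidean u"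

text \<open>The tempered distribution \<open>u\<close> is given by integration against the function \<open>g\<close>.\<close>

definition represented_by ::
    "((real^'n::finite \<Rightarrow> complex) \<Rightarrow> complex) \<Rightarrow> (real^'n \<Rightarrow> complex) \<Rightarrow> bool" where
  "represented_by u g \<longleftrightarrow>
     g \<in> borel_measurable lebesgue \<and>
     (\<forall>\<phi>\<in>schwartz_space. integrable lebesgue (\<lambda>x. g x * \<phi> x) \<and>
        u \<phi> = (LINT x|lebesgue. g x * \<phi> x))"


section \<open>Multilinear Calderon--Zygmund operators\<close>

text \<open>\<open>0 < p < \<infinity>\<close>; for \<open>p < 1\<close> the quantity \<open>Lp_norm p\<close> is only a quasi-norm.\<close>

definition Lp_space :: "real \<Rightarrow> ('a::euclidean_space \<Rightarrow> complex) set" where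
  "Lp_space p = {f \<in> borel_measurable lebesgue. integrable lebesgue (\<lambda>x. norm (f x) powr p)}"

definition Lp_norm :: "real \<Rightarrow> ('a::euclidean_space \<Rightarrow> complex) \<Rightarrow> real" where
  "Lp_norm p f = (LINT x|lebesgue. norm (f x) powr p) powr (1 / p)"

text \<open>
  \<open>m\<close>-tuples of functions are functions on a finite index type \<open>'m\<close> with \<open>m = CARD('m)\<close>.
  An operator from tuples of Schwartz functions to tempered distributions is a curried
  function: \<open>T f \<phi>\<close> is the pairing of the distribution \<open>T f\<close> with the test function \<open>\<phi>\<close>.
\<close>

definition schwartz_multilinear ::
    "(('m::finite \<Rightarrow> real^'n::finite \<Rightarrow> complex) \<Rightarrow> (real^'n \<Rightarrow> complex) \<Rightarrow> complex) \<Rightarrow> bool" where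
  "schwartz_multilinear T \<longleftrightarrow>
     (\<forall>f. (\<forall>j. f j \<in> schwartz_space) \<longrightarrow>
        tempered_distribution (T f) \<and>
        (\<forall>j. \<forall>g\<in>schwartz_space. \<forall>a b. \<forall>\<phi>\<in>schwartz_space.
           T (f(j := \<lambda>x. a * f j x + b * g x)) \<phi> = a * T f \<phi> + b * T (f(j := g)) \<phi>))"

text \<open>
  \<open>U\<close> extends \<open>T\<close> to a bounded multilinear operator
  \<open>L\<^sup>q\<^sup>1 \<times> \<dots> \<times> L\<^sup>q\<^sup>m \<rightarrow> L\<^sup>r\<close>, \<open>1/r = \<Sum>\<^sub>j 1/q\<^sub>j\<close>. Elements of the \<open>L\<^sup>p\<close> spaces are represented
  by functions, so \<open>U\<close> is multilinear up to null sets. Since \<open>r < 1\<close> is possible, agreement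
  with \<open>T\<close> on Schwartz functions means that \<open>U f\<close> is a function giving the distribution \<open>T f\<close>.
\<close>

definition bounded_extension_at ::
    "('m::finite \<Rightarrow> real) \<Rightarrow>
     (('m \<Rightarrow> real^'n::finite \<Rightarrow> complex) \<Rightarrow> (real^'n \<Rightarrow> complex) \<Rightarrow> complex) \<Rightarrow>
     (('m \<Rightarrow> real^'n \<Rightarrow> complex) \<Rightarrow> real^'n \<Rightarrow> complex) \<Rightarrow> bool" where
  "bounded_extension_at q T U \<longleftrightarrow>
     (let r = 1 / (\<Sum>j\<in>UNIV. 1 / q j) in
       (\<forall>f. (\<forall>j. f j \<in> Lp_space (q j)) \<longrightarrow>
          U f \<in> Lp_space r \<and>
          (\<forall>j. \<forall>g\<in>Lp_space (q j). \<forall>a b. AE x in lebesgue.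
             U (f(j := \<lambda>x. a * f j x + b * g x)) x = a * U f x + b * U (f(j := g)) x)) \<and>
       (\<exists>C. \<forall>f. (\<forall>j. f j \<in> Lp_space (q j)) \<longrightarrow>
          Lp_norm r (U f) \<le> C * (\<Prod>j\<in>UNIV. Lp_norm (q j) (f j))) \<and>
       (\<forall>f. (\<forall>j. f j \<in> schwartz_space) \<longrightarrow> represented_by (T f) (U f)))"

definition bounded_extension ::
    "(('m::finite \<Rightarrow> real^'n::finite \<Rightarrow> complex) \<Rightarrow> (real^'n \<Rightarrow> complex) \<Rightarrow> complex) \<Rightarrow>
     (('m \<Rightarrow> real^'n \<Rightarrow> complex) \<Rightarrow> real^'n \<Rightarrow> complex) \<Rightarrow> bool" where
  "bounded_extension T U \<longleftrightarrow> (\<exists>q. (\<forall>j. 1 \<le> q j) \<and> bounded_extension_at q T U)"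

text \<open>
  The \<open>m + 1\<close> points \<open>y\<^sub>0, y\<^sub>1, \<dots>, y\<^sub>m\<close> are indexed by \<open>'m option\<close>, with \<open>None\<close> for the index \<open>0\<close>.
  Values of \<open>K\<close> on the diagonal are irrelevant.
\<close>

definition kernel_dist :: "(real^'n::finite)^('k::finite) \<Rightarrow> real" where
  "kernel_dist y = (\<Sum>k\<in>UNIV. \<Sum>l\<in>UNIV. norm (y $ k - y $ l))"

definition CZ_kernel :: "((real^'n::finite)^('m::finite option) \<Rightarrow> complex) \<Rightarrow> bool" where
  "CZ_kernel K \<longleftrightarrow>
     (\<exists>A>0. \<exists>\<epsilon>>0. \<forall>y. (\<exists>k l. y $ k \<noteq> y $ l) \<longrightarrow>
        norm (K y) \<le> A / kernel_dist y ^ (CARD('m) * CARD('n)) \<and>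
        (\<forall>j y'. norm (y $ j - y') \<le> 1/2 * Max (range (\<lambda>k. norm (y $ j - y $ k))) \<longrightarrow>
           norm (K y - K (\<chi> k. if k = j then y' else y $ k))
             \<le> A * norm (y $ j - y') powr \<epsilon> /
                kernel_dist y powr (real (CARD('m) * CARD('n)) + \<epsilon>)))"

text \<open>
  The function giving \<open>T f\<close> is determined up to a null set, hence the \<open>AE\<close>.
\<close>

definition has_kernel ::
    "(('m::finite \<Rightarrow> real^'n::finite \<Rightarrow> complex) \<Rightarrow> (real^'n \<Rightarrow> complex) \<Rightarrow> complex) \<Rightarrow>
     ((real^'n)^('m option) \<Rightarrow> complex) \<Rightarrow> bool" where
  "has_kernel T K \<longleftrightarrow>
     (\<forall>f g. (\<forall>j. f j \<in> schwartz_space) \<and> represented_by (T f) g \<longrightarrow>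
        (AE x in lebesgue. x \<notin> (\<Inter>j. closure {z. f j z \<noteq> 0}) \<longrightarrow>
           g x = (LINT y|(lebesgue :: ((real^'n)^'m) measure).
                    K (\<chi> k. case k of None \<Rightarrow> x | Some j \<Rightarrow> y $ j) * (\<Prod>j\<in>UNIV. f j (y $ j)))))"

definition multilinear_CZ_operator ::
    "(('m::finite \<Rightarrow> real^'n::finite \<Rightarrow> complex) \<Rightarrow> (real^'n \<Rightarrow> complex) \<Rightarrow> complex) \<Rightarrow> bool" where
  "multilinear_CZ_operator T \<longleftrightarrow>
     schwartz_multilinear T \<and>
     (\<exists>U. bounded_extension T U) \<and>
     (\<exists>K. CZ_kernel K \<and> has_kernel T K)"


section \<open>Dyadic grids and sparse operators\<close>

text \<open>Cubes have sides parallel to the axes and are half-open, as usual for dyadic grids.\<close>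

definition cube :: "real^'n::finite \<Rightarrow> real \<Rightarrow> (real^'n) set" where
  "cube a l = {x. \<forall>i. a $ i \<le> x $ i \<and> x $ i < a $ i + l}"

definition dyadic_grid :: "(real^'n::finite) set set \<Rightarrow> bool" where
  "dyadic_grid D \<longleftrightarrow>
     (\<forall>Q\<in>D. \<exists>a. \<exists>k::int. Q = cube a (2 powi k)) \<and>
     (\<forall>Q\<in>D. \<forall>R\<in>D. Q \<inter> R \<in> {Q, R, {}}) \<and>
     (\<forall>k::int. partition_on UNIV {Q\<in>D. \<exists>a. Q = cube a (2 powi k)})"

text \<open>
  \<open>S k\<close> is the collection \<open>{Q\<^sub>j\<^sup>k : j}\<close> and \<open>\<Union>(S k)\<close> is \<open>\<Omega>\<^sub>k\<close>. Nonempty disjoint cubes are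
  distinct, so passing from the family \<open>j \<mapsto> Q\<^sub>j\<^sup>k\<close> to the set loses nothing.
\<close>

definition sparse_family :: "(nat \<Rightarrow> (real^'n::finite) set set) \<Rightarrow> bool" where
  "sparse_family S \<longleftrightarrow>
     (\<forall>k. disjoint (S k)) \<and>
     (\<forall>k. \<Union>(S (Suc k)) \<subseteq> \<Union>(S k)) \<and>
     (\<forall>k. \<forall>Q\<in>S k. emeasure lebesgue (\<Union>(S (Suc k)) \<inter> Q) \<le> emeasure lebesgue Q / 2)"

definition average :: "(real^'n::finite) set \<Rightarrow> (real^'n \<Rightarrow> ennreal) \<Rightarrow> ennreal" where
  "average Q g = (\<integral>\<^sup>+x\<in>Q. g x \<partial>lebesgue) / emeasure lebesgue Q"

text \<open>
  The sparse operator on tuples of nonnegative functions; it depends on the grid only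
  through the family \<open>S\<close>. The sum may be infinite.
\<close>

definition sparse_operator ::
    "(nat \<Rightarrow> (real^'n::finite) set set) \<Rightarrow> ('m::finite \<Rightarrow> real^'n \<Rightarrow> ennreal) \<Rightarrow>
     real^'n \<Rightarrow> ennreal" where
  "sparse_operator S g x =
     (\<Sum>\<^sub>\<infinity>(k, Q)\<in>Sigma UNIV S. (\<Prod>i\<in>UNIV. average Q (g i)) * indicator Q x)"

definition bounded_compactly_supported :: "(real^'n::finite \<Rightarrow> complex) \<Rightarrow> bool" where
  "bounded_compactly_supported f \<longleftrightarrow>
     f \<in> borel_measurable lebesgue \<and> bounded (range f) \<and> compact (closure {x. f x \<noteq> 0})"

end

theory Submission
  imports Defs
begin

text \<open>
  The theorem is a consequence of a pointwise statement: on a large dyadic cube, outside a set of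
  arbitrarily small measure, \<open>\<bar>T f\<bar>\<close> is at most a constant times a sum of boundedly many sparse
  operators applied to \<open>\<bar>f\<bar>\<close>. Once this is known, monotonicity and the triangle inequality of the
  norm bound the truncated function by the supremum on the right, and the Fatou property removes
  the truncation. The space \<open>X\<close> enters only in this last step, so the constant depends on \<open>T\<close>,
  \<open>m\<close> and \<open>n\<close> only.

  The pointwise bound comes from iterating one step (\<open>local_step\<close>). Given a dyadic cube \<open>Q\<close>, write
  \<open>Q*\<close> for a fixed dilate and \<open>f 1\<^sub>Q\<^sub>*\<close> for the truncated tuple. The weak endpoint inequality
  \<open>L\<^sup>1 \<times> \<dots> \<times> L\<^sup>1 \<rightarrow> L\<^sup>1\<^sup>/\<^sup>m\<^sup>,\<^sup>\<infinity>\<close> (\<open>weak_type\<close>) and the Hardy--Littlewood maximal inequality give an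
  open set \<open>G\<close> of small relative measure outside which \<open>T (f 1\<^sub>Q\<^sub>*)\<close> and the maximal functions of
  the \<open>f\<^sub>j 1\<^sub>Q\<^sub>*\<close> are controlled by the means of \<open>\<bar>f\<^sub>j\<bar>\<close> over \<open>Q*\<close>. Stopping at the maximal dyadic
  cubes \<open>P\<close> in which \<open>G\<close> has density above \<open>2\<^sup>-\<^sup>n\<^sup>-\<^sup>1\<close> covers \<open>Q \<inter> G\<close> by cubes of total measure at most
  \<open>\<bar>Q\<bar> / 2\<close>. On such a \<open>P\<close>, the difference \<open>T (f 1\<^sub>Q\<^sub>*) - T (f 1\<^sub>P\<^sub>*)\<close> is almost constant by the
  smoothness of the kernel (\<open>kernel_oscillation\<close>), and it is controlled by the means over \<open>Q*\<close> and
  \<open>P*\<close> at some point of \<open>P\<close> outside \<open>G\<close>.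
  What remains on \<open>P\<close> is \<open>T (f 1\<^sub>P\<^sub>*)\<close>, to which the step applies again. After \<open>N\<close> generations the
  uncontrolled set has measure at most \<open>(3/4)\<^sup>N \<bar>Q\<bar>\<close> (\<open>local_sparse_domination\<close>).

  The means so obtained are over dilates \<open>P*\<close>, which are not dyadic. By the one-third trick each
  \<open>P*\<close> lies in a cube of comparable size from one of \<open>2\<^sup>n\<close> shifted dyadic grids
  (\<open>star_in_third_grid\<close>). The resulting finite families satisfy a Carleson packing condition, and
  such a family is split, by its generation number modulo a fixed integer, into boundedly many
  sparse ones (\<open>layer_sparse\<close>, \<open>sum_sparse_operators\<close>).

  The weak endpoint inequality is proved with the multilinear Calderon--Zygmund decomposition of
  Grafakos and Torres. The operator acts through a bounded extension \<open>U\<close>, whereas the kernel formula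
  is given for Schwartz functions only. Every bounded function with bounded support is an almost
  everywhere limit of uniformly bounded Schwartz functions with supports in one box
  (\<open>schwartz_approximation\<close>), along which \<open>U\<close> converges on a subsequence; this transfers the kernel
  formula (\<open>kernel_representation\<close>) and shows that the extension is determined by \<open>T\<close>
  (\<open>bounded_extension_unique\<close>).
\<close>

section \<open>Smooth cutoffs and approximation by Schwartz functions\<close>

text \<open>
  The factor \<open>t\<^sup>-\<^sup>k\<close> makes the family closed under differentiation: the derivative of
  \<open>t\<^sup>-\<^sup>k exp (-1/t)\<close> is \<open>t\<^sup>-\<^sup>k\<^sup>-\<^sup>2 exp (-1/t) - k t\<^sup>-\<^sup>k\<^sup>-\<^sup>1 exp (-1/t)\<close>.
\<close>

definition flat_exp :: "nat \<Rightarrow> real \<Rightarrow> real" where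
  "flat_exp k t = (if t > 0 then inverse t ^ k * exp (- inverse t) else 0)"

lemma flat_exp_tendsto_0: "((\<lambda>t. flat_exp k t) \<longlongrightarrow> 0) (at 0)"
proof -
  have "((\<lambda>u::real. u ^ k / exp u) \<longlongrightarrow> 0) at_top"
    by (rule tendsto_power_div_exp_0)
  hence "((\<lambda>t::real. inverse t ^ k / exp (inverse t)) \<longlongrightarrow> 0) (at_right 0)"
    by (rule filterlim_compose[OF _ filterlim_inverse_at_top_right])
  moreover have "\<forall>\<^sub>F t in at_right (0::real). inverse t ^ k / exp (inverse t) = flat_exp k t"
    by (auto simp: eventually_at_filter flat_exp_def exp_minus divide_inverse)
  ultimately have R: "((\<lambda>t. flat_exp k t) \<longlongrightarrow> 0) (at_right 0)"
    by (rule Lim_transform_eventually)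
  have "\<forall>\<^sub>F t in at_left (0::real). 0 = flat_exp k t"
    by (auto simp: eventually_at_filter flat_exp_def)
  hence L: "((\<lambda>t. flat_exp k t) \<longlongrightarrow> 0) (at_left 0)"
    by (rule Lim_transform_eventually[rotated]) auto
  from L R show ?thesis by (simp add: filterlim_split_at)
qed

lemma DERIV_flat_exp:
  "(flat_exp k has_real_derivative - real k * flat_exp (Suc k) t + flat_exp (k + 2) t) (at t)"
proof -
  consider "t > 0" | "t < 0" | "t = 0" by linarith
  thus ?thesis
  proof cases
    case 1
    have "((\<lambda>t. inverse t ^ k * exp (- inverse t)) has_real_derivative
        - real k * flat_exp (Suc k) t + flat_exp (k + 2) t) (at t)"
    proof -
      have i: "(inverse has_real_derivative - (inverse t ^ 2)) (at t)"
        using 1 DERIV_inverse[of t UNIV] by (simp add: numeral_2_eq_2)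
      have D: "((\<lambda>t. inverse t ^ k * exp (- inverse t)) has_real_derivative
          (real k * (- (inverse t ^ 2)) * inverse t ^ (k - Suc 0)) * exp (- inverse t) +
          (exp (- inverse t) * - (- (inverse t ^ 2))) * inverse t ^ k) (at t)"
        using DERIV_mult[OF DERIV_power[OF i, of k] DERIV_chain2[OF DERIV_exp DERIV_minus[OF i]]]
        by (simp add: mult.assoc)
      have "real k * inverse t ^ 2 * inverse t ^ (k - Suc 0) = real k * inverse t ^ Suc k"
        by (cases k) (auto simp: power2_eq_square power_Suc)
      hence "(real k * (- (inverse t ^ 2)) * inverse t ^ (k - Suc 0)) * exp (- inverse t)
          = - real k * (inverse t ^ Suc k * exp (- inverse t))"
        by (simp only: minus_mult_left[symmetric] minus_mult_right[symmetric])
      moreover have "(exp (- inverse t) * - (- (inverse t ^ 2))) * inverse t ^ k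
          = inverse t ^ (k + 2) * exp (- inverse t)"
        by (simp add: power_add power2_eq_square)
      ultimately show ?thesis using 1 D by (simp only: flat_exp_def if_True)
    qed
    moreover have "\<forall>\<^sub>F s in nhds t. inverse s ^ k * exp (- inverse s) = flat_exp k s"
      using eventually_nhds_in_open[of "{0<..}" t] 1
      by (auto elim!: eventually_mono simp: flat_exp_def)
    ultimately show ?thesis
      by (subst (asm) DERIV_cong_ev[OF refl _ refl])
  next
    case 2
    have "((\<lambda>t::real. 0::real) has_real_derivative
        - real k * flat_exp (Suc k) t + flat_exp (k + 2) t) (at t)"
      using 2 by (auto simp: flat_exp_def)
    moreover have "\<forall>\<^sub>F s in nhds t. 0 = flat_exp k s"
      using eventually_nhds_in_open[of "{..<0}" t] 2
      by (auto elim!: eventually_mono simp: flat_exp_def)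
    ultimately show ?thesis
      by (subst (asm) DERIV_cong_ev[OF refl _ refl])
  next
    case 3
    have "\<forall>\<^sub>F s in at 0. flat_exp (Suc k) s = (flat_exp k (0 + s) - flat_exp k 0) / s"
      by (auto simp: eventually_at_filter flat_exp_def divide_inverse)
    hence "((\<lambda>s. (flat_exp k (0 + s) - flat_exp k 0) / s) \<longlongrightarrow> 0) (at 0)"
      by (rule Lim_transform_eventually[OF flat_exp_tendsto_0])
    thus ?thesis using 3 by (simp add: DERIV_def flat_exp_def)
  qed
qed

text \<open>
  An algebra of smooth functions generated by the coordinates. It is closed under directional
  derivatives by the rules alone (\<open>smooth_fun_has_derivative\<close>), so that iterated derivatives of
  explicitly built functions exist and are continuous without any computation.
\<close>

inductive_set smooth_fun :: "(real^'n::finite \<Rightarrow> real) set" where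
  const: "(\<lambda>x. c) \<in> smooth_fun"
| coord: "(\<lambda>x. x $ i) \<in> smooth_fun"
| add: "f \<in> smooth_fun \<Longrightarrow> g \<in> smooth_fun \<Longrightarrow> (\<lambda>x. f x + g x) \<in> smooth_fun"
| mult: "f \<in> smooth_fun \<Longrightarrow> g \<in> smooth_fun \<Longrightarrow> (\<lambda>x. f x * g x) \<in> smooth_fun"
| inv: "f \<in> smooth_fun \<Longrightarrow> (\<And>x. f x \<noteq> 0) \<Longrightarrow> (\<lambda>x. inverse (f x)) \<in> smooth_fun"
| flat: "f \<in> smooth_fun \<Longrightarrow> (\<lambda>x. flat_exp k (f x)) \<in> smooth_fun"

lemma smooth_fun_minus: "f \<in> smooth_fun \<Longrightarrow> (\<lambda>x. - f x) \<in> smooth_fun"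
  using smooth_fun.mult[OF smooth_fun.const[of "-1"], of f] by simp

lemma smooth_fun_diff: "f \<in> smooth_fun \<Longrightarrow> g \<in> smooth_fun \<Longrightarrow> (\<lambda>x. f x - g x) \<in> smooth_fun"
  using smooth_fun.add[of f "\<lambda>x. - g x"] smooth_fun_minus[of g] by simp

lemma smooth_fun_prod:
  "finite I \<Longrightarrow> (\<And>i. i \<in> I \<Longrightarrow> f i \<in> smooth_fun) \<Longrightarrow> (\<lambda>x. \<Prod>i\<in>I. f i x) \<in> smooth_fun"
  by (induction I rule: finite_induct) (auto intro: smooth_fun.intros)

lemma smooth_fun_sum:
  "finite I \<Longrightarrow> (\<And>i. i \<in> I \<Longrightarrow> f i \<in> smooth_fun) \<Longrightarrow> (\<lambda>x. \<Sum>i\<in>I. f i x) \<in> smooth_fun"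
  by (induction I rule: finite_induct) (auto intro: smooth_fun.intros)

lemma smooth_fun_has_derivative:
  assumes "f \<in> smooth_fun"
  shows "\<exists>f'. (\<forall>x. (f has_derivative f' x) (at x)) \<and> (\<forall>v. (\<lambda>x. f' x v) \<in> smooth_fun)"
  using assms
proof induction
  case (const c)
  show ?case by (rule exI[of _ "\<lambda>x v. 0"]) (auto intro: smooth_fun.const)
next
  case (coord i)
  show ?case
    by (rule exI[of _ "\<lambda>x v. v $ i"])
       (auto intro!: smooth_fun.const bounded_linear.has_derivative[OF bounded_linear_vec_nth] has_derivative_ident)
next
  case (add f g)
  then obtain f' g' where
    "\<forall>x. (f has_derivative f' x) (at x)" "\<forall>v. (\<lambda>x. f' x v) \<in> smooth_fun"
    "\<forall>x. (g has_derivative g' x) (at x)" "\<forall>v. (\<lambda>x. g' x v) \<in> smooth_fun" by blast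
  thus ?case
    by (intro exI[of _ "\<lambda>x v. f' x v + g' x v"])
       (auto intro!: has_derivative_add smooth_fun.add)
next
  case (mult f g)
  then obtain f' g' where
    "\<forall>x. (f has_derivative f' x) (at x)" "\<forall>v. (\<lambda>x. f' x v) \<in> smooth_fun"
    "\<forall>x. (g has_derivative g' x) (at x)" "\<forall>v. (\<lambda>x. g' x v) \<in> smooth_fun" by blast
  thus ?case using mult
    by (intro exI[of _ "\<lambda>x v. f x * g' x v + f' x v * g x"])
       (auto intro!: has_derivative_mult smooth_fun.intros)
next
  case (inv f)
  then obtain f' where
    f: "\<forall>x. (f has_derivative f' x) (at x)" "\<forall>v. (\<lambda>x. f' x v) \<in> smooth_fun" by blast
  show ?case
  proof (intro exI[of _ "\<lambda>x v. - (inverse (f x) * f' x v * inverse (f x))"] conjI allI)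
    fix x show "((\<lambda>x. inverse (f x)) has_derivative (\<lambda>v. - (inverse (f x) * f' x v * inverse (f x)))) (at x)"
      by (rule Deriv.has_derivative_inverse[OF \<open>f x \<noteq> 0\<close> f(1)[rule_format]])
  next
    fix v show "(\<lambda>x. - (inverse (f x) * f' x v * inverse (f x))) \<in> smooth_fun"
      using f inv by (intro smooth_fun_minus smooth_fun.intros) auto
  qed
next
  case (flat f k)
  then obtain f' where
    f: "\<forall>x. (f has_derivative f' x) (at x)" "\<forall>v. (\<lambda>x. f' x v) \<in> smooth_fun" by blast
  show ?case
  proof (intro exI[of _ "\<lambda>x v. f' x v * (- real k * flat_exp (Suc k) (f x) + flat_exp (k + 2) (f x))"] conjI allI)
    fix x
    show "((\<lambda>x. flat_exp k (f x)) has_derivative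
        (\<lambda>v. f' x v * (- real k * flat_exp (Suc k) (f x) + flat_exp (k + 2) (f x)))) (at x)"
      using DERIV_compose_FDERIV[OF DERIV_flat_exp, of f "f' x" x UNIV k] f by simp
  next
    fix v
    show "(\<lambda>x. f' x v * (- real k * flat_exp (Suc k) (f x) + flat_exp (k + 2) (f x))) \<in> smooth_fun"
      using f flat by (intro smooth_fun.intros) auto
  qed
qed

definition smooth_cfun :: "(real^'n::finite \<Rightarrow> complex) set" where
  "smooth_cfun = {\<lambda>x. Complex (u x) (v x) | u v. u \<in> smooth_fun \<and> v \<in> smooth_fun}"

lemma smooth_cfunI:
  "u \<in> smooth_fun \<Longrightarrow> v \<in> smooth_fun \<Longrightarrow> f = (\<lambda>x. Complex (u x) (v x)) \<Longrightarrow> f \<in> smooth_cfun"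
  unfolding smooth_cfun_def by (intro CollectI exI conjI)

lemma smooth_cfun_partial:
  assumes "f \<in> smooth_cfun"
  shows "f differentiable (at x)" "partial_deriv i f \<in> smooth_cfun"
proof -
  obtain u v where f: "f = (\<lambda>x. Complex (u x) (v x))" and uv: "u \<in> smooth_fun" "v \<in> smooth_fun"
    using assms by (auto simp: smooth_cfun_def)
  obtain u' v' where
    u: "\<And>x. (u has_derivative u' x) (at x)" "\<And>h. (\<lambda>x. u' x h) \<in> smooth_fun" and
    v: "\<And>x. (v has_derivative v' x) (at x)" "\<And>h. (\<lambda>x. v' x h) \<in> smooth_fun"
    using smooth_fun_has_derivative[OF uv(1)] smooth_fun_has_derivative[OF uv(2)] by blast
  have f2: "f = (\<lambda>x. of_real (u x) + \<i> * of_real (v x))"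
    unfolding f by (auto simp: Complex_eq)
  have D: "(f has_derivative (\<lambda>h. of_real (u' x h) + \<i> * of_real (v' x h))) (at x)" for x
    unfolding f2
    by (intro has_derivative_add has_derivative_mult_right has_derivative_of_real u v)
  thus "f differentiable (at x)" by (auto simp: differentiable_def)
  have "partial_deriv i f x = Complex (u' x (axis i 1)) (v' x (axis i 1))" for x
  proof -
    have "((\<lambda>t::real. x + t *\<^sub>R axis i 1) has_derivative (\<lambda>t. t *\<^sub>R axis i 1)) (at 0)"
      by (auto intro!: derivative_eq_intros)
    from has_derivative_compose[OF this, of f] D[of x]
    have "((\<lambda>t::real. f (x + t *\<^sub>R axis i 1)) has_derivative
      (\<lambda>t. of_real (u' x (t *\<^sub>R axis i 1)) + \<i> * of_real (v' x (t *\<^sub>R axis i 1)))) (at 0)"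
      by simp
    moreover have "u' x (t *\<^sub>R axis i 1) = t * u' x (axis i 1)" "v' x (t *\<^sub>R axis i 1) = t * v' x (axis i 1)" for t
      using linear_scale[OF has_derivative_linear[OF u(1)[of x]]] linear_scale[OF has_derivative_linear[OF v(1)[of x]]] by auto
    ultimately have "((\<lambda>t::real. f (x + t *\<^sub>R axis i 1)) has_vector_derivative
       Complex (u' x (axis i 1)) (v' x (axis i 1))) (at 0)"
      unfolding has_vector_derivative_def
      by (simp add: Complex_eq scaleR_conv_of_real algebra_simps)
    thus ?thesis unfolding partial_deriv_def by (rule vector_derivative_at)
  qed
  hence "partial_deriv i f = (\<lambda>x. Complex (u' x (axis i 1)) (v' x (axis i 1)))" by blast
  thus "partial_deriv i f \<in> smooth_cfun"
    unfolding smooth_cfun_def using u(2)[of "axis i 1"] v(2)[of "axis i 1"] by (intro CollectI exI conjI)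
qed

lemma smooth_cfun_foldr: "f \<in> smooth_cfun \<Longrightarrow> foldr partial_deriv is f \<in> smooth_cfun"
  by (induction "is") (auto simp: smooth_cfun_partial)

lemma partial_deriv_eq_0:
  assumes "open S" "\<And>x. x \<in> S \<Longrightarrow> f x = 0" "x \<in> S"
  shows "partial_deriv i f x = 0"
proof -
  have "\<forall>\<^sub>F t in nhds 0. x + t *\<^sub>R axis i 1 \<in> S"
  proof -
    have "open ((\<lambda>t::real. x + t *\<^sub>R axis i 1) -` S)"
      by (intro open_vimage assms(1) continuous_intros)
    from eventually_nhds_in_open[OF this, of 0] show ?thesis using assms(3) by simp
  qed
  hence "\<forall>\<^sub>F t in nhds 0. f (x + t *\<^sub>R axis i 1) = 0"
    by eventually_elim (use assms in auto)
  hence "((\<lambda>t. f (x + t *\<^sub>R axis i 1)) has_vector_derivative 0) (at 0) =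
     ((\<lambda>t. 0::complex) has_vector_derivative 0) (at (0::real))"
    using assms(2,3) by (intro has_vector_derivative_cong_ev) (auto elim: eventually_mono)
  thus ?thesis unfolding partial_deriv_def by (auto intro: vector_derivative_at)
qed

lemma foldr_partial_deriv_eq_0:
  assumes "open S" "\<And>x. x \<in> S \<Longrightarrow> f x = 0" "x \<in> S"
  shows "foldr partial_deriv is f x = 0"
  using assms(3) by (induction "is" arbitrary: x) (auto intro: partial_deriv_eq_0[OF assms(1)] assms(2))

text \<open>
  All iterated derivatives stay in the class and vanish outside the box, hence are bounded by
  compactness, and so are their products with monomials.
\<close>

lemma smooth_cfun_schwartz:
  assumes f: "f \<in> smooth_cfun" and 0: "\<And>x. x \<notin> cbox a b \<Longrightarrow> f x = 0"
  shows "f \<in> schwartz_space"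
  unfolding schwartz_space_def
proof (intro CollectI conjI allI)
  fix "is" x show "foldr partial_deriv is f differentiable at x"
    using smooth_cfun_partial(1)[OF smooth_cfun_foldr[OF f]] .
next
  fix \<alpha> "is"
  have "continuous_on UNIV (foldr partial_deriv is f)"
    using smooth_cfun_partial(1)[OF smooth_cfun_foldr[OF f]]
    by (intro differentiable_imp_continuous_on) (auto simp: differentiable_on_def intro: differentiable_at_withinI)
  hence "continuous_on UNIV (weighted_deriv \<alpha> is f)"
    unfolding weighted_deriv_def[abs_def] by (intro continuous_intros)
  hence "bounded (weighted_deriv \<alpha> is f ` cbox a b)"
    by (intro compact_imp_bounded compact_continuous_image) (auto intro: continuous_on_subset)
  moreover have "weighted_deriv \<alpha> is f x = 0" if "x \<notin> cbox a b" for x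
    unfolding weighted_deriv_def
    using foldr_partial_deriv_eq_0[of "- cbox a b" f x "is"] 0 that by (auto simp: open_Compl closed_cbox)
  hence "range (weighted_deriv \<alpha> is f) \<subseteq> insert 0 (weighted_deriv \<alpha> is f ` cbox a b)"
    by (smt (verit) image_iff imageI insertCI subsetI)
  ultimately show "bounded (range (weighted_deriv \<alpha> is f))"
    by (meson bounded_insert bounded_subset)
qed

definition smooth_step :: "real \<Rightarrow> real" where
  "smooth_step t = flat_exp 0 t * inverse (flat_exp 0 t + flat_exp 0 (1 - t))"

lemma flat_exp_nonneg: "flat_exp k t \<ge> 0" by (auto simp: flat_exp_def)

lemma smooth_step_denom: "flat_exp 0 t + flat_exp 0 (1 - t) > 0"
  by (cases "t > 0") (auto simp: flat_exp_def add_pos_nonneg)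

lemma smooth_step:
  "0 \<le> smooth_step t" "smooth_step t \<le> 1" "t \<le> 0 \<Longrightarrow> smooth_step t = 0" "t \<ge> 1 \<Longrightarrow> smooth_step t = 1"
proof -
  have *: "0 \<le> a * inverse (a + b)" "a * inverse (a + b) \<le> 1"
    if "0 \<le> a" "0 \<le> b" "0 < a + b" for a b :: real
    using that unfolding divide_inverse[symmetric] by simp_all
  show "0 \<le> smooth_step t" "smooth_step t \<le> 1"
    unfolding smooth_step_def
    using *[OF flat_exp_nonneg flat_exp_nonneg smooth_step_denom] by blast+
  show "t \<le> 0 \<Longrightarrow> smooth_step t = 0" "t \<ge> 1 \<Longrightarrow> smooth_step t = 1"
    using smooth_step_denom[of t] by (auto simp: smooth_step_def flat_exp_def)
qed

text \<open>
  The cutoff is supported in the closed box and equals one at distance \<open>1/k\<close> from its boundary, so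
  it tends to the indicator of the open box.
\<close>

definition box_cutoff :: "real^'n::finite \<Rightarrow> real^'n \<Rightarrow> nat \<Rightarrow> real^'n \<Rightarrow> real" where
  "box_cutoff a b k x =
     (\<Prod>i\<in>UNIV. smooth_step (real k * (x $ i - a $ i)) * smooth_step (real k * (b $ i - x $ i)))"

lemma box_cutoff_smooth: "box_cutoff a b k \<in> smooth_fun"
proof -
  have *: "f \<in> smooth_fun \<Longrightarrow> (\<lambda>x. smooth_step (f x)) \<in> smooth_fun" for f :: "real^'n \<Rightarrow> real"
    unfolding smooth_step_def
    by (intro smooth_fun.intros smooth_fun_diff) (auto simp: smooth_step_denom less_imp_neq[symmetric])
  show ?thesis unfolding box_cutoff_def[abs_def]
    by (intro smooth_fun_prod smooth_fun.mult * smooth_fun_diff smooth_fun.const smooth_fun.coord) auto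
qed

lemma box_cutoff_bounds: "0 \<le> box_cutoff a b k x" "box_cutoff a b k x \<le> 1"
  unfolding box_cutoff_def
  by (auto intro!: prod_nonneg prod_le_1 mult_nonneg_nonneg mult_le_one smooth_step)

lemma box_cutoff_outside:
  assumes "x \<notin> box a b" shows "box_cutoff a b k x = 0"
proof -
  obtain i where "x $ i \<le> a $ i \<or> b $ i \<le> x $ i" using assms by (auto simp: mem_box_cart not_less)
  hence "smooth_step (real k * (x $ i - a $ i)) * smooth_step (real k * (b $ i - x $ i)) = 0"
    by (auto simp: smooth_step(3) mult_nonneg_nonpos)
  thus ?thesis unfolding box_cutoff_def by (meson UNIV_I finite prod_zero)
qed

lemma box_cutoff_inside:
  assumes "\<And>i. real k * (x $ i - a $ i) \<ge> 1" "\<And>i. real k * (b $ i - x $ i) \<ge> 1"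
  shows "box_cutoff a b k x = 1"
  using assms unfolding box_cutoff_def by (auto simp: smooth_step(4))

lemma box_cutoff_eventually:
  assumes x: "x \<in> box a b"
  shows "\<exists>e>0. \<forall>\<^sub>F k in sequentially. \<forall>y\<in>ball x e. box_cutoff a b k y = 1"
proof -
  define d where "d = Min (range (\<lambda>i. min (x $ i - a $ i) (b $ i - x $ i)))"
  have dle: "d \<le> x $ i - a $ i" "d \<le> b $ i - x $ i" for i
  proof -
    have "d \<le> min (x $ i - a $ i) (b $ i - x $ i)" unfolding d_def by (rule Min_le) auto
    thus "d \<le> x $ i - a $ i" "d \<le> b $ i - x $ i" by auto
  qed
  have d: "d > 0" unfolding d_def using x by (subst Min_gr_iff) (auto simp: mem_box_cart)
  obtain k0 :: nat where k0: "real k0 * (d/2) > 1"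
    using reals_Archimedean3[of "d/2"] d by (meson half_gt_zero)
  have "\<forall>y\<in>ball x (d/2). box_cutoff a b k y = 1" if "k \<ge> k0" for k
  proof (intro ballI box_cutoff_inside)
    fix y i assume y: "y \<in> ball x (d/2)"
    have "\<bar>x $ i - y $ i\<bar> < d/2"
      using y component_le_norm_cart[of "x - y" i] by (simp add: dist_norm)
    hence "y $ i - a $ i \<ge> d/2" "b $ i - y $ i \<ge> d/2" using dle[of i] by linarith+
    moreover have "1 \<le> real k * (d/2)"
    proof -
      have "real k0 * (d/2) \<le> real k * (d/2)" using that d by (intro mult_right_mono) auto
      thus ?thesis using k0 by linarith
    qed
    ultimately show "1 \<le> real k * (y $ i - a $ i)" "1 \<le> real k * (b $ i - y $ i)"
      by (meson mult_left_mono of_nat_0_le_iff order_trans)+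
  qed
  hence "\<forall>\<^sub>F k in sequentially. \<forall>y\<in>ball x (d/2). box_cutoff a b k y = 1"
    by (auto simp: eventually_sequentially)
  with d show ?thesis by (intro exI[of _ "d/2"]) auto
qed

lemma real_polynomial_smooth: 
  fixes p :: "real^'n::finite \<Rightarrow> real"
  shows "real_polynomial_function p \<Longrightarrow> p \<in> smooth_fun"
proof (induction rule: real_polynomial_function.induct)
  case (linear f)
  have "f x = (\<Sum>i\<in>UNIV. x $ i * f (axis i 1))" for x
  proof -
    have "f x = f (\<Sum>i\<in>UNIV. x $ i *\<^sub>R axis i 1)"
      by (metis basis_expansion scalar_mult_eq_scaleR)
    also have "\<dots> = (\<Sum>i\<in>UNIV. x $ i * f (axis i 1))"
      using bounded_linear.linear[OF linear] by (simp add: linear_sum linear_scale)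
    finally show ?thesis .
  qed
  hence "f = (\<lambda>x. \<Sum>i\<in>UNIV. x $ i * f (axis i 1))" by blast
  moreover have "(\<lambda>x. \<Sum>i\<in>UNIV. x $ i * f (axis i 1)) \<in> smooth_fun"
    by (intro smooth_fun_sum smooth_fun.intros) auto
  ultimately show ?case by simp
qed (auto intro: smooth_fun.intros)

text \<open>
  A measurable function is an almost everywhere limit of continuous ones; clipping keeps them
  bounded by \<open>M\<close>, Stone--Weierstrass replaces them by polynomials on the box, and multiplication by
  cutoffs makes these Schwartz functions. A second cutoff makes the approximants vanish near points of
  an open box on which \<open>f\<close> vanishes; this is what lets the kernel formula, which holds only off the
  supports, pass to the limit.
\<close>

lemma schwartz_approximation:
  fixes f :: "real^'n::finite \<Rightarrow> complex"
  assumes f: "f \<in> borel_measurable lebesgue" and M: "\<And>x. norm (f x) \<le> M"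
    and 0: "\<And>x. x \<notin> cbox a b \<Longrightarrow> f x = 0" and P: "\<And>x. x \<in> box c d \<Longrightarrow> f x = 0"
  obtains F where "\<And>k. F k \<in> schwartz_space" "\<And>k x. norm (F k x) \<le> M + 1"
    "\<And>k x. x \<notin> cbox a b \<Longrightarrow> F k x = 0"
    "AE x in lborel. (\<lambda>k::nat. F k x) \<longlonglongrightarrow> f x"
    "\<And>x. x \<in> box c d \<Longrightarrow> \<exists>e>0. \<forall>\<^sub>F k in sequentially. \<forall>z\<in>ball x e. F k z = 0"
proof -
  have M0: "M \<ge> 0" using M[of undefined] norm_ge_zero order_trans by blast
  have "f measurable_on UNIV"
    using f by (subst measurable_on_iff_borel_measurable) (auto simp: lebesgue_on_UNIV_eq)
  then obtain N g where N: "negligible N" and g: "\<And>n. continuous_on UNIV (g n)"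
    and lim: "\<And>x. x \<notin> N \<Longrightarrow> (\<lambda>n. g n x) \<longlonglongrightarrow> f x"
    unfolding measurable_on_def by auto
  define g' where "g' = (\<lambda>n x. closest_point (cball 0 M) (g n x))"
  have c: "continuous_on UNIV (closest_point (cball (0::complex) M))"
    using M0 by (intro continuous_on_closest_point) auto
  have g'c: "continuous_on (cbox a b) (g' n)" for n
    unfolding g'_def by (intro continuous_on_compose2[OF c] continuous_on_subset[OF g]) auto
  have g'M: "norm (g' n x) \<le> M" for n x
    using closest_point_in_set[of "cball 0 M" "g n x"] M0 by (auto simp: g'_def)
  have lim': "(\<lambda>n. g' n x) \<longlonglongrightarrow> f x" if "x \<notin> N" for x
  proof -
    have "(\<lambda>n. g' n x) \<longlonglongrightarrow> closest_point (cball 0 M) (f x)"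
      unfolding g'_def
      by (rule isCont_tendsto_compose[OF _ lim[OF that]]) (use c in \<open>auto simp: continuous_on_eq_continuous_at\<close>)
    thus ?thesis using M[of x] by (simp add: closest_point_self)
  qed
  have "\<exists>p. polynomial_function p \<and> (\<forall>x\<in>cbox a b. norm (g' n x - p x) < 1 / (real n + 1))" for n
    by (rule Stone_Weierstrass_polynomial_function) (auto simp: g'c)
  then obtain p where p: "\<And>n. polynomial_function (p n)"
    and pg: "\<And>n x. x \<in> cbox a b \<Longrightarrow> norm (g' n x - p n x) < 1 / (real n + 1)" by metis
  have pRe: "(\<lambda>x. Re (p n x)) \<in> smooth_fun" "(\<lambda>x. Im (p n x)) \<in> smooth_fun" for n
    using p[of n] unfolding polynomial_function_def
    by (auto intro!: real_polynomial_smooth simp: o_def bounded_linear_Re bounded_linear_Im)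
  define \<eta> where "\<eta> = (\<lambda>k x. box_cutoff a b k x * (1 - box_cutoff c d k x))"
  have \<eta>S: "\<eta> k \<in> smooth_fun" for k
    unfolding \<eta>_def by (intro smooth_fun.intros smooth_fun_diff box_cutoff_smooth)
  have \<eta>b: "0 \<le> \<eta> k x" "\<eta> k x \<le> 1" for k x
    unfolding \<eta>_def using box_cutoff_bounds[of a b k x] box_cutoff_bounds[of c d k x]
    by (auto intro!: mult_nonneg_nonneg mult_le_one)
  define F where "F = (\<lambda>k x. \<eta> k x *\<^sub>R p k x)"
  have F0: "F k x = 0" if "x \<notin> box a b" for k x
    unfolding F_def \<eta>_def using box_cutoff_outside[OF that] by simp
  have F0c: "F k x = 0" if "x \<notin> cbox a b" for k x
    using F0[of x k] that subsetD[OF box_subset_cbox, of x a b] by argo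
  have "F k \<in> smooth_cfun" for k
  proof -
    have "F k = (\<lambda>x. Complex (\<eta> k x * Re (p k x)) (\<eta> k x * Im (p k x)))"
      unfolding F_def by (auto simp: complex_eq_iff)
    moreover have "(\<lambda>x. \<eta> k x * Re (p k x)) \<in> smooth_fun" "(\<lambda>x. \<eta> k x * Im (p k x)) \<in> smooth_fun"
      by (rule smooth_fun.mult[OF \<eta>S pRe(1)]) (rule smooth_fun.mult[OF \<eta>S pRe(2)])
    ultimately show ?thesis by (intro smooth_cfunI)
  qed
  hence S: "F k \<in> schwartz_space" for k
    using F0c by (intro smooth_cfun_schwartz[of _ a b])
  have FM: "norm (F k x) \<le> M + 1" for k x
  proof (cases "x \<in> cbox a b")
    case True
    have "norm (p k x) \<le> norm (g' k x) + norm (g' k x - p k x)" by (metis norm_minus_commute norm_triangle_sub)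
    also have "\<dots> \<le> M + 1 / (real k + 1)" using g'M pg[OF True, of k] by (intro add_mono) auto
    also have "\<dots> \<le> M + 1" by (simp add: field_simps)
    finally have "norm (p k x) \<le> M + 1" .
    thus ?thesis unfolding F_def using \<eta>b[of k x] mult_mono[of "\<eta> k x" 1 "norm (p k x)" "M + 1"] M0 by simp
  next
    case False
    hence "F k x = 0" by (rule F0c)
    thus ?thesis using M0 by simp
  qed
  have in_P: "\<exists>e>0. \<forall>\<^sub>F k in sequentially. \<forall>z\<in>ball x e. F k z = 0" if xcd: "x \<in> box c d" for x
  proof -
    obtain e where e: "e > 0" "\<forall>\<^sub>F k in sequentially. \<forall>y\<in>ball x e. box_cutoff c d k y = 1"
      using box_cutoff_eventually[OF xcd] by blast
    from e(2) have "\<forall>\<^sub>F k in sequentially. \<forall>y\<in>ball x e. F k y = 0"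
      by eventually_elim (auto simp: F_def \<eta>_def)
    with e(1) show ?thesis by blast
  qed
  have conv: "(\<lambda>k. F k x) \<longlonglongrightarrow> f x" if x: "x \<notin> N" "x \<notin> cbox a b - box a b" "x \<notin> cbox c d - box c d" for x
  proof -
    consider "x \<notin> cbox a b" | "x \<in> box c d" | "x \<in> box a b" "x \<notin> cbox c d" using x by blast
    thus ?thesis
    proof cases
      case 1
      hence "F k x = 0" for k by (rule F0c)
      thus ?thesis using 0[OF 1] by simp
    next
      case 2
      have "\<forall>\<^sub>F k in sequentially. F k x = 0"
        using in_P[OF 2] centre_in_ball[of x] by (auto elim!: eventually_mono)
      thus ?thesis using P[OF 2] by (simp add: tendsto_eventually)
    next
      case 3
      have cd: "box_cutoff c d k x = 0" for k
        using 3(2) subsetD[OF box_subset_cbox, of x c d] by (intro box_cutoff_outside) argo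
      have ev: "\<forall>\<^sub>F k in sequentially. \<eta> k x = 1"
        using box_cutoff_eventually[OF 3(1)] by (auto simp: \<eta>_def cd elim!: eventually_mono)
      have "(\<lambda>k. g' k x - p k x) \<longlonglongrightarrow> 0"
      proof (rule Lim_null_comparison)
        show "\<forall>\<^sub>F n in sequentially. norm (g' n x - p n x) \<le> 1 / (real n + 1)"
          using pg[of x] 3(1) subsetD[OF box_subset_cbox, of x a b] by (intro always_eventually) (auto intro: less_imp_le)
        show "(\<lambda>n. 1 / (real n + 1)) \<longlonglongrightarrow> 0" using LIMSEQ_inverse_real_of_nat by (simp add: inverse_eq_divide add.commute)
      qed
      from tendsto_diff[OF lim'[OF x(1)] this] have "(\<lambda>k. p k x) \<longlonglongrightarrow> f x" by simp
      moreover have "\<forall>\<^sub>F k in sequentially. p k x = F k x" using ev by eventually_elim (simp add: F_def)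
      ultimately show ?thesis by (rule Lim_transform_eventually)
    qed
  qed
  have "AE x in lebesgue. x \<notin> N \<and> x \<notin> cbox a b - box a b \<and> x \<notin> cbox c d - box c d"
    using N negligible_frontier_interval[of a b] negligible_frontier_interval[of c d]
    unfolding negligible_iff_null_sets by (intro AE_conjI AE_not_in)
  hence "AE x in lebesgue. (\<lambda>k. F k x) \<longlonglongrightarrow> f x" by (rule AE_mp) (use conv in auto)
  hence "AE x in lborel. (\<lambda>k. F k x) \<longlonglongrightarrow> f x" by (simp add: AE_completion_iff)
  from that[of F, OF S FM F0c this in_P] show ?thesis .
qed

section \<open>Lebesgue measure on products of Euclidean spaces\<close>

lemma prod_Basis_vec:
  fixes g :: "'a::euclidean_space ^ 'm::finite \<Rightarrow> 'b::comm_monoid_mult"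
  shows "prod g Basis = (\<Prod>j\<in>UNIV. \<Prod>b\<in>Basis. g (axis j b))"
proof -
  have *: "Basis = (\<lambda>(j, b). axis j b :: 'a^'m) ` (UNIV \<times> Basis)"
    by (auto simp: Basis_vec_def)
  have "inj_on (\<lambda>(j, b). axis j b :: 'a^'m) (UNIV \<times> Basis)"
    by (auto simp: inj_on_def axis_eq_axis)
  hence "prod g Basis = prod (g \<circ> (\<lambda>(j, b). axis j b)) (UNIV \<times> Basis)"
    unfolding * by (rule prod.reindex)
  also have "\<dots> = (\<Prod>j\<in>UNIV. \<Prod>b\<in>Basis. g (axis j b))"
    by (subst prod.cartesian_product) (auto intro!: prod.cong)
  finally show ?thesis .
qed

lemma mem_box_vec:
  fixes x :: "'a::euclidean_space ^ 'm::finite"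
  shows "x \<in> box l u \<longleftrightarrow> (\<forall>j. x $ j \<in> box (l $ j) (u $ j))"
  by (auto simp: mem_box Basis_vec_def inner_axis)

lemma measurable_vec_lambda [measurable]:
  "vec_lambda \<in> PiM UNIV (\<lambda>_::'m::finite. lborel :: 'a::euclidean_space measure) \<rightarrow>\<^sub>M borel"
proof (subst borel_measurable_euclidean_space, intro ballI)
  fix i :: "'a^'m" assume "i \<in> Basis"
  then obtain j b where "i = axis j b" by (auto simp: Basis_vec_def)
  thus "(\<lambda>x. vec_lambda x \<bullet> i) \<in> borel_measurable (PiM UNIV (\<lambda>_::'m. lborel :: 'a measure))"
    by (simp add: inner_axis)
qed

text \<open>
  The kernel formula integrates over \<open>(\<real>\<^sup>n)\<^sup>m\<close> as a Euclidean space. Identifying its Lebesgue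
  measure with the product of \<open>m\<close> copies makes Fubini's theorem available in the single variables.
\<close>

lemma lborel_vec:
  "(lborel :: ('a::euclidean_space ^ 'm::finite) measure) =
     distr (PiM UNIV (\<lambda>_. lborel)) borel vec_lambda"
proof (rule lborel_eqI)
  interpret product_sigma_finite "\<lambda>_::'m. lborel :: 'a measure" by standard
  fix l u :: "'a^'m" assume le: "\<And>b. b \<in> Basis \<Longrightarrow> l \<bullet> b \<le> u \<bullet> b"
  have le': "l $ j \<bullet> b \<le> u $ j \<bullet> b" if "b \<in> Basis" for j b
    using le[of "axis j b"] that by (auto simp: inner_axis Basis_vec_def)
  have "vec_lambda -` box l u = PiE UNIV (\<lambda>j. box (l $ j) (u $ j))"
    by (auto simp: mem_box_vec PiE_UNIV_domain Pi_iff)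
  hence "emeasure (distr (PiM UNIV (\<lambda>_. lborel)) borel vec_lambda) (box l u)
      = emeasure (PiM UNIV (\<lambda>_. lborel)) (PiE UNIV (\<lambda>j. box (l $ j) (u $ j)))"
    by (subst emeasure_distr) (auto simp: space_PiM)
  also have "\<dots> = (\<Prod>j\<in>UNIV. emeasure lborel (box (l $ j) (u $ j)))"
    by (subst emeasure_PiM) auto
  also have "\<dots> = (\<Prod>j\<in>UNIV. ennreal (\<Prod>b\<in>Basis. (u $ j - l $ j) \<bullet> b))"
    using le' by (intro prod.cong) (auto simp: emeasure_lborel_box)
  also have "\<dots> = ennreal (\<Prod>j\<in>UNIV. \<Prod>b\<in>Basis. (u $ j - l $ j) \<bullet> b)"
    using le' by (intro prod_ennreal) (auto intro!: prod_nonneg simp: inner_diff_left)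
  also have "(\<Prod>j\<in>UNIV. \<Prod>b\<in>Basis. (u $ j - l $ j) \<bullet> b) = (\<Prod>b\<in>Basis. (u - l) \<bullet> b)"
    by (subst prod_Basis_vec) (simp add: inner_axis)
  finally show "emeasure (distr (PiM UNIV (\<lambda>_. lborel)) borel vec_lambda) (box l u) =
      ennreal (\<Prod>b\<in>Basis. (u - l) \<bullet> b)" .
qed simp

lemma nn_integral_lborel_vec_prod:
  fixes h :: "'m::finite \<Rightarrow> 'a::euclidean_space \<Rightarrow> ennreal"
  assumes [measurable]: "\<And>j. h j \<in> borel_measurable borel"
  shows "(\<integral>\<^sup>+y. (\<Prod>j\<in>UNIV. h j (y $ j)) \<partial>(lborel :: ('a^'m) measure)) = (\<Prod>j\<in>UNIV. integral\<^sup>N lborel (h j))"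
proof -
  interpret product_sigma_finite "\<lambda>_::'m. lborel :: 'a measure" by standard
  have "(\<lambda>y::'a^'m. y $ j) \<in> borel_measurable borel" for j
    by (intro borel_measurable_continuous_onI continuous_intros)
  hence [measurable]: "(\<lambda>y::'a^'m. (\<Prod>j\<in>UNIV. h j (y $ j))) \<in> borel_measurable borel"
    by (intro borel_measurable_prod_ennreal) (auto intro: measurable_compose[OF _ assms])
  show ?thesis
    by (subst lborel_vec, subst nn_integral_distr) (auto simp: product_nn_integral_prod)
qed

text \<open>
  By Fubini the variable \<open>y\<^sub>j\<close> can be integrated first, against which \<open>F\<close> is constant.
\<close>

lemma integral_lborel_vec_mean_zero:
  fixes F :: "'a::euclidean_space ^ 'm::finite \<Rightarrow> complex" and b :: "'a \<Rightarrow> complex"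
  assumes int: "integrable lborel (\<lambda>y. F y * b (y $ j))"
    and indep: "\<And>y z. F (\<chi> i. if i = j then z else y $ i) = F y"
    and b: "integrable lborel b" "integral\<^sup>L lborel b = 0"
  shows "(LINT y|lborel. F y * b (y $ j)) = 0"
proof -
  interpret product_sigma_finite "\<lambda>_::'m. lborel :: 'a measure" by standard
  have I: "insert j (UNIV - {j}) = (UNIV :: 'm set)" by auto
  let ?f = "\<lambda>w::'m \<Rightarrow> 'a. F (vec_lambda w) * b (w j)"
  have m: "(\<lambda>y. F y * b (y $ j)) \<in> borel_measurable borel"
    using borel_measurable_integrable[OF int] by simp
  have int': "integrable (PiM UNIV (\<lambda>_. lborel)) ?f"
    using int m by (subst (asm) lborel_vec, subst (asm) integrable_distr_eq) auto
  have "(LINT y|lborel. F y * b (y $ j)) = integral\<^sup>L (PiM UNIV (\<lambda>_. lborel)) ?f"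
    using m by (subst lborel_vec, subst integral_distr) auto
  also have "\<dots> = (\<integral>w. (\<integral>z. ?f (w(j := z)) \<partial>lborel) \<partial>PiM (UNIV - {j}) (\<lambda>_. lborel))"
    using product_integral_insert[of "UNIV - {j}" j ?f] int' unfolding I by simp
  also have "\<dots> = (\<integral>w. 0 \<partial>PiM (UNIV - {j}) (\<lambda>_. lborel :: 'a measure))"
  proof (rule Bochner_Integration.integral_cong[OF refl])
    fix w :: "'m \<Rightarrow> 'a"
    have "F (vec_lambda (w(j := z))) = F (vec_lambda w)" for z
    proof -
      have "vec_lambda (w(j := z)) = (\<chi> i. if i = j then z else vec_lambda w $ i)"
        by (simp add: vec_eq_iff)
      thus ?thesis using indep[of z "vec_lambda w"] by simp
    qed
    thus "(\<integral>z. ?f (w(j := z)) \<partial>lborel) = 0" using b by simp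
  qed
  finally show ?thesis by simp
qed

section \<open>The maximal function and tail integrals\<close>

text \<open>
  The weak type \<open>(1,1)\<close> inequality for the centred maximal function. By the Vitali covering
  lemma the balls on which the mean of \<open>h\<close> is too large are covered by five-fold dilates of disjoint ones.
  Stating it with a Borel set \<open>W\<close> avoids the measurability of the maximal function itself.
\<close>

lemma Hardy_Littlewood_exceptional_set:
  fixes h :: "'a::euclidean_space \<Rightarrow> ennreal"
  assumes [measurable]: "h \<in> borel_measurable borel"
    and fin: "integral\<^sup>N lborel h < \<infinity>" and lam: "lam > 0"
  obtains W where "W \<in> sets borel"
    "emeasure lborel W \<le> ennreal (unit_ball_vol (real DIM('a)) * 5 ^ DIM('a) / lam) * integral\<^sup>N lborel h"
    "\<And>x s. x \<notin> W \<Longrightarrow> s > 0 \<Longrightarrow> (\<integral>\<^sup>+y\<in>cball x s. h y \<partial>lborel) \<le> ennreal (lam * s ^ DIM('a))"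
proof -
  have [measurable]: "cball (a::'a) s \<in> sets borel" for a s by simp
  define n where "n = DIM('a)"
  have n: "n > 0" by (simp add: n_def)
  define V where "V = unit_ball_vol (real n)"
  define K where "K = {(x::'a, s::real). s > 0 \<and> (\<integral>\<^sup>+y\<in>cball x s. h y \<partial>lborel) > ennreal (lam * s ^ n)}"
  obtain I where I: "integral\<^sup>N lborel h = ennreal I" "I \<ge> 0" using fin by (cases "integral\<^sup>N lborel h") auto
  \<comment> \<open>The radii of the bad balls are bounded, as the covering lemma requires.\<close>
  define B where "B = max 1 (I / lam)"
  have KB: "0 < snd i \<and> snd i \<le> B" if i: "i \<in> K" for i
  proof -
    obtain x s where xs: "i = (x, s)" "s > 0" "(\<integral>\<^sup>+y\<in>cball x s. h y \<partial>lborel) > ennreal (lam * s ^ n)"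
      using i by (auto simp: K_def)
    have "(\<integral>\<^sup>+y\<in>cball x s. h y \<partial>lborel) \<le> integral\<^sup>N lborel h"
      by (intro nn_integral_mono) (auto simp: indicator_def)
    hence "ennreal (lam * s ^ n) < ennreal I" using xs(3) I by auto
    hence *: "s ^ n < I / lam" using lam xs(2) by (simp add: ennreal_less_iff field_simps)
    have "s \<le> B"
    proof (rule ccontr)
      assume "\<not> s \<le> B"
      hence s: "s > 1" "s > I / lam" by (auto simp: B_def)
      have "s \<le> s ^ n" using s n self_le_power[of s n] by auto
      thus False using * s by linarith
    qed
    thus ?thesis using xs by simp
  qed
  obtain C where C: "countable C" "C \<subseteq> K"
    and disj: "pairwise (\<lambda>i j. disjnt (cball (fst i) (snd i)) (cball (fst j) (snd j))) C"
    and cov: "(\<Union>i\<in>K. cball (fst i) (snd i)) \<subseteq> (\<Union>i\<in>C. cball (fst i) (5 * snd i))"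
    by (rule Vitali_covering_lemma_cballs[OF order_refl KB, where a=fst]) (assumption, rule that)
  define W where "W = (\<Union>i\<in>C. cball (fst i) (5 * snd i))"
  have W: "W \<in> sets borel" unfolding W_def by (intro sets.countable_UN'' C(1)) auto
  have each: "ennreal (V * (5 * snd i) ^ n) \<le> ennreal (V * 5 ^ n / lam) * (\<integral>\<^sup>+y\<in>cball (fst i) (snd i). h y \<partial>lborel)"
    if i: "i \<in> C" for i
  proof -
    have "ennreal (V * (5 * snd i) ^ n) = ennreal (V * 5 ^ n / lam * (lam * snd i ^ n))"
      using lam by (simp add: field_simps)
    also have "\<dots> = ennreal (V * 5 ^ n / lam) * ennreal (lam * snd i ^ n)"
      using lam KB[of i] i C(2) by (intro ennreal_mult) (auto simp: V_def unit_ball_vol_nonneg)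
    also have "\<dots> \<le> ennreal (V * 5 ^ n / lam) * (\<integral>\<^sup>+y\<in>cball (fst i) (snd i). h y \<partial>lborel)"
      using i C(2) by (intro mult_left_mono) (auto simp: K_def less_imp_le)
    finally show ?thesis .
  qed
  have "emeasure lborel W = (\<integral>\<^sup>+y. indicator W y \<partial>lborel)" using W by simp
  also have "\<dots> \<le> (\<integral>\<^sup>+y. (\<integral>\<^sup>+i. indicator (cball (fst i) (5 * snd i)) y \<partial>count_space C) \<partial>lborel)"
  proof (intro nn_integral_mono)
    fix y
    show "indicator W y \<le> (\<integral>\<^sup>+i. indicator (cball (fst i) (5 * snd i)) y \<partial>count_space C :: ennreal)"
    proof (cases "y \<in> W")
      case True
      then obtain i where i: "i \<in> C" "y \<in> cball (fst i) (5 * snd i)" by (auto simp: W_def)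
      have "(1::ennreal) = (\<integral>\<^sup>+j. indicator {i} j \<partial>count_space C)" using i by simp
      also have "\<dots> \<le> (\<integral>\<^sup>+i. indicator (cball (fst i) (5 * snd i)) y \<partial>count_space C)"
        using i by (intro nn_integral_mono) (auto simp: indicator_def)
      finally show ?thesis using True by simp
    qed auto
  qed
  also have "\<dots> = (\<integral>\<^sup>+i. (\<integral>\<^sup>+y. indicator (cball (fst i) (5 * snd i)) y \<partial>lborel) \<partial>count_space C)"
    using C(1) by (intro nn_integral_count_space_nn_integral) (auto intro!: borel_measurable_indicator)
  also have "\<dots> = (\<integral>\<^sup>+i. ennreal (V * (5 * snd i) ^ n) \<partial>count_space C)"
  proof (intro nn_integral_cong)
    fix i assume "i \<in> space (count_space C)"
    hence "0 \<le> 5 * snd i" using KB[of i] C(2) by auto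
    from emeasure_cball[OF this, of "fst i"]
    show "(\<integral>\<^sup>+y. indicator (cball (fst i) (5 * snd i)) y \<partial>lborel) = ennreal (V * (5 * snd i) ^ n)"
      by (simp add: V_def n_def)
  qed
  also have "\<dots> \<le> (\<integral>\<^sup>+i. ennreal (V * 5 ^ n / lam) * (\<integral>\<^sup>+y\<in>cball (fst i) (snd i). h y \<partial>lborel) \<partial>count_space C)"
    using each by (intro nn_integral_mono) auto
  also have "\<dots> = ennreal (V * 5 ^ n / lam) * (\<integral>\<^sup>+i. (\<integral>\<^sup>+y\<in>cball (fst i) (snd i). h y \<partial>lborel) \<partial>count_space C)"
    by (intro nn_integral_cmult) auto
  also have "(\<integral>\<^sup>+i. (\<integral>\<^sup>+y\<in>cball (fst i) (snd i). h y \<partial>lborel) \<partial>count_space C)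
     = (\<integral>\<^sup>+y. (\<integral>\<^sup>+i. h y * indicator (cball (fst i) (snd i)) y \<partial>count_space C) \<partial>lborel)"
    using C(1) by (intro nn_integral_count_space_nn_integral[symmetric]) auto
  also have "\<dots> \<le> integral\<^sup>N lborel h"
  proof (intro nn_integral_mono)
    fix y
    have le1: "(\<integral>\<^sup>+i. indicator (cball (fst i) (snd i)) y \<partial>count_space C) \<le> (1::ennreal)"
    proof (cases "\<exists>i\<in>C. y \<in> cball (fst i) (snd i)")
      case True
      then obtain i where i: "i \<in> C" "y \<in> cball (fst i) (snd i)" by auto
      have "(\<integral>\<^sup>+i. indicator (cball (fst i) (snd i)) y \<partial>count_space C) \<le> (\<integral>\<^sup>+j. indicator {i} j \<partial>count_space C :: ennreal)"
      proof (intro nn_integral_mono)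
        fix j assume "j \<in> space (count_space C)"
        hence "j = i" if "y \<in> cball (fst j) (snd j)"
          using pairwiseD[OF disj, of i j] i that \<open>j \<in> _\<close> unfolding disjnt_def disjoint_iff space_count_space by blast
        thus "indicator (cball (fst j) (snd j)) y \<le> (indicator {i} j :: ennreal)"
          by (auto simp: indicator_def)
      qed
      also have "\<dots> = 1" using i by simp
      finally show ?thesis .
    next
      case False
      hence "(\<integral>\<^sup>+i. indicator (cball (fst i) (snd i)) y \<partial>count_space C) = (\<integral>\<^sup>+i. 0 \<partial>count_space C :: ennreal)"
        by (intro nn_integral_cong) (auto simp: indicator_def)
      thus ?thesis by simp
    qed
    have "(\<integral>\<^sup>+i. h y * indicator (cball (fst i) (snd i)) y \<partial>count_space C)
       = h y * (\<integral>\<^sup>+i. indicator (cball (fst i) (snd i)) y \<partial>count_space C)"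
      by (intro nn_integral_cmult) auto
    also have "\<dots> \<le> h y * 1" by (intro mult_left_mono le1) simp
    finally show "(\<integral>\<^sup>+i. h y * indicator (cball (fst i) (snd i)) y \<partial>count_space C) \<le> h y" by simp
  qed
  finally have "emeasure lborel W \<le> ennreal (V * 5 ^ n / lam) * integral\<^sup>N lborel h"
    by (metis mult_left_mono zero_le)
  moreover have "(\<integral>\<^sup>+y\<in>cball x s. h y \<partial>lborel) \<le> ennreal (lam * s ^ n)" if "x \<notin> W" "s > 0" for x s
  proof (rule ccontr)
    assume "\<not> ?thesis"
    hence "(x, s) \<in> K" using that by (auto simp: K_def)
    hence "x \<in> (\<Union>i\<in>K. cball (fst i) (snd i))" using that by (intro UN_I[of "(x,s)"]) auto
    from subsetD[OF cov this] show False using that by (simp add: W_def)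
  qed
  ultimately show thesis using that[OF W] unfolding V_def n_def by blast
qed

text \<open>
  Sum over the dyadic annuli \<open>2\<^sup>k\<^sup>-\<^sup>1 r \<le> \<bar>x - y\<bar> < 2\<^sup>k r\<close>: each contributes at most \<open>lam\<close>
  times a constant times \<open>2\<^sup>-\<^sup>k\<^sup>\<delta> r\<^sup>-\<^sup>\<delta>\<close>, a geometric series.
\<close>

lemma integral_tail_bound:
  fixes h :: "'a::euclidean_space \<Rightarrow> ennreal"
  assumes [measurable]: "h \<in> borel_measurable borel"
    and h: "\<And>s. s > 0 \<Longrightarrow> (\<integral>\<^sup>+y\<in>cball x s. h y \<partial>lborel) \<le> ennreal (lam * s ^ DIM('a))"
    and lam: "lam \<ge> 0" and r: "r > 0" and d: "\<delta> > 0"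
  shows "(\<integral>\<^sup>+y. h y * ennreal ((r + norm (x - y)) powr (- (real DIM('a) + \<delta>))) \<partial>lborel)
      \<le> ennreal (2 powr (real DIM('a) + \<delta>) / (1 - 2 powr (-\<delta>)) * lam * r powr (-\<delta>))"
proof -
  have [measurable]: "cball (a::'a) s \<in> sets borel" for a s by simp
  define n where "n = DIM('a)"
  define p where "p = real n + \<delta>"
  have p: "p > 0" using d by (simp add: p_def add_nonneg_pos)
  define c where "c = (\<lambda>k::nat. 2 powr p * (2 ^ k * r) powr (- p))"
  have pw: "h y * ennreal ((r + norm (x - y)) powr (- p))
     \<le> (\<Sum>k. ennreal (c k) * (h y * indicator (cball x (2 ^ k * r)) y))" for y
  proof -
    obtain k1 :: nat where "norm (x - y) / r < 2 ^ k1" using real_arch_pow[of 2 "norm (x - y) / r"] by auto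
    hence ex: "norm (x - y) \<le> 2 ^ k1 * r" using r by (simp add: field_simps)
    define k where "k = (LEAST k. norm (x - y) \<le> 2 ^ k * r)"
    have k: "norm (x - y) \<le> 2 ^ k * r" unfolding k_def by (rule LeastI[of _ k1]) (rule ex)
    have "2 ^ k * r / 2 \<le> r + norm (x - y)"
    proof (cases k)
      case 0 thus ?thesis using r by (simp add: field_simps add_nonneg_nonneg)
    next
      case (Suc j)
      have "\<not> norm (x - y) \<le> 2 ^ j * r" using not_less_Least[of j "\<lambda>k. norm (x - y) \<le> 2 ^ k * r"] Suc unfolding k_def by simp
      thus ?thesis using Suc r by (simp add: field_simps)
    qed
    hence "(r + norm (x - y)) powr (- p) \<le> (2 ^ k * r / 2) powr (- p)"
      using r p by (intro powr_mono2') auto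
    also have "\<dots> = c k" unfolding c_def using r by (simp add: powr_divide powr_minus field_simps)
    finally have "h y * ennreal ((r + norm (x - y)) powr (- p)) \<le> h y * ennreal (c k)"
      by (intro mult_left_mono ennreal_leI) auto
    also have "\<dots> = ennreal (c k) * (h y * indicator (cball x (2 ^ k * r)) y)"
      using k by (simp add: dist_norm mult.commute)
    also have "\<dots> = (\<Sum>k\<in>{k}. ennreal (c k) * (h y * indicator (cball x (2 ^ k * r)) y))" by simp
    also have "\<dots> \<le> (\<Sum>k. ennreal (c k) * (h y * indicator (cball x (2 ^ k * r)) y))"
      by (intro sum_le_suminf) auto
    finally show ?thesis .
  qed
  define q where "q = 2 powr (-\<delta>)"
  have q: "0 < q" "q < 1" using d powr_less_mono[of "-\<delta>" 0 2] by (auto simp: q_def)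
  have ck: "c k * (lam * (2 ^ k * r) ^ n) = 2 powr p * lam * r powr (-\<delta>) * q ^ k" for k
  proof -
    have "(2 ^ k * r) powr (- p) * (2 ^ k * r) ^ n = (2 ^ k * r) powr (- p + real n)"
      using r powr_realpow[of "2 ^ k * r" n] by (simp only: powr_add) simp
    also have "\<dots> = (2 ^ k) powr (-\<delta>) * r powr (-\<delta>)" using r by (simp add: p_def powr_mult)
    also have "(2 ^ k :: real) powr (-\<delta>) = q ^ k"
      unfolding q_def by (simp add: powr_powr powr_realpow[symmetric] mult.commute)
    finally show ?thesis unfolding c_def by (simp add: mult.assoc mult.left_commute mult.commute)
  qed
  have "(\<integral>\<^sup>+y. h y * ennreal ((r + norm (x - y)) powr (- p)) \<partial>lborel)
    \<le> (\<integral>\<^sup>+y. (\<Sum>k. ennreal (c k) * (h y * indicator (cball x (2 ^ k * r)) y)) \<partial>lborel)"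
    by (intro nn_integral_mono pw)
  also have "\<dots> = (\<Sum>k. ennreal (c k) * (\<integral>\<^sup>+y\<in>cball x (2 ^ k * r). h y \<partial>lborel))"
    by (subst nn_integral_suminf) (auto simp: nn_integral_cmult)
  also have "\<dots> \<le> (\<Sum>k. ennreal (2 powr p * lam * r powr (-\<delta>) * q ^ k))"
  proof (intro suminf_le allI)
    fix k
    have "ennreal (c k) * (\<integral>\<^sup>+y\<in>cball x (2 ^ k * r). h y \<partial>lborel) \<le> ennreal (c k) * ennreal (lam * (2 ^ k * r) ^ n)"
      using h[of "2 ^ k * r"] r by (intro mult_left_mono) (auto simp: n_def)
    also have "\<dots> = ennreal (c k * (lam * (2 ^ k * r) ^ n))"
      using lam r by (intro ennreal_mult[symmetric]) (auto simp: c_def)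
    finally show "ennreal (c k) * (\<integral>\<^sup>+y\<in>cball x (2 ^ k * r). h y \<partial>lborel) \<le> ennreal (2 powr p * lam * r powr (-\<delta>) * q ^ k)"
      by (simp add: ck)
  qed auto
  also have "\<dots> = ennreal (2 powr p * lam * r powr (-\<delta>) * (1 / (1 - q)))"
  proof (rule suminf_ennreal_eq)
    show "(\<lambda>k. 2 powr p * lam * r powr (-\<delta>) * q ^ k) sums (2 powr p * lam * r powr (-\<delta>) * (1 / (1 - q)))"
      using q by (intro sums_mult geometric_sums) auto
  qed (use q lam in auto)
  finally show ?thesis unfolding p_def n_def q_def by (simp add: field_simps)
qed

section \<open>Kernel estimates\<close>

text \<open>
  Borel functions that are bounded and have bounded support: the class on which the analysis takes place.
  It contains the Schwartz functions used for approximation, is stable under truncation to Borel sets,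
  and lies in every \<open>L\<^sup>p\<close>.
\<close>

definition bbs :: "('a::euclidean_space \<Rightarrow> complex) \<Rightarrow> bool" where
  "bbs f \<longleftrightarrow> f \<in> borel_measurable borel \<and> bounded (range f) \<and> bounded {x. f x \<noteq> 0}"

lemma bbsD:
  assumes "bbs f"
  shows "f \<in> borel_measurable borel" "\<exists>M\<ge>0. \<forall>x. norm (f x) \<le> M" "\<exists>a. \<forall>x. x \<notin> cbox (-a) a \<longrightarrow> f x = 0"
proof -
  show "f \<in> borel_measurable borel" using assms by (simp add: bbs_def)
  from assms obtain M where M: "\<forall>x. norm (f x) \<le> M" by (auto simp: bbs_def bounded_iff)
  have "0 \<le> norm (f 0)" by simp
  also have "norm (f 0) \<le> M" using M by blast
  finally show "\<exists>M\<ge>0. \<forall>x. norm (f x) \<le> M" using M by blast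
  from assms obtain a where "{x. f x \<noteq> 0} \<subseteq> cbox (-a) a"
    unfolding bbs_def using bounded_subset_cbox_symmetric by metis
  thus "\<exists>a. \<forall>x. x \<notin> cbox (-a) a \<longrightarrow> f x = 0" by blast
qed

lemma bbsI:
  assumes "f \<in> borel_measurable borel" "\<And>x. norm (f x) \<le> M" "\<And>x. x \<notin> cbox a b \<Longrightarrow> f x = 0"
  shows "bbs f"
  unfolding bbs_def
proof (intro conjI)
  show "bounded (range f)" using assms(2) by (auto simp: bounded_iff)
  have "{x. f x \<noteq> 0} \<subseteq> cbox a b" using assms(3) by blast
  thus "bounded {x. f x \<noteq> 0}" by (rule bounded_subset[OF bounded_cbox])
qed (rule assms)

lemma bbs_powr_integrable:
  assumes "bbs f" "p > 0"
  shows "integrable lborel (\<lambda>x. norm (f x) powr p)"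
proof -
  obtain M where M: "M \<ge> 0" "\<And>x. norm (f x) \<le> M" using bbsD(2)[OF assms(1)] by blast
  obtain a where a: "\<And>x. x \<notin> cbox (-a) a \<Longrightarrow> f x = 0" using bbsD(3)[OF assms(1)] by blast
  have [measurable]: "f \<in> borel_measurable borel" by (rule bbsD(1)[OF assms(1)])
  show ?thesis
  proof (rule Bochner_Integration.integrable_bound)
    show "integrable lborel (\<lambda>x. M powr p * indicator (cbox (-a) a) x)"
      by (intro integrable_mult_right integrable_real_indicator) (auto simp: emeasure_lborel_cbox_eq)
    show "AE x in lborel. norm (norm (f x) powr p) \<le> norm (M powr p * indicator (cbox (-a) a) x)"
    proof (intro always_eventually allI)
      fix x show "norm (norm (f x) powr p) \<le> norm (M powr p * indicator (cbox (-a) a) x)"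
        using M a[of x] assms(2) by (cases "x \<in> cbox (-a) a") (auto intro!: powr_mono2)
    qed
  qed simp
qed

lemma bbs_integrable:
  assumes "bbs f" shows "integrable lborel f"
proof -
  have [measurable]: "f \<in> borel_measurable borel" by (rule bbsD(1)[OF assms(1)])
  have "integrable lborel (\<lambda>x. norm (f x) powr 1)" by (rule bbs_powr_integrable[OF assms]) simp
  hence "integrable lborel (\<lambda>x. norm (f x))" by simp
  thus ?thesis by (rule Bochner_Integration.integrable_bound) auto
qed

lemma bbs_nn_integral:
  "bbs f \<Longrightarrow> (\<integral>\<^sup>+x. ennreal (norm (f x)) \<partial>lborel) = ennreal (LINT x|lborel. norm (f x))"
  by (intro nn_integral_eq_integral) (auto intro: integrable_norm bbs_integrable)

definition kernel_point :: "real^'n::finite \<Rightarrow> (real^'n)^'m::finite \<Rightarrow> (real^'n)^('m option)" where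
  "kernel_point x y = (\<chi> k. case k of None \<Rightarrow> x | Some j \<Rightarrow> y $ j)"

lemma kernel_point_nth [simp]: "kernel_point x y $ None = x" "kernel_point x y $ Some j = y $ j"
  by (simp_all add: kernel_point_def)

lemma kernel_dist_point_ge:
  "(\<Sum>j\<in>UNIV. norm (x - y $ j)) \<le> kernel_dist (kernel_point x (y :: (real^'n::finite)^'m::finite))"
proof -
  have "(\<Sum>j\<in>UNIV. norm (x - y $ j)) = (\<Sum>l\<in>Some ` UNIV. norm (kernel_point x y $ None - kernel_point x y $ l))"
    by (subst sum.reindex) auto
  also have "\<dots> \<le> (\<Sum>l\<in>UNIV. norm (kernel_point x y $ None - kernel_point x y $ l))"
    by (intro sum_mono2) auto
  also have "\<dots> = (\<Sum>k\<in>{None}. \<Sum>l\<in>UNIV. norm (kernel_point x y $ k - kernel_point x y $ l))" by simp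
  also have "\<dots> \<le> kernel_dist (kernel_point x y)"
    unfolding kernel_dist_def by (intro sum_mono2) (auto intro: sum_nonneg)
  finally show ?thesis .
qed

lemma kernel_dist_ge_pair: "norm (y $ k - y $ l) \<le> kernel_dist y"
proof -
  have "norm (y $ k - y $ l) = (\<Sum>k\<in>{k}. \<Sum>l\<in>{l}. norm (y $ k - y $ l))" by simp
  also have "\<dots> \<le> (\<Sum>k\<in>{k}. \<Sum>l\<in>UNIV. norm (y $ k - y $ l))" by (intro sum_mono sum_mono2) auto
  also have "\<dots> \<le> kernel_dist y"
    unfolding kernel_dist_def by (intro sum_mono2) (auto intro: sum_nonneg)
  finally show ?thesis .
qed

text \<open>
  The kernel decays in the sum of all distances. A power of a number that dominates every \<open>c a\<^sub>j\<close> is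
  distributed evenly over the \<open>m\<close> factors; this separates the variables, so that a multiple integral becomes a
  product of single tail integrals.
\<close>

lemma powr_le_prod:
  fixes a :: "'m::finite \<Rightarrow> real"
  assumes c: "c > 0" and t: "\<And>j. c * a j \<le> t" and a: "\<And>j. a j > 0"
    and e: "\<epsilon> > 0" and N: "N \<ge> 0"
  shows "t powr (- (real CARD('m) * N + \<epsilon>)) \<le>
    c powr (- (real CARD('m) * N + \<epsilon>)) * (\<Prod>j\<in>UNIV. a j powr (- (N + \<epsilon> / real CARD('m))))"
proof -
  define m where "m = real CARD('m)"
  define p where "p = N + \<epsilon> / m"
  have m: "m > 0" by (simp add: m_def)
  have p: "p > 0" using e N m by (simp add: p_def add_nonneg_pos)
  have mp: "m * N + \<epsilon> = m * p" using m by (simp add: p_def field_simps)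
  have t0: "t > 0" using t[of undefined] c a[of undefined] by (smt (verit) mult_pos_pos)
  have "t powr (- (m * p)) = (t powr (- p)) ^ CARD('m)"
    using t0 by (subst powr_realpow[symmetric]) (auto simp: powr_powr m_def mult.commute)
  also have "\<dots> = (\<Prod>j\<in>(UNIV::'m set). t powr (- p))" by simp
  also have "\<dots> \<le> (\<Prod>j\<in>UNIV. (c * a j) powr (- p))"
    using c a t p by (intro prod_mono conjI powr_mono2') auto
  also have "\<dots> = (\<Prod>j\<in>(UNIV::'m set). c powr (- p)) * (\<Prod>j\<in>UNIV. a j powr (- p))"
    using c a by (simp add: powr_mult less_imp_le prod.distrib del: prod_constant)
  also have "(\<Prod>j\<in>(UNIV::'m set). c powr (- p)) = c powr (- (m * p))"
    using c by (simp add: powr_realpow[symmetric] powr_powr m_def mult.commute)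
  finally show ?thesis unfolding m_def[symmetric] mp unfolding p_def .
qed

text \<open>
  The real parameters \<open>arity\<close> and \<open>dimn\<close> stand for \<open>m\<close> and \<open>n\<close>. As variables they keep the
  simplifier from evaluating the cardinalities in exponents.
\<close>

locale CZ_kernel_bounds =
  fixes K :: "(real^'n::finite)^('m::finite option) \<Rightarrow> complex" and A \<epsilon> arity dimn :: real
  assumes arity_eq [simp]: "real CARD('m) = arity" and dimn_eq [simp]: "real CARD('n) = dimn"
    and A_pos: "A > 0" and eps_pos: "\<epsilon> > 0"
    and size_bound: "\<And>y k l. y $ k \<noteq> y $ l \<Longrightarrow> norm (K y) \<le> A / kernel_dist y ^ (CARD('m) * CARD('n))"
    and smoothness: "\<And>y k l j y'. y $ k \<noteq> y $ l \<Longrightarrow>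
           norm (y $ j - y') \<le> 1/2 * Max (range (\<lambda>k. norm (y $ j - y $ k))) \<Longrightarrow>
           norm (K y - K (\<chi> k. if k = j then y' else y $ k))
             \<le> A * norm (y $ j - y') powr \<epsilon> / kernel_dist y powr (real (CARD('m) * CARD('n)) + \<epsilon>)"
begin

text \<open>
  The decay rate \<open>m n + \<epsilon>\<close> of differences of the kernel; \<open>tail_exp\<close> is its share \<open>n + \<epsilon> / m\<close> in each
  variable and \<open>tail_const\<close> the constant of the tail integral with that exponent.
\<close>

definition "homog = arity * dimn + \<epsilon>"
definition "tail_exp = dimn + \<epsilon> / arity"
definition "tail_const = 2 powr tail_exp / (1 - 2 powr (- (\<epsilon> / arity)))"

lemma arity_pos: "arity > 0" and dimn_pos: "dimn > 0"
  unfolding arity_eq[symmetric] dimn_eq[symmetric] of_nat_0_less_iff by simp_all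

lemma homog_pos: "homog > 0"
  unfolding homog_def using eps_pos arity_pos dimn_pos by (simp add: add_pos_pos)

lemma homog_le_prod:
  fixes a :: "'m \<Rightarrow> real"
  assumes "c > 0" "\<And>j. c * a j \<le> t" "\<And>j. a j > 0"
  shows "t powr (- homog) \<le> c powr (- homog) * (\<Prod>j\<in>UNIV. a j powr (- tail_exp))"
  using powr_le_prod[where c = c and a = a and t = t and \<epsilon> = \<epsilon> and N = dimn] assms eps_pos dimn_pos
  unfolding homog_def tail_exp_def by (simp only: arity_eq less_imp_le)

lemma tail_const_pos: "tail_const > 0"
proof -
  have "2 powr (- (\<epsilon> / arity)) < 1" using eps_pos arity_pos powr_less_mono[of "- (\<epsilon> / arity)" 0 2] by simp
  thus ?thesis by (simp add: tail_const_def)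
qed

lemma size_bound_ge:
  assumes "r > 0" "r \<le> norm (y $ k - y $ l)"
  shows "norm (K y) \<le> A / r ^ (CARD('m) * CARD('n))"
proof -
  have "y $ k \<noteq> y $ l" using assms by auto
  hence "norm (K y) \<le> A / kernel_dist y ^ (CARD('m) * CARD('n))" by (rule size_bound)
  also have "\<dots> \<le> A / r ^ (CARD('m) * CARD('n))"
    using A_pos assms kernel_dist_ge_pair[of y k l]
    by (intro divide_left_mono power_mono mult_pos_pos zero_less_power) auto
  finally show ?thesis .
qed

lemma smoothness_ge:
  assumes "norm (y $ j - y') \<le> 1/2 * norm (y $ j - y $ l)" "y $ j \<noteq> y $ l"
    and t: "t > 0" "t \<le> kernel_dist y"
  shows "norm (K y - K (\<chi> k. if k = j then y' else y $ k)) \<le> A * norm (y $ j - y') powr \<epsilon> * t powr (- homog)"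
proof -
  have "norm (y $ j - y $ l) \<le> Max (range (\<lambda>k. norm (y $ j - y $ k)))" by (rule Max_ge) auto
  hence "norm (y $ j - y') \<le> 1/2 * Max (range (\<lambda>k. norm (y $ j - y $ k)))" using assms(1) by linarith
  from smoothness[OF assms(2) this]
  have "norm (K y - K (\<chi> k. if k = j then y' else y $ k)) \<le>
      A * norm (y $ j - y') powr \<epsilon> / kernel_dist y powr homog"
    by (simp add: homog_def)
  also have "\<dots> = A * norm (y $ j - y') powr \<epsilon> * kernel_dist y powr (- homog)"
    by (simp add: powr_minus divide_inverse)
  also have "\<dots> \<le> A * norm (y $ j - y') powr \<epsilon> * t powr (- homog)"
    using A_pos t homog_pos by (intro mult_left_mono powr_mono2') auto
  finally show ?thesis .
qed

text \<open>
  Off the diagonal, moving the coordinates one after the other changes the kernel by an amount that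
  the smoothness condition bounds by a positive power of the displacement.
\<close>

lemma kernel_continuous_on: "continuous_on {y. \<exists>k l. y $ k \<noteq> y $ l} K"
proof -
  have "isCont K y0" if y0: "y0 $ k0 \<noteq> y0 $ l0" for y0 k0 l0
  proof -
    define D where "D = norm (y0 $ k0 - y0 $ l0)"
    have D: "D > 0" using y0 by (simp add: D_def)
    define B where "B = A * (D / 2) powr (- homog)"
    have B: "B \<ge> 0" using A_pos by (simp add: B_def)
    define mix where "mix = (\<lambda>y J. \<chi> k. if k \<in> J then y $ k else y0 $ k)"
    have step: "norm (K (mix y J) - K y0) \<le> real (card J) * (B * norm (y - y0) powr \<epsilon>)"
      if y: "norm (y - y0) \<le> D / 8" and "finite J" for y and J :: "'m option set"
      using \<open>finite J\<close>
    proof (induction J rule: finite_induct)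
      case empty
      have "mix y {} = y0" by (simp add: mix_def vec_eq_iff)
      thus ?case by simp
    next
      case (insert j J)
      have comp: "norm (y $ k - y0 $ k) \<le> norm (y - y0)" for k
        using Finite_Cartesian_Product.norm_nth_le[of "y - y0" k] by simp
      have near: "norm (mix y J $ k - y0 $ k) \<le> D / 8" for k
        using comp[of k] y D by (auto simp: mix_def)
      have "norm (mix y J $ k0 - mix y J $ l0) \<ge> D - D / 8 - D / 8"
        using near[of k0] near[of l0] unfolding D_def by norm
      hence far0: "norm (mix y J $ k0 - mix y J $ l0) \<ge> 3 / 4 * D" by simp
      have "\<exists>l. norm (mix y J $ j - mix y J $ l) \<ge> D / 4"
      proof (rule ccontr)
        assume "\<not> ?thesis"
        hence "norm (mix y J $ j - mix y J $ k0) < D / 4" "norm (mix y J $ j - mix y J $ l0) < D / 4"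
          by (auto simp: not_le)
        thus False using far0 D by norm
      qed
      then obtain l where l: "norm (mix y J $ j - mix y J $ l) \<ge> D / 4" by blast
      have yj: "mix y J $ j = y0 $ j" using insert by (simp add: mix_def)
      have "mix y (insert j J) = (\<chi> k. if k = j then y $ j else mix y J $ k)"
        by (auto simp: mix_def vec_eq_iff)
      moreover have "norm (K (mix y J) - K (\<chi> k. if k = j then y $ j else mix y J $ k))
         \<le> A * norm (mix y J $ j - y $ j) powr \<epsilon> * (D / 2) powr (- homog)"
      proof (rule smoothness_ge)
        show "norm (mix y J $ j - y $ j) \<le> 1/2 * norm (mix y J $ j - mix y J $ l)"
          using comp[of j] y l unfolding yj by (simp add: norm_minus_commute)
        show "mix y J $ j \<noteq> mix y J $ l" using l D by auto
        show "D / 2 \<le> kernel_dist (mix y J)" using kernel_dist_ge_pair[of "mix y J" k0 l0] far0 D by linarith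
      qed (use D in auto)
      moreover have "A * norm (mix y J $ j - y $ j) powr \<epsilon> * (D / 2) powr (- homog) \<le> B * norm (y - y0) powr \<epsilon>"
      proof -
        have "norm (mix y J $ j - y $ j) powr \<epsilon> \<le> norm (y - y0) powr \<epsilon>"
          using comp[of j] eps_pos unfolding yj by (intro powr_mono2) (auto simp: norm_minus_commute)
        hence "A * (D / 2) powr (- homog) * norm (mix y J $ j - y $ j) powr \<epsilon> \<le> A * (D / 2) powr (- homog) * norm (y - y0) powr \<epsilon>"
          using A_pos by (intro mult_left_mono) auto
        thus ?thesis unfolding B_def by (simp add: mult_ac)
      qed
      ultimately have "norm (K (mix y J) - K (mix y (insert j J))) \<le> B * norm (y - y0) powr \<epsilon>" by simp
      hence "norm (K (mix y (insert j J)) - K y0) \<le> real (card J) * (B * norm (y - y0) powr \<epsilon>) + B * norm (y - y0) powr \<epsilon>"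
        using norm_diff_triangle_le[of "K (mix y (insert j J))" "K (mix y J)", OF _ insert.IH]
        by (simp add: norm_minus_commute add.commute)
      thus ?case using insert by (simp add: algebra_simps)
    qed
    have "((\<lambda>y. K y - K y0) \<longlongrightarrow> 0) (at y0)"
    proof (rule Lim_null_comparison)
      have "\<forall>\<^sub>F y in at y0. dist y y0 < D / 8" using D unfolding eventually_at by (intro exI[of _ "D / 8"]) auto
      thus "\<forall>\<^sub>F y in at y0. norm (K y - K y0) \<le> real (card (UNIV :: 'm option set)) * (B * norm (y - y0) powr \<epsilon>)"
      proof eventually_elim
        case (elim y)
        have "mix y UNIV = y" by (simp add: mix_def vec_eq_iff)
        thus ?case using step[of y UNIV] elim by (simp add: dist_norm)
      qed
      have "((\<lambda>y. norm (y - y0)) \<longlongrightarrow> 0) (at y0)" by (intro tendsto_eq_intros) auto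
      hence "((\<lambda>y. norm (y - y0) powr \<epsilon>) \<longlongrightarrow> 0) (at y0)"
        using eps_pos by (intro tendsto_zero_powrI[of _ _ _ \<epsilon>]) auto
      thus "((\<lambda>y. real (card (UNIV :: 'm option set)) * (B * norm (y - y0) powr \<epsilon>)) \<longlongrightarrow> 0) (at y0)"
        by (intro tendsto_mult_right_zero)
    qed
    thus ?thesis unfolding isCont_def by (simp add: LIM_zero_iff)
  qed
  thus ?thesis by (intro continuous_at_imp_continuous_on) auto
qed

text \<open>
  The kernel is arbitrary on the diagonal, which for fixed \<open>x\<close> is the single point
  \<open>y\<^sub>1 = \<dots> = y\<^sub>m = x\<close>, so continuity elsewhere gives measurability.
\<close>

lemma kernel_point_measurable: "(\<lambda>y. K (kernel_point x y)) \<in> borel_measurable borel"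
proof -
  define S where "S = - {\<chi> j::'m. x}"
  have c: "continuous_on UNIV (kernel_point x :: (real^'n)^'m \<Rightarrow> _)"
    unfolding kernel_point_def
  proof (intro continuous_intros)
    fix k :: "'m option"
    show "continuous_on UNIV (\<lambda>y. case k of None \<Rightarrow> x | Some j \<Rightarrow> y $ j)"
      by (cases k) (auto intro!: continuous_intros)
  qed
  have "continuous_on S (\<lambda>y. K (kernel_point x y))"
  proof (rule continuous_on_compose2[OF kernel_continuous_on continuous_on_subset[OF c]])
    show "kernel_point x ` S \<subseteq> {y. \<exists>k l. y $ k \<noteq> y $ l}"
    proof clarify
      fix y assume "y \<in> S"
      then obtain j where "y $ j \<noteq> x" by (auto simp: S_def vec_eq_iff)
      hence "kernel_point x y $ Some j \<noteq> kernel_point x y $ None" by simp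
      thus "\<exists>k l. kernel_point x y $ k \<noteq> kernel_point x y $ l" by blast
    qed
  qed simp
  hence "(\<lambda>y. if y \<in> S then K (kernel_point x y) else K (kernel_point x (\<chi> j. x))) \<in> borel_measurable borel"
    by (intro borel_measurable_continuous_on_if) (auto simp: S_def)
  also have "(\<lambda>y. if y \<in> S then K (kernel_point x y) else K (kernel_point x (\<chi> j. x))) = (\<lambda>y. K (kernel_point x y))"
    by (auto simp: S_def)
  finally show ?thesis .
qed

definition kernel_integrand :: "('m \<Rightarrow> real^'n \<Rightarrow> complex) \<Rightarrow> real^'n \<Rightarrow> (real^'n)^'m \<Rightarrow> complex" where
  "kernel_integrand f x y = K (kernel_point x y) * (\<Prod>j\<in>UNIV. f j (y $ j))"

definition kernel_integral :: "('m \<Rightarrow> real^'n \<Rightarrow> complex) \<Rightarrow> real^'n \<Rightarrow> complex" where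
  "kernel_integral f x = (LINT y|lborel. kernel_integrand f x y)"

lemma prod_measurable:
  assumes "\<And>j. f j \<in> borel_measurable borel"
  shows "(\<lambda>y::(real^'n)^'m. \<Prod>j\<in>J. (f j (y $ j) :: complex)) \<in> borel_measurable borel"
proof -
  have "(\<lambda>y::(real^'n)^'m. y $ j) \<in> borel_measurable borel" for j
    by (intro borel_measurable_continuous_onI continuous_intros)
  thus ?thesis by (intro borel_measurable_prod) (auto intro: measurable_compose[OF _ assms])
qed

text \<open>
  If one of the functions vanishes near \<open>x\<close>, the size condition bounds the kernel on the support of the
  product.
\<close>

lemma kernel_integrand_integrable:
  assumes f: "\<And>j. bbs (f j)" and r: "r > 0" and far: "\<And>y. f j0 y \<noteq> 0 \<Longrightarrow> norm (x - y) \<ge> r"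
  shows "integrable lborel (kernel_integrand f x)"
proof (rule integrableI_bounded)
  have [measurable]: "\<And>j. f j \<in> borel_measurable borel" using f bbsD(1) by blast
  show "kernel_integrand f x \<in> borel_measurable lborel"
    unfolding kernel_integrand_def[abs_def]
    using kernel_point_measurable prod_measurable[of f UNIV] by simp
  define c where "c = A / r ^ (CARD('m) * CARD('n))"
  have c: "c \<ge> 0" using A_pos r by (simp add: c_def)
  have "norm (kernel_integrand f x y) \<le> c * (\<Prod>j\<in>UNIV. norm (f j (y $ j)))" for y
  proof (cases "f j0 (y $ j0) = 0")
    case True
    hence "(\<Prod>j\<in>UNIV. f j (y $ j)) = 0" by (intro prod_zero) auto
    hence "kernel_integrand f x y = 0" for x by (simp add: kernel_integrand_def)
    thus ?thesis using c by (auto intro!: mult_nonneg_nonneg prod_nonneg)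
  next
    case False
    have "norm (K (kernel_point x y)) \<le> c" unfolding c_def
      by (rule size_bound_ge[of r _ None "Some j0"]) (use r far[OF False] in auto)
    thus ?thesis unfolding kernel_integrand_def norm_mult prod_norm[symmetric]
      by (intro mult_right_mono prod_nonneg) auto
  qed
  hence "(\<integral>\<^sup>+y. ennreal (norm (kernel_integrand f x y)) \<partial>lborel)
      \<le> (\<integral>\<^sup>+y. ennreal c * (\<Prod>j\<in>UNIV. ennreal (norm (f j (y $ j)))) \<partial>lborel)"
    using c by (intro nn_integral_mono) (auto simp: prod_ennreal ennreal_mult[symmetric] prod_nonneg intro!: ennreal_leI)
  also have "\<dots> = ennreal c * (\<Prod>j\<in>UNIV. \<integral>\<^sup>+y. ennreal (norm (f j y)) \<partial>lborel)"
  proof (subst nn_integral_cmult)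
    have "(\<lambda>y::(real^'n)^'m. y $ j) \<in> borel_measurable borel" for j
      by (intro borel_measurable_continuous_onI continuous_intros)
    thus "(\<lambda>y::(real^'n)^'m. \<Prod>j\<in>UNIV. ennreal (norm (f j (y $ j)))) \<in> borel_measurable lborel"
      by measurable
    show "ennreal c * (\<integral>\<^sup>+y. (\<Prod>j\<in>UNIV. ennreal (norm (f j (y $ j)))) \<partial>(lborel :: ((real^'n)^'m) measure))
       = ennreal c * (\<Prod>j\<in>UNIV. \<integral>\<^sup>+y. ennreal (norm (f j y)) \<partial>lborel)"
      by (subst nn_integral_lborel_vec_prod[of "\<lambda>j y. ennreal (norm (f j y))"]) auto
  qed
  also have "\<dots> < \<infinity>"
    using f by (simp add: bbs_nn_integral prod_ennreal ennreal_mult_less_top)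
  finally show "(\<integral>\<^sup>+y. ennreal (norm (kernel_integrand f x y)) \<partial>lborel) < \<infinity>" .
qed

lemma nn_integral_prod_tail:
  assumes [measurable]: "\<And>j. f j \<in> borel_measurable borel"
  shows "(\<integral>\<^sup>+y. (\<Prod>j\<in>UNIV. ennreal (norm (f j (y $ j) :: complex) * (r + norm (z - y $ j)) powr (- tail_exp))) \<partial>(lborel :: ((real^'n)^'m) measure))
    = (\<Prod>j\<in>UNIV. \<integral>\<^sup>+y. ennreal (norm (f j y) * (r + norm (z - y)) powr (- tail_exp)) \<partial>lborel)"
  by (rule nn_integral_lborel_vec_prod[of "\<lambda>j y. ennreal (norm (f j y) * (r + norm (z - y)) powr (- tail_exp))"]) simp

lemma single_tail:
  assumes [measurable]: "h \<in> borel_measurable borel"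
    and "\<And>s. s > 0 \<Longrightarrow> (\<integral>\<^sup>+y\<in>cball x s. ennreal (norm (h y :: complex)) \<partial>lborel) \<le> ennreal (lam * s ^ CARD('n))"
    and "lam \<ge> 0" "r > 0"
  shows "(\<integral>\<^sup>+y. ennreal (norm (h y) * (r + norm (x - y :: real^'n)) powr (- tail_exp)) \<partial>lborel)
      \<le> ennreal (tail_const * lam * r powr (- (\<epsilon> / arity)))"
proof -
  have "(\<integral>\<^sup>+y. ennreal (norm (h y) * (r + norm (x - y)) powr (- tail_exp)) \<partial>lborel)
    = (\<integral>\<^sup>+y. ennreal (norm (h y)) * ennreal ((r + norm (x - y)) powr (- tail_exp)) \<partial>lborel)"
    by (simp add: ennreal_mult)
  also have "\<dots> \<le> ennreal (tail_const * lam * r powr (- (\<epsilon> / arity)))"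
  proof -
    have D: "real DIM(real^'n) + \<epsilon> / arity = tail_exp" by (simp add: tail_exp_def)
    have "(\<integral>\<^sup>+y. ennreal (norm (h y)) * ennreal ((r + norm (x - y)) powr (- (real DIM(real^'n) + \<epsilon> / arity))) \<partial>lborel)
      \<le> ennreal (2 powr (real DIM(real^'n) + \<epsilon> / arity) / (1 - 2 powr (-(\<epsilon> / arity))) * lam * r powr (-(\<epsilon> / arity)))"
      by (rule integral_tail_bound) (use assms eps_pos arity_pos in auto)
    thus ?thesis unfolding D tail_const_def .
  qed
  finally show ?thesis .
qed

definition "osc_const = A * (1/2) powr (- homog) * tail_const ^ CARD('m)"

text \<open>
  Smoothness in the output variable: when one input lives at distance at least \<open>2 L\<close>, moving the output
  by at most \<open>L\<close> changes the kernel by at most a constant times \<open>L\<^sup>\<epsilon>\<close> and a product of decaying factors. Each factor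
  integrates to at most a constant times \<open>lam j L\<^sup>-\<^sup>\<epsilon>\<^sup>/\<^sup>m\<close>, and the powers of \<open>L\<close> cancel. The maximal bound is assumed at a point \<open>z\<close>
  near \<open>x\<close>, because it is known only outside an exceptional set.
\<close>

lemma kernel_oscillation:
  assumes f: "\<And>j. bbs (f j)" and L: "L > 0"
    and xx': "norm (x - x') \<le> L" and xz: "norm (x - z) \<le> L"
    and far: "\<And>y. f j0 y \<noteq> 0 \<Longrightarrow> norm (x - y) \<ge> 2 * L"
    and mf: "\<And>j s. s > 0 \<Longrightarrow> (\<integral>\<^sup>+y\<in>cball z s. ennreal (norm (f j y)) \<partial>lborel) \<le> ennreal (lam j * s ^ CARD('n))"
    and lam: "\<And>j. lam j \<ge> 0"
  shows "norm (kernel_integral f x - kernel_integral f x') \<le> osc_const * (\<Prod>j\<in>UNIV. lam j)"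
proof -
  have [measurable]: "\<And>j. f j \<in> borel_measurable borel" using f bbsD(1) by blast
  have far': "norm (x' - y) \<ge> L" if "f j0 y \<noteq> 0" for y
    using far[OF that] xx' by norm
  have i1: "integrable lborel (kernel_integrand f x)"
    by (rule kernel_integrand_integrable[of f "2 * L" j0]) (use f far L in auto)
  have i2: "integrable lborel (kernel_integrand f x')"
    by (rule kernel_integrand_integrable[of f L j0]) (use f far' L in auto)
  define c where "c = A * L powr \<epsilon> * (1/2) powr (- homog)"
  have c: "c \<ge> 0" using A_pos by (simp add: c_def)
  have pw: "norm (kernel_integrand f x y - kernel_integrand f x' y) \<le>
      c * (\<Prod>j\<in>UNIV. norm (f j (y $ j)) * (L + norm (z - y $ j)) powr (- tail_exp))" for y
  proof (cases "f j0 (y $ j0) = 0")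
    case True
    hence "(\<Prod>j\<in>UNIV. f j (y $ j)) = 0" by (intro prod_zero) auto
    hence "kernel_integrand f x y = 0" for x by (simp add: kernel_integrand_def)
    thus ?thesis using c by (auto intro!: mult_nonneg_nonneg prod_nonneg)
  next
    case False
    define t where "t = (\<Sum>j\<in>UNIV. norm (x - y $ j))"
    have tj: "norm (x - y $ j) \<le> t" for j unfolding t_def by (rule member_le_sum) auto
    have t2: "t \<ge> 2 * L" using tj[of j0] far[OF False] by linarith
    have "norm (K (kernel_point x y) - K (\<chi> k. if k = None then x' else kernel_point x y $ k))
       \<le> A * norm (kernel_point x y $ None - x') powr \<epsilon> * t powr (- homog)"
    proof (rule smoothness_ge)
      show "norm (kernel_point x y $ None - x') \<le> 1/2 * norm (kernel_point x y $ None - kernel_point x y $ Some j0)"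
        using far[OF False] xx' by simp
      show "kernel_point x y $ None \<noteq> kernel_point x y $ Some j0" using far[OF False] L by auto
      show "t \<le> kernel_dist (kernel_point x y)" unfolding t_def by (rule kernel_dist_point_ge)
    qed (use t2 L in auto)
    also have "(\<chi> k. if k = None then x' else kernel_point x y $ k) = kernel_point x' y"
      by (auto simp: kernel_point_def vec_eq_iff split: option.splits)
    also have "A * norm (kernel_point x y $ None - x') powr \<epsilon> * t powr (- homog) \<le>
       A * L powr \<epsilon> * ((1/2) powr (- homog) * (\<Prod>j\<in>UNIV. (L + norm (z - y $ j)) powr (- tail_exp)))"
    proof (intro mult_mono)
      show "norm (kernel_point x y $ None - x') powr \<epsilon> \<le> L powr \<epsilon>"
        using xx' eps_pos by (intro powr_mono2) auto
      have "1/2 * (L + norm (z - y $ j)) \<le> t" for j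
      proof -
        have "norm (z - y $ j) \<le> L + norm (x - y $ j)" using xz by norm
        hence "L + norm (z - y $ j) \<le> t + t" using tj[of j] t2 by linarith
        thus ?thesis by simp
      qed
      thus "t powr (- homog) \<le> (1/2) powr (- homog) * (\<Prod>j\<in>UNIV. (L + norm (z - y $ j)) powr (- tail_exp))"
        by (intro homog_le_prod) (use L in \<open>auto simp: add_pos_nonneg\<close>)
    qed (use A_pos in auto)
    finally have *: "norm (K (kernel_point x y) - K (kernel_point x' y)) \<le>
        c * (\<Prod>j\<in>UNIV. (L + norm (z - y $ j)) powr (- tail_exp))"
      by (simp add: c_def mult_ac)
    have "norm (kernel_integrand f x y - kernel_integrand f x' y)
      = norm (K (kernel_point x y) - K (kernel_point x' y)) * (\<Prod>j\<in>UNIV. norm (f j (y $ j)))"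
      by (simp add: kernel_integrand_def norm_mult prod_norm left_diff_distrib[symmetric])
    also have "\<dots> \<le> c * (\<Prod>j\<in>UNIV. (L + norm (z - y $ j)) powr (- tail_exp)) * (\<Prod>j\<in>UNIV. norm (f j (y $ j)))"
      by (intro mult_right_mono * prod_nonneg) auto
    finally show ?thesis by (simp add: prod.distrib mult_ac)
  qed
  have "ennreal (norm (kernel_integral f x - kernel_integral f x'))
      = ennreal (norm (LINT y|lborel. kernel_integrand f x y - kernel_integrand f x' y))"
    using i1 i2 by (simp add: kernel_integral_def)
  also have "\<dots> \<le> (\<integral>\<^sup>+y. ennreal (norm (kernel_integrand f x y - kernel_integrand f x' y)) \<partial>lborel)"
    using i1 i2 by (intro integral_norm_bound_ennreal) auto
  also have "\<dots> \<le> (\<integral>\<^sup>+y. ennreal c * (\<Prod>j\<in>UNIV. ennreal (norm (f j (y $ j)) * (L + norm (z - y $ j)) powr (- tail_exp))) \<partial>lborel)"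
    using pw c L by (intro nn_integral_mono) (auto simp: prod_ennreal ennreal_mult[symmetric] prod_nonneg intro!: ennreal_leI)
  also have "\<dots> = ennreal c * (\<Prod>j\<in>UNIV. \<integral>\<^sup>+y. ennreal (norm (f j y) * (L + norm (z - y)) powr (- tail_exp)) \<partial>lborel)"
  proof (subst nn_integral_cmult)
    have "(\<lambda>y::(real^'n)^'m. y $ j) \<in> borel_measurable borel" for j
      by (intro borel_measurable_continuous_onI continuous_intros)
    thus "(\<lambda>y::(real^'n)^'m. \<Prod>j\<in>UNIV. ennreal (norm (f j (y $ j)) * (L + norm (z - y $ j)) powr (- tail_exp))) \<in> borel_measurable lborel"
      by measurable
  qed (simp add: nn_integral_prod_tail)
  also have "\<dots> \<le> ennreal c * (\<Prod>j\<in>UNIV. ennreal (tail_const * lam j * L powr (- (\<epsilon> / arity))))"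
    using mf lam L by (intro mult_left_mono prod_mono_ennreal single_tail) auto
  also have "\<dots> = ennreal (c * (\<Prod>j\<in>UNIV. tail_const * lam j * L powr (- (\<epsilon> / arity))))"
    using c lam tail_const_pos by (simp add: prod_ennreal ennreal_mult[symmetric] prod_nonneg)
  also have "c * (\<Prod>j\<in>UNIV. tail_const * lam j * L powr (- (\<epsilon> / arity))) = osc_const * (\<Prod>j\<in>UNIV. lam j)"
  proof -
    have "(L powr (- (\<epsilon> / arity))) ^ CARD('m) = L powr (- \<epsilon>)"
      using L arity_pos by (simp add: powr_realpow[symmetric] powr_powr)
    moreover have "L powr \<epsilon> * L powr (- \<epsilon>) = 1" using L by (simp add: powr_minus)
    ultimately show ?thesis by (simp add: prod.distrib c_def osc_const_def)
  qed
  finally show ?thesis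
    using lam A_pos tail_const_pos by (subst (asm) ennreal_le_iff) (auto simp: osc_const_def intro!: mult_nonneg_nonneg prod_nonneg)
qed

definition "canc_const = A * (1/3) powr (- homog) * tail_const ^ (CARD('m) - 1)"

text \<open>
  Since \<open>f\<^sub>j\<^sub>0\<close> has mean zero, the kernel may be replaced by its difference with the kernel frozen at the
  centre \<open>c\<close> in the variable \<open>j0\<close>. The smoothness in that variable gives decay with the extra power \<open>\<epsilon>\<close> in the
  distance from \<open>c\<close>, while the other variables are integrated with their maximal bounds at \<open>x\<close>.
\<close>

lemma kernel_cancellation:
  assumes f: "\<And>j. bbs (f j)" and L: "L > 0"
    and supp: "\<And>y. f j0 y \<noteq> 0 \<Longrightarrow> norm (y - c) \<le> L" and xc: "norm (x - c) \<ge> 4 * L"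
    and mean: "(LINT y|lborel. f j0 y) = 0"
    and mf: "\<And>j s. j \<noteq> j0 \<Longrightarrow> s > 0 \<Longrightarrow> (\<integral>\<^sup>+y\<in>cball x s. ennreal (norm (f j y)) \<partial>lborel) \<le> ennreal (lam j * s ^ CARD('n))"
    and lam: "\<And>j. lam j \<ge> 0"
  shows "norm (kernel_integral f x) \<le> canc_const * L powr \<epsilon> * norm (x - c) powr (- (dimn + \<epsilon>))
     * (LINT y|lborel. norm (f j0 y)) * (\<Prod>j\<in>UNIV-{j0}. lam j)"
proof -
  have [measurable]: "\<And>j. f j \<in> borel_measurable borel" using f bbsD(1) by blast
  define \<rho> where "\<rho> = norm (x - c)"
  have \<rho>: "\<rho> \<ge> 4 * L" "\<rho> > 0" using xc L by (auto simp: \<rho>_def)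
  have far: "norm (x - y) \<ge> 3/4 * \<rho>" "norm (x - y) \<ge> 2 * L" if "f j0 y \<noteq> 0" for y
  proof -
    have "\<rho> \<le> norm (x - y) + norm (y - c)" unfolding \<rho>_def by norm
    hence "\<rho> \<le> norm (x - y) + L" using supp[OF that] by linarith
    thus "norm (x - y) \<ge> 3/4 * \<rho>" "norm (x - y) \<ge> 2 * L" using \<rho>(1) L by argo+
  qed
  define rest where "rest = (\<lambda>y::(real^'n)^'m. \<Prod>j\<in>UNIV-{j0}. f j (y $ j))"
  have split: "(\<Prod>j\<in>UNIV. f j (y $ j)) = rest y * f j0 (y $ j0)" for y
    unfolding rest_def by (subst prod.remove[of UNIV j0]) auto
  define F where "F = (\<lambda>y. K (kernel_point x (\<chi> j. if j = j0 then c else y $ j)) * rest y)"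
  have setc: "(\<lambda>y::(real^'n)^'m. \<chi> j. if j = j0 then c else y $ j) \<in> borel_measurable borel"
  proof (rule borel_measurable_continuous_onI, rule continuous_on_vec_lambda)
    fix j show "continuous_on UNIV (\<lambda>y::(real^'n)^'m. if j = j0 then c else y $ j)"
      by (cases "j = j0") (auto intro!: continuous_intros)
  qed
  have Fm: "(\<lambda>y. F y * f j0 (y $ j0)) \<in> borel_measurable borel"
  proof -
    have "(\<lambda>y. K (kernel_point x (\<chi> j. if j = j0 then c else y $ j)) * (\<Prod>j\<in>UNIV. f j (y $ j))) \<in> borel_measurable borel"
      by (intro borel_measurable_times prod_measurable measurable_compose[OF setc kernel_point_measurable]) simp
    thus ?thesis by (simp add: F_def split mult.assoc)
  qed
  have i1: "integrable lborel (kernel_integrand f x)"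
    by (rule kernel_integrand_integrable[of f "2 * L" j0]) (use f far(2) L in auto)
  define c1 where "c1 = A * L powr \<epsilon> * (1/3) powr (- homog)"
  have c1: "c1 \<ge> 0" using A_pos by (simp add: c1_def)
  have pw: "norm (kernel_integrand f x y - F y * f j0 (y $ j0)) \<le>
      c1 * (\<Prod>j\<in>UNIV. norm (f j (y $ j)) * (\<rho> + norm (x - y $ j)) powr (- tail_exp))" for y
  proof (cases "f j0 (y $ j0) = 0")
    case True
    hence "(\<Prod>j\<in>UNIV. f j (y $ j)) = 0" by (intro prod_zero) auto
    hence "kernel_integrand f x y = 0" for x by (simp add: kernel_integrand_def)
    thus ?thesis using c1 True by (auto intro!: mult_nonneg_nonneg prod_nonneg)
  next
    case False
    define t where "t = (\<Sum>j\<in>UNIV. norm (x - y $ j))"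
    have tj: "norm (x - y $ j) \<le> t" for j unfolding t_def by (rule member_le_sum) auto
    have t2: "t \<ge> 3/4 * \<rho>" using tj[of j0] far[OF False] by linarith
    have eq: "kernel_point x (\<chi> j. if j = j0 then c else y $ j) = (\<chi> k. if k = Some j0 then c else kernel_point x y $ k)"
      by (auto simp: kernel_point_def vec_eq_iff split: option.splits)
    have "norm (K (kernel_point x y) - K (\<chi> k. if k = Some j0 then c else kernel_point x y $ k))
       \<le> A * norm (kernel_point x y $ Some j0 - c) powr \<epsilon> * t powr (- homog)"
    proof (rule smoothness_ge)
      show "norm (kernel_point x y $ Some j0 - c) \<le> 1/2 * norm (kernel_point x y $ Some j0 - kernel_point x y $ None)"
        using far(2)[OF False] supp[OF False] by (simp add: norm_minus_commute)
      show "kernel_point x y $ Some j0 \<noteq> kernel_point x y $ None" using far(2)[OF False] L by auto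
      show "t \<le> kernel_dist (kernel_point x y)" unfolding t_def by (rule kernel_dist_point_ge)
    qed (use t2 \<rho> in auto)
    also have "A * norm (kernel_point x y $ Some j0 - c) powr \<epsilon> * t powr (- homog) \<le>
       A * L powr \<epsilon> * ((1/3) powr (- homog) * (\<Prod>j\<in>UNIV. (\<rho> + norm (x - y $ j)) powr (- tail_exp)))"
    proof (intro mult_mono)
      show "norm (kernel_point x y $ Some j0 - c) powr \<epsilon> \<le> L powr \<epsilon>"
        using supp[OF False] eps_pos by (intro powr_mono2) auto
      have "1/3 * (\<rho> + norm (x - y $ j)) \<le> t" for j
        using tj[of j] t2 \<rho>(2) by argo
      thus "t powr (- homog) \<le> (1/3) powr (- homog) * (\<Prod>j\<in>UNIV. (\<rho> + norm (x - y $ j)) powr (- tail_exp))"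
        by (intro homog_le_prod) (use \<rho> in \<open>auto simp: add_pos_nonneg\<close>)
    qed (use A_pos in auto)
    finally have *: "norm (K (kernel_point x y) - K (kernel_point x (\<chi> j. if j = j0 then c else y $ j))) \<le>
        c1 * (\<Prod>j\<in>UNIV. (\<rho> + norm (x - y $ j)) powr (- tail_exp))"
      unfolding eq by (simp add: c1_def mult_ac)
    have "kernel_integrand f x y - F y * f j0 (y $ j0)
      = (K (kernel_point x y) - K (kernel_point x (\<chi> j. if j = j0 then c else y $ j))) * (\<Prod>j\<in>UNIV. f j (y $ j))"
      by (simp add: kernel_integrand_def F_def split left_diff_distrib mult.assoc)
    hence "norm (kernel_integrand f x y - F y * f j0 (y $ j0))
      = norm (K (kernel_point x y) - K (kernel_point x (\<chi> j. if j = j0 then c else y $ j))) * (\<Prod>j\<in>UNIV. norm (f j (y $ j)))"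
      by (simp add: norm_mult prod_norm)
    also have "\<dots> \<le> c1 * (\<Prod>j\<in>UNIV. (\<rho> + norm (x - y $ j)) powr (- tail_exp)) * (\<Prod>j\<in>UNIV. norm (f j (y $ j)))"
      by (intro mult_right_mono * prod_nonneg) auto
    finally show ?thesis by (simp add: prod.distrib mult_ac)
  qed
  have bound: "(\<integral>\<^sup>+y. ennreal (norm (kernel_integrand f x y - F y * f j0 (y $ j0))) \<partial>lborel)
      \<le> ennreal (canc_const * L powr \<epsilon> * \<rho> powr (- (dimn + \<epsilon>)) * (LINT y|lborel. norm (f j0 y)) * (\<Prod>j\<in>UNIV-{j0}. lam j))"
    (is "?I \<le> ennreal ?R")
  proof -
    have "?I \<le> (\<integral>\<^sup>+y. ennreal c1 * (\<Prod>j\<in>UNIV. ennreal (norm (f j (y $ j)) * (\<rho> + norm (x - y $ j)) powr (- tail_exp))) \<partial>lborel)"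
      using pw c1 \<rho> by (intro nn_integral_mono) (auto simp: prod_ennreal ennreal_mult[symmetric] prod_nonneg intro!: ennreal_leI)
    also have "\<dots> = ennreal c1 * (\<Prod>j\<in>UNIV. \<integral>\<^sup>+y. ennreal (norm (f j y) * (\<rho> + norm (x - y)) powr (- tail_exp)) \<partial>lborel)"
    proof (subst nn_integral_cmult)
      have "(\<lambda>y::(real^'n)^'m. y $ j) \<in> borel_measurable borel" for j
        by (intro borel_measurable_continuous_onI continuous_intros)
      thus "(\<lambda>y::(real^'n)^'m. \<Prod>j\<in>UNIV. ennreal (norm (f j (y $ j)) * (\<rho> + norm (x - y $ j)) powr (- tail_exp))) \<in> borel_measurable lborel"
        by measurable
    qed (simp add: nn_integral_prod_tail)
    also have "\<dots> = ennreal c1 * ((\<integral>\<^sup>+y. ennreal (norm (f j0 y) * (\<rho> + norm (x - y)) powr (- tail_exp)) \<partial>lborel)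
       * (\<Prod>j\<in>UNIV-{j0}. \<integral>\<^sup>+y. ennreal (norm (f j y) * (\<rho> + norm (x - y)) powr (- tail_exp)) \<partial>lborel))"
      by (subst prod.remove[of UNIV j0]) auto
    also have "\<dots> \<le> ennreal c1 * (ennreal (\<rho> powr (- tail_exp) * (LINT y|lborel. norm (f j0 y)))
       * (\<Prod>j\<in>UNIV-{j0}. ennreal (tail_const * lam j * \<rho> powr (- (\<epsilon> / arity)))))"
    proof (intro mult_left_mono mult_mono prod_mono_ennreal single_tail)
      have "(\<integral>\<^sup>+y. ennreal (norm (f j0 y) * (\<rho> + norm (x - y)) powr (- tail_exp)) \<partial>lborel)
        \<le> (\<integral>\<^sup>+y. ennreal (\<rho> powr (- tail_exp)) * ennreal (norm (f j0 y)) \<partial>lborel)"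
      proof (intro nn_integral_mono)
        fix y
        have "tail_exp > 0" unfolding tail_exp_def using dimn_pos eps_pos arity_pos by (simp add: add_pos_pos)
        hence "(\<rho> + norm (x - y)) powr (- tail_exp) \<le> \<rho> powr (- tail_exp)"
          using \<rho> by (intro powr_mono2') auto
        hence "norm (f j0 y) * (\<rho> + norm (x - y)) powr (- tail_exp) \<le> \<rho> powr (- tail_exp) * norm (f j0 y)"
          by (subst mult.commute) (intro mult_right_mono, auto)
        thus "ennreal (norm (f j0 y) * (\<rho> + norm (x - y)) powr (- tail_exp)) \<le> ennreal (\<rho> powr (- tail_exp)) * ennreal (norm (f j0 y))"
          by (subst ennreal_mult[symmetric]) (auto intro!: ennreal_leI)
      qed
      also have "\<dots> = ennreal (\<rho> powr (- tail_exp)) * ennreal (LINT y|lborel. norm (f j0 y))"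
        using bbs_nn_integral[OF f] by (subst nn_integral_cmult) auto
      also have "\<dots> = ennreal (\<rho> powr (- tail_exp) * (LINT y|lborel. norm (f j0 y)))"
        by (intro ennreal_mult[symmetric]) auto
      finally show "(\<integral>\<^sup>+y. ennreal (norm (f j0 y) * (\<rho> + norm (x - y)) powr (- tail_exp)) \<partial>lborel)
         \<le> ennreal (\<rho> powr (- tail_exp) * (LINT y|lborel. norm (f j0 y)))" .
    qed (use mf lam \<rho> in auto)
    also have "\<dots> = ennreal (c1 * (\<rho> powr (- tail_exp) * (LINT y|lborel. norm (f j0 y)) * (\<Prod>j\<in>UNIV-{j0}. tail_const * lam j * \<rho> powr (- (\<epsilon> / arity)))))"
      using c1 lam tail_const_pos by (simp add: prod_ennreal ennreal_mult[symmetric] prod_nonneg)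
    also have "c1 * (\<rho> powr (- tail_exp) * (LINT y|lborel. norm (f j0 y)) * (\<Prod>j\<in>UNIV-{j0}. tail_const * lam j * \<rho> powr (- (\<epsilon> / arity)))) = ?R"
    proof -
      have "(\<Prod>j\<in>UNIV-{j0}. tail_const * lam j * \<rho> powr (- (\<epsilon> / arity)))
        = tail_const ^ (CARD('m) - 1) * (\<Prod>j\<in>UNIV-{j0}. lam j) * (\<rho> powr (- (\<epsilon> / arity))) ^ (CARD('m) - 1)"
        by (simp add: prod.distrib card_Diff_subset)
      moreover have "\<rho> powr (- tail_exp) * (\<rho> powr (- (\<epsilon> / arity))) ^ (CARD('m) - 1) = \<rho> powr (- (dimn + \<epsilon>))"
      proof -
        have "real (CARD('m) - 1) = arity - 1"
          by (subst of_nat_diff) (auto simp: Suc_leI)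
        hence "\<rho> powr (- tail_exp) * (\<rho> powr (- (\<epsilon> / arity))) ^ (CARD('m) - 1) = \<rho> powr (- tail_exp + - (\<epsilon> / arity) * (arity - 1))"
          using \<rho> by (subst powr_realpow[symmetric]) (auto simp: powr_powr powr_add[symmetric])
        also have "- tail_exp + - (\<epsilon> / arity) * (arity - 1) = - (dimn + \<epsilon>)"
          using arity_pos by (simp add: tail_exp_def field_simps)
        finally show ?thesis .
      qed
      ultimately show ?thesis unfolding canc_const_def c1_def by (simp add: mult_ac)
    qed
    finally show ?thesis .
  qed
  have "integrable lborel (\<lambda>y. kernel_integrand f x y - F y * f j0 (y $ j0))"
  proof (rule integrableI_bounded)
    show "(\<lambda>y. kernel_integrand f x y - F y * f j0 (y $ j0)) \<in> borel_measurable lborel"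
      using borel_measurable_integrable[OF i1] Fm by simp
    show "(\<integral>\<^sup>+y. ennreal (norm (kernel_integrand f x y - F y * f j0 (y $ j0))) \<partial>lborel) < \<infinity>"
      by (rule le_less_trans[OF bound]) simp
  qed
  from Bochner_Integration.integrable_diff[OF i1 this] have i2: "integrable lborel (\<lambda>y. F y * f j0 (y $ j0))" by simp
  have "(LINT y|lborel. F y * f j0 (y $ j0)) = 0"
  proof (rule integral_lborel_vec_mean_zero[OF i2])
    fix y z
    have "(\<chi> j. if j = j0 then c else (\<chi> i. if i = j0 then z else y $ i) $ j) = (\<chi> j. if j = j0 then c else y $ j)"
      by (auto simp: vec_eq_iff)
    moreover have "rest (\<chi> i. if i = j0 then z else y $ i) = rest y"
      unfolding rest_def by (intro prod.cong) auto
    ultimately show "F (\<chi> i. if i = j0 then z else y $ i) = F y" by (simp add: F_def)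
  qed (use mean bbs_integrable[OF f] in auto)
  hence "ennreal (norm (kernel_integral f x)) = ennreal (norm (LINT y|lborel. kernel_integrand f x y - F y * f j0 (y $ j0)))"
    using i1 i2 by (simp add: kernel_integral_def)
  also have "\<dots> \<le> (\<integral>\<^sup>+y. ennreal (norm (kernel_integrand f x y - F y * f j0 (y $ j0))) \<partial>lborel)"
    using i1 i2 by (intro integral_norm_bound_ennreal) auto
  also note bound
  finally show ?thesis unfolding \<rho>_def
    using lam A_pos tail_const_pos
    by (subst (asm) ennreal_le_iff) (auto simp: canc_const_def intro!: mult_nonneg_nonneg prod_nonneg integral_nonneg)
qed

end

section \<open>Bounded extensions and the kernel formula\<close>

lemma AE_lborel_vec_component:
  assumes "AE x in (lborel :: 'a::euclidean_space measure). P x"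
  shows "AE y in (lborel :: ('a^'m::finite) measure). P (y $ j)"
proof -
  obtain N where N: "{x. \<not> P x} \<subseteq> N" "N \<in> sets lborel" "emeasure lborel N = 0"
    using assms by (auto elim: AE_E)
  have c: "(\<lambda>y::'a^'m. y $ j) \<in> borel_measurable borel"
    by (intro borel_measurable_continuous_onI continuous_intros)
  define N' where "N' = {y::'a^'m. y $ j \<in> N}"
  have N': "N' \<in> sets lborel"
    using measurable_sets[OF c, of N] N(2) by (simp add: N'_def vimage_def)
  have "emeasure lborel N' = (\<integral>\<^sup>+y. indicator N' y \<partial>lborel)" using N' by simp
  also have "\<dots> = (\<integral>\<^sup>+y. (\<Prod>i\<in>UNIV. (if i = j then indicator N (y $ i) else 1)) \<partial>lborel)"
    by (intro nn_integral_cong) (auto simp: N'_def indicator_def prod.If_cases)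
  also have "\<dots> = (\<Prod>i\<in>UNIV. \<integral>\<^sup>+y. (if i = j then indicator N y else 1) \<partial>lborel)"
  proof (rule nn_integral_lborel_vec_prod[of "\<lambda>i y. if i = j then indicator N y else 1"])
    fix i show "(\<lambda>y. if i = j then indicator N y else (1::ennreal)) \<in> borel_measurable borel"
      using N(2) by (cases "i = j") auto
  qed
  also have "\<dots> = 0"
  proof (intro prod_zero bexI[of _ j])
    show "(\<integral>\<^sup>+y. (if j = j then indicator N y else 1) \<partial>lborel) = 0" using N(2,3) by simp
  qed auto
  finally have "N' \<in> null_sets lborel" using N' by (auto simp: null_sets_def)
  thus ?thesis by (rule AE_I') (use N(1) in \<open>auto simp: N'_def\<close>)
qed

lemma bbs_Lp: 
  assumes "bbs f" "p > 0"
  shows "f \<in> Lp_space p" "Lp_norm p f = (LINT x|lborel. norm (f x) powr p) powr (1 / p)"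
proof -
  have [measurable]: "f \<in> borel_measurable borel" by (rule bbsD(1)[OF assms(1)])
  show "f \<in> Lp_space p"
    unfolding Lp_space_def using bbs_powr_integrable[OF assms]
    by (auto simp: integrable_completion intro: measurable_completion)
  show "Lp_norm p f = (LINT x|lborel. norm (f x) powr p) powr (1 / p)"
    unfolding Lp_norm_def by (subst integral_completion) auto
qed

lemma bbs_diff: "bbs f \<Longrightarrow> bbs g \<Longrightarrow> bbs (\<lambda>x. f x - g x)"
proof -
  assume f: "bbs f" and g: "bbs g"
  have "bounded ({x. f x \<noteq> 0} \<union> {x. g x \<noteq> 0})" using f g by (auto simp: bbs_def)
  moreover have "{x. f x - g x \<noteq> 0} \<subseteq> {x. f x \<noteq> 0} \<union> {x. g x \<noteq> 0}" by auto
  ultimately have "bounded {x. f x - g x \<noteq> 0}" by (rule bounded_subset)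
  moreover have "bounded (range (\<lambda>x. f x - g x))"
    using f g unfolding bbs_def by (intro bounded_minus_comp) auto
  ultimately show ?thesis using f g unfolding bbs_def by auto
qed

lemma bbs_mult_indicator: "bbs f \<Longrightarrow> S \<in> sets borel \<Longrightarrow> bbs (\<lambda>x. f x * indicator S x)"
proof -
  assume f: "bbs f" and S: "S \<in> sets borel"
  have "{x. f x * indicator S x \<noteq> 0} \<subseteq> {x. f x \<noteq> 0}" by auto
  hence "bounded {x. f x * indicator S x \<noteq> 0}" using f unfolding bbs_def using bounded_subset by blast
  moreover have "bounded (range (\<lambda>x. f x * indicator S x))"
  proof -
    obtain M where "\<And>x. norm (f x) \<le> M" "M \<ge> 0" using bbsD(2)[OF f] by blast
    thus ?thesis unfolding bounded_iff by (intro exI[of _ M]) (auto simp: indicator_def)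
  qed
  ultimately show ?thesis using f S unfolding bbs_def by auto
qed

text \<open>
  A fixed extension and its exponents. The target exponent may be less than one, so all estimates use the
  \<open>target_exp\<close>-th power of the function instead of its norm.
\<close>

locale bounded_multilinear_extension =
  fixes q :: "'m::finite \<Rightarrow> real"
    and T :: "('m \<Rightarrow> real^'n::finite \<Rightarrow> complex) \<Rightarrow> (real^'n \<Rightarrow> complex) \<Rightarrow> complex"
    and U :: "('m \<Rightarrow> real^'n \<Rightarrow> complex) \<Rightarrow> real^'n \<Rightarrow> complex"
  assumes q1: "\<And>j. 1 \<le> q j" and ext: "bounded_extension_at q T U"
begin

definition "target_exp = 1 / (\<Sum>j\<in>UNIV. 1 / q j)"

lemma q_pos: "q j > 0" using q1[of j] by linarith

lemma target_exp_pos: "target_exp > 0"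
  unfolding target_exp_def using q_pos by (intro divide_pos_pos sum_pos) auto

lemma U_Lp: "(\<And>j. f j \<in> Lp_space (q j)) \<Longrightarrow> U f \<in> Lp_space target_exp"
  using ext unfolding bounded_extension_at_def Let_def target_exp_def by blast

lemma U_linear:
  "(\<And>j. f j \<in> Lp_space (q j)) \<Longrightarrow> g \<in> Lp_space (q j) \<Longrightarrow>
   AE x in lborel. U (f(j := \<lambda>x. a * f j x + b * g x)) x = a * U f x + b * U (f(j := g)) x"
  using ext unfolding bounded_extension_at_def Let_def AE_completion_iff by blast

lemma U_schwartz: "(\<And>j. f j \<in> schwartz_space) \<Longrightarrow> represented_by (T f) (U f)"
  using ext unfolding bounded_extension_at_def Let_def by blast

definition "op_norm = (SOME C. C \<ge> 0 \<and> (\<forall>f. (\<forall>j. f j \<in> Lp_space (q j)) \<longrightarrow>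
          Lp_norm target_exp (U f) \<le> C * (\<Prod>j\<in>UNIV. Lp_norm (q j) (f j))))"

lemma Lp_norm_nonneg: "Lp_norm p h \<ge> 0"
  by (simp add: Lp_norm_def)

lemma op_norm:
  shows op_norm_nonneg: "op_norm \<ge> 0"
    and op_norm_bound: "\<And>f. (\<And>j. f j \<in> Lp_space (q j)) \<Longrightarrow>
       Lp_norm target_exp (U f) \<le> op_norm * (\<Prod>j\<in>UNIV. Lp_norm (q j) (f j))"
proof -
  obtain C where C: "\<forall>f. (\<forall>j. f j \<in> Lp_space (q j)) \<longrightarrow>
          Lp_norm target_exp (U f) \<le> C * (\<Prod>j\<in>UNIV. Lp_norm (q j) (f j))"
    using ext unfolding bounded_extension_at_def Let_def target_exp_def by blast
  have "max C 0 \<ge> 0 \<and> (\<forall>f. (\<forall>j. f j \<in> Lp_space (q j)) \<longrightarrow>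
          Lp_norm target_exp (U f) \<le> max C 0 * (\<Prod>j\<in>UNIV. Lp_norm (q j) (f j)))"
  proof (intro conjI allI impI)
    fix f :: "'m \<Rightarrow> real^'n \<Rightarrow> complex" assume "\<forall>j. f j \<in> Lp_space (q j)"
    hence "Lp_norm target_exp (U f) \<le> C * (\<Prod>j\<in>UNIV. Lp_norm (q j) (f j))" using C by blast
    also have "\<dots> \<le> max C 0 * (\<Prod>j\<in>UNIV. Lp_norm (q j) (f j))"
      by (intro mult_right_mono prod_nonneg) (auto simp: Lp_norm_nonneg)
    finally show "Lp_norm target_exp (U f) \<le> max C 0 * (\<Prod>j\<in>UNIV. Lp_norm (q j) (f j))" .
  qed simp
  from someI[where P="\<lambda>C. C \<ge> 0 \<and> (\<forall>f. (\<forall>j. f j \<in> Lp_space (q j)) \<longrightarrow>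
          Lp_norm target_exp (U f) \<le> C * (\<Prod>j\<in>UNIV. Lp_norm (q j) (f j)))", OF this]
  show "op_norm \<ge> 0" "\<And>f. (\<And>j. f j \<in> Lp_space (q j)) \<Longrightarrow>
       Lp_norm target_exp (U f) \<le> op_norm * (\<Prod>j\<in>UNIV. Lp_norm (q j) (f j))"
    unfolding op_norm_def by blast+
qed

lemma U_powr_bound:
  assumes "\<And>j. f j \<in> Lp_space (q j)"
  shows "integrable lebesgue (\<lambda>x. norm (U f x) powr target_exp)"
    "(LINT x|lebesgue. norm (U f x) powr target_exp) \<le> (op_norm * (\<Prod>j\<in>UNIV. Lp_norm (q j) (f j))) powr target_exp"
proof -
  show "integrable lebesgue (\<lambda>x. norm (U f x) powr target_exp)"
    using U_Lp[OF assms] by (simp add: Lp_space_def)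
  define I where "I = (LINT x|lebesgue. norm (U f x) powr target_exp)"
  have I: "I \<ge> 0" unfolding I_def by (intro Bochner_Integration.integral_nonneg) auto
  have "I = (Lp_norm target_exp (U f)) powr target_exp"
    using I target_exp_pos by (simp add: Lp_norm_def powr_powr I_def[symmetric])
  also have "\<dots> \<le> (op_norm * (\<Prod>j\<in>UNIV. Lp_norm (q j) (f j))) powr target_exp"
    using target_exp_pos op_norm_bound[OF assms] Lp_norm_nonneg by (intro powr_mono2) auto
  finally show "I \<le> (op_norm * (\<Prod>j\<in>UNIV. Lp_norm (q j) (f j))) powr target_exp" .
qed

lemma U_measurable: "(\<And>j. f j \<in> Lp_space (q j)) \<Longrightarrow> U f \<in> borel_measurable lebesgue"
  using U_Lp by (simp add: Lp_space_def)

text \<open>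
  The boundedness of \<open>U\<close> is what makes it insensitive to null sets.
\<close>

lemma U_zero:
  fixes f :: "'m \<Rightarrow> real^'n \<Rightarrow> complex"
  assumes "\<And>j. f j \<in> Lp_space (q j)" "AE x in lborel. f j0 x = 0"
  shows "AE x in lborel. U f x = 0"
proof -
  have "(LINT x|lebesgue. norm (f j0 x) powr q j0) = (LINT x|(lebesgue :: (real^'n) measure). 0)"
    using assms(1)[of j0] assms(2) q_pos[of j0] unfolding AE_completion_iff[symmetric, where M = lborel]
    by (intro Bochner_Integration.integral_cong_AE) (auto simp: Lp_space_def elim: eventually_mono)
  hence "Lp_norm (q j0) (f j0) = 0" by (simp add: Lp_norm_def)
  hence z: "(\<Prod>j\<in>UNIV. Lp_norm (q j) (f j)) = 0" by (intro prod_zero) auto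
  have "(LINT x|lebesgue. norm (U f x) powr target_exp) \<le> 0"
    using U_powr_bound(2)[OF assms(1)] target_exp_pos by (simp add: z)
  moreover have "(LINT x|lebesgue. norm (U f x) powr target_exp) \<ge> 0" by (intro Bochner_Integration.integral_nonneg) auto
  ultimately have "(LINT x|lebesgue. norm (U f x) powr target_exp) = 0" by linarith
  hence "AE x in lebesgue. norm (U f x) powr target_exp = 0"
    using integral_nonneg_eq_0_iff_AE[OF U_powr_bound(1)[OF assms(1)]] by simp
  thus ?thesis unfolding AE_completion_iff by (auto elim: eventually_mono)
qed

text \<open>
  Multilinearity: replace the entries of \<open>f\<close> by those of \<open>g\<close> one at a time. In the \<open>j\<close>-th term the \<open>j\<close>-th entry
  is \<open>f j - g j\<close>, and the other entries need not be known beyond being taken from \<open>f\<close> or \<open>g\<close>.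
\<close>

lemma U_telescope:
  fixes f g :: "'m \<Rightarrow> real^'n \<Rightarrow> complex"
  assumes f: "\<And>j. f j \<in> Lp_space (q j)" and g: "\<And>j. g j \<in> Lp_space (q j)"
    and fg: "\<And>j. (\<lambda>x. f j x - g j x) \<in> Lp_space (q j)"
  shows "\<exists>H. (\<forall>j. H j j = (\<lambda>x. f j x - g j x)) \<and> (\<forall>j i. i \<noteq> j \<longrightarrow> H j i = f i \<or> H j i = g i) \<and>
    (AE x in lborel. U f x - U g x = (\<Sum>j\<in>UNIV. U (H j) x))"
proof -
  have "\<exists>H. (\<forall>j. H j j = (\<lambda>x. f j x - g j x)) \<and> (\<forall>j i. i \<noteq> j \<longrightarrow> H j i = f i \<or> H j i = g i) \<and>
     (AE x in lborel. U (\<lambda>i. if i \<in> J then f i else g i) x - U g x = (\<Sum>j\<in>J. U (H j) x))"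
    if "finite J" for J
    using that
  proof (induction J rule: finite_induct)
    case empty
    show ?case by (rule exI[of _ "\<lambda>j. f(j := \<lambda>x. f j x - g j x)"]) auto
  next
    case (insert j J)
    define M where "M = (\<lambda>i. if i \<in> J then f i else g i)"
    from insert.IH obtain H where H: "\<forall>j. H j j = (\<lambda>x. f j x - g j x)" "\<forall>j i. i \<noteq> j \<longrightarrow> H j i = f i \<or> H j i = g i"
      "AE x in lborel. U M x - U g x = (\<Sum>j\<in>J. U (H j) x)"
      unfolding M_def by blast
    have M: "M i \<in> Lp_space (q i)" for i using f g by (simp add: M_def)
    define H' where "H' = H(j := M(j := \<lambda>x. f j x - g j x))"
    have "M j = g j" using insert by (simp add: M_def)
    hence "M(j := \<lambda>x. 1 * M j x + 1 * (f j x - g j x)) = (\<lambda>i. if i \<in> insert j J then f i else g i)"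
      by (auto simp: M_def fun_eq_iff)
    with U_linear[of M "\<lambda>x. f j x - g j x" j 1 1, OF M fg]
    have "AE x in lborel. U (\<lambda>i. if i \<in> insert j J then f i else g i) x = U M x + U (H' j) x"
      by (simp add: H'_def)
    with H(3) have "AE x in lborel. U (\<lambda>i. if i \<in> insert j J then f i else g i) x - U g x = (\<Sum>i\<in>insert j J. U (H' i) x)"
    proof eventually_elim
      case (elim x)
      have "(\<Sum>i\<in>J. U (H' i) x) = (\<Sum>i\<in>J. U (H i) x)"
        using insert by (intro sum.cong) (auto simp: H'_def)
      thus ?case using elim insert by simp
    qed
    moreover have "\<forall>j. H' j j = (\<lambda>x. f j x - g j x)" "\<forall>j i. i \<noteq> j \<longrightarrow> H' j i = f i \<or> H' j i = g i"
      using H by (auto simp: H'_def M_def)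
    ultimately show ?case by blast
  qed
  from this[of UNIV] show ?thesis by simp
qed

lemma U_cong_AE:
  fixes f g :: "'m \<Rightarrow> real^'n \<Rightarrow> complex"
  assumes f: "\<And>j. f j \<in> Lp_space (q j)" and g: "\<And>j. g j \<in> Lp_space (q j)"
    and fg: "\<And>j. AE x in lborel. f j x = g j x"
  shows "AE x in lborel. U f x = U g x"
proof -
  have d: "AE x in lborel. f j x - g j x = 0" for j using fg[of j] by eventually_elim simp
  have m: "f j \<in> borel_measurable lebesgue" "g j \<in> borel_measurable lebesgue" for j
    using f[of j] g[of j] by (auto simp: Lp_space_def)
  have Lp: "(\<lambda>x. f j x - g j x) \<in> Lp_space (q j)" for j
  proof -
    have "integrable lebesgue (\<lambda>x. norm (f j x - g j x) powr q j)"
    proof (subst Bochner_Integration.integrable_cong_AE[of _ lebesgue "\<lambda>x. 0"])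
      show "(\<lambda>x. norm (f j x - g j x) powr q j) \<in> borel_measurable lebesgue" using m[of j] by simp
      show "AE x in lebesgue. norm (f j x - g j x) powr q j = 0"
        unfolding AE_completion_iff using d[of j] by eventually_elim simp
    qed auto
    thus ?thesis using m[of j] by (simp add: Lp_space_def)
  qed
  obtain H where H: "\<And>j. H j j = (\<lambda>x. f j x - g j x)" "\<And>j i. i \<noteq> j \<Longrightarrow> H j i = f i \<or> H j i = g i"
    "AE x in lborel. U f x - U g x = (\<Sum>j\<in>UNIV. U (H j) x)"
    using U_telescope[OF f g Lp] by auto
  have "AE x in lborel. U (H j) x = 0" for j
  proof (rule U_zero[of _ j])
    fix i show "H j i \<in> Lp_space (q i)"
      using H(1)[of j] H(2)[of i j] f[of i] g[of i] Lp[of i] by (cases "i = j") auto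
    show "AE x in lborel. H j j x = 0" unfolding H(1) by (rule d)
  qed
  hence "AE x in lborel. \<forall>j\<in>UNIV. U (H j) x = 0" by (intro AE_finite_allI) auto
  with H(3) show ?thesis by eventually_elim simp
qed

text \<open>
  By dominated convergence the entries converge in \<open>L\<^sup>q\<^sup>j\<close>, and telescoping with the bound for \<open>U\<close> shows that
  \<open>\<bar>U (F k) - U f\<bar>\<close> raised to \<open>target_exp\<close> tends to zero in mean, so a subsequence converges almost
  everywhere.
\<close>

lemma U_convergence:
  fixes F :: "nat \<Rightarrow> 'm \<Rightarrow> real^'n \<Rightarrow> complex"
  assumes F: "\<And>k j. bbs (F k j)" and f: "\<And>j. bbs (f j)"
    and M: "\<And>k j x. norm (F k j x) \<le> M j" and supp: "\<And>k j x. x \<notin> cbox (a j) (b j) \<Longrightarrow> F k j x = 0"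
    and conv: "\<And>j. AE x in lborel. (\<lambda>k. F k j x) \<longlonglongrightarrow> f j x"
  obtains s where "strict_mono s" "AE x in lborel. (\<lambda>k. U (F (s k)) x) \<longlonglongrightarrow> U f x"
proof -
  have [measurable]: "F k j \<in> borel_measurable borel" "f j \<in> borel_measurable borel" for k j
    using bbsD(1)[OF F] bbsD(1)[OF f] by auto
  have FLp: "F k j \<in> Lp_space (q j)" and fLp: "f j \<in> Lp_space (q j)"
    and dLp: "(\<lambda>x. F k j x - f j x) \<in> Lp_space (q j)" for k j
    by (intro bbs_Lp F f bbs_diff q_pos)+
  have M0: "M j \<ge> 0" for j using M[of undefined j undefined] norm_ge_zero order_trans by blast
  obtain Mf where Mf: "\<And>j x. norm (f j x) \<le> Mf j" "\<And>j. Mf j \<ge> 0"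
    using bbsD(2)[OF f] by metis
  obtain af where af: "\<And>j x. x \<notin> cbox (- af j) (af j) \<Longrightarrow> f j x = 0"
    using bbsD(3)[OF f] by metis
  define w where "w = (\<lambda>j x. (M j + Mf j) powr q j * (indicator (cbox (a j) (b j)) x + indicator (cbox (- af j) (af j)) x :: real))"
  have wi: "integrable lborel (w j)" for j
    unfolding w_def
    by (intro integrable_mult_right Bochner_Integration.integrable_add integrable_real_indicator) (auto simp: emeasure_lborel_cbox_eq)
  have wbound: "norm (F k j x - f j x) powr q j \<le> w j x" "norm (F k j x) powr q j \<le> w j x" "norm (f j x) powr q j \<le> w j x" for k j x
  proof -
    have *: "norm z powr q j \<le> w j x" if "norm z \<le> M j + Mf j" "x \<notin> cbox (a j) (b j) \<Longrightarrow> x \<notin> cbox (- af j) (af j) \<Longrightarrow> z = 0" for z :: complex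
    proof (cases "x \<in> cbox (a j) (b j) \<or> x \<in> cbox (- af j) (af j)")
      case True
      have "norm z powr q j \<le> (M j + Mf j) powr q j * 1" using that(1) q_pos[of j] by (simp add: powr_mono2)
      also have "\<dots> \<le> w j x" unfolding w_def using True by (intro mult_left_mono) (auto simp: indicator_def)
      finally show ?thesis .
    next
      case False
      hence "z = 0" using that(2) by blast
      thus ?thesis by (simp add: w_def)
    qed
    show "norm (F k j x - f j x) powr q j \<le> w j x"
      using norm_triangle_ineq4[of "F k j x" "f j x"] M[of k j x] Mf(1)[of j x] supp[of x j k] af[of x j] by (intro *) (linarith, simp)
    show "norm (F k j x) powr q j \<le> w j x"
      using M[of k j x] Mf(2)[of j] supp[of x j k] by (intro *) (linarith, simp)
    show "norm (f j x) powr q j \<le> w j x"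
      using M0[of j] Mf(1)[of j x] af[of x j] by (intro *) (linarith, simp)
  qed
  define N where "N = (\<lambda>k j. Lp_norm (q j) (\<lambda>x. F k j x - f j x))"
  define W where "W = (\<lambda>j. (LINT x|lborel. w j x) powr (1 / q j))"
  have Wb: "Lp_norm (q j) (F k j) \<le> W j" "Lp_norm (q j) (f j) \<le> W j" for k j
    unfolding bbs_Lp(2)[OF F q_pos] bbs_Lp(2)[OF f q_pos] W_def using q_pos[of j] wbound wi
    by (auto intro!: powr_mono2 Bochner_Integration.integral_nonneg integral_mono bbs_powr_integrable F f)
  have N0: "(\<lambda>k. N k j) \<longlonglongrightarrow> 0" for j
  proof -
    have "(\<lambda>k. LINT x|lborel. norm (F k j x - f j x) powr q j) \<longlonglongrightarrow> (LINT x|(lborel :: (real^'n) measure). 0)"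
    proof (rule integral_dominated_convergence[where w = "w j"])
      show "AE x in lborel. (\<lambda>k. norm (F k j x - f j x) powr q j) \<longlonglongrightarrow> 0"
        using conv[of j]
      proof eventually_elim
        case (elim x)
        hence "(\<lambda>k. norm (F k j x - f j x)) \<longlonglongrightarrow> 0" by (simp add: LIM_zero tendsto_norm_zero)
        thus ?case using q_pos[of j] by (intro tendsto_zero_powrI[of _ _ _ "q j"]) auto
      qed
      show "AE x in lborel. norm (norm (F k j x - f j x) powr q j) \<le> w j x" for k
        using wbound(1) by (intro always_eventually) auto
    qed (auto intro: wi)
    hence "(\<lambda>k. (LINT x|lborel. norm (F k j x - f j x) powr q j) powr (1 / q j)) \<longlonglongrightarrow> 0"
      using q_pos[of j] by (intro tendsto_zero_powrI[of _ _ _ "1 / q j"]) (auto intro!: always_eventually Bochner_Integration.integral_nonneg)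
    thus ?thesis unfolding N_def by (simp add: bbs_Lp(2)[OF bbs_diff[OF F f] q_pos])
  qed
  have "\<forall>k. \<exists>H. (\<forall>j. H j j = (\<lambda>x. F k j x - f j x)) \<and> (\<forall>j i. i \<noteq> j \<longrightarrow> H j i = F k i \<or> H j i = f i) \<and>
    (AE x in lborel. U (F k) x - U f x = (\<Sum>j\<in>UNIV. U (H j) x))"
    by (intro allI U_telescope FLp fLp dLp)
  from choice[OF this] obtain H where H': "\<forall>k. (\<forall>j. H k j j = (\<lambda>x. F k j x - f j x)) \<and> (\<forall>j i. i \<noteq> j \<longrightarrow> H k j i = F k i \<or> H k j i = f i) \<and>
    (AE x in lborel. U (F k) x - U f x = (\<Sum>j\<in>UNIV. U (H k j) x))" ..
  have H: "\<And>k j. H k j j = (\<lambda>x. F k j x - f j x)" "\<And>k j i. i \<noteq> j \<Longrightarrow> H k j i = F k i \<or> H k j i = f i"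
    "\<And>k. AE x in lborel. U (F k) x - U f x = (\<Sum>j\<in>UNIV. U (H k j) x)"
    using H' by (blast, blast, blast)
  have HLp: "H k j i \<in> Lp_space (q i)" for k j i
    using H(1)[of k j] H(2)[of i j k] FLp[of k i] fLp[of i] dLp[of k i] by (cases "i = j") auto
  define S where "S = (\<lambda>k x. \<Sum>j\<in>UNIV. norm (U (H k j) x) powr target_exp)"
  have Si: "integrable lebesgue (S k)" for k
    unfolding S_def by (intro Bochner_Integration.integrable_sum U_powr_bound HLp)
  have le: "(LINT x|lebesgue. norm (S k x)) \<le> (\<Sum>j\<in>UNIV. (op_norm * (N k j * (\<Prod>i\<in>UNIV-{j}. W i))) powr target_exp)" for k
  proof -
    have "norm (S k x) = S k x" for x by (simp add: S_def sum_nonneg)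
    hence "(LINT x|lebesgue. norm (S k x)) = (\<Sum>j\<in>UNIV. LINT x|lebesgue. norm (U (H k j) x) powr target_exp)"
      by (simp add: S_def integral_sum U_powr_bound(1)[OF HLp])
    also have "\<dots> \<le> (\<Sum>j\<in>UNIV. (op_norm * (N k j * (\<Prod>i\<in>UNIV-{j}. W i))) powr target_exp)"
    proof (intro sum_mono)
      fix j
      have "(\<Prod>i\<in>UNIV. Lp_norm (q i) (H k j i)) = Lp_norm (q j) (H k j j) * (\<Prod>i\<in>UNIV-{j}. Lp_norm (q i) (H k j i))"
        by (subst prod.remove[of UNIV j]) auto
      also have "\<dots> \<le> N k j * (\<Prod>i\<in>UNIV-{j}. W i)"
        unfolding H(1) N_def
      proof (intro mult_left_mono prod_mono conjI Lp_norm_nonneg)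
        fix i assume "i \<in> UNIV - {j}"
        thus "Lp_norm (q i) (H k j i) \<le> W i" using H(2)[of i j k] Wb(1)[where k = k and j = i] Wb(2)[of i] by auto
      qed
      finally have "op_norm * (\<Prod>i\<in>UNIV. Lp_norm (q i) (H k j i)) \<le> op_norm * (N k j * (\<Prod>i\<in>UNIV-{j}. W i))"
        by (intro mult_left_mono op_norm_nonneg)
      hence "(op_norm * (\<Prod>i\<in>UNIV. Lp_norm (q i) (H k j i))) powr target_exp \<le> (op_norm * (N k j * (\<Prod>i\<in>UNIV-{j}. W i))) powr target_exp"
        using target_exp_pos op_norm_nonneg by (intro powr_mono2) (auto intro!: mult_nonneg_nonneg prod_nonneg Lp_norm_nonneg)
      thus "(LINT x|lebesgue. norm (U (H k j) x) powr target_exp) \<le> (op_norm * (N k j * (\<Prod>i\<in>UNIV-{j}. W i))) powr target_exp"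
        using U_powr_bound(2)[of "H k j", OF HLp] by linarith
    qed
    finally show ?thesis .
  qed
  have lim: "(\<lambda>k. \<Sum>j\<in>UNIV. (op_norm * (N k j * (\<Prod>i\<in>UNIV-{j}. W i))) powr target_exp) \<longlonglongrightarrow> 0"
  proof (intro tendsto_null_sum)
    fix j
    have "(\<lambda>k. op_norm * (N k j * (\<Prod>i\<in>UNIV-{j}. W i))) \<longlonglongrightarrow> 0"
      by (intro tendsto_mult_right_zero tendsto_mult_left_zero N0)
    thus "(\<lambda>k. (op_norm * (N k j * (\<Prod>i\<in>UNIV-{j}. W i))) powr target_exp) \<longlonglongrightarrow> 0"
      using target_exp_pos op_norm_nonneg
      by (intro tendsto_zero_powrI[of _ _ _ target_exp])
         (auto intro!: always_eventually mult_nonneg_nonneg prod_nonneg simp: N_def Lp_norm_nonneg W_def)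
  qed
  have "(\<lambda>k. LINT x|lebesgue. norm (S k x)) \<longlonglongrightarrow> 0"
  proof (rule Lim_null_comparison[OF _ lim])
    have "0 \<le> (LINT x|lebesgue. norm (S k x))" for k by (intro Bochner_Integration.integral_nonneg) auto
    thus "\<forall>\<^sub>F k in sequentially. norm (LINT x|lebesgue. norm (S k x)) \<le> (\<Sum>j\<in>UNIV. (op_norm * (N k j * (\<Prod>i\<in>UNIV-{j}. W i))) powr target_exp)"
      using le by (intro always_eventually allI) (simp only: real_norm_def abs_of_nonneg)
  qed
  from tendsto_L1_AE_subseq[OF Si this]
  obtain s where s: "strict_mono s" "AE x in lebesgue. (\<lambda>k. S (s k) x) \<longlonglongrightarrow> 0" by blast
  have "AE x in lborel. \<forall>k. U (F k) x - U f x = (\<Sum>j\<in>UNIV. U (H k j) x)"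
    using H(3) by (subst AE_all_countable) blast
  with s(2)[unfolded AE_completion_iff] have "AE x in lborel. (\<lambda>k. U (F (s k)) x) \<longlonglongrightarrow> U f x"
  proof eventually_elim
    case (elim x)
    have "(\<lambda>k. U (H (s k) j) x) \<longlonglongrightarrow> 0" for j
    proof -
      have L: "(\<lambda>k. norm (U (H (s k) j) x) powr target_exp) \<longlonglongrightarrow> 0"
      proof (rule tendsto_sandwich[OF _ _ tendsto_const elim(1)])
        show "\<forall>\<^sub>F k in sequentially. norm (U (H (s k) j) x) powr target_exp \<le> S (s k) x"
          unfolding S_def by (intro always_eventually allI member_le_sum) auto
      qed auto
      hence "(\<lambda>k. (norm (U (H (s k) j) x) powr target_exp) powr (1 / target_exp)) \<longlonglongrightarrow> 0"
        using target_exp_pos by (intro tendsto_zero_powrI[OF L tendsto_const]) auto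
      hence "(\<lambda>k. norm (U (H (s k) j) x)) \<longlonglongrightarrow> 0" using target_exp_pos by (simp add: powr_powr)
      thus ?thesis by (rule tendsto_norm_zero_cancel)
    qed
    hence "(\<lambda>k. \<Sum>j\<in>UNIV. U (H (s k) j) x) \<longlonglongrightarrow> 0" by (intro tendsto_null_sum) auto
    hence "(\<lambda>k. U (F (s k)) x - U f x) \<longlonglongrightarrow> 0" using elim(2) by simp
    thus ?case by (simp add: LIM_zero_iff)
  qed
  with s(1) show thesis by (rule that)
qed

end

lemma schwartz_continuous:
  assumes "f \<in> schwartz_space" shows "continuous_on UNIV f"
proof -
  have "foldr partial_deriv [] f differentiable (at x)" for x
    using assms unfolding schwartz_space_def by blast
  thus ?thesis
    by (intro differentiable_imp_continuous_on) (auto simp: differentiable_on_def intro: differentiable_at_withinI)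
qed

lemma schwartz_borel: "f \<in> schwartz_space \<Longrightarrow> f \<in> borel_measurable borel"
  by (intro borel_measurable_continuous_onI schwartz_continuous)

text \<open>
  The approximation is used for tuples throughout, with at most one entry having to vanish in a given
  box.
\<close>

lemma schwartz_approximation_tuple:
  fixes f :: "'m \<Rightarrow> real^'n::finite \<Rightarrow> complex"
  assumes f: "\<And>j. bbs (f j)" and 0: "\<And>x. x \<in> box c d \<Longrightarrow> f j0 x = 0"
  obtains F M a where "\<And>k j. F k j \<in> schwartz_space" "\<And>k j x. norm (F k j x) \<le> M j + 1" "\<And>j. M j \<ge> 0"
    "\<And>k j x. x \<notin> cbox (- a j) (a j) \<Longrightarrow> F k j x = 0"
    "\<And>j. AE x in lborel. (\<lambda>k::nat. F k j x) \<longlonglongrightarrow> f j x"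
    "\<And>x. x \<in> box c d \<Longrightarrow> \<exists>e>0. \<forall>\<^sub>F k in sequentially. \<forall>z\<in>ball x e. F k j0 z = 0"
proof -
  obtain M where M: "\<And>j x. norm (f j x) \<le> M j" "\<And>j. M j \<ge> 0" using bbsD(2)[OF f] by metis
  obtain a where a: "\<And>j x. x \<notin> cbox (- a j) (a j) \<Longrightarrow> f j x = 0" using bbsD(3)[OF f] by metis
  define c' d' where "c' = (\<lambda>j. if j = j0 then c else 0)" and "d' = (\<lambda>j. if j = j0 then d else 0)"
  have [measurable]: "f j \<in> borel_measurable borel" for j by (rule bbsD(1)[OF f])
  have b0: "box 0 (0::real^'n) = {}" by (auto simp: mem_box)
  have "\<forall>j. \<exists>G. (\<forall>k. G k \<in> schwartz_space) \<and> (\<forall>k x. norm (G k x) \<le> M j + 1) \<and>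
    (\<forall>k x. x \<notin> cbox (- a j) (a j) \<longrightarrow> G k x = 0) \<and> (AE x in lborel. (\<lambda>k::nat. G k x) \<longlonglongrightarrow> f j x) \<and>
    (\<forall>x\<in>box (c' j) (d' j). \<exists>e>0. \<forall>\<^sub>F k in sequentially. \<forall>z\<in>ball x e. G k z = 0)"
  proof
    fix j
    have m: "f j \<in> borel_measurable lebesgue" by (rule measurable_completion) simp
    have z: "f j x = 0" if "x \<in> box (c' j) (d' j)" for x
      using that 0 b0 by (cases "j = j0") (auto simp: c'_def d'_def)
    show "\<exists>G. (\<forall>k. G k \<in> schwartz_space) \<and> (\<forall>k x. norm (G k x) \<le> M j + 1) \<and>
      (\<forall>k x. x \<notin> cbox (- a j) (a j) \<longrightarrow> G k x = 0) \<and> (AE x in lborel. (\<lambda>k::nat. G k x) \<longlonglongrightarrow> f j x) \<and>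
      (\<forall>x\<in>box (c' j) (d' j). \<exists>e>0. \<forall>\<^sub>F k in sequentially. \<forall>z\<in>ball x e. G k z = 0)"
    proof (rule schwartz_approximation[OF m M(1)[of j] a[of _ j] z])
      fix F assume "\<And>k. F k \<in> schwartz_space" "\<And>k x. norm (F k x) \<le> M j + 1"
        "\<And>k x. x \<notin> cbox (- a j) (a j) \<Longrightarrow> F k x = 0"
        "AE x in lborel. (\<lambda>k. F k x) \<longlonglongrightarrow> f j x"
        "\<And>x. x \<in> box (c' j) (d' j) \<Longrightarrow> \<exists>e>0. \<forall>\<^sub>F k in sequentially. \<forall>z\<in>ball x e. F k z = 0"
      thus ?thesis by (intro exI[of _ F]) simp
    qed
  qed
  from choice[OF this] obtain G where G: "\<forall>j. (\<forall>k. G j k \<in> schwartz_space) \<and> (\<forall>k x. norm (G j k x) \<le> M j + 1) \<and>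
    (\<forall>k x. x \<notin> cbox (- a j) (a j) \<longrightarrow> G j k x = 0) \<and> (AE x in lborel. (\<lambda>k::nat. G j k x) \<longlonglongrightarrow> f j x) \<and>
    (\<forall>x\<in>box (c' j) (d' j). \<exists>e>0. \<forall>\<^sub>F k in sequentially. \<forall>z\<in>ball x e. G j k z = 0)" ..
  define F where "F = (\<lambda>k j. G j k)"
  have FS: "F k j \<in> schwartz_space" and FM: "norm (F k j x) \<le> M j + 1"
    and Fsupp: "x \<notin> cbox (- a j) (a j) \<Longrightarrow> F k j x = 0"
    and Fconv: "AE x in lborel. (\<lambda>k. F k j x) \<longlonglongrightarrow> f j x" for k j x
    using G unfolding F_def by (blast, blast, blast, blast)
  have Fbox: "\<exists>e>0. \<forall>\<^sub>F k in sequentially. \<forall>z\<in>ball x e. F k j0 z = 0" if "x \<in> box c d" for x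
    using G that unfolding F_def c'_def d'_def by presburger
  show thesis by (rule that[of F M a]) (fact FS FM M(2) Fsupp Fconv Fbox)+
qed

locale CZ_operator = bounded_multilinear_extension q T U + CZ_kernel_bounds K A \<epsilon> arity dimn
  for q :: "'m::finite \<Rightarrow> real"
    and T :: "('m \<Rightarrow> real^'n::finite \<Rightarrow> complex) \<Rightarrow> (real^'n \<Rightarrow> complex) \<Rightarrow> complex"
    and U :: "('m \<Rightarrow> real^'n \<Rightarrow> complex) \<Rightarrow> real^'n \<Rightarrow> complex"
    and K :: "(real^'n)^('m option) \<Rightarrow> complex" and A \<epsilon> arity dimn :: real +
  assumes kernel: "has_kernel T K"
begin

text \<open>
  On the box the kernel formula holds for the approximating Schwartz functions, whose entry \<open>j0\<close> vanishes near
  the point in question. The left side converges along a subsequence by \<open>U_convergence\<close>, the right side by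
  dominated convergence, as the kernel is bounded where the integrands do not vanish.
\<close>

lemma kernel_representation_box:
  assumes f: "\<And>j. bbs (f j)" and 0: "\<And>x. x \<in> box c d \<Longrightarrow> f j0 x = 0"
  shows "AE x in lborel. x \<in> box c d \<longrightarrow> U f x = kernel_integral f x"
proof -
  have [measurable]: "f j \<in> borel_measurable borel" for j by (rule bbsD(1)[OF f])
  obtain F M a where FS: "\<And>k j. F k j \<in> schwartz_space" and FM: "\<And>k j x. norm (F k j x) \<le> M j + 1" and M: "\<And>j. M j \<ge> 0"
    and Fsupp: "\<And>k j x. x \<notin> cbox (- a j) (a j) \<Longrightarrow> F k j x = 0"
    and Fconv: "\<And>j. AE x in lborel. (\<lambda>k::nat. F k j x) \<longlonglongrightarrow> f j x"
    and Fbox: "\<And>x. x \<in> box c d \<Longrightarrow> \<exists>e>0. \<forall>\<^sub>F k in sequentially. \<forall>z\<in>ball x e. F k j0 z = 0"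
  proof (rule schwartz_approximation_tuple[of f c d j0, OF f 0])
    fix F M a
    assume h: "\<And>k j. F k j \<in> schwartz_space" "\<And>k j x. norm (F k j x) \<le> M j + 1" "\<And>j. M j \<ge> 0"
      "\<And>k j x. x \<notin> cbox (- a j) (a j) \<Longrightarrow> F k j x = 0"
      "\<And>j. AE x in lborel. (\<lambda>k::nat. F k j x) \<longlonglongrightarrow> f j x"
      "\<And>x. x \<in> box c d \<Longrightarrow> \<exists>e>0. \<forall>\<^sub>F k in sequentially. \<forall>z\<in>ball x e. F k j0 z = 0"
    show thesis by (rule that[of F M a]) (fact h)+
  qed
  have Fc: "F k j \<in> borel_measurable borel" for k j
    by (rule schwartz_borel[OF FS])
  have Fb: "bbs (F k j)" for k j by (rule bbsI[OF Fc FM Fsupp])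
  obtain s where s: "strict_mono s" "AE x in lborel. (\<lambda>k. U (F (s k)) x) \<longlonglongrightarrow> U f x"
    by (rule U_convergence[OF Fb f FM Fsupp Fconv])
  have rep: "AE x in lborel. x \<notin> (\<Inter>j. closure {z. F k j z \<noteq> 0}) \<longrightarrow> U (F k) x = kernel_integral (F k) x" for k
  proof -
    have "AE x in lebesgue. x \<notin> (\<Inter>j. closure {z. F k j z \<noteq> 0}) \<longrightarrow>
           U (F k) x = (LINT y|(lebesgue :: ((real^'n)^'m) measure).
                    K (\<chi> k. case k of None \<Rightarrow> x | Some j \<Rightarrow> y $ j) * (\<Prod>j\<in>UNIV. F k j (y $ j)))"
      using kernel U_schwartz[of "F k", OF FS] FS unfolding has_kernel_def by blast
    moreover have "(LINT y|(lebesgue :: ((real^'n)^'m) measure).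
         K (\<chi> k. case k of None \<Rightarrow> x | Some j \<Rightarrow> y $ j) * (\<Prod>j\<in>UNIV. F k j (y $ j))) = kernel_integral (F k) x" for x
      unfolding kernel_integral_def kernel_integrand_def kernel_point_def[symmetric]
      by (rule integral_completion)
         (use kernel_point_measurable[of x] prod_measurable[of "F k" UNIV] Fc in simp)
    ultimately show ?thesis unfolding AE_completion_iff by simp
  qed
  have Fy: "AE y in (lborel :: ((real^'n)^'m) measure). \<forall>j\<in>UNIV. (\<lambda>k. F k j (y $ j)) \<longlonglongrightarrow> f j (y $ j)"
    using Fconv by (intro AE_finite_allI AE_lborel_vec_component) auto
  have kconv: "(\<lambda>k. kernel_integral (F k) x) \<longlonglongrightarrow> kernel_integral f x" if x: "x \<in> box c d" for x
  proof -
    obtain e where e: "e > 0" "\<forall>\<^sub>F k in sequentially. \<forall>z\<in>ball x e. F k j0 z = 0" using Fbox[OF x] by blast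
    then obtain k0 where k0: "\<And>k z. k \<ge> k0 \<Longrightarrow> z \<in> ball x e \<Longrightarrow> F k j0 z = 0"
      unfolding eventually_sequentially by blast
    define C where "C = A / e ^ (CARD('m) * CARD('n))"
    define w where "w = (\<lambda>y::(real^'n)^'m. C * (\<Prod>j\<in>UNIV. (M j + 1) * indicator (cbox (- a j) (a j)) (y $ j)))"
    have C: "C \<ge> 0" using A_pos e(1) by (simp add: C_def)
    have wi: "integrable lborel w"
    proof -
      have "bbs (\<lambda>x. of_real ((M j + 1) * indicator (cbox (- a j) (a j)) x))" for j
        by (rule bbsI[where M = "M j + 1" and a = "- a j" and b = "a j"]) (use M[of j] in \<open>auto simp: indicator_def\<close>)
      note b = this
      have "integrable lborel (\<lambda>y::(real^'n)^'m. \<Prod>j\<in>UNIV. (M j + 1) * indicator (cbox (- a j) (a j)) (y $ j))"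
      proof (rule integrableI_bounded)
        have c: "(\<lambda>y::(real^'n)^'m. y $ j) \<in> borel_measurable borel" for j
          by (intro borel_measurable_continuous_onI continuous_intros)
        show "(\<lambda>y::(real^'n)^'m. \<Prod>j\<in>UNIV. (M j + 1) * indicator (cbox (- a j) (a j)) (y $ j)) \<in> borel_measurable lborel"
          using c by measurable
        have "(\<integral>\<^sup>+y. ennreal (norm (\<Prod>j\<in>UNIV. (M j + 1) * indicator (cbox (- a j) (a j)) (y $ j))) \<partial>(lborel :: ((real^'n)^'m) measure))
           = (\<integral>\<^sup>+y. (\<Prod>j\<in>UNIV. ennreal ((M j + 1) * indicator (cbox (- a j) (a j)) (y $ j))) \<partial>lborel)"
          using M by (intro nn_integral_cong) (auto simp: prod_ennreal prod_nonneg add_nonneg_nonneg)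
        also have "\<dots> = (\<Prod>j\<in>UNIV. \<integral>\<^sup>+y. ennreal ((M j + 1) * indicator (cbox (- a j) (a j)) y) \<partial>lborel)"
          by (rule nn_integral_lborel_vec_prod[of "\<lambda>j y. ennreal ((M j + 1) * indicator (cbox (- a j) (a j)) y)"]) simp
        also have "\<dots> < \<infinity>"
        proof -
          define v where "v = (\<lambda>j. LINT y|lborel. norm (complex_of_real ((M j + 1) * indicator (cbox (- a j) (a j)) y)))"
          have "(\<integral>\<^sup>+y. ennreal ((M j + 1) * indicator (cbox (- a j) (a j)) y) \<partial>lborel) = ennreal (v j)" for j
          proof -
            have "(\<integral>\<^sup>+y. ennreal ((M j + 1) * indicator (cbox (- a j) (a j)) y) \<partial>lborel)
              = (\<integral>\<^sup>+y. ennreal (norm (complex_of_real ((M j + 1) * indicator (cbox (- a j) (a j)) y))) \<partial>lborel)"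
              using M[of j] by (intro nn_integral_cong) (auto simp: indicator_def)
            also have "\<dots> = ennreal (v j)" unfolding v_def by (rule bbs_nn_integral[OF b])
            finally show ?thesis .
          qed
          moreover have "v j \<ge> 0" for j unfolding v_def by (intro Bochner_Integration.integral_nonneg) auto
          ultimately show ?thesis by (simp add: prod_ennreal)
        qed
        finally show "(\<integral>\<^sup>+y. ennreal (norm (\<Prod>j\<in>UNIV. (M j + 1) * indicator (cbox (- a j) (a j)) (y $ j))) \<partial>(lborel :: ((real^'n)^'m) measure)) < \<infinity>" .
      qed
      thus ?thesis unfolding w_def by (rule integrable_mult_right)
    qed
    have "(\<lambda>k. LINT y|lborel. kernel_integrand (F (k + k0)) x y) \<longlonglongrightarrow> (LINT y|lborel. kernel_integrand f x y)"
    proof (rule integral_dominated_convergence[OF _ _ wi])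
      show "kernel_integrand f x \<in> borel_measurable lborel" "kernel_integrand (F (k + k0)) x \<in> borel_measurable lborel" for k
        unfolding kernel_integrand_def[abs_def]
        using kernel_point_measurable[of x] prod_measurable[of f UNIV] prod_measurable[of "F (k + k0)" UNIV] Fc by simp_all
      show "AE y in lborel. (\<lambda>k. kernel_integrand (F (k + k0)) x y) \<longlonglongrightarrow> kernel_integrand f x y"
        using Fy
      proof eventually_elim
        case (elim y)
        have "(\<lambda>k. F (k + k0) j (y $ j)) \<longlonglongrightarrow> f j (y $ j)" for j
          using elim LIMSEQ_ignore_initial_segment[of "\<lambda>k. F k j (y $ j)"] by blast
        thus ?case unfolding kernel_integrand_def by (intro tendsto_intros)
      qed
      show "AE y in lborel. norm (kernel_integrand (F (k + k0)) x y) \<le> w y" for k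
      proof (intro always_eventually allI)
        fix y :: "(real^'n)^'m"
        show "norm (kernel_integrand (F (k + k0)) x y) \<le> w y"
        proof (cases "F (k + k0) j0 (y $ j0) = 0")
          case True
          hence "(\<Prod>j\<in>UNIV. F (k + k0) j (y $ j)) = 0" by (intro prod_zero) auto
          hence "kernel_integrand (F (k + k0)) x y = 0" by (simp add: kernel_integrand_def)
          thus ?thesis unfolding w_def using C M by (auto intro!: mult_nonneg_nonneg prod_nonneg add_nonneg_nonneg)
        next
          case False
          hence "y $ j0 \<notin> ball x e" using k0[of "k + k0" "y $ j0"] by auto
          hence far: "e \<le> norm (x - y $ j0)" by (simp add: dist_norm)
          have "norm (K (kernel_point x y)) \<le> C" unfolding C_def
            by (rule size_bound_ge[of e _ None "Some j0"]) (use e far in auto)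
          moreover have "norm (F (k + k0) j (y $ j)) \<le> (M j + 1) * indicator (cbox (- a j) (a j)) (y $ j)" for j
            using FM[of "k + k0" j "y $ j"] Fsupp[of "y $ j" j "k + k0"] by (cases "y $ j \<in> cbox (- a j) (a j)") auto
          ultimately show ?thesis unfolding kernel_integrand_def norm_mult prod_norm[symmetric] w_def
            using C by (intro mult_mono prod_mono prod_nonneg) auto
        qed
      qed
    qed
    hence "(\<lambda>k. kernel_integral (F (k + k0)) x) \<longlonglongrightarrow> kernel_integral f x" by (simp add: kernel_integral_def)
    thus ?thesis by (rule LIMSEQ_offset)
  qed
  have "AE x in lborel. \<forall>k. x \<notin> (\<Inter>j. closure {z. F k j z \<noteq> 0}) \<longrightarrow> U (F k) x = kernel_integral (F k) x"
    using rep by (subst AE_all_countable) blast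
  with s(2) show ?thesis
  proof eventually_elim
    case (elim x)
    show ?case
    proof
      assume x: "x \<in> box c d"
      obtain e where e: "e > 0" "\<forall>\<^sub>F k in sequentially. \<forall>z\<in>ball x e. F k j0 z = 0" using Fbox[OF x] by blast
      from e(2) have "\<forall>\<^sub>F k in sequentially. U (F k) x = kernel_integral (F k) x"
      proof eventually_elim
        case (elim k)
        hence "ball x e \<inter> {z. F k j0 z \<noteq> 0} = {}" by auto
        hence "ball x e \<inter> closure {z. F k j0 z \<noteq> 0} = {}" by (simp add: open_Int_closure_eq_empty)
        hence "x \<notin> closure {z. F k j0 z \<noteq> 0}" using centre_in_ball[of x e] e(1) by blast
        hence "x \<notin> (\<Inter>j. closure {z. F k j z \<noteq> 0})" by blast
        thus ?case using \<open>\<forall>k. x \<notin> (\<Inter>j. closure {z. F k j z \<noteq> 0}) \<longrightarrow> U (F k) x = kernel_integral (F k) x\<close> by blast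
      qed
      hence "\<forall>\<^sub>F k in sequentially. U (F (s k)) x = kernel_integral (F (s k)) x"
        by (rule eventually_subseq[OF s(1)])
      hence ev: "\<forall>\<^sub>F k in sequentially. kernel_integral (F (s k)) x = U (F (s k)) x"
        by (auto elim: eventually_mono)
      have "(\<lambda>k. kernel_integral (F (s k)) x) \<longlonglongrightarrow> kernel_integral f x"
        using LIMSEQ_subseq_LIMSEQ[OF kconv[OF x] s(1)] by (simp add: o_def)
      from Lim_transform_eventually[OF this ev] have "(\<lambda>k. U (F (s k)) x) \<longlonglongrightarrow> kernel_integral f x" .
      with elim(1) show "U f x = kernel_integral f x" by (rule LIMSEQ_unique)
    qed
  qed
qed

text \<open>
  The complement of the support is a countable union of boxes.
\<close>

lemma kernel_representation:
  assumes f: "\<And>j. bbs (f j)"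
  shows "AE x in lborel. x \<notin> closure {z. f j0 z \<noteq> 0} \<longrightarrow> U f x = kernel_integral f x"
proof -
  let ?O = "- closure {z. f j0 z \<noteq> 0}"
  obtain D where D: "countable D" "D \<subseteq> Pow ?O" "\<And>X. X \<in> D \<Longrightarrow> \<exists>a b. X = box a b" "\<Union>D = ?O"
    by (rule open_countable_Union_open_box[of ?O]) auto
  have "AE x in lborel. \<forall>X\<in>D. x \<in> X \<longrightarrow> U f x = kernel_integral f x"
  proof (subst AE_ball_countable[OF D(1)], intro ballI)
    fix X assume X: "X \<in> D"
    then obtain a b where ab: "X = box a b" using D(3) by blast
    have "f j0 x = 0" if "x \<in> box a b" for x
      using that X D(2) closure_subset[of "{z. f j0 z \<noteq> 0}"] unfolding ab by blast
    from kernel_representation_box[of f, OF f this]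
    show "AE x in lborel. x \<in> X \<longrightarrow> U f x = kernel_integral f x" unfolding ab .
  qed
  thus ?thesis
  proof eventually_elim
    case (elim x)
    thus ?case using D(4) by blast
  qed
qed

end

text \<open>
  The difference \<open>h\<close> integrates to zero against Schwartz functions. On a box these approximate the conjugate of the
  sign of \<open>h\<close> boundedly, so \<open>\<bar>h\<bar>\<close> has integral zero there. Integrability of \<open>h\<close> on the box comes from testing with a cutoff
  that equals one on it.
\<close>

lemma represented_by_unique:
  fixes g g' :: "real^'n::finite \<Rightarrow> complex"
  assumes g: "represented_by u g" and g': "represented_by u g'"
  shows "AE x in lborel. g x = g' x"
proof -
  define h where "h = (\<lambda>x. g x - g' x)"
  have hm [measurable]: "h \<in> borel_measurable lebesgue"
    using g g' unfolding represented_by_def h_def by (intro borel_measurable_diff) auto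
  have hi: "integrable lebesgue (\<lambda>x. h x * \<phi> x)" "(LINT x|lebesgue. h x * \<phi> x) = 0" if "\<phi> \<in> schwartz_space" for \<phi>
  proof -
    have i: "integrable lebesgue (\<lambda>x. g x * \<phi> x)" "integrable lebesgue (\<lambda>x. g' x * \<phi> x)"
      "(LINT x|lebesgue. g x * \<phi> x) = (LINT x|lebesgue. g' x * \<phi> x)"
      using g g' that unfolding represented_by_def by (blast, blast, metis)
    show "integrable lebesgue (\<lambda>x. h x * \<phi> x)" "(LINT x|lebesgue. h x * \<phi> x) = 0"
      using Bochner_Integration.integrable_diff[OF i(1,2)] Bochner_Integration.integral_diff[OF i(1,2)] i(3)
      by (simp_all add: h_def left_diff_distrib)
  qed
  have box0: "AE x in lborel. x \<in> cbox (- a) a \<longrightarrow> h x = 0" for a :: "real^'n"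
  proof -
    let ?B = "cbox (- a) a"
    define \<eta> where "\<eta> = (\<lambda>x. complex_of_real (box_cutoff (- a - 1) (a + 1) 1 x))"
    have \<eta>1: "\<eta> x = 1" if "x \<in> ?B" for x
    proof -
      have "box_cutoff (- a - 1) (a + 1) 1 x = 1"
      proof (rule box_cutoff_inside)
        fix i
        have "- a $ i \<le> x $ i \<and> x $ i \<le> a $ i" using that by (simp add: mem_box_cart)
        thus "1 \<le> real 1 * (x $ i - (- a - 1) $ i)" "1 \<le> real 1 * ((a + 1) $ i - x $ i)" by auto
      qed
      thus ?thesis by (simp add: \<eta>_def)
    qed
    have "\<eta> \<in> schwartz_space"
    proof (rule smooth_cfun_schwartz)
      show "\<eta> \<in> smooth_cfun"
        by (rule smooth_cfunI[OF box_cutoff_smooth smooth_fun.const[of 0]]) (auto simp: \<eta>_def complex_eq_iff)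
      show "\<eta> x = 0" if "x \<notin> cbox (- a - 1) (a + 1)" for x
        using box_cutoff_outside[of x "- a - 1" "a + 1" 1] that subsetD[OF box_subset_cbox, of x "- a - 1" "a + 1"]
        unfolding \<eta>_def by auto
    qed
    from integrable_norm[OF hi(1)[OF this]] have i1: "integrable lebesgue (\<lambda>x. norm (h x * \<eta> x))" .
    have Bm: "(indicator ?B :: _ \<Rightarrow> real) \<in> borel_measurable lebesgue" by (intro borel_measurable_indicator) auto
    have i2: "integrable lebesgue (\<lambda>x. norm (h x) * indicator ?B x)"
      by (rule Bochner_Integration.integrable_bound[OF i1 borel_measurable_times[OF measurable_compose[OF hm borel_measurable_norm] Bm]])
         (auto simp: indicator_def \<eta>1 norm_mult)
    define \<psi> where "\<psi> = (\<lambda>x. cnj (sgn (h x)) * indicator ?B x)"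
    have \<psi>m: "\<psi> \<in> borel_measurable lebesgue"
    proof -
      have "(\<lambda>x. sgn (h x)) \<in> borel_measurable lebesgue" unfolding sgn_div_norm by measurable
      moreover have "cnj \<in> borel_measurable borel" by (intro borel_measurable_continuous_onI continuous_intros)
      ultimately have "(\<lambda>x. cnj (sgn (h x))) \<in> borel_measurable lebesgue" by (rule measurable_compose)
      thus ?thesis unfolding \<psi>_def by (intro borel_measurable_times borel_measurable_indicator) auto
    qed
    have \<psi>1: "norm (\<psi> x) \<le> 1" for x by (auto simp: \<psi>_def norm_mult norm_sgn indicator_def)
    have \<psi>0: "\<psi> x = 0" if "x \<notin> ?B" for x using that by (simp add: \<psi>_def)
    have b0: "\<psi> x = 0" if "x \<in> box 0 (0::real^'n)" for x using that by (auto simp: mem_box)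
    obtain F where F: "\<And>k. F k \<in> schwartz_space" "\<And>k x. norm (F k x) \<le> 1 + 1"
      "\<And>k x. x \<notin> ?B \<Longrightarrow> F k x = 0" "AE x in lborel. (\<lambda>k::nat. F k x) \<longlonglongrightarrow> \<psi> x"
      by (rule schwartz_approximation[OF \<psi>m \<psi>1, where a = "- a" and b = a and c = 0 and d = 0, OF \<psi>0 b0]) (assumption, assumption, rule that)
    have "(\<lambda>k. LINT x|lebesgue. h x * F k x) \<longlonglongrightarrow> (LINT x|lebesgue. h x * \<psi> x)"
    proof (rule integral_dominated_convergence[where w = "\<lambda>x. 2 * (norm (h x) * indicator ?B x)"])
      show "(\<lambda>x. h x * \<psi> x) \<in> borel_measurable lebesgue" by (intro borel_measurable_times hm \<psi>m)
      show "(\<lambda>x. h x * F k x) \<in> borel_measurable lebesgue" for k by (rule borel_measurable_integrable[OF hi(1)[OF F(1)]])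
      show "integrable lebesgue (\<lambda>x. 2 * (norm (h x) * indicator ?B x))" using i2 by simp
      show "AE x in lebesgue. (\<lambda>k. h x * F k x) \<longlonglongrightarrow> h x * \<psi> x"
        unfolding AE_completion_iff using F(4) by eventually_elim (intro tendsto_intros)
      show "AE x in lebesgue. norm (h x * F k x) \<le> 2 * (norm (h x) * indicator ?B x)" for k
      proof (intro always_eventually allI)
        fix x show "norm (h x * F k x) \<le> 2 * (norm (h x) * indicator ?B x)"
          using F(2)[of k x] F(3)[of x k] mult_left_mono[of "norm (F k x)" 2 "norm (h x)"]
          by (cases "x \<in> ?B") (auto simp: norm_mult)
      qed
    qed
    hence "(LINT x|lebesgue. h x * \<psi> x) = 0" using hi(2)[OF F(1)] by (simp add: LIMSEQ_const_iff)
    moreover have eq: "h x * \<psi> x = of_real (norm (h x) * indicator ?B x)" for x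
    proof -
      have "h x * cnj (sgn (h x)) = of_real (norm (h x))"
      proof (cases "h x = 0")
        case False
        have "h x * cnj (sgn (h x)) = (h x * cnj (h x)) / of_real (norm (h x))"
          by (simp add: sgn_div_norm scaleR_conv_of_real divide_inverse)
        also have "\<dots> = of_real (norm (h x) * norm (h x)) / of_real (norm (h x))"
          by (simp only: complex_norm_square[symmetric] power2_eq_square)
        finally show ?thesis using False by simp
      qed simp
      thus ?thesis by (simp add: \<psi>_def indicator_def)
    qed
    ultimately have "(LINT x|lebesgue. norm (h x) * indicator ?B x) = 0"
      unfolding eq integral_complex_of_real by simp
    hence "AE x in lebesgue. norm (h x) * indicator ?B x = 0"
      using integral_nonneg_eq_0_iff_AE[OF i2] by simp
    thus ?thesis unfolding AE_completion_iff by (auto elim!: eventually_mono simp: indicator_def)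
  qed
  have "AE x in lborel. \<forall>N::nat. x \<in> cbox (- (\<chi> i. real N)) (\<chi> i. real N) \<longrightarrow> h x = 0"
    using box0 by (subst AE_all_countable) blast
  thus ?thesis
  proof eventually_elim
    case (elim x)
    obtain N :: nat where N: "norm x \<le> real N" using real_arch_simple by blast
    have "\<bar>x $ i\<bar> \<le> real N" for i using component_le_norm_cart[of x i] N by linarith
    hence "x \<in> cbox (- (\<chi> i. real N)) (\<chi> i. real N)" by (auto simp: mem_box_cart abs_le_iff minus_le_iff)
    thus ?case using elim unfolding h_def by auto
  qed
qed

text \<open>
  The exponents of the two extensions may differ. Both agree with \<open>T\<close> on Schwartz functions, and both converge
  along a common subsequence of one approximating sequence.
\<close>

lemma bounded_extension_unique:
  fixes f :: "'m::finite \<Rightarrow> real^'n::finite \<Rightarrow> complex"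
  assumes "bounded_multilinear_extension q T U" "bounded_multilinear_extension q' T U'"
    and f: "\<And>j. bbs (f j)"
  shows "AE x in lborel. U f x = U' f x"
proof -
  interpret A: bounded_multilinear_extension q T U by fact
  interpret B: bounded_multilinear_extension q' T U' by fact
  have empty: "f undefined x = 0" if "x \<in> box 0 (0::real^'n)" for x using that by (auto simp: mem_box)
  obtain F M a where FS: "\<And>k j. F k j \<in> schwartz_space" and FM: "\<And>k j x. norm (F k j x) \<le> M j + 1"
    and Fsupp: "\<And>k j x. x \<notin> cbox (- a j) (a j) \<Longrightarrow> F k j x = 0"
    and Fconv: "\<And>j. AE x in lborel. (\<lambda>k::nat. F k j x) \<longlonglongrightarrow> f j x"
  proof (rule schwartz_approximation_tuple[of f 0 0 undefined, OF f empty])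
    fix F M a
    assume h: "\<And>k j. F k j \<in> schwartz_space" "\<And>k j x. norm (F k j x) \<le> M j + 1"
      "\<And>k j x. x \<notin> cbox (- a j) (a j) \<Longrightarrow> F k j x = 0"
      "\<And>j. AE x in lborel. (\<lambda>k::nat. F k j x) \<longlonglongrightarrow> f j x"
    show thesis by (rule that[of F M a]) (fact h)+
  qed
  have Fb: "bbs (F k j)" for k j by (rule bbsI[OF schwartz_borel[OF FS] FM Fsupp])
  obtain s where s: "strict_mono s" "AE x in lborel. (\<lambda>k. U (F (s k)) x) \<longlonglongrightarrow> U f x"
    by (rule A.U_convergence[OF Fb f FM Fsupp Fconv])
  have Fconv': "AE x in lborel. (\<lambda>k. F (s k) j x) \<longlonglongrightarrow> f j x" for j
    using Fconv[of j]
  proof eventually_elim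
    case (elim x)
    show ?case using LIMSEQ_subseq_LIMSEQ[OF elim s(1)] by (simp add: o_def)
  qed
  obtain s' where s': "strict_mono s'" "AE x in lborel. (\<lambda>k. U' (F (s (s' k))) x) \<longlonglongrightarrow> U' f x"
    by (rule B.U_convergence[of "\<lambda>k. F (s k)", OF Fb f FM Fsupp Fconv'])
  have "AE x in lborel. U (F k) x = U' (F k) x" for k
    by (rule represented_by_unique[OF A.U_schwartz[OF FS] B.U_schwartz[OF FS]])
  hence "AE x in lborel. \<forall>k. U (F k) x = U' (F k) x" by (subst AE_all_countable) blast
  with s(2) s'(2) show ?thesis
  proof eventually_elim
    case (elim x)
    have "(\<lambda>k. U (F (s (s' k))) x) \<longlonglongrightarrow> U f x"
      using LIMSEQ_subseq_LIMSEQ[OF elim(1) s'(1)] by (simp add: o_def)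
    with elim(2,3) show ?case by (simp add: LIMSEQ_unique)
  qed
qed

section \<open>Dyadic cubes and stopping times\<close>

lemma cube_measure:
  fixes a :: "real^'n::finite"
  assumes "l \<ge> 0"
  shows "cube a l \<in> sets borel" "emeasure lborel (cube a l) = ennreal (l ^ CARD('n))"
proof -
  have "cube a l = (\<Inter>i\<in>UNIV. {x. a $ i \<le> x $ i} \<inter> {x. x $ i < a $ i + l})"
    by (auto simp: cube_def)
  also have "\<dots> \<in> sets borel"
    by (intro sets.finite_INT sets.Int borel_closed borel_open closed_Collect_le open_Collect_less continuous_intros) auto
  finally show m: "cube a l \<in> sets borel" .
  have sub: "box a (a + (\<chi> i. l)) \<subseteq> cube a l" "cube a l \<subseteq> cbox a (a + (\<chi> i. l))"
    by (auto simp: cube_def mem_box_cart less_imp_le)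
  have prod: "(\<Prod>b\<in>Basis. ((a + (\<chi> i. l)) - a) \<bullet> b) = l ^ CARD('n)"
  proof -
    have "(\<Prod>b\<in>Basis. ((a + (\<chi> i. l)) - a) \<bullet> b) = (\<Prod>b\<in>(Basis :: (real^'n) set). l)"
      by (intro prod.cong refl) (auto simp: Basis_vec_def inner_axis)
    thus ?thesis by simp
  qed
  have le: "a \<bullet> b \<le> (a + (\<chi> i. l)) \<bullet> b" if "b \<in> Basis" for b
    using that assms by (auto simp: Basis_vec_def inner_axis)
  have "emeasure lborel (cube a l) \<le> emeasure lborel (cbox a (a + (\<chi> i. l)))"
    by (intro emeasure_mono sub) auto
  also have "\<dots> = ennreal (l ^ CARD('n))" using emeasure_lborel_cbox[OF le] prod by simp
  finally have 1: "emeasure lborel (cube a l) \<le> ennreal (l ^ CARD('n))" .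
  have "ennreal (l ^ CARD('n)) = emeasure lborel (box a (a + (\<chi> i. l)))" using emeasure_lborel_box[OF le] prod by simp
  also have "\<dots> \<le> emeasure lborel (cube a l)" using m by (intro emeasure_mono sub) auto
  finally show "emeasure lborel (cube a l) = ennreal (l ^ CARD('n))" using 1 by (intro antisym)
qed

text \<open>
  The cube of side \<open>2\<^sup>k\<close> containing \<open>x\<close> in the dyadic grid whose lattice is shifted by \<open>s\<close>.
\<close>

definition dcube :: "real^'n::finite \<Rightarrow> int \<Rightarrow> real^'n \<Rightarrow> (real^'n) set" where
  "dcube s k x = {y. \<forall>i. \<lfloor>(y $ i - s $ i) / 2 powi k\<rfloor> = \<lfloor>(x $ i - s $ i) / 2 powi k\<rfloor>}"

lemma dcube_self [simp]: "x \<in> dcube s k x"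
  by (simp add: dcube_def)

lemma dcube_eq: "y \<in> dcube s k x \<Longrightarrow> dcube s k y = dcube s k x"
  by (auto simp: dcube_def)

lemma dcube_mono:
  assumes "k \<le> l" shows "dcube s k x \<subseteq> dcube s l x"
proof
  define d where "d = nat (l - k)"
  have l: "l = k + int d" using assms by (simp add: d_def)
  have *: "\<lfloor>z / 2 powi l\<rfloor> = \<lfloor>z / 2 powi k\<rfloor> div 2 ^ d" for z :: real
  proof -
    have "(2::real) powi l = 2 powi k * 2 ^ d" unfolding l by (subst power_int_add) auto
    hence "z / 2 powi l = (z / 2 powi k) / real_of_int (2 ^ d)" by simp
    also have "\<lfloor>\<dots>\<rfloor> = \<lfloor>z / 2 powi k\<rfloor> div 2 ^ d" by (rule floor_divide_real_eq_div) simp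
    finally show ?thesis .
  qed
  fix y assume "y \<in> dcube s k x"
  thus "y \<in> dcube s l x" by (simp add: dcube_def *)
qed

lemma dcube_subset:
  assumes "k \<le> l" "z \<in> dcube s k x" "z \<in> dcube s l y"
  shows "dcube s k x \<subseteq> dcube s l y"
  using dcube_mono[OF assms(1), of s z] dcube_eq[OF assms(2)] dcube_eq[OF assms(3)] by simp

lemma dcube_is_cube: "dcube s k x = cube (\<chi> i. s $ i + 2 powi k * \<lfloor>(x $ i - s $ i) / 2 powi k\<rfloor>) (2 powi k)"
proof -
  have p: "(2::real) powi k > 0" by simp
  have "\<lfloor>(y $ i - s $ i) / 2 powi k\<rfloor> = c \<longleftrightarrow> s $ i + 2 powi k * real_of_int c \<le> y $ i \<and> y $ i < s $ i + 2 powi k * real_of_int c + 2 powi k"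
    for y :: "real^'a" and i and c :: int
    using p by (auto simp: floor_eq_iff field_simps)
  thus ?thesis by (simp add: dcube_def cube_def)
qed

lemma dcube_measure:
  fixes x :: "real^'n::finite"
  shows "dcube s k x \<in> sets borel" "emeasure lborel (dcube s k x) = ennreal ((2 powi k) ^ CARD('n))"
  unfolding dcube_is_cube by (rule cube_measure; simp)+

lemma two_powi_inject: "(2::real) powi k = 2 powi l \<Longrightarrow> k = l"
  using power_int_strict_increasing[of k l "2::real"] power_int_strict_increasing[of l k "2::real"]
  by (cases k l rule: linorder_cases) auto

lemma dcube_level_unique:
  fixes x y :: "real^'n::finite"
  assumes "dcube s k x = dcube t l y" shows "k = l"
proof -
  have "ennreal ((2 powi k) ^ CARD('n)) = ennreal ((2 powi l) ^ CARD('n))"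
    using assms dcube_measure(2) by metis
  hence "((2::real) powi k) ^ CARD('n) = (2 powi l) ^ CARD('n)" by (subst (asm) ennreal_inj) auto
  hence "(2::real) powi k = 2 powi l" by (rule power_eq_imp_eq_base) auto
  thus ?thesis by (rule two_powi_inject)
qed

lemma dcube_component_dist:
  assumes "y \<in> dcube s k x" "z \<in> dcube s k x" shows "\<bar>y $ i - z $ i\<bar> < 2 powi k"
  using assms unfolding dcube_is_cube cube_def mem_Collect_eq by (smt (verit, best))

lemma dcube_norm_dist:
  fixes x :: "real^'n::finite"
  assumes "y \<in> dcube s k x" "z \<in> dcube s k x" shows "norm (y - z) \<le> real CARD('n) * 2 powi k"
proof -
  have "norm (y - z) \<le> (\<Sum>i\<in>UNIV. \<bar>(y - z) $ i\<bar>)" by (rule norm_le_l1_cart)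
  also have "\<dots> \<le> (\<Sum>i\<in>(UNIV::'n set). 2 powi k)"
    using dcube_component_dist[OF assms] by (intro sum_mono) (auto simp: less_imp_le)
  finally show ?thesis by simp
qed

lemma powi_small: 
  assumes "e > 0" shows "\<exists>k::int. (2::real) powi k < e"
proof -
  obtain n :: nat where "(1/2) ^ n < e" using real_arch_pow_inv[OF assms, of "1/2"] by auto
  hence "(2::real) powi (- int n) < e" by (simp add: power_int_minus power_one_over inverse_eq_divide)
  thus ?thesis by blast
qed

lemma powi_large: "\<exists>k::int. e < (2::real) powi k"
proof -
  obtain n :: nat where "e < 2 ^ n" using real_arch_pow[of 2 e] by auto
  thus ?thesis by (intro exI[of _ "int n"]) simp
qed

lemma dcube_in_open:
  fixes x :: "real^'n::finite"
  assumes "open G" "x \<in> G"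
  shows "\<exists>k. \<forall>l\<le>k. dcube s l x \<subseteq> G"
proof -
  obtain e where e: "e > 0" "ball x e \<subseteq> G" using assms openE by blast
  obtain k where k: "(2::real) powi k < e / real CARD('n)" using powi_small[of "e / real CARD('n)"] e(1) by auto
  have "dcube s l x \<subseteq> G" if "l \<le> k" for l
  proof
    fix y assume "y \<in> dcube s l x"
    hence "norm (x - y) \<le> real CARD('n) * 2 powi l" by (intro dcube_norm_dist[of _ s l x]) auto
    also have "\<dots> \<le> real CARD('n) * 2 powi k" using that by (intro mult_left_mono power_int_increasing) auto
    also have "\<dots> < e" using k by (simp add: field_simps)
    finally show "y \<in> G" using e(2) by (auto simp: dist_norm)
  qed
  thus ?thesis by blast
qed

definition dgrid :: "real^'n::finite \<Rightarrow> (real^'n) set set" where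
  "dgrid s = {dcube s k x | k x. True}"

lemma countable_dgrid: "countable (dgrid (s :: real^'n::finite))"
proof -
  define f where "f = (\<lambda>(k::int, v::int^'n). {y::real^'n. \<forall>i. \<lfloor>(y $ i - s $ i) / 2 powi k\<rfloor> = v $ i})"
  have "dgrid s \<subseteq> range f"
  proof
    fix Q assume "Q \<in> dgrid s"
    then obtain k x where "Q = dcube s k x" by (auto simp: dgrid_def)
    hence "Q = f (k, \<chi> i. \<lfloor>(x $ i - s $ i) / 2 powi k\<rfloor>)" by (simp add: dcube_def f_def)
    thus "Q \<in> range f" by blast
  qed
  moreover have "countable (UNIV :: (int \<times> (int^'n)) set)"
  proof -
    have "countable (UNIV :: (int^'n) set)"
    proof (rule countable_image_inj_on[of vec_nth])
      have "countable (PiE (UNIV::'n set) (\<lambda>_. UNIV :: int set))" by (rule countable_PiE) auto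
      thus "countable (vec_nth ` (UNIV :: (int^'n) set))" by (rule countable_subset[rotated]) (auto simp: PiE_UNIV_domain)
    qed (auto simp: inj_on_def vec_eq_iff fun_eq_iff)
    hence "countable ((UNIV :: int set) \<times> (UNIV :: (int^'n) set))" by (intro countable_SIGMA) auto
    thus ?thesis by simp
  qed
  ultimately show ?thesis using countable_subset countable_image by metis
qed

lemma dyadic_grid_dgrid: "dyadic_grid (dgrid (s :: real^'n::finite))"
  unfolding dyadic_grid_def
proof (intro conjI ballI allI)
  fix Q assume "Q \<in> dgrid s"
  thus "\<exists>a. \<exists>k::int. Q = cube a (2 powi k)" unfolding dgrid_def using dcube_is_cube by blast
next
  fix Q R assume "Q \<in> dgrid s" "R \<in> dgrid s"
  then obtain k x l y where QR: "Q = dcube s k x" "R = dcube s l y" by (auto simp: dgrid_def)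
  show "Q \<inter> R \<in> {Q, R, {}}"
  proof (cases "Q \<inter> R = {}")
    case False
    then obtain z where z: "z \<in> dcube s k x" "z \<in> dcube s l y" using QR by auto
    show ?thesis
    proof (cases "k \<le> l")
      case True
      thus ?thesis using dcube_subset[OF True z] QR by blast
    next
      case False
      hence "l \<le> k" by simp
      from dcube_subset[OF this z(2,1)] show ?thesis using QR by blast
    qed
  qed simp
next
  fix k :: int
  have eq: "{Q \<in> dgrid s. \<exists>a. Q = cube a (2 powi k)} = {dcube s k x | x. True}"
  proof (intro set_eqI iffI)
    fix Q assume "Q \<in> {Q \<in> dgrid s. \<exists>a. Q = cube a (2 powi k)}"
    then obtain l x a where Q: "Q = dcube s l x" "Q = cube a (2 powi k)" by (auto simp: dgrid_def)
    have "ennreal ((2 powi l) ^ CARD('n)) = ennreal ((2 powi k) ^ CARD('n))"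
      using dcube_measure(2)[of s l x] cube_measure(2)[of "2 powi k" a] Q by simp
    hence "((2::real) powi l) ^ CARD('n) = (2 powi k) ^ CARD('n)" by (subst (asm) ennreal_inj) auto
    hence "(2::real) powi l = 2 powi k" by (rule power_eq_imp_eq_base) auto
    hence "l = k" by (rule two_powi_inject)
    thus "Q \<in> {dcube s k x | x. True}" using Q(1) by blast
  next
    fix Q assume "Q \<in> {dcube s k x | x. True}"
    then obtain x where Q: "Q = dcube s k x" by auto
    thus "Q \<in> {Q \<in> dgrid s. \<exists>a. Q = cube a (2 powi k)}" unfolding dgrid_def using dcube_is_cube[of s k x] by blast
  qed
  show "partition_on UNIV {Q \<in> dgrid s. \<exists>a. Q = cube a (2 powi k)}"
    unfolding eq
  proof (rule partition_onI)
    have "x \<in> dcube s k x" for x by simp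
    thus "\<Union>{dcube s k x | x. True} = UNIV" by blast
    show "{} \<notin> {dcube s k x | x. True}" using \<open>\<And>x. x \<in> dcube s k x\<close> by blast
    show "disjnt p p'" if "p \<in> {dcube s k x | x. True}" "p' \<in> {dcube s k x | x. True}" "p \<noteq> p'" for p p'
    proof -
      obtain x y where xy: "p = dcube s k x" "p' = dcube s k y" using \<open>p \<in> _\<close> \<open>p' \<in> _\<close> by blast
      show ?thesis unfolding disjnt_def
      proof (rule ccontr)
        assume "p \<inter> p' \<noteq> {}"
        then obtain z where "z \<in> dcube s k x" "z \<in> dcube s k y" using xy by auto
        hence "p = p'" using dcube_eq[of z s k x] dcube_eq[of z s k y] xy by simp
        thus False using \<open>p \<noteq> p'\<close> by simp
      qed
    qed
  qed
qed

text \<open>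
  The maximal selected cubes below level \<open>K\<close>.
\<close>

definition stopping_cubes :: "(int \<Rightarrow> (real^'n::finite) set \<Rightarrow> bool) \<Rightarrow> real^'n \<Rightarrow> int \<Rightarrow> (real^'n) set set" where
  "stopping_cubes Sel s K = {dcube s k x | k x. k < K \<and> Sel k (dcube s k x) \<and>
     (\<forall>l. k < l \<and> l \<le> K \<longrightarrow> \<not> Sel l (dcube s l x))}"

lemma stopping_cubes_cover:
  assumes "Sel k (dcube s k x)" "k \<le> K" "\<not> Sel K (dcube s K x)"
  obtains l where "k \<le> l" "l < K" "dcube s l x \<in> stopping_cubes Sel s K"
proof -
  define d where "d = (LEAST d. Sel (K - int d) (dcube s (K - int d) x))"
  have "Sel (K - int (nat (K - k))) (dcube s (K - int (nat (K - k))) x)" using assms by simp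
  hence d: "Sel (K - int d) (dcube s (K - int d) x)" and dle: "d \<le> nat (K - k)"
    unfolding d_def by (rule LeastI, rule Least_le)
  have d0: "d > 0" using d assms(3) by (cases d) auto
  have "\<not> Sel l (dcube s l x)" if "K - int d < l" "l \<le> K" for l
  proof -
    have "nat (K - l) < d" using that by linarith
    hence "\<not> Sel (K - int (nat (K - l))) (dcube s (K - int (nat (K - l))) x)"
      unfolding d_def by (rule not_less_Least)
    thus ?thesis using that by simp
  qed
  hence "dcube s (K - int d) x \<in> stopping_cubes Sel s K"
    unfolding stopping_cubes_def mem_Collect_eq using d d0 by (intro exI[of _ "K - int d"] exI[of _ x]) simp
  moreover have "k \<le> K - int d" "K - int d < K" using dle d0 assms(2) by linarith+
  ultimately show thesis using that by blast
qed

lemma stopping_cubes_disjoint: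
  assumes "P \<in> stopping_cubes Sel s K" "P' \<in> stopping_cubes Sel s K" "z \<in> P" "z \<in> P'"
  shows "P = P'"
proof -
  obtain k x where P: "P = dcube s k x" "k < K" "Sel k P" "\<And>l. k < l \<Longrightarrow> l \<le> K \<Longrightarrow> \<not> Sel l (dcube s l x)"
    using assms(1) by (auto simp: stopping_cubes_def)
  obtain k' x' where P': "P' = dcube s k' x'" "k' < K" "Sel k' P'" "\<And>l. k' < l \<Longrightarrow> l \<le> K \<Longrightarrow> \<not> Sel l (dcube s l x')"
    using assms(2) by (auto simp: stopping_cubes_def)
  have up: "dcube s l x = dcube s l z" if "k \<le> l" for l
    using dcube_mono[OF that, of s x] assms(3) P(1) by (intro dcube_eq[symmetric]) auto
  have up': "dcube s l x' = dcube s l z" if "k' \<le> l" for l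
    using dcube_mono[OF that, of s x'] assms(4) P'(1) by (intro dcube_eq[symmetric]) auto
  have "\<not> k < k'" using P(4)[of k'] P'(1,2,3) up[of k'] up'[of k'] by auto
  moreover have "\<not> k' < k" using P'(4)[of k] P(1,2,3) up[of k] up'[of k] by auto
  ultimately have "k = k'" by simp
  thus ?thesis using P(1) P'(1) up[of k] up'[of k] by simp
qed

lemma countable_stopping_cubes: "countable (stopping_cubes Sel s K)"
  by (rule countable_subset[OF _ countable_dgrid[of s]]) (auto simp: stopping_cubes_def dgrid_def)

section \<open>The Calderon--Zygmund decomposition\<close>

lemma emeasure_lebesgue_borel: "S \<in> sets borel \<Longrightarrow> emeasure lebesgue S = emeasure lborel S"
  by (simp add: main_part_sets)

lemma bbs_mass_integrable:
  assumes "bbs f" "Q \<in> sets borel"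
  shows "integrable lborel (\<lambda>x. norm (f x) * indicator Q x)"
proof -
  have "integrable lborel (\<lambda>x. norm (f x * indicator Q x))"
    by (intro integrable_norm bbs_integrable bbs_mult_indicator assms)
  also have "(\<lambda>x. norm (f x * indicator Q x)) = (\<lambda>x. norm (f x) * indicator Q x)"
    by (auto simp: indicator_def)
  finally show ?thesis .
qed

lemma sum_mass_le:
  assumes f: "bbs f" and F: "finite F" "\<And>P. P \<in> F \<Longrightarrow> P \<in> sets borel"
    and disj: "\<And>P P' z. P \<in> F \<Longrightarrow> P' \<in> F \<Longrightarrow> z \<in> P \<Longrightarrow> z \<in> P' \<Longrightarrow> P = P'"
  shows "(\<Sum>P\<in>F. LINT x|lborel. norm (f x) * indicator P x) \<le> (LINT x|lborel. norm (f x))"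
proof -
  have ind: "(\<Sum>P\<in>F. indicator P x :: real) \<le> 1" for x
  proof -
    have "(\<Sum>P\<in>F. indicator P x :: real) = indicator (\<Union>P\<in>F. P) x"
      by (rule indicator_UN_disjoint[symmetric, OF F(1)]) (use disj in \<open>auto simp: disjoint_family_on_def\<close>)
    thus ?thesis by (simp add: indicator_def)
  qed
  have "(\<Sum>P\<in>F. LINT x|lborel. norm (f x) * indicator P x) = (LINT x|lborel. (\<Sum>P\<in>F. norm (f x) * indicator P x))"
    using F by (intro Bochner_Integration.integral_sum[symmetric] bbs_mass_integrable f)
  also have "\<dots> \<le> (LINT x|lborel. norm (f x))"
  proof (rule integral_mono)
    show "integrable lborel (\<lambda>x. \<Sum>P\<in>F. norm (f x) * indicator P x)"
      using F by (intro Bochner_Integration.integrable_sum bbs_mass_integrable f)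
    show "integrable lborel (\<lambda>x. norm (f x))" by (intro integrable_norm bbs_integrable f)
    show "(\<Sum>P\<in>F. norm (f x) * indicator P x) \<le> norm (f x)" for x
      using ind[of x] mult_left_mono[OF ind, of "norm (f x)" x] by (simp add: sum_distrib_left)
  qed
  finally show ?thesis .
qed

text \<open>
  The classical decomposition at height \<open>lam\<close>, with stopping cubes for the condition that the mean of \<open>\<bar>f\<bar>\<close> over
  the cube exceeds \<open>lam\<close>. For continuous \<open>f\<close> the stopping may be restricted to cubes that are not too small: at
  the smallest admitted scale \<open>f\<close> varies by less than \<open>lam\<close>, so the good part is bounded by uniform
  continuity in place of Lebesgue's differentiation theorem, and the family of cubes is finite.
\<close>

lemma CZ_decomposition:
  fixes f :: "real^'n::finite \<Rightarrow> complex"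
  assumes f: "bbs f" and cont: "continuous_on UNIV f" and lam: "lam > 0" and V: "V > 0"
    and fV: "(LINT x|lborel. norm (f x)) \<le> lam * V"
  obtains S :: "(real^'n) set set" and c :: "(real^'n) set \<Rightarrow> real^'n" and L :: "(real^'n) set \<Rightarrow> real"
      and b :: "(real^'n) set \<Rightarrow> real^'n \<Rightarrow> complex" and g :: "real^'n \<Rightarrow> complex"
  where "finite S" "\<And>P. bbs (b P)" "\<And>P. P \<in> S \<Longrightarrow> L P > 0"
    "\<And>P y. P \<in> S \<Longrightarrow> b P y \<noteq> 0 \<Longrightarrow> norm (y - c P) \<le> L P"
    "\<And>P. P \<in> S \<Longrightarrow> (LINT x|lborel. b P x) = 0"
    "(\<Sum>P\<in>S. LINT x|lborel. norm (b P x)) \<le> 2 * lam * V"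
    "(\<Sum>P\<in>S. L P ^ CARD('n)) \<le> real CARD('n) ^ CARD('n) * V"
    "bbs g" "\<And>x. norm (g x) \<le> 2 ^ CARD('n) * lam" "(LINT x|lborel. norm (g x)) \<le> 2 * lam * V"
    "\<And>x. f x = g x + (\<Sum>P\<in>S. b P x)"
proof -
  define n where "n = CARD('n)"
  have n: "n > 0" by (simp add: n_def)
  have [measurable]: "f \<in> borel_measurable borel" by (rule bbsD(1)[OF f])
  define mass where "mass = (\<lambda>Q. LINT x|lborel. norm (f x) * indicator Q x)"
  have mass_int: "integrable lborel (\<lambda>x. norm (f x) * indicator Q x)" if "Q \<in> sets borel" for Q
    by (rule bbs_mass_integrable[OF f that])
  have mass_le: "mass Q \<le> (LINT x|lborel. norm (f x))" if "Q \<in> sets borel" for Q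
    using sum_mass_le[OF f, of "{Q}"] that by (simp add: mass_def)
  obtain K1 :: int where K1: "max V 1 < 2 powi K1" using powi_large by blast
  have "(2::real) powi K1 \<le> (2 powi K1) ^ n" using K1 n by (intro self_le_power) auto
  hence K1n: "V \<le> (2 powi K1) ^ n" using K1 by linarith
  obtain a where a: "\<And>x. x \<notin> cbox (-a) a \<Longrightarrow> f x = 0" using bbsD(3)[OF f] by blast
  have "uniformly_continuous_on (cbox (-a - 1) (a + 1)) f"
    by (intro compact_uniformly_continuous continuous_on_subset[OF cont]) auto
  then obtain e where e: "e > 0" "\<And>x y. x \<in> cbox (-a - 1) (a + 1) \<Longrightarrow> y \<in> cbox (-a - 1) (a + 1) \<Longrightarrow> dist y x < e \<Longrightarrow> dist (f y) (f x) < lam"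
    unfolding uniformly_continuous_on_def using lam by metis
  obtain K2' :: int where K2': "(2::real) powi K2' < min e 1 / real n" using powi_small[of "min e 1 / real n"] e(1) n by auto
  define K2 where "K2 = min K1 K2'"
  have "(2::real) powi K2 \<le> 2 powi K2'" by (intro power_int_increasing) (auto simp: K2_def)
  hence "real n * 2 powi K2 \<le> real n * 2 powi K2'" by (intro mult_left_mono) auto
  also have "\<dots> < min e 1" using K2' n by (simp add: pos_less_divide_eq mult.commute)
  finally have K2: "real n * 2 powi K2 < min e 1" .
  define Sel where "Sel = (\<lambda>k Q. K2 \<le> k \<and> lam * (2 powi k) ^ n < mass Q)"
  define S where "S = stopping_cubes Sel (0::real^'n) K1"
  have top: "\<not> Sel K1 (dcube 0 K1 x)" for x
  proof -
    have "mass (dcube 0 K1 x) \<le> lam * V" using mass_le[OF dcube_measure(1)] fV by (rule order_trans)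
    also have "\<dots> \<le> lam * (2 powi K1) ^ n" using K1n lam by (intro mult_left_mono) auto
    finally show ?thesis by (simp add: Sel_def)
  qed
  have "\<exists>k x. P = dcube 0 k x \<and> K2 \<le> k \<and> lam * (2 powi k) ^ n < mass P \<and> mass P \<le> 2 ^ n * lam * (2 powi k) ^ n" if P: "P \<in> S" for P
  proof -
    obtain k x where kx: "P = dcube 0 k x" "k < K1" "Sel k P" "\<And>l. k < l \<Longrightarrow> l \<le> K1 \<Longrightarrow> \<not> Sel l (dcube 0 l x)"
      using P by (auto simp: S_def stopping_cubes_def)
    have "\<not> Sel (k + 1) (dcube 0 (k + 1) x)" using kx(4)[of "k + 1"] kx(2) by simp
    hence "mass (dcube 0 (k + 1) x) \<le> lam * (2 powi (k + 1)) ^ n" using kx(3) by (auto simp: Sel_def)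
    also have "\<dots> = 2 ^ n * lam * (2 powi k) ^ n" by (simp add: power_int_add power_mult_distrib)
    finally have "mass (dcube 0 (k + 1) x) \<le> 2 ^ n * lam * (2 powi k) ^ n" .
    moreover have "mass P \<le> mass (dcube 0 (k + 1) x)"
      unfolding mass_def kx(1)
    proof (intro integral_mono mass_int dcube_measure(1))
      fix y show "norm (f y) * indicator (dcube 0 k x) y \<le> norm (f y) * indicator (dcube 0 (k + 1) x) y"
        using dcube_mono[of k "k + 1" 0 x] by (auto simp: indicator_def)
    qed
    ultimately show ?thesis using kx unfolding Sel_def by (intro exI[of _ k] exI[of _ x]) auto
  qed
  then obtain kk c where kc: "\<And>P. P \<in> S \<Longrightarrow> P = dcube 0 (kk P) (c P)" "\<And>P. P \<in> S \<Longrightarrow> K2 \<le> kk P"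
    "\<And>P. P \<in> S \<Longrightarrow> lam * (2 powi (kk P)) ^ n < mass P" "\<And>P. P \<in> S \<Longrightarrow> mass P \<le> 2 ^ n * lam * (2 powi (kk P)) ^ n"
    by metis
  have Pm: "P \<in> sets borel" if "P \<in> S" for P using kc(1)[OF that] dcube_measure(1) by metis
  have disj: "P = P'" if "P \<in> S" "P' \<in> S" "z \<in> P" "z \<in> P'" for P P' z
    using stopping_cubes_disjoint[of P Sel 0 K1 P' z] that unfolding S_def by blast
  have summass: "(\<Sum>P\<in>F. mass P) \<le> lam * V" if "F \<subseteq> S" "finite F" for F
  proof -
    have "(\<Sum>P\<in>F. mass P) \<le> (LINT x|lborel. norm (f x))"
      unfolding mass_def by (rule sum_mass_le[OF f that(2)]) (use that(1) Pm disj in blast)+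
    thus ?thesis using fV by linarith
  qed
  have sumvol: "(\<Sum>P\<in>F. (2 powi (kk P)) ^ n) \<le> V" if "F \<subseteq> S" "finite F" for F
  proof -
    have "lam * (\<Sum>P\<in>F. (2 powi (kk P)) ^ n) = (\<Sum>P\<in>F. lam * (2 powi (kk P)) ^ n)" by (simp add: sum_distrib_left)
    also have "\<dots> \<le> (\<Sum>P\<in>F. mass P)" using that(1) kc(3) by (intro sum_mono) (auto intro: less_imp_le)
    also have "\<dots> \<le> lam * V" by (rule summass[OF that])
    finally show ?thesis using lam by simp
  qed
  define v0 where "v0 = ((2::real) powi K2) ^ n"
  have v0: "v0 > 0" by (simp add: v0_def)
  have fin: "finite S"
  proof -
    have "card F \<le> nat \<lceil>V / v0\<rceil>" if F: "F \<subseteq> S" "finite F" for F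
    proof -
      have "real (card F) * v0 = (\<Sum>P\<in>F. v0)" by simp
      also have "\<dots> \<le> (\<Sum>P\<in>F. (2 powi (kk P)) ^ n)"
        unfolding v0_def using F kc(2) by (intro sum_mono power_mono power_int_increasing) auto
      also have "\<dots> \<le> V" by (rule sumvol[OF F])
      finally have "real (card F) \<le> V / v0" using v0 by (simp add: field_simps)
      thus ?thesis by linarith
    qed
    thus ?thesis using finite_if_finite_subsets_card_bdd[of S] by blast
  qed
  define avg where "avg = (\<lambda>P. (LINT x|lborel. f x * indicator P x) / of_real ((2 powi (kk P)) ^ n))"
  define b where "b = (\<lambda>P x. if P \<in> S then f x * indicator P x - avg P * indicator P x else 0)"
  have fi: "integrable lborel (\<lambda>x. f x * indicator P x)" if "P \<in> S" for P
    by (intro bbs_integrable bbs_mult_indicator f Pm that)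
  have volP: "emeasure lborel P = ennreal ((2 powi (kk P)) ^ n)" if "P \<in> S" for P
    using dcube_measure(2)[of 0 "kk P" "c P"] kc(1)[OF that] by (simp add: n_def)
  have indb: "bbs (\<lambda>x. C * indicator P x)" if "P \<in> S" for P and C :: complex
  proof (rule bbsI)
    have P: "P = cube (\<chi> i. 0 $ i + 2 powi (kk P) * \<lfloor>(c P $ i - 0 $ i) / 2 powi (kk P)\<rfloor>) (2 powi (kk P))"
      using dcube_is_cube kc(1)[OF that] by metis
    define A where "A = (\<chi> i. 0 $ i + 2 powi (kk P) * \<lfloor>(c P $ i - 0 $ i) / 2 powi (kk P)\<rfloor>)"
    show "(\<lambda>x. C * indicator P x) \<in> borel_measurable borel" using Pm[OF that] by measurable
    show "norm (C * indicator P x) \<le> norm C" for x by (auto simp: indicator_def)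
    show "C * indicator P x = 0" if "x \<notin> cbox A (A + (\<chi> i. 2 powi (kk P)))" for x
    proof -
      have "x \<notin> cube A (2 powi (kk P))" using that by (auto simp: cube_def mem_box_cart intro: less_imp_le)
      thus ?thesis using P by (simp add: A_def)
    qed
  qed
  have bb: "bbs (b P)" for P
  proof (cases "P \<in> S")
    case True
    have "b P = (\<lambda>x. f x * indicator P x - avg P * indicator P x)" using True by (auto simp: b_def)
    thus ?thesis using bbs_diff[OF bbs_mult_indicator[OF f Pm[OF True]] indb[OF True]] by simp
  next
    case False
    hence "b P = (\<lambda>x. 0)" by (auto simp: b_def)
    thus ?thesis by (simp add: bbs_def)
  qed
  have normavg: "norm (avg P) * (2 powi (kk P)) ^ n \<le> mass P" if "P \<in> S" for P
  proof -
    have "norm (LINT x|lborel. f x * indicator P x) \<le> (LINT x|lborel. norm (f x * indicator P x))"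
      by (rule integral_norm_bound)
    also have "\<dots> = mass P" unfolding mass_def by (intro Bochner_Integration.integral_cong) (auto simp: indicator_def)
    finally have "norm (LINT x|lborel. f x * indicator P x) \<le> mass P" .
    moreover have "norm (avg P) = norm (LINT x|lborel. f x * indicator P x) / \<bar>(2 powi (kk P)) ^ n\<bar>"
      by (simp only: avg_def norm_divide norm_of_real)
    ultimately show ?thesis by simp
  qed
  have avgle: "norm (avg P) \<le> 2 ^ n * lam" if "P \<in> S" for P
  proof -
    have "norm (avg P) * (2 powi (kk P)) ^ n \<le> (2 ^ n * lam) * (2 powi (kk P)) ^ n"
      using normavg[OF that] kc(4)[OF that] by linarith
    thus ?thesis by (rule mult_right_le_imp_le) simp
  qed
  have ii: "integrable lborel (\<lambda>x. C * indicator P x)" if "P \<in> S" for P and C :: complex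
    by (rule bbs_integrable[OF indb[OF that]])
  have measP: "measure lborel P = (2 powi (kk P)) ^ n" if "P \<in> S" for P
    using volP[OF that] by (simp add: measure_def)
  have bmean: "(LINT x|lborel. b P x) = 0" if "P \<in> S" for P
  proof -
    have "(LINT x|lborel. b P x) = (LINT x|lborel. f x * indicator P x) - (LINT x|lborel. avg P * indicator P x)"
      using that fi[OF that] ii[OF that] by (simp add: b_def)
    also have "(LINT x|lborel. avg P * indicator P x) = avg P * of_real ((2 powi (kk P)) ^ n)"
    proof -
      have "(LINT x|lborel. avg P * indicator P x) = avg P * (LINT x|lborel. of_real (indicator P x))"
        by (simp add: of_real_indicator)
      also have "(LINT x|lborel. complex_of_real (indicator P x)) = of_real (measure lborel P)"
        using Pm[OF that] by (subst integral_complex_of_real) simp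
      finally show ?thesis using measP[OF that] by simp
    qed
    also have "avg P * of_real ((2 powi (kk P)) ^ n) = (LINT x|lborel. f x * indicator P x)"
      by (simp add: avg_def)
    finally show ?thesis by simp
  qed
  have intind: "(LINT x|lborel. norm (avg P) * indicator P x) \<le> mass P" if "P \<in> S" for P
  proof -
    have "(LINT x|lborel. norm (avg P) * indicator P x) = norm (avg P) * measure lborel P"
      using Pm[OF that] by simp
    also have "\<dots> \<le> mass P" unfolding measP[OF that] by (rule normavg[OF that])
    finally show ?thesis .
  qed
  have indi: "integrable lborel (\<lambda>x. norm (avg P) * indicator P x)" if "P \<in> S" for P
  proof -
    have "integrable lborel (\<lambda>x. norm (avg P * indicator P x))" by (intro integrable_norm ii that)
    also have "(\<lambda>x. norm (avg P * indicator P x)) = (\<lambda>x. norm (avg P) * indicator P x)" by (auto simp: indicator_def)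
    finally show ?thesis .
  qed
  have bnorm: "(LINT x|lborel. norm (b P x)) \<le> 2 * mass P" if "P \<in> S" for P
  proof -
    have "(LINT x|lborel. norm (b P x)) \<le> (LINT x|lborel. norm (f x) * indicator P x + norm (avg P) * indicator P x)"
    proof (rule integral_mono)
      show "integrable lborel (\<lambda>x. norm (b P x))" by (intro integrable_norm bbs_integrable bb)
      show "integrable lborel (\<lambda>x. norm (f x) * indicator P x + norm (avg P) * indicator P x)"
        by (intro Bochner_Integration.integrable_add mass_int Pm indi that)
      fix x show "norm (b P x) \<le> norm (f x) * indicator P x + norm (avg P) * indicator P x"
        using norm_triangle_ineq4[of "f x" "avg P"] that by (auto simp: b_def indicator_def)
    qed
    also have "\<dots> = mass P + (LINT x|lborel. norm (avg P) * indicator P x)"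
      unfolding mass_def by (intro Bochner_Integration.integral_add mass_int Pm indi that)
    also have "\<dots> \<le> 2 * mass P" using intind[OF that] by simp
    finally show ?thesis .
  qed
  define g where "g = (\<lambda>x. f x - (\<Sum>P\<in>S. b P x))"
  have sumb: "bbs (\<lambda>x. \<Sum>P\<in>F. b P x)" if "finite F" for F
    using that
  proof (induction F rule: finite_induct)
    case empty show ?case by (simp add: bbs_def)
  next
    case (insert P F)
    have "bbs (\<lambda>x. (\<Sum>P\<in>F. b P x) - (0 - b P x))"
      by (intro bbs_diff insert.IH bb) (simp add: bbs_def)
    thus ?case using insert by (simp add: add.commute)
  qed
  have gb: "bbs g" unfolding g_def by (intro bbs_diff f sumb fin)
  have g_in: "g x = avg P" if "P \<in> S" "x \<in> P" for x P
  proof -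
    have "(\<Sum>P'\<in>S. b P' x) = (\<Sum>P'\<in>S. if P' = P then b P x else 0)"
    proof (intro sum.cong refl)
      fix P' assume "P' \<in> S"
      show "b P' x = (if P' = P then b P x else 0)"
      proof (cases "P' = P")
        case False
        hence "x \<notin> P'" using disj[OF \<open>P' \<in> S\<close> that(1) _ that(2)] by blast
        thus ?thesis using False by (simp add: b_def)
      qed simp
    qed
    also have "\<dots> = b P x" using that fin by simp
    finally show ?thesis using that by (simp add: g_def b_def)
  qed
  have g_out: "g x = f x" if "\<And>P. P \<in> S \<Longrightarrow> x \<notin> P" for x
  proof -
    have "(\<Sum>P\<in>S. b P x) = 0" using that by (intro sum.neutral) (auto simp: b_def)
    thus ?thesis by (simp add: g_def)
  qed
  have n2: "(2::real) \<le> 2 ^ n" using n self_le_power[of "2::real" n] by simp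
  have gbound: "norm (g x) \<le> 2 ^ n * lam" for x
  proof (cases "\<exists>P\<in>S. x \<in> P")
    case True
    then obtain P where "P \<in> S" "x \<in> P" by blast
    thus ?thesis using g_in avgle by simp
  next
    case False
    hence gf: "g x = f x" using g_out by blast
    show ?thesis
    proof (cases "f x = 0")
      case True thus ?thesis using gf lam by simp
    next
      case fx: False
      let ?Q = "dcube 0 K2 x"
      have "\<not> Sel K2 ?Q"
      proof
        assume "Sel K2 ?Q"
        then obtain l where "dcube 0 l x \<in> S"
          using stopping_cubes_cover[of Sel K2 0 x K1] top[of x] unfolding S_def by (auto simp: K2_def)
        thus False using False dcube_self[of x 0 l] by blast
      qed
      hence m: "mass ?Q \<le> lam * (2 powi K2) ^ n" by (simp add: Sel_def)
      have xin: "x \<in> cbox (-a) a" using a fx by blast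
      have near: "norm (f x) - lam \<le> norm (f y)" if y: "y \<in> ?Q" for y
      proof -
        have d: "norm (y - x) < min e 1" using dcube_norm_dist[OF y dcube_self] K2 by (simp add: n_def)
        have "y \<in> cbox (-a - 1) (a + 1)" "x \<in> cbox (-a - 1) (a + 1)"
        proof -
          have "- a $ i - 1 \<le> y $ i \<and> y $ i \<le> a $ i + 1 \<and> - a $ i - 1 \<le> x $ i \<and> x $ i \<le> a $ i + 1" for i
          proof -
            have "- a $ i \<le> x $ i \<and> x $ i \<le> a $ i" using xin by (simp add: mem_box_cart)
            moreover have "\<bar>y $ i - x $ i\<bar> < 1" using component_le_norm_cart[of "y - x" i] d by simp
            ultimately show ?thesis by linarith
          qed
          thus "y \<in> cbox (-a - 1) (a + 1)" "x \<in> cbox (-a - 1) (a + 1)" by (simp_all add: mem_box_cart)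
        qed
        hence "dist (f y) (f x) < lam" using e(2)[of x y] d by (simp add: dist_norm)
        thus ?thesis using norm_triangle_ineq2[of "f x" "f y"] by (simp add: dist_norm norm_minus_commute)
      qed
      have "(norm (f x) - lam) * (2 powi K2) ^ n = (LINT y|lborel. (norm (f x) - lam) * indicator ?Q y)"
        using dcube_measure[of 0 K2 x] by (simp add: measure_def n_def)
      also have "\<dots> \<le> mass ?Q"
        unfolding mass_def
      proof (rule integral_mono)
        show "integrable lborel (\<lambda>y. (norm (f x) - lam) * indicator ?Q y)"
          using dcube_measure[of 0 K2 x] by (intro integrable_mult_right integrable_real_indicator) auto
        show "integrable lborel (\<lambda>y. norm (f y) * indicator ?Q y)" by (rule mass_int[OF dcube_measure(1)])
        show "(norm (f x) - lam) * indicator ?Q y \<le> norm (f y) * indicator ?Q y" for y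
          using near by (auto simp: indicator_def)
      qed
      finally have "(norm (f x) - lam) * (2 powi K2) ^ n \<le> lam * (2 powi K2) ^ n" using m by linarith
      hence "norm (f x) - lam \<le> lam" by (rule mult_right_le_imp_le) simp
      hence "norm (g x) \<le> 2 * lam" using gf by simp
      also have "\<dots> \<le> 2 ^ n * lam" using n2 lam by (intro mult_right_mono) auto
      finally show ?thesis .
    qed
  qed
  have gint: "(LINT x|lborel. norm (g x)) \<le> 2 * lam * V"
  proof -
    have "(LINT x|lborel. norm (g x)) \<le> (LINT x|lborel. norm (f x) + (\<Sum>P\<in>S. norm (avg P) * indicator P x))"
    proof (rule integral_mono)
      show "integrable lborel (\<lambda>x. norm (g x))" by (intro integrable_norm bbs_integrable gb)
      show "integrable lborel (\<lambda>x. norm (f x) + (\<Sum>P\<in>S. norm (avg P) * indicator P x))"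
        by (intro Bochner_Integration.integrable_add Bochner_Integration.integrable_sum integrable_norm bbs_integrable f indi)
      fix x show "norm (g x) \<le> norm (f x) + (\<Sum>P\<in>S. norm (avg P) * indicator P x)"
      proof (cases "\<exists>P\<in>S. x \<in> P")
        case True
        then obtain P where P: "P \<in> S" "x \<in> P" by blast
        have "norm (g x) = norm (avg P) * indicator P x" using g_in[OF P] P by simp
        also have "\<dots> \<le> (\<Sum>P\<in>S. norm (avg P) * indicator P x)"
          using P fin by (intro member_le_sum[where f = "\<lambda>P. norm (avg P) * indicator P x"]) auto
        finally show ?thesis by (simp add: add_increasing)
      next
        case False
        hence "g x = f x" using g_out by blast
        thus ?thesis by (simp add: sum_nonneg)
      qed
    qed
    also have "\<dots> = (LINT x|lborel. norm (f x)) + (\<Sum>P\<in>S. LINT x|lborel. norm (avg P) * indicator P x)"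
    proof -
      have "(LINT x|lborel. (\<Sum>P\<in>S. norm (avg P) * indicator P x)) = (\<Sum>P\<in>S. LINT x|lborel. norm (avg P) * indicator P x)"
        by (intro Bochner_Integration.integral_sum indi)
      moreover have "integrable lborel (\<lambda>x. \<Sum>P\<in>S. norm (avg P) * indicator P x)"
        by (intro Bochner_Integration.integrable_sum indi)
      ultimately show ?thesis
        using Bochner_Integration.integral_add[OF integrable_norm[OF bbs_integrable[OF f]]] by simp
    qed
    also have "\<dots> \<le> lam * V + (\<Sum>P\<in>S. mass P)"
      using fV intind by (intro add_mono sum_mono) auto
    also have "\<dots> \<le> 2 * lam * V" using summass[OF order_refl fin] by (simp add: mult.commute)
    finally show ?thesis .
  qed
  show thesis
  proof (rule that[of S b "\<lambda>P. real n * 2 powi (kk P)" c g])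
    show "b P y \<noteq> 0 \<Longrightarrow> norm (y - c P) \<le> real n * 2 powi (kk P)" if "P \<in> S" for P y
    proof -
      assume "b P y \<noteq> 0"
      hence "y \<in> P" by (auto simp: b_def indicator_def split: if_splits)
      hence "y \<in> dcube 0 (kk P) (c P)" using kc(1)[OF that] by simp
      thus ?thesis using dcube_norm_dist[OF _ dcube_self] by (simp add: n_def)
    qed
    show "(\<Sum>P\<in>S. LINT x|lborel. norm (b P x)) \<le> 2 * lam * V"
    proof -
      have "(\<Sum>P\<in>S. LINT x|lborel. norm (b P x)) \<le> (\<Sum>P\<in>S. 2 * mass P)" by (intro sum_mono bnorm)
      also have "\<dots> = 2 * (\<Sum>P\<in>S. mass P)" by (simp add: sum_distrib_left)
      also have "\<dots> \<le> 2 * (lam * V)" using summass[OF order_refl fin] by simp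
      finally show ?thesis by simp
    qed
    have "(\<Sum>P\<in>S. (real n * 2 powi (kk P)) ^ n) = real n ^ n * (\<Sum>P\<in>S. (2 powi (kk P)) ^ n)"
      by (simp add: power_mult_distrib sum_distrib_left)
    also have "\<dots> \<le> real n ^ n * V" by (intro mult_left_mono sumvol fin) auto
    finally show "(\<Sum>P\<in>S. (real n * 2 powi (kk P)) ^ CARD('n)) \<le> real CARD('n) ^ CARD('n) * V" by (simp add: n_def)
    show "norm (g x) \<le> 2 ^ CARD('n) * lam" for x using gbound[of x] by (simp add: n_def)
  qed (use fin bb bmean gb gint n in \<open>auto simp: g_def\<close>)
qed

section \<open>Good and bad parts\<close>

context CZ_operator
begin

lemma bbs_Lpq: "bbs h \<Longrightarrow> h \<in> Lp_space (q j)"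
  by (rule bbs_Lp(1)[OF _ q_pos])

lemma U_sum:
  fixes h :: "'m \<Rightarrow> real^'n \<Rightarrow> complex"
  assumes "finite S" and h: "\<And>i. bbs (h i)" and b: "\<And>P. bbs (b P)"
  shows "AE x in lborel. U (h(j := \<lambda>x. \<Sum>P\<in>S. b P x)) x = (\<Sum>P\<in>S. U (h(j := b P)) x)"
  using assms(1)
proof (induction S rule: finite_induct)
  case empty
  have "AE x in lborel. U (h(j := \<lambda>x. 0)) x = 0"
  proof (rule U_zero[of _ j])
    fix i show "(h(j := \<lambda>x. 0)) i \<in> Lp_space (q i)"
      using bbs_Lpq[OF h] by (auto intro: bbs_Lpq simp: bbs_def)
  qed simp
  thus ?case by (simp only: sum.empty)
next
  case (insert P S)
  define M where "M = h(j := \<lambda>x. \<Sum>P\<in>S. b P x)"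
  have sumb: "bbs (\<lambda>x. \<Sum>P\<in>F. b P x)" if "finite F" for F
    using that
  proof (induction F rule: finite_induct)
    case empty show ?case by (simp add: bbs_def)
  next
    case (insert P F)
    have "bbs (\<lambda>x. (\<Sum>P\<in>F. b P x) - (0 - b P x))"
      by (intro bbs_diff insert.IH b) (simp add: bbs_def)
    thus ?case using insert by (simp add: add.commute)
  qed
  have M: "M i \<in> Lp_space (q i)" for i
    unfolding M_def using h sumb[OF insert(1)] by (auto intro: bbs_Lpq)
  have "M(j := \<lambda>x. 1 * M j x + 1 * b P x) = h(j := \<lambda>x. \<Sum>P\<in>insert P S. b P x)"
    using insert by (auto simp: M_def fun_eq_iff)
  moreover have "M(j := b P) = h(j := b P)" by (simp add: M_def)
  ultimately have "AE x in lborel. U (h(j := \<lambda>x. \<Sum>P\<in>insert P S. b P x)) x = U M x + U (h(j := b P)) x"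
    using U_linear[of M "b P" j 1 1, OF M bbs_Lpq[OF b]] by simp
  with insert.IH show ?case
    unfolding M_def[symmetric] by eventually_elim (use insert(1,2) in \<open>simp del: fun_upd_apply add: add.commute\<close>)
qed

lemma sum_inverse_q: "(\<Sum>j\<in>UNIV. 1 / q j) = 1 / target_exp"
  by (simp add: target_exp_def)

text \<open>
  The good functions are bounded and integrable, hence bounded in \<open>L\<^sup>q\<^sup>j\<close>, and Chebyshev's inequality for
  \<open>U g\<close> applies. The powers of \<open>lam j\<close> and \<open>V\<close> match because \<open>1 / target_exp\<close> is the sum of the \<open>1 / q j\<close>.
\<close>

lemma good_part:
  fixes g :: "'m \<Rightarrow> real^'n \<Rightarrow> complex"
  assumes g: "\<And>j. bbs (g j)" and gB: "\<And>j x. norm (g j x) \<le> B * lam j" and B: "B \<ge> 1"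
    and gi: "\<And>j. (LINT x|lborel. norm (g j x)) \<le> 2 * lam j * V" and lam: "\<And>j. lam j > 0" and V: "V > 0"
  shows "emeasure lebesgue {x. norm (U g x) > (\<Prod>j\<in>UNIV. lam j)} \<le> ennreal ((op_norm * B ^ CARD('m)) powr target_exp * 2 * V)"
proof -
  have gLp: "g j \<in> Lp_space (q j)" for j by (rule bbs_Lpq[OF g])
  have norm1: "Lp_norm (q j) (g j) \<le> B * lam j * (2 * V) powr (1 / q j)" for j
  proof -
    have Bl: "B * lam j > 0" using B lam[of j] by simp
    have "(LINT x|lborel. norm (g j x) powr q j) \<le> (LINT x|lborel. (B * lam j) powr (q j - 1) * norm (g j x))"
    proof (rule integral_mono)
      show "integrable lborel (\<lambda>x. norm (g j x) powr q j)" by (rule bbs_powr_integrable[OF g q_pos])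
      show "integrable lborel (\<lambda>x. (B * lam j) powr (q j - 1) * norm (g j x))"
        by (intro integrable_mult_right integrable_norm bbs_integrable g)
      fix x show "norm (g j x) powr q j \<le> (B * lam j) powr (q j - 1) * norm (g j x)"
      proof (cases "g j x = 0")
        case False
        have "norm (g j x) powr q j = norm (g j x) powr (q j - 1) * norm (g j x) powr 1"
          by (subst powr_add[symmetric]) simp
        also have "\<dots> = norm (g j x) powr (q j - 1) * norm (g j x)" by simp
        also have "\<dots> \<le> (B * lam j) powr (q j - 1) * norm (g j x)"
          using gB[of j x] q1[of j] by (intro mult_right_mono powr_mono2) auto
        finally show ?thesis .
      qed simp
    qed
    also have "\<dots> = (B * lam j) powr (q j - 1) * (LINT x|lborel. norm (g j x))" by simp
    also have "\<dots> \<le> (B * lam j) powr (q j - 1) * (2 * lam j * V)" by (intro mult_left_mono gi) auto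
    also have "\<dots> \<le> (B * lam j) powr (q j - 1) * (B * lam j * (2 * V))"
      using B lam[of j] V by (intro mult_left_mono) (auto simp: mult_ac)
    also have "\<dots> = (B * lam j) powr (q j - 1) * (B * lam j) powr 1 * (2 * V)" using Bl by simp
    also have "\<dots> = (B * lam j) powr q j * (2 * V)" by (subst powr_add[symmetric]) simp
    finally have *: "(LINT x|lborel. norm (g j x) powr q j) \<le> (B * lam j) powr q j * (2 * V)" .
    have "Lp_norm (q j) (g j) \<le> ((B * lam j) powr q j * (2 * V)) powr (1 / q j)"
      unfolding bbs_Lp(2)[OF g q_pos] using q_pos[of j] *
      by (intro powr_mono2) (auto intro!: Bochner_Integration.integral_nonneg)
    also have "\<dots> = B * lam j * (2 * V) powr (1 / q j)"
      using Bl B lam[of j] V q_pos[of j] by (simp add: powr_mult powr_powr)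
    finally show ?thesis .
  qed
  define Lm where "Lm = (\<Prod>j\<in>UNIV. lam j)"
  have Lm: "Lm > 0" unfolding Lm_def using lam by (intro prod_pos) auto
  have "(\<Prod>j\<in>UNIV. Lp_norm (q j) (g j)) \<le> (\<Prod>j\<in>UNIV. B * lam j * (2 * V) powr (1 / q j))"
    by (intro prod_mono conjI norm1 Lp_norm_nonneg)
  also have "\<dots> = B ^ CARD('m) * Lm * (2 * V) powr (1 / target_exp)"
  proof -
    have "(\<Prod>j\<in>UNIV. (2 * V) powr (1 / q j)) = (2 * V) powr (\<Sum>j\<in>UNIV. 1 / q j)"
      using V by (intro powr_sum[symmetric]) auto
    thus ?thesis by (simp add: prod.distrib Lm_def sum_inverse_q)
  qed
  finally have "op_norm * (\<Prod>j\<in>UNIV. Lp_norm (q j) (g j)) \<le> op_norm * (B ^ CARD('m) * Lm * (2 * V) powr (1 / target_exp))"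
    by (intro mult_left_mono op_norm_nonneg)
  hence "(op_norm * (\<Prod>j\<in>UNIV. Lp_norm (q j) (g j))) powr target_exp \<le> (op_norm * (B ^ CARD('m) * Lm * (2 * V) powr (1 / target_exp))) powr target_exp"
    using target_exp_pos op_norm_nonneg by (intro powr_mono2) (auto intro!: mult_nonneg_nonneg prod_nonneg Lp_norm_nonneg)
  also have "\<dots> = (op_norm * B ^ CARD('m)) powr target_exp * Lm powr target_exp * (2 * V)"
    using op_norm_nonneg B Lm V target_exp_pos by (simp add: powr_mult powr_powr mult_ac)
  finally have I: "(LINT x|lebesgue. norm (U g x) powr target_exp) \<le> (op_norm * B ^ CARD('m)) powr target_exp * Lm powr target_exp * (2 * V)"
    using U_powr_bound(2)[of g, OF gLp] by linarith
  have "emeasure lebesgue {x. norm (U g x) > Lm} \<le> emeasure lebesgue {x \<in> space lebesgue. norm (U g x) powr target_exp \<ge> Lm powr target_exp}"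
  proof (rule emeasure_mono)
    show "{x. norm (U g x) > Lm} \<subseteq> {x \<in> space lebesgue. norm (U g x) powr target_exp \<ge> Lm powr target_exp}"
      using Lm target_exp_pos by (auto intro!: powr_mono2)
    have [measurable]: "U g \<in> borel_measurable lebesgue" by (rule U_measurable[OF gLp])
    show "{x \<in> space lebesgue. norm (U g x) powr target_exp \<ge> Lm powr target_exp} \<in> sets lebesgue" by measurable
  qed
  also have "\<dots> \<le> ennreal (1 / (Lm powr target_exp) * (LINT x|lebesgue. norm (U g x) powr target_exp))"
    using Lm by (intro integral_Markov_inequality[OF U_powr_bound(1)[of g, OF gLp]]) auto
  also have "\<dots> \<le> ennreal ((op_norm * B ^ CARD('m)) powr target_exp * 2 * V)"
  proof (rule ennreal_leI)
    have "1 / (Lm powr target_exp) * (LINT x|lebesgue. norm (U g x) powr target_exp)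
      \<le> 1 / (Lm powr target_exp) * ((op_norm * B ^ CARD('m)) powr target_exp * Lm powr target_exp * (2 * V))"
      by (intro mult_left_mono I) auto
    also have "\<dots> = (op_norm * B ^ CARD('m)) powr target_exp * 2 * V" using Lm by simp
    finally show "1 / (Lm powr target_exp) * (LINT x|lebesgue. norm (U g x) powr target_exp) \<le> (op_norm * B ^ CARD('m)) powr target_exp * 2 * V" .
  qed
  finally show ?thesis unfolding Lm_def .
qed

definition "ball_vol = unit_ball_vol dimn"
definition "tail1 = 2 powr (dimn + \<epsilon>) / (1 - 2 powr (- \<epsilon>)) * ball_vol"
definition "bad_out = canc_const * (1/2) powr (- (dimn + \<epsilon>))"

lemma ball_vol_nonneg: "ball_vol \<ge> 0"
  unfolding ball_vol_def using dimn_pos by (simp add: unit_ball_vol_nonneg)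

lemma emeasure_ball_vol:
  "r \<ge> 0 \<Longrightarrow> emeasure lborel (cball (x::real^'n) r) = ennreal (ball_vol * r ^ CARD('n))"
  using emeasure_cball[of r x] by (simp add: ball_vol_def)

lemma tail1_nonneg: "tail1 \<ge> 0"
proof -
  have "2 powr (- \<epsilon>) < 1" using eps_pos powr_less_mono[of "- \<epsilon>" 0 2] by simp
  thus ?thesis using ball_vol_nonneg by (simp add: tail1_def)
qed

lemma tail_one:
  assumes "r > 0"
  shows "(\<integral>\<^sup>+y. ennreal ((r + norm (c - y :: real^'n)) powr (- (dimn + \<epsilon>))) \<partial>lborel) \<le> ennreal (tail1 * r powr (- \<epsilon>))"
proof -
  have "(\<integral>\<^sup>+y. 1 * ennreal ((r + norm (c - y)) powr (- (real DIM(real^'n) + \<epsilon>))) \<partial>lborel)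
      \<le> ennreal (2 powr (real DIM(real^'n) + \<epsilon>) / (1 - 2 powr (-\<epsilon>)) * ball_vol * r powr (-\<epsilon>))"
  proof (rule integral_tail_bound)
    fix s :: real assume "s > 0"
    thus "(\<integral>\<^sup>+y\<in>cball c s. 1 \<partial>lborel) \<le> ennreal (ball_vol * s ^ DIM(real^'n))"
      using emeasure_ball_vol[of s c] by simp
  qed (use assms eps_pos ball_vol_nonneg in auto)
  moreover have "real DIM(real^'n) + \<epsilon> = dimn + \<epsilon>" by simp
  ultimately show ?thesis by (simp only: tail1_def mult_1)
qed

text \<open>
  One entry is a sum of pieces with mean zero, the others are arbitrary with controlled maximal functions
  off \<open>W\<close>. Away from the four-fold dilates each piece contributes a decaying term by \<open>kernel_cancellation\<close>; the sum \<open>\<Phi>\<close>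
  of these terms has integral at most a multiple of \<open>lam j V\<close>, so it is below \<open>lam j\<close> off a set of measure at
  most a multiple of \<open>V\<close>.
\<close>

lemma bad_part:
  fixes h :: "'m \<Rightarrow> real^'n \<Rightarrow> complex" and S :: "(real^'n) set set"
  assumes S: "finite S" and b: "\<And>P. bbs (b P)" and L: "\<And>P. P \<in> S \<Longrightarrow> L P > 0"
    and supp: "\<And>P y. P \<in> S \<Longrightarrow> b P y \<noteq> 0 \<Longrightarrow> norm (y - c P) \<le> L P"
    and mean: "\<And>P. P \<in> S \<Longrightarrow> (LINT x|lborel. b P x) = 0"
    and bsum: "(\<Sum>P\<in>S. LINT x|lborel. norm (b P x)) \<le> 2 * lam j * V"
    and Lsum: "(\<Sum>P\<in>S. L P ^ CARD('n)) \<le> N * V" and N: "N \<ge> 0"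
    and h: "\<And>i. bbs (h i)" and lam: "\<And>i. lam i > 0" and V: "V > 0"
    and W: "\<And>x i s. x \<notin> W \<Longrightarrow> i \<noteq> j \<Longrightarrow> s > 0 \<Longrightarrow> (\<integral>\<^sup>+y\<in>cball x s. ennreal (norm (h i y)) \<partial>lborel) \<le> ennreal (lam i * s ^ CARD('n))"
  obtains E where "E \<in> sets borel" "emeasure lborel E \<le> ennreal ((ball_vol * 4 ^ CARD('n) * N + 2 * tail1) * V)"
    "AE x in lborel. x \<notin> W \<and> x \<notin> E \<longrightarrow> norm (U (h(j := \<lambda>x. \<Sum>P\<in>S. b P x)) x) \<le> bad_out * (\<Prod>i\<in>UNIV. lam i)"
proof -
  define m1 where "m1 = (\<lambda>P. LINT x|lborel. norm (b P x))"
  have m1: "m1 P \<ge> 0" for P unfolding m1_def by (intro Bochner_Integration.integral_nonneg) auto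
  define \<Phi> where "\<Phi> = (\<lambda>x. \<Sum>P\<in>S. L P powr \<epsilon> * m1 P * (L P + norm (c P - x)) powr (- (dimn + \<epsilon>)))"
  have \<Phi>m [measurable]: "\<Phi> \<in> borel_measurable borel" unfolding \<Phi>_def by measurable
  have \<Phi>0: "\<Phi> x \<ge> 0" for x unfolding \<Phi>_def using m1 by (intro sum_nonneg mult_nonneg_nonneg) auto
  define E1 where "E1 = (\<Union>P\<in>S. cball (c P) (4 * L P))"
  define E2 where "E2 = {x. \<Phi> x \<ge> lam j}"
  have E1: "E1 \<in> sets borel" unfolding E1_def by (intro sets.finite_UN S) auto
  have E2: "E2 \<in> sets borel" unfolding E2_def by measurable
  have "emeasure lborel E1 \<le> (\<Sum>P\<in>S. emeasure lborel (cball (c P) (4 * L P)))"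
    unfolding E1_def by (intro emeasure_subadditive_finite S) auto
  also have "\<dots> = (\<Sum>P\<in>S. ennreal (ball_vol * (4 * L P) ^ CARD('n)))"
    using L by (intro sum.cong refl emeasure_ball_vol) (auto simp: less_imp_le)
  also have "\<dots> = ennreal (\<Sum>P\<in>S. ball_vol * (4 * L P) ^ CARD('n))"
    using L ball_vol_nonneg by (intro sum_ennreal) (auto simp: less_imp_le)
  also have "(\<Sum>P\<in>S. ball_vol * (4 * L P) ^ CARD('n)) = ball_vol * 4 ^ CARD('n) * (\<Sum>P\<in>S. L P ^ CARD('n))"
    by (simp add: power_mult_distrib sum_distrib_left mult.assoc)
  also have "ennreal \<dots> \<le> ennreal (ball_vol * 4 ^ CARD('n) * (N * V))"
    using ball_vol_nonneg by (intro ennreal_leI mult_left_mono Lsum) auto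
  finally have mE1: "emeasure lborel E1 \<le> ennreal (ball_vol * 4 ^ CARD('n) * N * V)" by (simp add: mult.assoc)
  have "(\<integral>\<^sup>+x. ennreal (\<Phi> x) \<partial>lborel) = (\<integral>\<^sup>+x. (\<Sum>P\<in>S. ennreal (L P powr \<epsilon> * m1 P) * ennreal ((L P + norm (c P - x)) powr (- (dimn + \<epsilon>)))) \<partial>lborel)"
    unfolding \<Phi>_def using m1 by (intro nn_integral_cong) (auto simp: sum_ennreal[symmetric] ennreal_mult)
  also have "\<dots> = (\<Sum>P\<in>S. ennreal (L P powr \<epsilon> * m1 P) * (\<integral>\<^sup>+x. ennreal ((L P + norm (c P - x)) powr (- (dimn + \<epsilon>))) \<partial>lborel))"
    by (subst nn_integral_sum) (auto simp: nn_integral_cmult)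
  also have "\<dots> \<le> (\<Sum>P\<in>S. ennreal (L P powr \<epsilon> * m1 P) * ennreal (tail1 * L P powr (- \<epsilon>)))"
    by (intro sum_mono mult_left_mono tail_one L) auto
  also have "\<dots> = (\<Sum>P\<in>S. ennreal (tail1 * m1 P))"
  proof (intro sum.cong refl)
    fix P assume "P \<in> S"
    have "L P powr \<epsilon> * m1 P * (tail1 * L P powr (- \<epsilon>)) = tail1 * m1 P"
      using L[OF \<open>P \<in> S\<close>] by (simp add: powr_minus)
    thus "ennreal (L P powr \<epsilon> * m1 P) * ennreal (tail1 * L P powr (- \<epsilon>)) = ennreal (tail1 * m1 P)"
      using m1 tail1_nonneg by (simp add: ennreal_mult[symmetric])
  qed
  also have "\<dots> = ennreal (tail1 * (\<Sum>P\<in>S. m1 P))"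
    using m1 tail1_nonneg by (subst sum_ennreal) (auto simp: sum_distrib_left)
  also have "\<dots> \<le> ennreal (tail1 * (2 * lam j * V))"
    using bsum tail1_nonneg by (intro ennreal_leI mult_left_mono) (auto simp: m1_def)
  finally have I\<Phi>: "(\<integral>\<^sup>+x. ennreal (\<Phi> x) \<partial>lborel) \<le> ennreal (tail1 * (2 * lam j * V))" .
  have mE2: "emeasure lborel E2 \<le> ennreal (2 * tail1 * V)"
  proof -
    have "ennreal (lam j) * emeasure lborel E2 = (\<integral>\<^sup>+x. ennreal (lam j) * indicator E2 x \<partial>lborel)"
      using E2 by (simp add: nn_integral_cmult)
    also have "\<dots> \<le> (\<integral>\<^sup>+x. ennreal (\<Phi> x) \<partial>lborel)"
      by (intro nn_integral_mono) (auto simp: E2_def indicator_def intro: ennreal_leI)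
    also have "\<dots> \<le> ennreal (tail1 * (2 * lam j * V))" by (rule I\<Phi>)
    also have "\<dots> = ennreal (lam j) * ennreal (2 * tail1 * V)"
      using lam[of j] tail1_nonneg V by (subst ennreal_mult[symmetric]) (auto simp: mult_ac)
    finally show ?thesis using lam[of j] by (subst (asm) ennreal_mult_le_mult_iff) auto
  qed
  define E where "E = E1 \<union> E2"
  have mE: "emeasure lborel E \<le> ennreal ((ball_vol * 4 ^ CARD('n) * N + 2 * tail1) * V)"
  proof -
    have "emeasure lborel E \<le> emeasure lborel E1 + emeasure lborel E2"
      unfolding E_def using E1 E2 by (intro emeasure_subadditive) auto
    also have "\<dots> \<le> ennreal (ball_vol * 4 ^ CARD('n) * N * V) + ennreal (2 * tail1 * V)" by (intro add_mono mE1 mE2)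
    also have "\<dots> = ennreal ((ball_vol * 4 ^ CARD('n) * N + 2 * tail1) * V)"
      using ball_vol_nonneg tail1_nonneg N V by (subst ennreal_plus[symmetric]) (auto simp: algebra_simps)
    finally show ?thesis .
  qed
  have hb: "bbs ((h(j := b P)) i)" for P i using h b by simp
  have rep: "AE x in lborel. \<forall>P\<in>S. x \<notin> closure {z. (h(j := b P)) j z \<noteq> 0} \<longrightarrow> U (h(j := b P)) x = kernel_integral (h(j := b P)) x"
    using S by (intro AE_finite_allI kernel_representation hb)
  have "AE x in lborel. x \<notin> W \<and> x \<notin> E \<longrightarrow> norm (U (h(j := \<lambda>x. \<Sum>P\<in>S. b P x)) x) \<le> bad_out * (\<Prod>i\<in>UNIV. lam i)"
    using rep U_sum[OF S, where h = h and b = b and j = j, OF h b]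
  proof eventually_elim
    case (elim x)
    show ?case
    proof
      assume x: "x \<notin> W \<and> x \<notin> E"
      define R where "R = (\<Prod>i\<in>UNIV-{j}. lam i)"
      have R: "R > 0" unfolding R_def using lam by (intro prod_pos) auto
      have "norm (U (h(j := b P)) x) \<le> bad_out * (L P powr \<epsilon> * m1 P * (L P + norm (c P - x)) powr (- (dimn + \<epsilon>))) * R"
        if P: "P \<in> S" for P
      proof -
        have "x \<notin> cball (c P) (4 * L P)" using x P by (auto simp: E_def E1_def)
        hence far: "norm (x - c P) \<ge> 4 * L P" by (simp add: dist_norm norm_minus_commute)
        have "{z. b P z \<noteq> 0} \<subseteq> cball (c P) (L P)" using supp[OF P] by (auto simp: dist_norm norm_minus_commute)
        hence "closure {z. b P z \<noteq> 0} \<subseteq> cball (c P) (L P)" by (rule closure_minimal) simp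
        moreover have "x \<notin> cball (c P) (L P)" using far L[OF P] by (simp add: dist_norm norm_minus_commute)
        ultimately have "x \<notin> closure {z. (h(j := b P)) j z \<noteq> 0}" by auto
        hence "U (h(j := b P)) x = kernel_integral (h(j := b P)) x" using elim(1) P by blast
        moreover have "norm (kernel_integral (h(j := b P)) x) \<le> canc_const * L P powr \<epsilon> * norm (x - c P) powr (- (dimn + \<epsilon>))
             * (LINT y|lborel. norm ((h(j := b P)) j y)) * (\<Prod>i\<in>UNIV-{j}. lam i)"
        proof (rule kernel_cancellation[OF hb L[OF P] _ far])
          show "norm (y - c P) \<le> L P" if "(h(j := b P)) j y \<noteq> 0" for y using supp[OF P, of y] that by simp
          show "(LINT y|lborel. (h(j := b P)) j y) = 0" using mean[OF P] by simp
          show "(\<integral>\<^sup>+y\<in>cball x s. ennreal (norm ((h(j := b P)) i y)) \<partial>lborel) \<le> ennreal (lam i * s ^ CARD('n))" if "i \<noteq> j" "s > 0" for i s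
            using W[of x i s] x that by simp
          show "0 \<le> lam i" for i using lam[of i] by simp
        qed
        ultimately have "norm (U (h(j := b P)) x) \<le> canc_const * L P powr \<epsilon> * norm (x - c P) powr (- (dimn + \<epsilon>)) * m1 P * R"
          by (simp add: m1_def R_def)
        also have "\<dots> = canc_const * L P powr \<epsilon> * m1 P * R * norm (x - c P) powr (- (dimn + \<epsilon>))" by (simp add: mult_ac)
        also have "\<dots> \<le> canc_const * L P powr \<epsilon> * m1 P * R * (1/2 * (L P + norm (c P - x))) powr (- (dimn + \<epsilon>))"
        proof (intro mult_left_mono powr_mono2')
          show "1/2 * (L P + norm (c P - x)) \<le> norm (x - c P)" using far L[OF P] by (simp add: norm_minus_commute)
          show "0 < 1/2 * (L P + norm (c P - x))" using L[OF P] by (simp add: add_pos_nonneg)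
          show "- (dimn + \<epsilon>) \<le> 0" using dimn_pos eps_pos by simp
          show "0 \<le> canc_const * L P powr \<epsilon> * m1 P * R"
            using A_pos tail_const_pos m1 R by (simp add: canc_const_def)
        qed
        also have "\<dots> = bad_out * (L P powr \<epsilon> * m1 P * (L P + norm (c P - x)) powr (- (dimn + \<epsilon>))) * R"
          using L[OF P] by (subst powr_mult) (auto simp: bad_out_def mult_ac add_nonneg_nonneg)
        finally show ?thesis .
      qed
      hence "(\<Sum>P\<in>S. norm (U (h(j := b P)) x)) \<le> (\<Sum>P\<in>S. bad_out * (L P powr \<epsilon> * m1 P * (L P + norm (c P - x)) powr (- (dimn + \<epsilon>))) * R)"
        by (intro sum_mono)
      also have "\<dots> = bad_out * \<Phi> x * R" by (simp add: \<Phi>_def sum_distrib_left sum_distrib_right)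
      also have "\<dots> \<le> bad_out * lam j * R"
      proof (intro mult_right_mono mult_left_mono)
        show "\<Phi> x \<le> lam j" using x by (auto simp: E_def E2_def)
        show "0 \<le> bad_out" using A_pos tail_const_pos by (simp add: bad_out_def canc_const_def)
      qed (use R in auto)
      also have "\<dots> = bad_out * (\<Prod>i\<in>UNIV. lam i)"
        unfolding R_def by (subst prod.remove[of UNIV j lam]) auto
      finally have "(\<Sum>P\<in>S. norm (U (h(j := b P)) x)) \<le> bad_out * (\<Prod>i\<in>UNIV. lam i)" .
      thus "norm (U (h(j := \<lambda>x. \<Sum>P\<in>S. b P x)) x) \<le> bad_out * (\<Prod>i\<in>UNIV. lam i)"
        unfolding elim(2) using norm_sum[of "\<lambda>P. U (h(j := b P)) x" S] by linarith
    qed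
  qed
  from that[OF _ mE this] show thesis using E1 E2 by (simp add: E_def)
qed

end

section \<open>The weak endpoint inequality\<close>

text \<open>
  The parameter \<open>\<mu>\<close> trades the measure of the exceptional set against the bound off it.
\<close>

lemma maximal_exceptional_set:
  fixes h :: "real^'n::finite \<Rightarrow> complex"
  assumes h: "bbs h" and hV: "(LINT x|lborel. norm (h x)) \<le> lam * V" and lam: "lam > 0" and V: "V > 0"
    and \<mu>: "\<mu> > 0"
  shows "\<exists>W. W \<in> sets borel \<and> emeasure lborel W \<le> ennreal (unit_ball_vol (real CARD('n)) * 5 ^ CARD('n) / \<mu> * V) \<and>
    (\<forall>x s. x \<notin> W \<longrightarrow> s > 0 \<longrightarrow> (\<integral>\<^sup>+y\<in>cball x s. ennreal (norm (h y)) \<partial>lborel) \<le> ennreal (\<mu> * lam * s ^ CARD('n)))"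
proof -
  have [measurable]: "h \<in> borel_measurable borel" by (rule bbsD(1)[OF h])
  have I: "(\<integral>\<^sup>+x. ennreal (norm (h x)) \<partial>lborel) = ennreal (LINT x|lborel. norm (h x))" by (rule bbs_nn_integral[OF h])
  obtain W where W: "W \<in> sets borel"
    "emeasure lborel W \<le> ennreal (unit_ball_vol (real DIM(real^'n)) * 5 ^ DIM(real^'n) / (\<mu> * lam)) * (\<integral>\<^sup>+x. ennreal (norm (h x)) \<partial>lborel)"
    "\<And>x s. x \<notin> W \<Longrightarrow> s > 0 \<Longrightarrow> (\<integral>\<^sup>+y\<in>cball x s. ennreal (norm (h y)) \<partial>lborel) \<le> ennreal (\<mu> * lam * s ^ DIM(real^'n))"
    by (rule Hardy_Littlewood_exceptional_set[of "\<lambda>x. ennreal (norm (h x))" "\<mu> * lam"]) (use I lam \<mu> in auto)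
  have "emeasure lborel W \<le> ennreal (unit_ball_vol (real CARD('n)) * 5 ^ CARD('n) / (\<mu> * lam)) * ennreal (lam * V)"
    using W(2) hV unfolding I by (auto intro!: order_trans[OF W(2)[unfolded I]] mult_left_mono ennreal_leI)
  also have "\<dots> = ennreal (unit_ball_vol (real CARD('n)) * 5 ^ CARD('n) / (\<mu> * lam) * (lam * V))"
    using lam V \<mu> by (intro ennreal_mult[symmetric]) (auto simp: unit_ball_vol_nonneg)
  also have "unit_ball_vol (real CARD('n)) * 5 ^ CARD('n) / (\<mu> * lam) * (lam * V) = unit_ball_vol (real CARD('n)) * 5 ^ CARD('n) / \<mu> * V"
    using lam by simp
  finally show ?thesis using W(1,3) by auto
qed

lemma emeasure_UN_index_le:
  fixes E :: "'m::finite \<Rightarrow> 'a::euclidean_space set"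
  assumes "\<And>j. E j \<in> sets borel" "\<And>j. emeasure lborel (E j) \<le> ennreal (c * V)" "c \<ge> 0" "V > 0"
  shows "emeasure lborel (\<Union>j. E j) \<le> ennreal (real CARD('m) * c * V)"
proof -
  have "emeasure lborel (\<Union>j\<in>UNIV. E j) \<le> (\<Sum>j\<in>UNIV. emeasure lborel (E j))"
    using assms(1) by (intro emeasure_subadditive_finite) auto
  also have "\<dots> \<le> (\<Sum>j\<in>(UNIV::'m set). ennreal (c * V))" by (intro sum_mono assms(2))
  also have "\<dots> = ennreal (real CARD('m) * c * V)"
    using assms(3,4) by (subst sum_ennreal) (auto simp: mult.assoc)
  finally show ?thesis by simp
qed

context CZ_operator
begin

text \<open>
  Decompose every entry at its own height \<open>lam j\<close>. After telescoping from \<open>f\<close> to the tuple of good parts,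
  each term has one bad entry, while the others are full or good functions, whose maximal functions are both
  controlled off a small set.
\<close>

lemma weak_type_continuous:
  shows "\<exists>C>0. \<forall>(f :: 'm \<Rightarrow> real^'n \<Rightarrow> complex) lam V. (\<forall>j. bbs (f j)) \<longrightarrow> (\<forall>j. continuous_on UNIV (f j)) \<longrightarrow> (\<forall>j. lam j > 0) \<longrightarrow> V > 0 \<longrightarrow>
      (\<forall>j. (LINT x|lborel. norm (f j x)) \<le> lam j * V) \<longrightarrow>
      emeasure lebesgue {x. norm (U f x) > C * (\<Prod>j\<in>UNIV. lam j)} \<le> ennreal (C * V)"
proof -
  define \<omega> where "\<omega> = unit_ball_vol (real CARD('n)) * 5 ^ CARD('n)"
  define c1 where "c1 = (op_norm * (2 ^ CARD('n)) ^ CARD('m)) powr target_exp * 2"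
  define c2 where "c2 = ball_vol * 4 ^ CARD('n) * real CARD('n) ^ CARD('n) + 2 * tail1"
  define C where "C = 1 + real CARD('m) * bad_out + (c1 + (real CARD('m) * \<omega> + real CARD('m) * (\<omega> * 2) + real CARD('m) * c2))"
  have \<omega>: "\<omega> \<ge> 0" unfolding \<omega>_def by (intro mult_nonneg_nonneg unit_ball_vol_nonneg of_nat_0_le_iff zero_le_power) auto
  have c1: "c1 \<ge> 0" by (simp add: c1_def)
  have c2: "c2 \<ge> 0" unfolding c2_def using ball_vol_nonneg tail1_nonneg by (intro add_nonneg_nonneg mult_nonneg_nonneg zero_le_power of_nat_0_le_iff) auto
  have bo: "bad_out \<ge> 0" using A_pos tail_const_pos by (simp add: bad_out_def canc_const_def)
  have C1: "C \<ge> 1 + real CARD('m) * bad_out" using \<omega> c1 c2 unfolding C_def by (simp add: add_nonneg_nonneg del: arity_eq)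
  have C2: "C \<ge> c1 + (real CARD('m) * \<omega> + real CARD('m) * (\<omega> * 2) + real CARD('m) * c2)"
    using bo unfolding C_def by (simp add: add_nonneg_nonneg del: arity_eq)
  have "C > 0" using C1 bo by (smt (verit) mult_nonneg_nonneg of_nat_0_le_iff)
  moreover have "emeasure lebesgue {x. norm (U f x) > C * (\<Prod>j\<in>UNIV. lam j)} \<le> ennreal (C * V)"
    if f: "\<And>j. bbs (f j)" and cont: "\<And>j. continuous_on UNIV (f j)" and lam: "\<And>j. lam j > 0" and V: "V > 0"
      and fV: "\<And>j. (LINT x|lborel. norm (f j x)) \<le> lam j * V" for f :: "'m \<Rightarrow> real^'n \<Rightarrow> complex" and lam V
  proof -
    have "\<forall>j. \<exists>g. (bbs g \<and> (\<forall>x. norm (g x) \<le> 2 ^ CARD('n) * lam j) \<and> (LINT x|lborel. norm (g x)) \<le> 2 * lam j * V) \<and>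
      (\<exists>(S::(real^'n) set set) c L b. finite S \<and> (\<forall>P. bbs (b P)) \<and> (\<forall>P\<in>S. L P > 0) \<and> (\<forall>P\<in>S. \<forall>y. b P y \<noteq> 0 \<longrightarrow> norm (y - c P) \<le> L P) \<and>
        (\<forall>P\<in>S. (LINT x|lborel. b P x) = 0) \<and> (\<Sum>P\<in>S. LINT x|lborel. norm (b P x)) \<le> 2 * lam j * V \<and>
        (\<Sum>P\<in>S. L P ^ CARD('n)) \<le> real CARD('n) ^ CARD('n) * V \<and> (\<forall>x. f j x = g x + (\<Sum>P\<in>S. b P x)))"
    proof
      fix j
      show "\<exists>g. (bbs g \<and> (\<forall>x. norm (g x) \<le> 2 ^ CARD('n) * lam j) \<and> (LINT x|lborel. norm (g x)) \<le> 2 * lam j * V) \<and>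
        (\<exists>(S::(real^'n) set set) c L b. finite S \<and> (\<forall>P. bbs (b P)) \<and> (\<forall>P\<in>S. L P > 0) \<and> (\<forall>P\<in>S. \<forall>y. b P y \<noteq> 0 \<longrightarrow> norm (y - c P) \<le> L P) \<and>
        (\<forall>P\<in>S. (LINT x|lborel. b P x) = 0) \<and> (\<Sum>P\<in>S. LINT x|lborel. norm (b P x)) \<le> 2 * lam j * V \<and>
        (\<Sum>P\<in>S. L P ^ CARD('n)) \<le> real CARD('n) ^ CARD('n) * V \<and> (\<forall>x. f j x = g x + (\<Sum>P\<in>S. b P x)))"
        apply (rule CZ_decomposition[OF f cont lam V fV, of j])
        subgoal for S c L b g
          apply (rule exI[of _ g])
          apply (rule conjI)
          apply (intro conjI; simp)
          apply (rule exI[of _ S], rule exI[of _ c], rule exI[of _ L], rule exI[of _ b])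
          apply (intro conjI allI ballI impI; (assumption | simp))
          done
        done
    qed
    from choice[OF this] obtain g where g': "\<forall>j. (bbs (g j) \<and> (\<forall>x. norm (g j x) \<le> 2 ^ CARD('n) * lam j) \<and> (LINT x|lborel. norm (g j x)) \<le> 2 * lam j * V) \<and>
      (\<exists>(S::(real^'n) set set) c L b. finite S \<and> (\<forall>P. bbs (b P)) \<and> (\<forall>P\<in>S. L P > 0) \<and> (\<forall>P\<in>S. \<forall>y. b P y \<noteq> 0 \<longrightarrow> norm (y - c P) \<le> L P) \<and>
        (\<forall>P\<in>S. (LINT x|lborel. b P x) = 0) \<and> (\<Sum>P\<in>S. LINT x|lborel. norm (b P x)) \<le> 2 * lam j * V \<and>
        (\<Sum>P\<in>S. L P ^ CARD('n)) \<le> real CARD('n) ^ CARD('n) * V \<and> (\<forall>x. f j x = g j x + (\<Sum>P\<in>S. b P x)))" ..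
    have g: "bbs (g j)" and gB: "norm (g j x) \<le> 2 ^ CARD('n) * lam j" and gV: "(LINT x|lborel. norm (g j x)) \<le> 2 * lam j * V" for j x
      using g' by simp_all
    define Eg where "Eg = {x. norm (U g x) > (\<Prod>j\<in>UNIV. lam j)}"
    have Ug [measurable]: "U g \<in> borel_measurable lebesgue" by (rule U_measurable[OF bbs_Lpq[OF g]])
    have Egm: "Eg \<in> sets lebesgue"
    proof -
      have "{x \<in> space lebesgue. norm (U g x) > (\<Prod>j\<in>UNIV. lam j)} \<in> sets lebesgue" by measurable
      thus ?thesis by (simp add: Eg_def)
    qed
    have Eg: "emeasure lebesgue Eg \<le> ennreal (c1 * V)"
      unfolding Eg_def c1_def by (rule good_part[OF g gB _ gV lam V]) simp
    have "\<forall>j. \<exists>W. W \<in> sets borel \<and> emeasure lborel W \<le> ennreal (\<omega> * V) \<and>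
      (\<forall>x s. x \<notin> W \<longrightarrow> s > 0 \<longrightarrow> (\<integral>\<^sup>+y\<in>cball x s. ennreal (norm (f j y)) \<partial>lborel) \<le> ennreal (lam j * s ^ CARD('n)))"
    proof
      fix j
      show "\<exists>W. W \<in> sets borel \<and> emeasure lborel W \<le> ennreal (\<omega> * V) \<and>
        (\<forall>x s. x \<notin> W \<longrightarrow> s > 0 \<longrightarrow> (\<integral>\<^sup>+y\<in>cball x s. ennreal (norm (f j y)) \<partial>lborel) \<le> ennreal (lam j * s ^ CARD('n)))"
        using maximal_exceptional_set[OF f fV[of j] lam V zero_less_one] unfolding \<omega>_def div_by_1 mult_1 .
    qed
    from choice[OF this] obtain Wf where Wf: "\<And>j. Wf j \<in> sets borel" "\<And>j. emeasure lborel (Wf j) \<le> ennreal (\<omega> * V)"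
      "\<And>j x s. x \<notin> Wf j \<Longrightarrow> s > 0 \<Longrightarrow> (\<integral>\<^sup>+y\<in>cball x s. ennreal (norm (f j y)) \<partial>lborel) \<le> ennreal (lam j * s ^ CARD('n))"
      by blast
    have gV': "(LINT x|lborel. norm (g j x)) \<le> lam j * (2 * V)" for j using gV[of j] by (simp add: mult_ac)
    have V2: "2 * V > 0" using V by simp
    have "\<forall>j. \<exists>W. W \<in> sets borel \<and> emeasure lborel W \<le> ennreal (\<omega> * (2 * V)) \<and>
      (\<forall>x s. x \<notin> W \<longrightarrow> s > 0 \<longrightarrow> (\<integral>\<^sup>+y\<in>cball x s. ennreal (norm (g j y)) \<partial>lborel) \<le> ennreal (lam j * s ^ CARD('n)))"
    proof
      fix j
      show "\<exists>W. W \<in> sets borel \<and> emeasure lborel W \<le> ennreal (\<omega> * (2 * V)) \<and>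
        (\<forall>x s. x \<notin> W \<longrightarrow> s > 0 \<longrightarrow> (\<integral>\<^sup>+y\<in>cball x s. ennreal (norm (g j y)) \<partial>lborel) \<le> ennreal (lam j * s ^ CARD('n)))"
        using maximal_exceptional_set[OF g gV'[of j] lam V2 zero_less_one] unfolding \<omega>_def div_by_1 mult_1 .
    qed
    from choice[OF this] obtain Wg where Wg: "\<And>j. Wg j \<in> sets borel" "\<And>j. emeasure lborel (Wg j) \<le> ennreal (\<omega> * (2 * V))"
      "\<And>j x s. x \<notin> Wg j \<Longrightarrow> s > 0 \<Longrightarrow> (\<integral>\<^sup>+y\<in>cball x s. ennreal (norm (g j y)) \<partial>lborel) \<le> ennreal (lam j * s ^ CARD('n))"
      by blast
    define W where "W = (\<Union>j. Wf j) \<union> (\<Union>j. Wg j)"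
    have "\<exists>H. (\<forall>j. H j j = (\<lambda>x. f j x - g j x)) \<and> (\<forall>j i. i \<noteq> j \<longrightarrow> H j i = f i \<or> H j i = g i) \<and>
      (AE x in lborel. U f x - U g x = (\<Sum>j\<in>UNIV. U (H j) x))"
      by (intro U_telescope bbs_Lpq f g bbs_diff)
    then obtain H where H: "\<And>j. H j j = (\<lambda>x. f j x - g j x)" "\<And>j i. i \<noteq> j \<Longrightarrow> H j i = f i \<or> H j i = g i"
      "AE x in lborel. U f x - U g x = (\<Sum>j\<in>UNIV. U (H j) x)" by blast
    have Hb: "bbs (H j i)" for j i
      using H(1)[of j] H(2)[of i j] f g bbs_diff[OF f g] by (cases "i = j") auto
    have "\<forall>j. \<exists>E. E \<in> sets borel \<and> emeasure lborel E \<le> ennreal (c2 * V) \<and>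
       (AE x in lborel. x \<notin> W \<and> x \<notin> E \<longrightarrow> norm (U (H j) x) \<le> bad_out * (\<Prod>i\<in>UNIV. lam i))"
    proof
      fix j
      obtain S :: "(real^'n) set set" and c L b where S0: "finite S \<and> (\<forall>P. bbs (b P)) \<and> (\<forall>P\<in>S. L P > 0) \<and> (\<forall>P\<in>S. \<forall>y. b P y \<noteq> 0 \<longrightarrow> norm (y - c P) \<le> L P) \<and>
        (\<forall>P\<in>S. (LINT x|lborel. b P x) = 0) \<and> (\<Sum>P\<in>S. LINT x|lborel. norm (b P x)) \<le> 2 * lam j * V \<and>
        (\<Sum>P\<in>S. L P ^ CARD('n)) \<le> real CARD('n) ^ CARD('n) * V \<and> (\<forall>x. f j x = g j x + (\<Sum>P\<in>S. b P x))"
        using conjunct2[OF spec[OF g', of j]] by (elim exE) (rule that)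
      have S: "finite S" "\<And>P. bbs (b P)" "\<And>P. P \<in> S \<Longrightarrow> L P > 0"
        "\<And>P y. P \<in> S \<Longrightarrow> b P y \<noteq> 0 \<Longrightarrow> norm (y - c P) \<le> L P" "\<And>P. P \<in> S \<Longrightarrow> (LINT x|lborel. b P x) = 0"
        "(\<Sum>P\<in>S. LINT x|lborel. norm (b P x)) \<le> 2 * lam j * V"
        "(\<Sum>P\<in>S. L P ^ CARD('n)) \<le> real CARD('n) ^ CARD('n) * V" "\<And>x. f j x = g j x + (\<Sum>P\<in>S. b P x)"
        using S0 by (blast, blast, blast, blast, blast, blast, blast, blast)
      have eq: "(H j)(j := \<lambda>x. \<Sum>P\<in>S. b P x) = H j"
        using H(1)[of j] S(8) by (auto simp: fun_eq_iff)
      show "\<exists>E. E \<in> sets borel \<and> emeasure lborel E \<le> ennreal (c2 * V) \<and>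
       (AE x in lborel. x \<notin> W \<and> x \<notin> E \<longrightarrow> norm (U (H j) x) \<le> bad_out * (\<Prod>i\<in>UNIV. lam i))"
      proof (rule bad_part[where S = S and b = b and L = L and c = c and j = j and V = V and N = "real CARD('n) ^ CARD('n)" and h = "H j" and lam = lam and W = W, OF S(1-7) _ Hb lam V])
        show "(\<integral>\<^sup>+y\<in>cball x s. ennreal (norm (H j i y)) \<partial>lborel) \<le> ennreal (lam i * s ^ CARD('n))"
          if "x \<notin> W" "i \<noteq> j" "s > 0" for x i s
          using H(2)[OF that(2)] Wf(3)[of x i s] Wg(3)[of x i s] that by (auto simp: W_def)
        fix E assume "E \<in> sets borel" "emeasure lborel E \<le> ennreal ((ball_vol * 4 ^ CARD('n) * real CARD('n) ^ CARD('n) + 2 * tail1) * V)"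
          "AE x in lborel. x \<notin> W \<and> x \<notin> E \<longrightarrow> norm (U ((H j)(j := \<lambda>x. \<Sum>P\<in>S. b P x)) x) \<le> bad_out * (\<Prod>i\<in>UNIV. lam i)"
        thus "\<exists>E. E \<in> sets borel \<and> emeasure lborel E \<le> ennreal (c2 * V) \<and>
       (AE x in lborel. x \<notin> W \<and> x \<notin> E \<longrightarrow> norm (U (H j) x) \<le> bad_out * (\<Prod>i\<in>UNIV. lam i))"
          unfolding eq c2_def[symmetric] by (intro exI[of _ E] conjI)
      qed (assumption | intro zero_le_power of_nat_0_le_iff)+
    qed
    from choice[OF this] obtain E where E: "\<And>j. E j \<in> sets borel" "\<And>j. emeasure lborel (E j) \<le> ennreal (c2 * V)"
       "\<And>j. AE x in lborel. x \<notin> W \<and> x \<notin> E j \<longrightarrow> norm (U (H j) x) \<le> bad_out * (\<Prod>i\<in>UNIV. lam i)" by blast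
    define Lm where "Lm = (\<Prod>i\<in>UNIV. lam i)"
    have Lm: "Lm > 0" unfolding Lm_def using lam by (intro prod_pos) auto
    define Z where "Z = Eg \<union> (((\<Union>j. Wf j) \<union> (\<Union>j. Wg j)) \<union> (\<Union>j. E j))"
    have bor: "(\<Union>j. Wf j) \<in> sets borel" "(\<Union>j. Wg j) \<in> sets borel" "(\<Union>j. E j) \<in> sets borel"
      by (intro sets.finite_UN finite Wf(1) Wg(1) E(1))+
    hence bor': "((\<Union>j. Wf j) \<union> (\<Union>j. Wg j)) \<union> (\<Union>j. E j) \<in> sets borel" by (intro sets.Un)
    have Zm: "Z \<in> sets lebesgue" unfolding Z_def by (intro sets.Un[OF Egm] sets_completionI_sets) (use bor' in simp)
    have Z: "emeasure lebesgue Z \<le> ennreal (C * V)"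
    proof -
      have "emeasure lebesgue Z \<le> emeasure lebesgue Eg + emeasure lebesgue (((\<Union>j. Wf j) \<union> (\<Union>j. Wg j)) \<union> (\<Union>j. E j))"
        unfolding Z_def by (intro emeasure_subadditive Egm sets_completionI_sets) (use bor' in simp)
      also have "\<dots> \<le> ennreal (c1 * V) + (ennreal (real CARD('m) * \<omega> * V) + ennreal (real CARD('m) * (\<omega> * 2) * V) + ennreal (real CARD('m) * c2 * V))"
      proof (intro add_mono Eg)
        have "emeasure lborel (((\<Union>j. Wf j) \<union> (\<Union>j. Wg j)) \<union> (\<Union>j. E j)) \<le> emeasure lborel ((\<Union>j. Wf j) \<union> (\<Union>j. Wg j)) + emeasure lborel (\<Union>j. E j)"
          by (rule emeasure_subadditive) (use bor in simp_all)
        also have "\<dots> \<le> (emeasure lborel (\<Union>j. Wf j) + emeasure lborel (\<Union>j. Wg j)) + emeasure lborel (\<Union>j. E j)"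
          by (rule add_right_mono, rule emeasure_subadditive) (use bor in simp_all)
        also have "\<dots> \<le> (ennreal (real CARD('m) * \<omega> * V) + ennreal (real CARD('m) * (\<omega> * 2) * V)) + ennreal (real CARD('m) * c2 * V)"
        proof (intro add_mono)
          show "emeasure lborel (\<Union>j. Wf j) \<le> ennreal (real CARD('m) * \<omega> * V)"
            by (rule emeasure_UN_index_le[OF Wf(1,2) \<omega> V])
          have "emeasure lborel (Wg j) \<le> ennreal ((\<omega> * 2) * V)" for j using Wg(2)[of j] by (simp add: mult.assoc)
          thus "emeasure lborel (\<Union>j. Wg j) \<le> ennreal (real CARD('m) * (\<omega> * 2) * V)"
            using \<omega> by (intro emeasure_UN_index_le Wg(1) V) auto
          show "emeasure lborel (\<Union>j. E j) \<le> ennreal (real CARD('m) * c2 * V)"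
            by (rule emeasure_UN_index_le[OF E(1,2) c2 V])
        qed
        finally show "emeasure lebesgue (((\<Union>j. Wf j) \<union> (\<Union>j. Wg j)) \<union> (\<Union>j. E j)) \<le> ennreal (real CARD('m) * \<omega> * V) + ennreal (real CARD('m) * (\<omega> * 2) * V) + ennreal (real CARD('m) * c2 * V)"
          by (subst emeasure_lebesgue_borel[OF bor'])
      qed
      also have "\<dots> = ennreal ((c1 + (real CARD('m) * \<omega> + real CARD('m) * (\<omega> * 2) + real CARD('m) * c2)) * V)"
        using c1 c2 \<omega> V by (simp add: ennreal_plus[symmetric] distrib_right del: arity_eq ennreal_plus)
      also have "\<dots> \<le> ennreal (C * V)" using C2 V by (intro ennreal_leI mult_right_mono) auto
      finally show ?thesis .
    qed
    have "AE x in lborel. \<forall>j\<in>UNIV. x \<notin> W \<and> x \<notin> E j \<longrightarrow> norm (U (H j) x) \<le> bad_out * Lm"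
      using E(3) unfolding Lm_def by (intro AE_finite_allI) auto
    with H(3) have "AE x in lborel. norm (U f x) > C * Lm \<longrightarrow> x \<in> Z"
    proof eventually_elim
      case (elim x)
      show ?case
      proof (rule impI, rule ccontr)
        assume big: "norm (U f x) > C * Lm" and "x \<notin> Z"
        hence x: "norm (U g x) \<le> Lm" "x \<notin> W" "\<And>j. x \<notin> E j" by (auto simp: Z_def Eg_def Lm_def W_def)
        have "norm (\<Sum>j\<in>UNIV. U (H j) x) \<le> (\<Sum>j\<in>(UNIV::'m set). bad_out * Lm)"
          using elim(2) x by (intro sum_norm_le) auto
        hence "norm (U f x - U g x) \<le> real CARD('m) * (bad_out * Lm)" using elim(1) by simp
        hence "norm (U f x) \<le> Lm + real CARD('m) * (bad_out * Lm)"
          using x(1) norm_triangle_sub[of "U f x" "U g x"] by linarith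
        also have "\<dots> = (1 + real CARD('m) * bad_out) * Lm" by (simp add: algebra_simps)
        also have "\<dots> \<le> C * Lm" using C1 Lm by (intro mult_right_mono) auto
        finally show False using big by simp
      qed
    qed
    hence "emeasure lebesgue {x. norm (U f x) > C * Lm} \<le> emeasure lebesgue Z"
      unfolding AE_completion_iff[symmetric, where M = lborel] by (intro emeasure_mono_AE Zm) auto
    with Z show ?thesis unfolding Lm_def by (rule order_trans[rotated])
  qed
  ultimately show ?thesis by (intro exI[of _ C]) auto
qed

text \<open>
  Continuity of the entries is removed by approximation. The doubled value of \<open>V\<close> leaves room for the \<open>L\<^sup>1\<close> norms
  of the approximants.
\<close>

lemma weak_type:
  shows "\<exists>C>0. \<forall>(f :: 'm \<Rightarrow> real^'n \<Rightarrow> complex) lam V. (\<forall>j. bbs (f j)) \<longrightarrow> (\<forall>j. lam j > 0) \<longrightarrow> V > 0 \<longrightarrow>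
      (\<forall>j. (LINT x|lborel. norm (f j x)) \<le> lam j * V) \<longrightarrow>
      emeasure lebesgue {x. norm (U f x) > C * (\<Prod>j\<in>UNIV. lam j)} \<le> ennreal (C * V)"
proof -
  obtain C where C: "C > 0" "\<And>(f :: 'm \<Rightarrow> real^'n \<Rightarrow> complex) lam V. (\<And>j. bbs (f j)) \<Longrightarrow> (\<And>j. continuous_on UNIV (f j)) \<Longrightarrow> (\<And>j. lam j > 0) \<Longrightarrow> V > 0 \<Longrightarrow>
      (\<And>j. (LINT x|lborel. norm (f j x)) \<le> lam j * V) \<Longrightarrow>
      emeasure lebesgue {x. norm (U f x) > C * (\<Prod>j\<in>UNIV. lam j)} \<le> ennreal (C * V)"
    using weak_type_continuous by blast
  have main: "emeasure lebesgue {x. norm (U f x) > C * (\<Prod>j\<in>UNIV. lam j)} \<le> ennreal (C * (2 * V))"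
    if f: "\<And>j. bbs (f j)" and lam: "\<And>j. lam j > 0" and V: "V > 0"
      and fV: "\<And>j. (LINT x|lborel. norm (f j x)) \<le> lam j * V" for f :: "'m \<Rightarrow> real^'n \<Rightarrow> complex" and lam V
  proof -
    have empty: "f undefined x = 0" if "x \<in> box 0 (0::real^'n)" for x using that by (auto simp: mem_box)
    obtain F M a where FS: "\<And>k j. F k j \<in> schwartz_space" and FM: "\<And>k j x. norm (F k j x) \<le> M j + 1"
      and Fsupp: "\<And>k j x. x \<notin> cbox (- a j) (a j) \<Longrightarrow> F k j x = 0"
      and Fconv: "\<And>j. AE x in lborel. (\<lambda>k::nat. F k j x) \<longlonglongrightarrow> f j x"
    proof (rule schwartz_approximation_tuple[of f 0 0 undefined, OF f empty])
      fix F M a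
      assume h: "\<And>k j. F k j \<in> schwartz_space" "\<And>k j x. norm (F k j x) \<le> M j + 1"
        "\<And>k j x. x \<notin> cbox (- a j) (a j) \<Longrightarrow> F k j x = 0"
        "\<And>j. AE x in lborel. (\<lambda>k::nat. F k j x) \<longlonglongrightarrow> f j x"
      show thesis by (rule that[of F M a]) (fact h)+
    qed
    have Fb: "bbs (F k j)" for k j by (rule bbsI[OF schwartz_borel[OF FS] FM Fsupp])
    have Fc: "continuous_on UNIV (F k j)" for k j by (rule schwartz_continuous[OF FS])
    have [measurable]: "F k j \<in> borel_measurable borel" "f j \<in> borel_measurable borel" for k j
      using bbsD(1)[OF Fb] bbsD(1)[OF f] by auto
    obtain s where s: "strict_mono s" "AE x in lborel. (\<lambda>k. U (F (s k)) x) \<longlonglongrightarrow> U f x"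
      by (rule U_convergence[OF Fb f FM Fsupp Fconv])
    have "\<forall>\<^sub>F k in sequentially. (LINT x|lborel. norm (F k j x)) \<le> lam j * (2 * V)" for j
    proof -
      have "(\<lambda>k. LINT x|lborel. norm (F k j x)) \<longlonglongrightarrow> (LINT x|lborel. norm (f j x))"
      proof (rule integral_dominated_convergence[where w = "\<lambda>x. (M j + 1) * indicator (cbox (- a j) (a j)) x"])
        show "AE x in lborel. (\<lambda>k. norm (F k j x)) \<longlonglongrightarrow> norm (f j x)"
          using Fconv[of j] by eventually_elim (rule tendsto_norm)
        show "AE x in lborel. norm (norm (F k j x)) \<le> (M j + 1) * indicator (cbox (- a j) (a j)) x" for k
        proof (intro always_eventually allI)
          fix x show "norm (norm (F k j x)) \<le> (M j + 1) * indicator (cbox (- a j) (a j)) x"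
            using FM[of k j x] Fsupp[of x j k] by (cases "x \<in> cbox (- a j) (a j)") auto
        qed
      qed (auto intro!: integrable_mult_right integrable_real_indicator simp: emeasure_lborel_cbox_eq)
      moreover have "(LINT x|lborel. norm (f j x)) < lam j * (2 * V)"
        using fV[of j] mult_pos_pos[OF lam[of j] V] by linarith
      ultimately have "\<forall>\<^sub>F k in sequentially. (LINT x|lborel. norm (F k j x)) < lam j * (2 * V)"
        by (rule order_tendstoD(2))
      thus ?thesis by eventually_elim simp
    qed
    hence "\<forall>\<^sub>F k in sequentially. \<forall>j. (LINT x|lborel. norm (F k j x)) \<le> lam j * (2 * V)"
      by (rule eventually_all_finite)
    hence "\<forall>\<^sub>F k in sequentially. \<forall>j. (LINT x|lborel. norm (F (s k) j x)) \<le> lam j * (2 * V)"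
      by (rule eventually_subseq[OF s(1)])
    then obtain k0 where k0: "\<And>k j. k \<ge> k0 \<Longrightarrow> (LINT x|lborel. norm (F (s k) j x)) \<le> lam j * (2 * V)"
      unfolding eventually_sequentially by blast
    define t where "t = C * (\<Prod>j\<in>UNIV. lam j)"
    define B where "B = (\<lambda>k. {x. norm (U (F (s k)) x) > t})"
    have UFm [measurable]: "U (F (s k)) \<in> borel_measurable lebesgue" for k
      by (rule U_measurable[OF bbs_Lpq[OF Fb]])
    have Bm: "B k \<in> sets lebesgue" for k
    proof -
      have "{x \<in> space lebesgue. norm (U (F (s k)) x) > t} \<in> sets lebesgue" by measurable
      thus ?thesis by (simp add: B_def)
    qed
    have BV: "emeasure lebesgue (B k) \<le> ennreal (C * (2 * V))" if "k \<ge> k0" for k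
      unfolding B_def t_def by (rule C(2)[OF Fb Fc lam _ k0[OF that]]) (use V in simp)
    define I where "I = (\<lambda>N. \<Inter>k\<in>{N + k0..}. B k)"
    have Im: "I N \<in> sets lebesgue" for N unfolding I_def by (intro sets.countable_INT'') (auto intro: Bm)
    have "incseq I" unfolding I_def incseq_def by fastforce
    have "emeasure lebesgue (\<Union>N. I N) = (SUP N. emeasure lebesgue (I N))"
      using Im \<open>incseq I\<close> by (intro SUP_emeasure_incseq[symmetric]) auto
    also have "\<dots> \<le> ennreal (C * (2 * V))"
    proof (rule SUP_least)
      fix N
      have "emeasure lebesgue (I N) \<le> emeasure lebesgue (B (N + k0))" by (intro emeasure_mono Bm) (auto simp: I_def)
      also have "\<dots> \<le> ennreal (C * (2 * V))" by (rule BV) simp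
      finally show "emeasure lebesgue (I N) \<le> ennreal (C * (2 * V))" .
    qed
    finally have UI: "emeasure lebesgue (\<Union>N. I N) \<le> ennreal (C * (2 * V))" .
    have "AE x in lebesgue. norm (U f x) > t \<longrightarrow> x \<in> (\<Union>N. I N)"
      unfolding AE_completion_iff using s(2)
    proof eventually_elim
      case (elim x)
      show ?case
      proof
        assume "t < norm (U f x)"
        from order_tendstoD(1)[OF tendsto_norm[OF elim] this]
        obtain N where N: "\<And>k. k \<ge> N \<Longrightarrow> t < norm (U (F (s k)) x)" unfolding eventually_sequentially by blast
        hence "x \<in> I N" by (auto simp: I_def B_def)
        thus "x \<in> (\<Union>N. I N)" by blast
      qed
    qed
    hence "emeasure lebesgue {x. norm (U f x) > t} \<le> emeasure lebesgue (\<Union>N. I N)"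
      using Im by (intro emeasure_mono_AE) auto
    with UI show ?thesis unfolding t_def by (rule order_trans[rotated])
  qed
  have "emeasure lebesgue {x. norm (U f x) > 2 * C * (\<Prod>j\<in>UNIV. lam j)} \<le> ennreal (2 * C * V)"
    if f: "\<And>j. bbs (f j)" and lam: "\<And>j. lam j > 0" and V: "V > 0"
      and fV: "\<And>j. (LINT x|lborel. norm (f j x)) \<le> lam j * V" for f :: "'m \<Rightarrow> real^'n \<Rightarrow> complex" and lam V
  proof -
    have p: "(\<Prod>j\<in>UNIV. lam j) > 0" using lam by (intro prod_pos) auto
    have m: "{x. norm (U f x) > C * (\<Prod>j\<in>UNIV. lam j)} \<in> sets lebesgue"
    proof -
      have [measurable]: "U f \<in> borel_measurable lebesgue" by (rule U_measurable[OF bbs_Lpq[OF f]])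
      have "{x \<in> space lebesgue. norm (U f x) > C * (\<Prod>j\<in>UNIV. lam j)} \<in> sets lebesgue" by measurable
      thus ?thesis by simp
    qed
    have "emeasure lebesgue {x. norm (U f x) > 2 * C * (\<Prod>j\<in>UNIV. lam j)} \<le> emeasure lebesgue {x. norm (U f x) > C * (\<Prod>j\<in>UNIV. lam j)}"
    proof (rule emeasure_mono[OF _ m], clarify)
      fix x assume "2 * C * (\<Prod>j\<in>UNIV. lam j) < norm (U f x)"
      thus "C * (\<Prod>j\<in>UNIV. lam j) < norm (U f x)" using mult_pos_pos[OF C(1) p] by linarith
    qed
    also have "\<dots> \<le> ennreal (2 * C * V)" using main[OF f lam V fV] by (simp add: mult_ac)
    finally show ?thesis .
  qed
  thus ?thesis using C(1) by (intro exI[of _ "2 * C"]) auto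
qed

text \<open>
  Raising the heights \<open>lam j\<close> by a common factor lowers \<open>V\<close> by the same factor, which makes the exceptional set as small
  as desired.
\<close>

lemma weak_type_small_set:
  assumes \<theta>: "\<theta> > 0"
  shows "\<exists>C>0. \<forall>(f :: 'm \<Rightarrow> real^'n \<Rightarrow> complex) lam V. (\<forall>j. bbs (f j)) \<longrightarrow> (\<forall>j. lam j \<ge> 0) \<longrightarrow> V > 0 \<longrightarrow>
      (\<forall>j. (LINT x|lborel. norm (f j x)) \<le> lam j * V) \<longrightarrow>
      emeasure lebesgue {x. norm (U f x) > C * (\<Prod>j\<in>UNIV. lam j)} \<le> ennreal (\<theta> * V)"
proof -
  obtain C where C: "C > 0" "\<And>(f :: 'm \<Rightarrow> real^'n \<Rightarrow> complex) lam V. (\<And>j. bbs (f j)) \<Longrightarrow> (\<And>j. lam j > 0) \<Longrightarrow> V > 0 \<Longrightarrow>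
      (\<And>j. (LINT x|lborel. norm (f j x)) \<le> lam j * V) \<Longrightarrow>
      emeasure lebesgue {x. norm (U f x) > C * (\<Prod>j\<in>UNIV. lam j)} \<le> ennreal (C * V)"
    using weak_type by blast
  define s where "s = C / \<theta>"
  have s: "s > 0" using C(1) \<theta> by (simp add: s_def)
  have "emeasure lebesgue {x. norm (U f x) > C * s ^ CARD('m) * (\<Prod>j\<in>UNIV. lam j)} \<le> ennreal (\<theta> * V)"
    if f: "\<And>j. bbs (f j)" and lam: "\<And>j. lam j \<ge> 0" and V: "V > 0"
      and fV: "\<And>j. (LINT x|lborel. norm (f j x)) \<le> lam j * V" for f :: "'m \<Rightarrow> real^'n \<Rightarrow> complex" and lam V
  proof (cases "\<forall>j. lam j > 0")
    case True
    have "emeasure lebesgue {x. norm (U f x) > C * (\<Prod>j\<in>UNIV. lam j * s)} \<le> ennreal (C * (V / s))"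
      by (rule C(2)[OF f]) (use True s V fV in auto)
    also have "C * (V / s) = \<theta> * V" using C(1) \<theta> by (simp add: s_def)
    finally show ?thesis by (simp add: prod.distrib mult_ac)
  next
    case False
    then obtain j where j: "lam j = 0" using lam by (metis less_le)
    hence "(LINT x|lborel. norm (f j x)) = 0"
    proof -
      have nn: "0 \<le> (LINT x|lborel. norm (f j x))" by (intro Bochner_Integration.integral_nonneg) auto
      have "(LINT x|lborel. norm (f j x)) \<le> 0" using fV[of j] j by simp
      thus ?thesis using nn by (rule antisym)
    qed
    hence "AE x in lborel. norm (f j x) = 0"
      using integral_nonneg_eq_0_iff_AE[OF integrable_norm[OF bbs_integrable[OF f[of j]]]] by simp
    hence "AE x in lborel. f j x = 0" by eventually_elim simp
    from U_zero[of f, OF bbs_Lpq[OF f] this] have z: "AE x in lborel. U f x = 0" .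
    have p0: "(\<Prod>j\<in>UNIV. lam j) = 0" using j by (intro prod_zero) auto
    have "AE x in lebesgue. x \<in> {x. norm (U f x) > C * s ^ CARD('m) * (\<Prod>j\<in>UNIV. lam j)} \<longrightarrow> x \<in> {}"
      unfolding AE_completion_iff p0 using z by eventually_elim simp
    hence "emeasure lebesgue {x. norm (U f x) > C * s ^ CARD('m) * (\<Prod>j\<in>UNIV. lam j)} \<le> emeasure lebesgue ({} :: (real^'n) set)"
      by (rule emeasure_mono_AE) simp
    thus ?thesis by simp
  qed
  thus ?thesis using C(1) s by (intro exI[of _ "C * s ^ CARD('m)"]) auto
qed

end

section \<open>One step of the local domination\<close>

lemma maximal_exceptional_set_small:
  fixes h :: "real^'n::finite \<Rightarrow> complex"
  assumes h: "bbs h" and hV: "(LINT x|lborel. norm (h x)) \<le> lam * V" and lam: "lam \<ge> 0" and V: "V > 0"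
    and \<theta>: "\<theta> > 0"
  shows "\<exists>W. W \<in> sets borel \<and> emeasure lborel W \<le> ennreal (\<theta> * V) \<and>
    (\<forall>x s. x \<notin> W \<longrightarrow> s > 0 \<longrightarrow> (\<integral>\<^sup>+y\<in>cball x s. ennreal (norm (h y)) \<partial>lborel) \<le>
      ennreal ((unit_ball_vol (real CARD('n)) * 5 ^ CARD('n) + 1) / \<theta> * lam * s ^ CARD('n)))"
proof (cases "lam = 0")
  case True
  have [measurable]: "h \<in> borel_measurable borel" by (rule bbsD(1)[OF h])
  have nn: "0 \<le> (LINT x|lborel. norm (h x))" by (intro Bochner_Integration.integral_nonneg) auto
  have "(LINT x|lborel. norm (h x)) \<le> 0" using hV True by simp
  hence "(LINT x|lborel. norm (h x)) = 0" using nn by (rule antisym)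
  hence "(\<integral>\<^sup>+x. ennreal (norm (h x)) \<partial>lborel) = 0" using bbs_nn_integral[OF h] by simp
  hence "(\<integral>\<^sup>+y\<in>cball x s. ennreal (norm (h y)) \<partial>lborel) \<le> 0" for x s
  proof -
    have "(\<integral>\<^sup>+y\<in>cball x s. ennreal (norm (h y)) \<partial>lborel) \<le> (\<integral>\<^sup>+x. ennreal (norm (h x)) \<partial>lborel)"
      by (intro nn_integral_mono) (auto simp: indicator_def)
    thus ?thesis using \<open>(\<integral>\<^sup>+x. ennreal (norm (h x)) \<partial>lborel) = 0\<close> by simp
  qed
  thus ?thesis using True by (intro exI[of _ "{}"]) auto
next
  case False
  define w where "w = unit_ball_vol (real CARD('n)) * 5 ^ CARD('n)"
  have w: "w \<ge> 0" by (simp add: w_def unit_ball_vol_nonneg)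
  have \<mu>: "(w + 1) / \<theta> > 0" using w \<theta> by simp
  have "lam > 0" using False lam by simp
  from maximal_exceptional_set[OF h hV this V \<mu>] obtain W where W: "W \<in> sets borel" "emeasure lborel W \<le> ennreal (w / ((w + 1) / \<theta>) * V)"
    "\<forall>x s. x \<notin> W \<longrightarrow> s > 0 \<longrightarrow> (\<integral>\<^sup>+y\<in>cball x s. ennreal (norm (h y)) \<partial>lborel) \<le> ennreal ((w + 1) / \<theta> * lam * s ^ CARD('n))"
    unfolding w_def by blast
  have "w / ((w + 1) / \<theta>) = \<theta> * (w / (w + 1))" by simp
  also have "\<dots> \<le> \<theta> * 1" using w \<theta> by (intro mult_left_mono) auto
  finally have "w / ((w + 1) / \<theta>) * V \<le> \<theta> * V" using V by (intro mult_right_mono) auto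
  hence "emeasure lborel W \<le> ennreal (\<theta> * V)" using W(2) by (meson ennreal_leI order_trans)
  thus ?thesis using W(1,3) unfolding w_def by blast
qed

text \<open>
  The dilate is open, and points of \<open>Q\<close> have distance at least \<open>2 n 2\<^sup>k\<close> from its complement. For a cube \<open>Q\<close> of
  side \<open>2\<^sup>k\<close> this is twice the bound \<open>n 2\<^sup>k\<close> for the diameter, as \<open>kernel_oscillation\<close> demands.
\<close>

definition star :: "int \<Rightarrow> (real^'n::finite) set \<Rightarrow> (real^'n) set" where
  "star k Q = {y. \<exists>z\<in>Q. \<forall>i. \<bar>y $ i - z $ i\<bar> < 2 * real CARD('n) * 2 powi k}"

lemma star_open: "open (star k (Q :: (real^'n::finite) set))"
proof -
  have "star k Q = (\<Union>z\<in>Q. \<Inter>i\<in>UNIV. {y. \<bar>y $ i - z $ i\<bar> < 2 * real CARD('n) * 2 powi k})"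
    by (auto simp: star_def)
  also have "open \<dots>" by (intro open_UN ballI open_INT open_Collect_less continuous_intros) auto
  finally show ?thesis .
qed

lemma star_superset: "Q \<subseteq> star k (Q :: (real^'n::finite) set)"
proof
  fix x assume "x \<in> Q"
  moreover have "0 < 2 * real CARD('n) * 2 powi k" by simp
  ultimately show "x \<in> star k Q" unfolding star_def by (auto intro!: bexI[of _ x])
qed

lemma star_mono:
  fixes P :: "(real^'n::finite) set"
  assumes "l \<le> k" "P \<subseteq> Q" shows "star l P \<subseteq> star k Q"
proof
  fix y assume "y \<in> star l P"
  then obtain z where z: "z \<in> P" "\<And>i. \<bar>y $ i - z $ i\<bar> < 2 * real CARD('n) * 2 powi l" by (auto simp: star_def)
  have "2 * real CARD('n) * 2 powi l \<le> 2 * real CARD('n) * 2 powi k"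
    using assms(1) by (intro mult_left_mono power_int_increasing) auto
  hence "\<bar>y $ i - z $ i\<bar> < 2 * real CARD('n) * 2 powi k" for i using z(2)[of i] by linarith
  thus "y \<in> star k Q" using z(1) assms(2) by (auto simp: star_def)
qed

lemma star_far:
  fixes P :: "(real^'n::finite) set"
  assumes "x \<in> P" "y \<notin> star l P" shows "2 * (real CARD('n) * 2 powi l) \<le> norm (x - y)"
proof -
  obtain i where "\<not> \<bar>y $ i - x $ i\<bar> < 2 * real CARD('n) * 2 powi l" using assms by (auto simp: star_def)
  moreover have "\<bar>(x - y) $ i\<bar> \<le> norm (x - y)" by (rule component_le_norm_cart)
  ultimately show ?thesis by (simp add: abs_minus_commute)
qed

definition localize :: "('m \<Rightarrow> real^'n::finite \<Rightarrow> complex) \<Rightarrow> (real^'n) set \<Rightarrow> 'm \<Rightarrow> real^'n \<Rightarrow> complex" where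
  "localize f R j y = f j y * indicator R y"

text \<open>
  The integrals over the dilate are divided by the measure of the cube itself, so each factor is the mean over the
  dilate up to a dimensional constant.
\<close>

definition star_mean :: "('m::finite \<Rightarrow> real^'n::finite \<Rightarrow> complex) \<Rightarrow> int \<times> (real^'n) set \<Rightarrow> real" where
  "star_mean f = (\<lambda>(k, Q). \<Prod>j\<in>UNIV. (LINT y|lborel. norm (f j y) * indicator (star k Q) y) / (2 powi k) ^ CARD('n))"

lemma star_mean_nonneg: "star_mean f (k, Q) \<ge> 0"
  unfolding star_mean_def by (auto intro!: prod_nonneg divide_nonneg_nonneg Bochner_Integration.integral_nonneg)

context CZ_operator
begin

text \<open>
  The exceptional set \<open>E\<close> collects the points where \<open>U (f 1\<^sub>Q\<^sub>*)\<close> or one of the maximal functions is large, and \<open>G\<close> is an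
  open superset. By stopping at density above \<open>2\<^sup>-\<^sup>n\<^sup>-\<^sup>1\<close> the cubes \<open>P\<close> cover \<open>G \<inter> Q\<close>, since \<open>G\<close> is open,
  their total measure is at most \<open>2\<^sup>n\<^sup>+\<^sup>1 \<bar>G\<bar>\<close>, and \<open>G\<close> fills at most half of each \<open>P\<close> by maximality. The other half
  supplies the reference point \<open>x'\<close>, at which \<open>U (f 1\<^sub>Q\<^sub>*)\<close> and \<open>U (f 1\<^sub>P\<^sub>*)\<close> are both under control.
\<close>

lemma local_step:
  "\<exists>C>0. \<forall>(f :: 'm \<Rightarrow> real^'n \<Rightarrow> complex) s k x. (\<forall>j. bbs (f j)) \<longrightarrow>
    (\<exists>\<P>. countable \<P> \<and> (\<forall>(l, P)\<in>\<P>. l < k \<and> (\<exists>z. P = dcube s l z) \<and> P \<subseteq> dcube s k x) \<and>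
      (\<forall>p\<in>\<P>. \<forall>p'\<in>\<P>. snd p \<inter> snd p' \<noteq> {} \<longrightarrow> p = p') \<and>
      emeasure lborel (\<Union>p\<in>\<P>. snd p) \<le> ennreal (1/2 * (2 powi k) ^ CARD('n)) \<and>
      (AE y in lborel. y \<in> dcube s k x \<longrightarrow>
        ((\<forall>p\<in>\<P>. y \<notin> snd p) \<longrightarrow> norm (U (localize f (star k (dcube s k x))) y) \<le> C * star_mean f (k, dcube s k x)) \<and>
        (\<forall>(l, P)\<in>\<P>. y \<in> P \<longrightarrow> norm (U (localize f (star k (dcube s k x))) y)
            \<le> norm (U (localize f (star l P)) y) + C * star_mean f (k, dcube s k x) + C * star_mean f (l, P))))"
proof -
  define n where "n = CARD('n)"
  \<comment> \<open>One share of measure for \<open>U\<close>, one for each maximal function and one for passing to an open set.\<close>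
  define \<theta> where "\<theta> = (1/2) ^ (n + 2) / (real CARD('m) + 2)"
  have \<theta>: "\<theta> > 0" unfolding \<theta>_def by (simp del: arity_eq add: add_pos_pos)
  have \<theta>m: "(real CARD('m) + 2) * \<theta> = (1/2) ^ (n + 2)"
  proof -
    have "real CARD('m) + 2 > 0" by (simp del: arity_eq)
    hence "real CARD('m) + 2 \<noteq> 0" by linarith
    thus ?thesis unfolding \<theta>_def times_divide_eq_right by (rule nonzero_mult_div_cancel_left)
  qed
  have \<theta>half: "\<theta> < 1/2"
  proof -
    have "\<theta> * 1 \<le> \<theta> * (real CARD('m) + 2)" using \<theta> by (intro mult_left_mono) (auto simp del: arity_eq)
    also have "\<dots> = (1/2) ^ (n + 2)" using \<theta>m by (simp add: mult.commute)
    also have "\<dots> = (1/2) ^ n * (1/4 :: real)" by (simp add: power_add power2_eq_square)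
    also have "\<dots> \<le> 1 * (1/4)" by (intro mult_right_mono power_le_one) auto
    finally show ?thesis by simp
  qed
  obtain C1 where C1: "C1 > 0" "\<And>(f :: 'm \<Rightarrow> real^'n \<Rightarrow> complex) lam V. (\<And>j. bbs (f j)) \<Longrightarrow> (\<And>j. lam j \<ge> 0) \<Longrightarrow> V > 0 \<Longrightarrow>
      (\<And>j. (LINT x|lborel. norm (f j x)) \<le> lam j * V) \<Longrightarrow>
      emeasure lebesgue {x. norm (U f x) > C1 * (\<Prod>j\<in>UNIV. lam j)} \<le> ennreal (\<theta> * V)"
    using weak_type_small_set[OF \<theta>] by blast
  define C2 where "C2 = (unit_ball_vol (real CARD('n)) * 5 ^ CARD('n) + 1) / \<theta>"
  have C2: "C2 > 0" unfolding C2_def using \<theta>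
    by (intro divide_pos_pos add_nonneg_pos mult_nonneg_nonneg unit_ball_vol_nonneg of_nat_0_le_iff) auto
  define C where "C = C1 + real CARD('m) * (osc_const * C2 ^ CARD('m))"
  have osc0: "osc_const \<ge> 0" using A_pos tail_const_pos by (simp add: osc_const_def)
  have CC1: "C \<ge> C1" unfolding C_def using osc0 C2 by (simp add: mult_nonneg_nonneg less_imp_le del: arity_eq)
  define mean where "mean = (\<lambda>(f :: 'm \<Rightarrow> real^'n \<Rightarrow> complex) k Q j. (LINT y|lborel. norm (f j y) * indicator (star k Q) y) / (2 powi k) ^ n)"
  have mean0: "mean f k Q j \<ge> 0" for f k Q j
    unfolding mean_def by (auto intro!: divide_nonneg_nonneg Bochner_Integration.integral_nonneg)
  have sm: "star_mean f (k, Q) = (\<Prod>j\<in>UNIV. mean f k Q j)" for f k Q by (simp add: star_mean_def mean_def n_def)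
  have loc: "bbs (localize f R j)" if "\<And>j. bbs (f j)" "R \<in> sets borel" for f :: "'m \<Rightarrow> real^'n \<Rightarrow> complex" and R j
    unfolding localize_def[abs_def] by (intro bbs_mult_indicator that)
  have starb: "star k Q \<in> sets borel" for k and Q :: "(real^'n) set" by (intro borel_open star_open)
  have locint: "(LINT y|lborel. norm (localize f (star k Q) j y)) = mean f k Q j * (2 powi k) ^ n" for f :: "'m \<Rightarrow> real^'n \<Rightarrow> complex" and k Q j
  proof -
    have "(LINT y|lborel. norm (localize f (star k Q) j y)) = (LINT y|lborel. norm (f j y) * indicator (star k Q) y)"
      by (intro Bochner_Integration.integral_cong) (auto simp: localize_def indicator_def)
    thus ?thesis by (simp add: mean_def)
  qed
  have weak: "emeasure lebesgue {y. norm (U (localize f (star k Q)) y) > C1 * star_mean f (k, Q)} \<le> ennreal (\<theta> * (2 powi k) ^ n)"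
    if f: "\<And>j. bbs (f j)" for f :: "'m \<Rightarrow> real^'n \<Rightarrow> complex" and k Q
    unfolding sm by (rule C1(2)) (use loc[OF f starb] mean0 locint in auto)
  have Um: "{y. norm (U (localize f (star k Q)) y) > t} \<in> sets lebesgue"
    if f: "\<And>j. bbs (f j)" for f :: "'m \<Rightarrow> real^'n \<Rightarrow> complex" and k Q t
  proof -
    have [measurable]: "U (localize f (star k Q)) \<in> borel_measurable lebesgue"
      by (rule U_measurable[OF bbs_Lpq[OF loc[OF f starb]]])
    have "{y \<in> space lebesgue. norm (U (localize f (star k Q)) y) > t} \<in> sets lebesgue" by measurable
    thus ?thesis by simp
  qed
  have main: "\<exists>\<P>. countable \<P> \<and> (\<forall>(l, P)\<in>\<P>. l < k \<and> (\<exists>z. P = dcube s l z) \<and> P \<subseteq> dcube s k x) \<and>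
      (\<forall>p\<in>\<P>. \<forall>p'\<in>\<P>. snd p \<inter> snd p' \<noteq> {} \<longrightarrow> p = p') \<and>
      emeasure lborel (\<Union>p\<in>\<P>. snd p) \<le> ennreal (1/2 * (2 powi k) ^ CARD('n)) \<and>
      (AE y in lborel. y \<in> dcube s k x \<longrightarrow>
        ((\<forall>p\<in>\<P>. y \<notin> snd p) \<longrightarrow> norm (U (localize f (star k (dcube s k x))) y) \<le> C * star_mean f (k, dcube s k x)) \<and>
        (\<forall>(l, P)\<in>\<P>. y \<in> P \<longrightarrow> norm (U (localize f (star k (dcube s k x))) y)
            \<le> norm (U (localize f (star l P)) y) + C * star_mean f (k, dcube s k x) + C * star_mean f (l, P)))"
    if f: "\<And>j. bbs (f j)" for f :: "'m \<Rightarrow> real^'n \<Rightarrow> complex" and s k x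
  proof -
    define Q where "Q = dcube s k x"
    define V where "V = ((2::real) powi k) ^ n"
    have V: "V > 0" by (simp add: V_def)
    define g where "g = localize f (star k Q)"
    have gb: "bbs (g j)" for j unfolding g_def by (rule loc[OF f starb])
    define E1 where "E1 = {y. norm (U g y) > C1 * star_mean f (k, Q)}"
    have E1: "emeasure lebesgue E1 \<le> ennreal (\<theta> * V)" "E1 \<in> sets lebesgue"
      unfolding E1_def g_def V_def by (rule weak[OF f], rule Um[OF f])
    have "\<forall>j. \<exists>W. W \<in> sets borel \<and> emeasure lborel W \<le> ennreal (\<theta> * V) \<and>
      (\<forall>x s. x \<notin> W \<longrightarrow> s > 0 \<longrightarrow> (\<integral>\<^sup>+y\<in>cball x s. ennreal (norm (g j y)) \<partial>lborel) \<le> ennreal (C2 * mean f k Q j * s ^ CARD('n)))"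
    proof
      fix j
      have "(LINT y|lborel. norm (g j y)) \<le> mean f k Q j * V" using locint[of f k Q j] by (simp add: g_def V_def)
      from maximal_exceptional_set_small[OF gb this mean0 V \<theta>]
      show "\<exists>W. W \<in> sets borel \<and> emeasure lborel W \<le> ennreal (\<theta> * V) \<and>
        (\<forall>x s. x \<notin> W \<longrightarrow> s > 0 \<longrightarrow> (\<integral>\<^sup>+y\<in>cball x s. ennreal (norm (g j y)) \<partial>lborel) \<le> ennreal (C2 * mean f k Q j * s ^ CARD('n)))"
        unfolding C2_def .
    qed
    from choice[OF this] obtain W where W: "\<And>j. W j \<in> sets borel" "\<And>j. emeasure lborel (W j) \<le> ennreal (\<theta> * V)"
      "\<And>j x s. x \<notin> W j \<Longrightarrow> s > 0 \<Longrightarrow> (\<integral>\<^sup>+y\<in>cball x s. ennreal (norm (g j y)) \<partial>lborel) \<le> ennreal (C2 * mean f k Q j * s ^ CARD('n))"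
      by blast
    define E where "E = E1 \<union> (\<Union>j. W j)"
    have Wm: "(\<Union>j. W j) \<in> sets borel" by (intro sets.finite_UN finite W(1))
    have Em: "E \<in> sets lebesgue" unfolding E_def by (intro sets.Un[OF E1(2)] sets_completionI_sets) (use Wm in simp)
    have EV: "emeasure lebesgue E \<le> ennreal ((real CARD('m) + 1) * \<theta> * V)"
    proof -
      have "emeasure lebesgue E \<le> emeasure lebesgue E1 + emeasure lebesgue (\<Union>j. W j)"
        unfolding E_def by (intro emeasure_subadditive E1(2) sets_completionI_sets) (use Wm in simp)
      also have "\<dots> \<le> ennreal (\<theta> * V) + ennreal (real CARD('m) * \<theta> * V)"
        unfolding emeasure_lebesgue_borel[OF Wm] using \<theta> V by (intro add_mono E1(1) emeasure_UN_index_le W(1,2)) auto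
      also have "\<dots> = ennreal ((real CARD('m) + 1) * \<theta> * V)"
        using \<theta> V by (subst ennreal_plus[symmetric]) (auto simp: algebra_simps intro!: mult_nonneg_nonneg simp del: arity_eq)
      finally show ?thesis .
    qed
    obtain G where G: "open G" "E \<subseteq> G" "G - E \<in> lmeasurable" "emeasure lebesgue (G - E) < ennreal (\<theta> * V)"
      using sets_lebesgue_outer_open[OF Em, of "\<theta> * V"] \<theta> V by auto
    have Gb: "G \<in> sets borel" using G(1) by (rule borel_open)
    have GV: "emeasure lborel G \<le> ennreal ((1/2) ^ (n + 2) * V)"
    proof -
      have "emeasure lborel G = emeasure lebesgue (E \<union> (G - E))"
        using G(2) emeasure_lebesgue_borel[OF Gb] by (simp add: Un_absorb1)
      also have "\<dots> \<le> emeasure lebesgue E + emeasure lebesgue (G - E)"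
        using Em G(3) by (intro emeasure_subadditive) auto
      also have "\<dots> \<le> ennreal ((real CARD('m) + 1) * \<theta> * V) + ennreal (\<theta> * V)"
        using EV G(4) by (intro add_mono) auto
      also have "\<dots> = ennreal (((real CARD('m) + 2) * \<theta>) * V)"
        using \<theta> V by (subst ennreal_plus[symmetric]) (auto simp: algebra_simps intro!: mult_nonneg_nonneg add_nonneg_nonneg simp del: arity_eq)
      finally show ?thesis unfolding \<theta>m .
    qed
    define Sel where "Sel = (\<lambda>l P. ennreal ((1/2) ^ (n + 1) * (2 powi l) ^ n) < emeasure lborel (P \<inter> G))"
    have top: "\<not> Sel k Q"
    proof -
      have "emeasure lborel (Q \<inter> G) \<le> emeasure lborel G" using Gb by (intro emeasure_mono) auto
      also have "\<dots> \<le> ennreal ((1/2) ^ (n + 2) * V)" by (rule GV)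
      also have "\<dots> \<le> ennreal ((1/2) ^ (n + 1) * V)" using V by (intro ennreal_leI mult_right_mono power_decreasing) auto
      finally show ?thesis by (simp add: Sel_def V_def)
    qed
    define St where "St = {P \<in> stopping_cubes Sel s k. P \<subseteq> Q}"
    define \<P> where "\<P> = {(l, P). P \<in> St \<and> (\<exists>z. P = dcube s l z)}"
    have Pprop: "l < k \<and> Sel l P \<and> emeasure lborel (P \<inter> G) \<le> ennreal (1/2 * (2 powi l) ^ n) \<and> (\<exists>z. P = dcube s l z) \<and> P \<in> St \<and> P \<subseteq> Q"
      if p: "(l, P) \<in> \<P>" for l P
    proof -
      from p have P: "P \<in> St" and "\<exists>z. P = dcube s l z" by (auto simp: \<P>_def)
      then obtain z where z: "P = dcube s l z" by blast
      from P obtain l' x' where l': "P = dcube s l' x'" "l' < k" "Sel l' P" "\<And>i. l' < i \<Longrightarrow> i \<le> k \<Longrightarrow> \<not> Sel i (dcube s i x')"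
        unfolding St_def stopping_cubes_def by blast
      have ll: "l' = l" using l'(1) z by (metis dcube_level_unique)
      have "\<not> Sel (l + 1) (dcube s (l + 1) x')" using l'(2,4) ll by simp
      hence "emeasure lborel (dcube s (l + 1) x' \<inter> G) \<le> ennreal ((1/2) ^ (n + 1) * (2 powi (l + 1)) ^ n)"
        by (simp add: Sel_def not_less)
      also have "(1/2) ^ (n + 1) * ((2::real) powi (l + 1)) ^ n = 1/2 * (2 powi l) ^ n"
        by (simp add: power_int_add power_mult_distrib power_one_over)
      finally have "emeasure lborel (dcube s (l + 1) x' \<inter> G) \<le> ennreal (1/2 * (2 powi l) ^ n)" .
      moreover have "emeasure lborel (P \<inter> G) \<le> emeasure lborel (dcube s (l + 1) x' \<inter> G)"
        using dcube_mono[of l "l + 1" s x'] l'(1) ll Gb dcube_measure(1)[of s "l + 1" x'] by (intro emeasure_mono) auto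
      ultimately show ?thesis using l' ll z P by (auto simp: St_def)
    qed
    have \<P>disj: "p = p'" if "p \<in> \<P>" "p' \<in> \<P>" "snd p \<inter> snd p' \<noteq> {}" for p p'
    proof -
      obtain l P l' P' where pp: "p = (l, P)" "p' = (l', P')" by (cases p, cases p')
      from that(3) obtain z where z: "z \<in> P" "z \<in> P'" using pp by auto
      have "P = P'"
        by (rule stopping_cubes_disjoint[of P Sel s k P' z]) (use that z pp in \<open>auto simp: \<P>_def St_def\<close>)
      moreover have "l = l'" using that pp \<open>P = P'\<close> unfolding \<P>_def by (auto dest: dcube_level_unique)
      ultimately show ?thesis using pp by simp
    qed
    have cover: "y \<in> Q \<Longrightarrow> y \<in> G \<Longrightarrow> \<exists>p\<in>\<P>. y \<in> snd p" for y
    proof -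
      assume yQ: "y \<in> Q" and yG: "y \<in> G"
      obtain l0 where l0: "\<And>l. l \<le> l0 \<Longrightarrow> dcube s l y \<subseteq> G" using dcube_in_open[OF G(1) yG, of s] by blast
      define l where "l = min l0 k"
      have Qy: "dcube s k y = Q" using dcube_eq[of y s k x] yQ by (simp add: Q_def)
      have "dcube s l y \<inter> G = dcube s l y" using l0[of l] by (auto simp: l_def)
      hence "emeasure lborel (dcube s l y \<inter> G) = ennreal ((2 powi l) ^ n)" using dcube_measure(2)[of s l y] by (simp add: n_def)
      moreover have "(1/2) ^ (n + 1) * (2 powi l) ^ n < 1 * ((2::real) powi l) ^ n"
        by (intro mult_strict_right_mono) (auto simp: power_less_one_iff simp del: power_Suc)
      ultimately have "Sel l (dcube s l y)" by (simp add: Sel_def ennreal_less_iff)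
      then obtain i where i: "l \<le> i" "i < k" "dcube s i y \<in> stopping_cubes Sel s k"
        using stopping_cubes_cover[of Sel l s y k] top Qy by (auto simp: l_def)
      have "dcube s i y \<subseteq> Q" using dcube_mono[of i k s y] i(2) Qy by simp
      hence "(i, dcube s i y) \<in> \<P>" using i by (auto simp: \<P>_def St_def)
      thus ?thesis by (intro bexI[of _ "(i, dcube s i y)"]) auto
    qed
    have ctSt: "countable St" by (rule countable_subset[OF _ countable_stopping_cubes[of Sel s k]]) (auto simp: St_def)
    have ct: "countable \<P>"
    proof (rule countable_image_inj_on[of snd])
      show "countable (snd ` \<P>)" by (rule countable_subset[OF _ ctSt]) (auto simp: \<P>_def)
      show "inj_on snd \<P>"
      proof (rule inj_onI)
        fix p p' assume p: "p \<in> \<P>" "p' \<in> \<P>" and eq: "snd p = snd p'"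
        have "dcube s l z \<noteq> {}" for l z using dcube_self[of z s l] by blast
        hence "snd p \<noteq> {}" using p(1) by (auto simp: \<P>_def)
        thus "p = p'" using \<P>disj[OF p] eq by simp
      qed
    qed
    have mU: "emeasure lborel (\<Union>p\<in>\<P>. snd p) \<le> ennreal (1/2 * V)"
    proof -
      have bP: "snd p \<in> sets borel" if "p \<in> \<P>" for p
        using that by (auto simp: \<P>_def dcube_measure(1))
      have dj: "disjoint_family_on snd \<P>"
        unfolding disjoint_family_on_def using \<P>disj by blast
      hence djG: "disjoint_family_on (\<lambda>p. snd p \<inter> G) \<P>"
        unfolding disjoint_family_on_def by blast
      have "emeasure lborel (\<Union>p\<in>\<P>. snd p) = (\<integral>\<^sup>+p. emeasure lborel (snd p) \<partial>count_space \<P>)"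
        using bP by (intro emeasure_UN_countable ct dj) simp
      also have "\<dots> \<le> (\<integral>\<^sup>+p. ennreal (2 ^ (n + 1)) * emeasure lborel (snd p \<inter> G) \<partial>count_space \<P>)"
      proof (intro nn_integral_mono)
        fix p assume "p \<in> space (count_space \<P>)"
        then obtain l P where p: "p = (l, P)" "(l, P) \<in> \<P>" by (cases p) auto
        from Pprop[OF p(2)] obtain z where z: "P = dcube s l z" and S: "Sel l P" by blast
        have "emeasure lborel P = ennreal (2 ^ (n + 1) * ((1/2) ^ (n + 1) * (2 powi l) ^ n))"
          using dcube_measure(2)[of s l z] z by (simp add: n_def power_one_over)
        also have "\<dots> = ennreal (2 ^ (n + 1)) * ennreal ((1/2) ^ (n + 1) * (2 powi l) ^ n)" by (rule ennreal_mult) auto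
        also have "\<dots> \<le> ennreal (2 ^ (n + 1)) * emeasure lborel (P \<inter> G)"
          using S by (intro mult_left_mono) (auto simp: Sel_def)
        finally show "emeasure lborel (snd p) \<le> ennreal (2 ^ (n + 1)) * emeasure lborel (snd p \<inter> G)" using p by simp
      qed
      also have "\<dots> = ennreal (2 ^ (n + 1)) * (\<integral>\<^sup>+p. emeasure lborel (snd p \<inter> G) \<partial>count_space \<P>)"
        by (rule nn_integral_cmult) simp
      also have "(\<integral>\<^sup>+p. emeasure lborel (snd p \<inter> G) \<partial>count_space \<P>) = emeasure lborel (\<Union>p\<in>\<P>. snd p \<inter> G)"
        using bP Gb by (intro emeasure_UN_countable[symmetric] ct djG) auto
      also have "ennreal (2 ^ (n + 1)) * \<dots> \<le> ennreal (2 ^ (n + 1)) * ennreal ((1/2) ^ (n + 2) * V)"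
      proof (intro mult_left_mono)
        have "emeasure lborel (\<Union>p\<in>\<P>. snd p \<inter> G) \<le> emeasure lborel G" using Gb by (intro emeasure_mono) auto
        thus "emeasure lborel (\<Union>p\<in>\<P>. snd p \<inter> G) \<le> ennreal ((1/2) ^ (n + 2) * V)" using GV by (rule order_trans)
      qed simp
      also have "\<dots> = ennreal (2 ^ (n + 1) * ((1/2) ^ (n + 2) * V))" using V by (intro ennreal_mult[symmetric]) auto
      also have "2 ^ (n + 1) * ((1/2) ^ (n + 2) * V) = 1/2 * V" by (simp add: power_one_over power_add)
      finally show ?thesis .
    qed
    have piece: "AE y in lborel. y \<in> P \<longrightarrow> norm (U g y) \<le> norm (U (localize f (star l P)) y) + C * star_mean f (k, Q) + C * star_mean f (l, P)"
      if p: "(l, P) \<in> \<P>" for l P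
    proof -
      from Pprop[OF p] obtain z0 where lk: "l < k" and PG: "emeasure lborel (P \<inter> G) \<le> ennreal (1/2 * (2 powi l) ^ n)"
        and z0: "P = dcube s l z0" and PQ: "P \<subseteq> Q" by blast
      define L where "L = real CARD('n) * 2 powi l"
      have L: "L > 0" unfolding L_def by (simp del: dimn_eq)
      define g' where "g' = localize f (star l P)"
      have g'b: "bbs (g' j)" for j unfolding g'_def by (rule loc[OF f starb])
      have Pb: "P \<in> sets borel" unfolding z0 by (rule dcube_measure(1))
      have star_sub: "star l P \<subseteq> star k Q" using lk PQ by (intro star_mono) auto
      have "\<exists>H. (\<forall>j. H j j = (\<lambda>x. g j x - g' j x)) \<and> (\<forall>j i. i \<noteq> j \<longrightarrow> H j i = g i \<or> H j i = g' i) \<and>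
        (AE x in lborel. U g x - U g' x = (\<Sum>j\<in>UNIV. U (H j) x))"
        by (intro U_telescope bbs_Lpq gb g'b bbs_diff)
      then obtain H where H: "\<And>j. H j j = (\<lambda>x. g j x - g' j x)" "\<And>j i. i \<noteq> j \<Longrightarrow> H j i = g i \<or> H j i = g' i"
        "AE x in lborel. U g x - U g' x = (\<Sum>j\<in>UNIV. U (H j) x)" by blast
      have Hb: "bbs (H j i)" for j i
        using H(1)[of j] H(2)[of i j] gb g'b bbs_diff[OF gb g'b] by (cases "i = j") auto
      have Hle: "norm (H j i y) \<le> norm (g i y)" for j i y
        using H(1)[of j] H(2)[of i j] star_sub
        by (cases "i = j") (auto simp: g_def g'_def localize_def indicator_def)
      have Hj0: "y \<notin> star l P" if "H j j y \<noteq> 0" for j y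
        using that star_sub unfolding H(1) by (auto simp: g_def g'_def localize_def indicator_def split: if_splits)
      have notcl: "y \<notin> closure {z. H j j z \<noteq> 0}" if "y \<in> P" for y j
      proof -
        have "star l P \<inter> {z. H j j z \<noteq> 0} = {}" using Hj0 by blast
        hence "star l P \<inter> closure {z. H j j z \<noteq> 0} = {}" by (simp only: open_Int_closure_eq_empty[OF star_open])
        thus ?thesis using that star_superset[of P l] by blast
      qed
      have "AE y in lborel. \<forall>j\<in>UNIV. y \<notin> closure {z. H j j z \<noteq> 0} \<longrightarrow> U (H j) y = kernel_integral (H j) y"
        by (intro AE_finite_allI kernel_representation Hb) auto
      with H(3) have rep: "AE y in lborel. y \<in> P \<longrightarrow> U g y - U g' y = (\<Sum>j\<in>UNIV. kernel_integral (H j) y)"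
        by eventually_elim (use notcl in auto)
      define B where "B = {y. norm (U g' y) > C1 * star_mean f (l, P)}"
      have BV: "emeasure lebesgue B \<le> ennreal (\<theta> * (2 powi l) ^ n)" and Bm: "B \<in> sets lebesgue"
        unfolding B_def g'_def by (rule weak[OF f], rule Um[OF f])
      \<comment> \<open>The reference point exists since \<open>G\<close> and \<open>B\<close> together cannot cover \<open>P\<close>: \<open>1/2 + \<theta> < 1\<close>.\<close>
      have "\<exists>x'. x' \<in> P \<and> x' \<notin> G \<and> x' \<notin> B \<and> U g x' - U g' x' = (\<Sum>j\<in>UNIV. kernel_integral (H j) x')"
      proof (rule ccontr)
        assume no: "\<not> ?thesis"
        have "AE y in lebesgue. y \<in> P \<longrightarrow> y \<in> (P \<inter> G) \<union> B"
          unfolding AE_completion_iff using rep by eventually_elim (use no in blast)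
        moreover have PGl: "P \<inter> G \<in> sets lebesgue" by (intro sets_completionI_sets) (use Pb Gb in auto)
        ultimately have "emeasure lebesgue P \<le> emeasure lebesgue ((P \<inter> G) \<union> B)"
          by (intro emeasure_mono_AE sets.Un[OF _ Bm])
        also have "\<dots> \<le> emeasure lebesgue (P \<inter> G) + emeasure lebesgue B"
          by (intro emeasure_subadditive PGl Bm)
        also have "\<dots> \<le> ennreal (1/2 * (2 powi l) ^ n) + ennreal (\<theta> * (2 powi l) ^ n)"
          using PG BV emeasure_lebesgue_borel[OF sets.Int[OF Pb Gb]] by (intro add_mono) auto
        also have "\<dots> = ennreal ((1/2 + \<theta>) * (2 powi l) ^ n)"
          using \<theta> by (subst ennreal_plus[symmetric]) (auto simp: distrib_right)
        also have "\<dots> < ennreal (1 * (2 powi l) ^ n)"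
          using \<theta>half \<theta> by (intro ennreal_lessI mult_strict_right_mono) auto
        finally have "emeasure lebesgue P < ennreal ((2 powi l) ^ n)" by simp
        moreover have "emeasure lebesgue P = ennreal ((2 powi l) ^ n)"
          using emeasure_lebesgue_borel[OF Pb] dcube_measure(2)[of s l z0] z0 by (simp add: n_def)
        ultimately show False by simp
      qed
      then obtain x' where x': "x' \<in> P" "x' \<notin> G" "x' \<notin> B" "U g x' - U g' x' = (\<Sum>j\<in>UNIV. kernel_integral (H j) x')" by blast
      have x'E: "x' \<notin> E1" "\<And>j. x' \<notin> W j" using x'(2) G(2) by (auto simp: E_def)
      have osc: "norm (kernel_integral (H j) y - kernel_integral (H j) x') \<le> osc_const * C2 ^ CARD('m) * star_mean f (k, Q)" if y: "y \<in> P" for y j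
      proof -
        have dist: "norm (y - x') \<le> L" using y x'(1) unfolding L_def z0 by (rule dcube_norm_dist)
        have "norm (kernel_integral (H j) y - kernel_integral (H j) x') \<le> osc_const * (\<Prod>i\<in>UNIV. C2 * mean f k Q i)"
        proof (rule kernel_oscillation[OF Hb L dist dist])
          show "2 * L \<le> norm (y - y')" if "H j j y' \<noteq> 0" for y'
            using star_far[OF y Hj0[OF that]] by (simp add: L_def)
          show "0 \<le> C2 * mean f k Q i" for i using C2 mean0 by simp
          fix i and s :: real assume s: "s > 0"
          have "(\<integral>\<^sup>+y\<in>cball x' s. ennreal (norm (H j i y)) \<partial>lborel) \<le> (\<integral>\<^sup>+y\<in>cball x' s. ennreal (norm (g i y)) \<partial>lborel)"
            by (intro nn_integral_mono mult_right_mono ennreal_leI Hle) auto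
          also have "\<dots> \<le> ennreal (C2 * mean f k Q i * s ^ CARD('n))" by (rule W(3)[OF x'E(2) s])
          finally show "(\<integral>\<^sup>+y\<in>cball x' s. ennreal (norm (H j i y)) \<partial>lborel) \<le> ennreal (C2 * mean f k Q i * s ^ CARD('n))" .
        qed
        also have "\<dots> = osc_const * C2 ^ CARD('m) * star_mean f (k, Q)" by (simp add: prod.distrib sm)
        finally show ?thesis .
      qed
      show ?thesis using rep
      proof eventually_elim
        case (elim y)
        show ?case
        proof
          assume y: "y \<in> P"
          define D where "D = (\<Sum>j\<in>UNIV. kernel_integral (H j) y - kernel_integral (H j) x')"
          have "norm D \<le> (\<Sum>j\<in>(UNIV::'m set). osc_const * C2 ^ CARD('m) * star_mean f (k, Q))"
            unfolding D_def by (intro sum_norm_le osc y)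
          hence D: "norm D \<le> real CARD('m) * (osc_const * C2 ^ CARD('m)) * star_mean f (k, Q)" by (simp add: mult.assoc)
          have "U g y - U g' y = D + (U g x' - U g' x')"
            using elim y x'(4) by (simp add: D_def sum_subtractf)
          hence "norm (U g y - U g' y) \<le> norm D + norm (U g x' - U g' x')"
            using norm_triangle_ineq[of D "U g x' - U g' x'"] by simp
          moreover have "norm (U g x' - U g' x') \<le> norm (U g x') + norm (U g' x')" by (rule norm_triangle_ineq4)
          moreover have "norm (U g y) \<le> norm (U g' y) + norm (U g y - U g' y)" by (rule norm_triangle_sub)
          moreover have "norm (U g x') \<le> C1 * star_mean f (k, Q)" using x'E(1) by (simp add: E1_def)
          moreover have "norm (U g' x') \<le> C1 * star_mean f (l, P)" using x'(3) by (simp add: B_def)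
          moreover have "C1 * star_mean f (l, P) \<le> C * star_mean f (l, P)" using CC1 star_mean_nonneg by (intro mult_right_mono) auto
          moreover have "C1 * star_mean f (k, Q) + real CARD('m) * (osc_const * C2 ^ CARD('m)) * star_mean f (k, Q) = C * star_mean f (k, Q)"
            unfolding C_def by (simp add: distrib_right del: arity_eq)
          ultimately show "norm (U g y) \<le> norm (U (localize f (star l P)) y) + C * star_mean f (k, Q) + C * star_mean f (l, P)"
            using D unfolding g'_def by linarith
        qed
      qed
    qed
    have "AE y in lborel. \<forall>p\<in>\<P>. y \<in> snd p \<longrightarrow> norm (U g y) \<le> norm (U (localize f (star (fst p) (snd p))) y) + C * star_mean f (k, Q) + C * star_mean f p"
    proof (subst AE_ball_countable[OF ct], intro ballI)
      fix p assume "p \<in> \<P>"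
      thus "AE y in lborel. y \<in> snd p \<longrightarrow> norm (U g y) \<le> norm (U (localize f (star (fst p) (snd p))) y) + C * star_mean f (k, Q) + C * star_mean f p"
        using piece[of "fst p" "snd p"] by simp
    qed
    hence ae: "AE y in lborel. y \<in> Q \<longrightarrow>
        ((\<forall>p\<in>\<P>. y \<notin> snd p) \<longrightarrow> norm (U g y) \<le> C * star_mean f (k, Q)) \<and>
        (\<forall>(l, P)\<in>\<P>. y \<in> P \<longrightarrow> norm (U g y) \<le> norm (U (localize f (star l P)) y) + C * star_mean f (k, Q) + C * star_mean f (l, P))"
    proof eventually_elim
      case (elim y)
      have "norm (U g y) \<le> C * star_mean f (k, Q)" if "y \<in> Q" "\<forall>p\<in>\<P>. y \<notin> snd p"
      proof -
        have "y \<notin> G" using cover[of y] that by blast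
        hence "y \<notin> E1" using G(2) by (auto simp: E_def)
        hence "norm (U g y) \<le> C1 * star_mean f (k, Q)" by (simp add: E1_def)
        also have "\<dots> \<le> C * star_mean f (k, Q)" using CC1 star_mean_nonneg by (intro mult_right_mono) auto
        finally show ?thesis .
      qed
      thus ?case using elim by auto
    qed
    have sub: "\<forall>(l, P)\<in>\<P>. l < k \<and> (\<exists>z. P = dcube s l z) \<and> P \<subseteq> Q" using Pprop by blast
    have disj': "\<forall>p\<in>\<P>. \<forall>p'\<in>\<P>. snd p \<inter> snd p' \<noteq> {} \<longrightarrow> p = p'"
      by (intro ballI impI \<P>disj)
    have mU': "emeasure lborel (\<Union>p\<in>\<P>. snd p) \<le> ennreal (1/2 * (2 powi k) ^ CARD('n))"
      using mU by (simp only: V_def n_def)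
    show ?thesis
      unfolding Q_def[symmetric] by (rule exI[of _ \<P>], intro conjI ct sub disj' mU' ae[unfolded g_def])
  qed
  have C0: "C > 0" using CC1 C1(1) by linarith
  show ?thesis
  proof (rule exI[of _ C], intro conjI allI impI)
    fix f :: "'m \<Rightarrow> real^'n \<Rightarrow> complex" and s k x
    assume "\<forall>j. bbs (f j)"
    thus "\<exists>\<P>. countable \<P> \<and> (\<forall>(l, P)\<in>\<P>. l < k \<and> (\<exists>z. P = dcube s l z) \<and> P \<subseteq> dcube s k x) \<and>
      (\<forall>p\<in>\<P>. \<forall>p'\<in>\<P>. snd p \<inter> snd p' \<noteq> {} \<longrightarrow> p = p') \<and>
      emeasure lborel (\<Union>p\<in>\<P>. snd p) \<le> ennreal (1/2 * (2 powi k) ^ CARD('n)) \<and>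
      (AE y in lborel. y \<in> dcube s k x \<longrightarrow>
        ((\<forall>p\<in>\<P>. y \<notin> snd p) \<longrightarrow> norm (U (localize f (star k (dcube s k x))) y) \<le> C * star_mean f (k, dcube s k x)) \<and>
        (\<forall>(l, P)\<in>\<P>. y \<in> P \<longrightarrow> norm (U (localize f (star k (dcube s k x))) y)
            \<le> norm (U (localize f (star l P)) y) + C * star_mean f (k, dcube s k x) + C * star_mean f (l, P)))"
      by (intro main) (erule spec)
  qed (rule C0)
qed

end

section \<open>Iteration of the local step\<close>

lemma sum_UN_le_ennreal:
  fixes g :: "'a \<Rightarrow> ennreal"
  assumes "finite I" "\<And>i. i \<in> I \<Longrightarrow> finite (A i)"
  shows "sum g (\<Union>i\<in>I. A i) \<le> (\<Sum>i\<in>I. sum g (A i))"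
  using assms
proof (induction I rule: finite_induct)
  case (insert i I)
  have "sum g (A i \<union> (\<Union>i\<in>I. A i)) \<le> sum g (A i \<union> (\<Union>i\<in>I. A i)) + sum g (A i \<inter> (\<Union>i\<in>I. A i))" by simp
  also have "\<dots> = sum g (A i) + sum g (\<Union>i\<in>I. A i)" using insert by (intro sum.union_inter) auto
  also have "\<dots> \<le> sum g (A i) + (\<Sum>i\<in>I. sum g (A i))" using insert by (intro add_left_mono insert.IH) auto
  finally show ?case using insert by simp
qed simp

text \<open>
  Continuity from above: all but finitely many of the disjoint sets have arbitrarily small total measure.
\<close>

lemma finite_subfamily_small_remainder:
  fixes \<P> :: "'i set" and P :: "'i \<Rightarrow> 'a::euclidean_space set"
  assumes ct: "countable \<P>" and b: "\<And>p. p \<in> \<P> \<Longrightarrow> P p \<in> sets borel"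
    and disj: "\<And>p p'. p \<in> \<P> \<Longrightarrow> p' \<in> \<P> \<Longrightarrow> P p \<inter> P p' \<noteq> {} \<Longrightarrow> p = p'"
    and fin: "emeasure lborel (\<Union>p\<in>\<P>. P p) < \<infinity>" and e: "e > 0"
  obtains \<P>0 where "finite \<P>0" "\<P>0 \<subseteq> \<P>" "emeasure lborel (\<Union>p\<in>\<P>-\<P>0. P p) < e"
proof -
  define A where "A = (\<lambda>i::nat. \<Union>p\<in>\<P> - from_nat_into \<P> ` {..<i}. P p)"
  have Am: "A i \<in> sets borel" for i unfolding A_def using b ct by (intro sets.countable_UN'') auto
  have dec: "decseq A" unfolding A_def decseq_def by fastforce
  have "(\<Inter>i. A i) = {}"
  proof (rule ccontr)
    assume "(\<Inter>i. A i) \<noteq> {}"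
    then obtain y where y: "\<And>i. y \<in> A i" by blast
    from y[of 0] obtain p where p: "p \<in> \<P>" "y \<in> P p" by (auto simp: A_def)
    obtain j where j: "from_nat_into \<P> j = p" using from_nat_into_surj[OF ct p(1)] by blast
    from y[of "Suc j"] obtain p' where p': "p' \<in> \<P>" "p' \<notin> from_nat_into \<P> ` {..<Suc j}" "y \<in> P p'" by (auto simp: A_def)
    have "p = p'" using disj[OF p(1) p'(1)] p(2) p'(3) by blast
    thus False using p'(2) j by blast
  qed
  moreover have "(\<lambda>i. emeasure lborel (A i)) \<longlonglongrightarrow> emeasure lborel (\<Inter>i. A i)"
  proof (rule Lim_emeasure_decseq)
    show "range A \<subseteq> sets lborel" using Am by auto
    show "emeasure lborel (A i) \<noteq> \<infinity>" for i
    proof -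
      have "(\<Union>p\<in>\<P>. P p) \<in> sets borel" using b ct by (intro sets.countable_UN'') auto
      hence "emeasure lborel (A i) \<le> emeasure lborel (\<Union>p\<in>\<P>. P p)" by (intro emeasure_mono) (auto simp: A_def)
      thus ?thesis using fin by auto
    qed
  qed (rule dec)
  ultimately have "(\<lambda>i. emeasure lborel (A i)) \<longlonglongrightarrow> 0" by simp
  from order_tendstoD(2)[OF this e] obtain i where i: "emeasure lborel (A i) < e"
    unfolding eventually_sequentially by blast
  have "\<P> - (\<P> \<inter> from_nat_into \<P> ` {..<i}) = \<P> - from_nat_into \<P> ` {..<i}" by blast
  hence "emeasure lborel (\<Union>p\<in>\<P>-(\<P> \<inter> from_nat_into \<P> ` {..<i}). P p) < e" using i by (simp add: A_def)
  thus thesis by (intro that[of "\<P> \<inter> from_nat_into \<P> ` {..<i}"]) auto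
qed

context CZ_operator
begin

text \<open>
  Induction on the number \<open>N\<close> of generations. The strengthened claim carries the additional term \<open>C star_mean f Q\<close> on the
  left, which absorbs the term \<open>C star_mean f P\<close> that \<open>local_step\<close> leaves on each stopping cube. Half of the measure
  passes to the next generation; discarding all but finitely many stopping cubes keeps the family
  finite at the price of a slightly larger exceptional set, whence \<open>3/4\<close> in place of \<open>1/2\<close>. The packing bound with
  factor \<open>2\<close> is the geometric series \<open>1 + 1/2 + 1/4 + \<dots>\<close>.
\<close>

lemma local_sparse_domination:
  "\<exists>C\<ge>0. \<forall>(f :: 'm \<Rightarrow> real^'n \<Rightarrow> complex) s k x N. (\<forall>j. bbs (f j)) \<longrightarrow>
    (\<exists>F Z. finite F \<and> (\<forall>(l, P)\<in>F. l \<le> k \<and> (\<exists>z. P = dcube s l z)) \<and>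
      (\<forall>V\<in>sets borel. (\<Sum>p\<in>F. if snd p \<subseteq> V then emeasure lborel (snd p) else 0) \<le> 2 * emeasure lborel (V \<inter> dcube s k x)) \<and>
      Z \<in> sets borel \<and> emeasure lborel Z \<le> ennreal ((3/4) ^ N * (2 powi k) ^ CARD('n)) \<and>
      (AE y in lborel. y \<in> dcube s k x \<and> y \<notin> Z \<longrightarrow>
        norm (U (localize f (star k (dcube s k x))) y) \<le> C * (\<Sum>p\<in>F. star_mean f p * indicator (snd p) y)))"
proof -
  define n where "n = CARD('n)"
  obtain C1 where C1: "C1 > 0" and step: "\<And>(f :: 'm \<Rightarrow> real^'n \<Rightarrow> complex) s k x. (\<And>j. bbs (f j)) \<Longrightarrow>
    \<exists>\<P>. countable \<P> \<and> (\<forall>(l, P)\<in>\<P>. l < k \<and> (\<exists>z. P = dcube s l z) \<and> P \<subseteq> dcube s k x) \<and>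
      (\<forall>p\<in>\<P>. \<forall>p'\<in>\<P>. snd p \<inter> snd p' \<noteq> {} \<longrightarrow> p = p') \<and>
      emeasure lborel (\<Union>p\<in>\<P>. snd p) \<le> ennreal (1/2 * (2 powi k) ^ n) \<and>
      (AE y in lborel. y \<in> dcube s k x \<longrightarrow>
        ((\<forall>p\<in>\<P>. y \<notin> snd p) \<longrightarrow> norm (U (localize f (star k (dcube s k x))) y) \<le> C1 * star_mean f (k, dcube s k x)) \<and>
        (\<forall>(l, P)\<in>\<P>. y \<in> P \<longrightarrow> norm (U (localize f (star k (dcube s k x))) y)
            \<le> norm (U (localize f (star l P)) y) + C1 * star_mean f (k, dcube s k x) + C1 * star_mean f (l, P)))"
    using local_step unfolding n_def by blast
  have main: "\<exists>F Z. finite F \<and> (\<forall>(l, P)\<in>F. l \<le> k \<and> (\<exists>z. P = dcube s l z)) \<and>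
      (\<forall>V\<in>sets borel. (\<Sum>p\<in>F. if snd p \<subseteq> V then emeasure lborel (snd p) else 0) \<le> 2 * emeasure lborel (V \<inter> dcube s k x)) \<and>
      Z \<in> sets borel \<and> emeasure lborel Z \<le> ennreal ((3/4) ^ N * (2 powi k) ^ n) \<and>
      (AE y in lborel. y \<in> dcube s k x \<and> y \<notin> Z \<longrightarrow>
        norm (U (localize f (star k (dcube s k x))) y) + C1 * star_mean f (k, dcube s k x) \<le> 2 * C1 * (\<Sum>p\<in>F. star_mean f p * indicator (snd p) y))"
    if f: "\<And>j. bbs (f j)" for f :: "'m \<Rightarrow> real^'n \<Rightarrow> complex" and s k x N
  proof (induction N arbitrary: k x)
    case 0
    show ?case
      by (rule exI[of _ "{}"], rule exI[of _ "dcube s k x"]) (simp add: dcube_measure n_def)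
  next
    case (Suc N)
    define Q where "Q = dcube s k x"
    define V0 where "V0 = ((2::real) powi k) ^ n"
    have V0: "V0 > 0" by (simp add: V0_def)
    have Qb: "Q \<in> sets borel" and Qm: "emeasure lborel Q = ennreal V0"
      unfolding Q_def V0_def n_def by (rule dcube_measure)+
    have "\<exists>\<P>. countable \<P> \<and> (\<forall>(l, P)\<in>\<P>. l < k \<and> (\<exists>z. P = dcube s l z) \<and> P \<subseteq> Q) \<and>
      (\<forall>p\<in>\<P>. \<forall>p'\<in>\<P>. snd p \<inter> snd p' \<noteq> {} \<longrightarrow> p = p') \<and>
      emeasure lborel (\<Union>p\<in>\<P>. snd p) \<le> ennreal (1/2 * V0) \<and>
      (AE y in lborel. y \<in> Q \<longrightarrow>
        ((\<forall>p\<in>\<P>. y \<notin> snd p) \<longrightarrow> norm (U (localize f (star k Q)) y) \<le> C1 * star_mean f (k, Q)) \<and>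
        (\<forall>(l, P)\<in>\<P>. y \<in> P \<longrightarrow> norm (U (localize f (star k Q)) y)
            \<le> norm (U (localize f (star l P)) y) + C1 * star_mean f (k, Q) + C1 * star_mean f (l, P)))"
      using step[of f k s x, OF f] unfolding Q_def V0_def .
    then obtain \<P> where raw: "countable \<P> \<and> (\<forall>(l, P)\<in>\<P>. l < k \<and> (\<exists>z. P = dcube s l z) \<and> P \<subseteq> Q) \<and>
      (\<forall>p\<in>\<P>. \<forall>p'\<in>\<P>. snd p \<inter> snd p' \<noteq> {} \<longrightarrow> p = p') \<and>
      emeasure lborel (\<Union>p\<in>\<P>. snd p) \<le> ennreal (1/2 * V0) \<and>
      (AE y in lborel. y \<in> Q \<longrightarrow>
        ((\<forall>p\<in>\<P>. y \<notin> snd p) \<longrightarrow> norm (U (localize f (star k Q)) y) \<le> C1 * star_mean f (k, Q)) \<and>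
        (\<forall>(l, P)\<in>\<P>. y \<in> P \<longrightarrow> norm (U (localize f (star k Q)) y)
            \<le> norm (U (localize f (star l P)) y) + C1 * star_mean f (k, Q) + C1 * star_mean f (l, P)))" ..
    note r1 = conjunct1[OF raw] and t1 = conjunct2[OF raw]
    note r2 = conjunct1[OF t1] and t2 = conjunct2[OF t1]
    note r3 = conjunct1[OF t2] and t3 = conjunct2[OF t2]
    have P2: "l < k \<and> (\<exists>z. P = dcube s l z) \<and> P \<subseteq> Q" if "(l, P) \<in> \<P>" for l P using r2 that by blast
    have P3: "p = p'" if "p \<in> \<P>" "p' \<in> \<P>" "snd p \<inter> snd p' \<noteq> {}" for p p' using r3 that by blast
    note \<P> = r1 P2 P3 conjunct1[OF t3] conjunct2[OF t3]
    have Pb: "snd p \<in> sets borel" if "p \<in> \<P>" for p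
    proof -
      have "(fst p, snd p) \<in> \<P>" using that by simp
      from \<P>(2)[OF this] obtain z where "snd p = dcube s (fst p) z" by blast
      thus ?thesis by (simp add: dcube_measure)
    qed
    have fin\<P>: "emeasure lborel (\<Union>p\<in>\<P>. snd p) < \<infinity>" using le_less_trans[OF \<P>(4)] by simp
    have e0: "0 < ennreal ((3/4) ^ Suc N / 3 * V0)" using V0 by simp
    obtain \<P>0 where \<P>0: "finite \<P>0" "\<P>0 \<subseteq> \<P>" "emeasure lborel (\<Union>p\<in>\<P>-\<P>0. snd p) < ennreal ((3/4) ^ Suc N / 3 * V0)"
      by (rule finite_subfamily_small_remainder[where P = snd, OF \<P>(1) Pb \<P>(3) fin\<P> e0]) (assumption | rule that)+
    define good where "good = (\<lambda>p (FZ :: (int \<times> (real^'n) set) set \<times> (real^'n) set). case FZ of (F, Z) \<Rightarrow> finite F \<and> (\<forall>(l, P)\<in>F. l \<le> fst p \<and> (\<exists>z. P = dcube s l z)) \<and>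
      (\<forall>V\<in>sets borel. (\<Sum>p\<in>F. if snd p \<subseteq> V then emeasure lborel (snd p) else 0) \<le> 2 * emeasure lborel (V \<inter> snd p)) \<and>
      Z \<in> sets borel \<and> emeasure lborel Z \<le> ennreal ((3/4) ^ N * (2 powi (fst p)) ^ n) \<and>
      (AE y in lborel. y \<in> snd p \<and> y \<notin> Z \<longrightarrow>
        norm (U (localize f (star (fst p) (snd p))) y) + C1 * star_mean f p \<le> 2 * C1 * (\<Sum>p\<in>F. star_mean f p * indicator (snd p) y)))"
    have "\<forall>p\<in>\<P>0. \<exists>FZ. good p FZ"
    proof
      fix p assume "p \<in> \<P>0"
      hence "(fst p, snd p) \<in> \<P>" using \<P>0(2) by auto
      then obtain z where z: "snd p = dcube s (fst p) z" using \<P>(2) by blast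
      have pp: "p = (fst p, dcube s (fst p) z)" using z by (metis prod.collapse)
      from Suc.IH[of "fst p" z] obtain F Z where "good p (F, Z)"
        unfolding good_def prod.case z[symmetric] prod.collapse by (elim exE)
      thus "\<exists>FZ. good p FZ" by (rule exI)
    qed
    from bchoice[OF this] obtain FZ where FZ: "\<And>p. p \<in> \<P>0 \<Longrightarrow> good p (FZ p)" by blast
    define F where "F = (\<lambda>p. fst (FZ p))"
    define Z where "Z = (\<lambda>p. snd (FZ p))"
    have G: "good p (F p, Z p)" if "p \<in> \<P>0" for p using FZ[OF that] by (simp add: F_def Z_def)
    note G0 = G[unfolded good_def prod.case]
    note G1 = conjunct2[OF G0]
    note G2 = conjunct2[OF G1]
    note G3 = conjunct2[OF G2]
    note G4 = conjunct2[OF G3]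
    note Ffin = conjunct1[OF G0] and Zb = conjunct1[OF G3] and Zm = conjunct1[OF G4] and Fdom = conjunct2[OF G4]
    have Flev: "l \<le> fst p \<and> (\<exists>z. P = dcube s l z)" if "p \<in> \<P>0" "(l, P) \<in> F p" for p l P
      using conjunct1[OF G1[OF that(1)]] that(2) by blast
    have Fcar: "(\<Sum>p\<in>F p. if snd p \<subseteq> V then emeasure lborel (snd p) else 0) \<le> 2 * emeasure lborel (V \<inter> snd p)"
      if "p \<in> \<P>0" "V \<in> sets borel" for p V
      using conjunct1[OF G2[OF that(1)]] that(2) by (rule bspec)
    \<comment> \<open>The new family: the cube itself and the families of the retained stopping cubes.\<close>
    define F' where "F' = insert (k, Q) (\<Union>p\<in>\<P>0. F p)"
    define Z' where "Z' = (\<Union>p\<in>\<P>0. Z p) \<union> (\<Union>p\<in>\<P>-\<P>0. snd p)"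
    have F'fin: "finite F'" unfolding F'_def using Ffin \<P>0(1) by simp
    have klt: "fst p < k" if "p \<in> \<P>" for p using \<P>(2)[of "fst p" "snd p"] that by simp
    have kQ: "(k, Q) \<notin> F p" if "p \<in> \<P>0" for p
      using Flev[OF that, of k Q] klt[of p] \<P>0(2) that by fastforce
    have lev: "l \<le> k \<and> (\<exists>z. P = dcube s l z)" if lP: "(l, P) \<in> F'" for l P
    proof (cases "(l, P) = (k, Q)")
      case True thus ?thesis by (auto simp: Q_def)
    next
      case False
      then obtain p where p: "p \<in> \<P>0" "(l, P) \<in> F p" using lP by (auto simp: F'_def)
      thus ?thesis using Flev[OF p] klt[of p] \<P>0(2) by fastforce
    qed
    have volP: "emeasure lborel (snd p) = ennreal ((2 powi (fst p)) ^ n)" if p: "p \<in> \<P>" for p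
    proof -
      have "(fst p, snd p) \<in> \<P>" using p by simp
      then obtain z where "snd p = dcube s (fst p) z" using \<P>(2) by blast
      thus ?thesis by (simp add: dcube_measure n_def)
    qed
    have dj: "disjoint_family_on snd \<P>0" unfolding disjoint_family_on_def using \<P>(3) \<P>0(2) by blast
    have sum\<P>0: "(\<Sum>p\<in>\<P>0. emeasure lborel (V \<inter> snd p)) = emeasure lborel (\<Union>p\<in>\<P>0. V \<inter> snd p)" if V: "V \<in> sets borel" for V
    proof (rule sum_emeasure)
      show "(\<lambda>p. V \<inter> snd p) ` \<P>0 \<subseteq> sets lborel" using V Pb \<P>0(2) by auto
      show "disjoint_family_on (\<lambda>p. V \<inter> snd p) \<P>0" using dj unfolding disjoint_family_on_def by blast
    qed (rule \<P>0(1))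
    have car: "(\<Sum>p\<in>F'. if snd p \<subseteq> V then emeasure lborel (snd p) else 0) \<le> 2 * emeasure lborel (V \<inter> Q)" if V: "V \<in> sets borel" for V
    proof -
      define h where "h = (\<lambda>p :: int \<times> (real^'n) set. if snd p \<subseteq> V then emeasure lborel (snd p) else 0)"
      have "sum h F' \<le> h (k, Q) + sum h (\<Union>p\<in>\<P>0. F p)"
        unfolding F'_def using Ffin \<P>0(1) kQ by (subst sum.insert) auto
      also have "\<dots> \<le> h (k, Q) + (\<Sum>p\<in>\<P>0. sum h (F p))"
        by (intro add_left_mono sum_UN_le_ennreal \<P>0(1) Ffin)
      also have "\<dots> \<le> h (k, Q) + (\<Sum>p\<in>\<P>0. 2 * emeasure lborel (V \<inter> snd p))"
        unfolding h_def by (intro add_left_mono sum_mono Fcar V)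
      also have "\<dots> = h (k, Q) + 2 * emeasure lborel (\<Union>p\<in>\<P>0. V \<inter> snd p)"
        using sum\<P>0[OF V] by (simp add: sum_distrib_left[symmetric])
      also have "\<dots> \<le> 2 * emeasure lborel (V \<inter> Q)"
      proof (cases "Q \<subseteq> V")
        case True
        have "(\<Union>p\<in>\<P>. snd p) \<in> sets borel" using Pb \<P>(1) by (intro sets.countable_UN'') auto
        hence "emeasure lborel (\<Union>p\<in>\<P>0. V \<inter> snd p) \<le> emeasure lborel (\<Union>p\<in>\<P>. snd p)"
          using \<P>0(2) by (intro emeasure_mono) auto
        hence "2 * emeasure lborel (\<Union>p\<in>\<P>0. V \<inter> snd p) \<le> 2 * ennreal (1/2 * V0)"
          using \<P>(4) by (intro mult_left_mono) (auto intro: order_trans)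
        also have "2 * ennreal (1/2 * V0) = ennreal V0"
        proof -
          have "ennreal 2 * ennreal (1/2 * V0) = ennreal (2 * (1/2 * V0))" using V0 by (intro ennreal_mult[symmetric]) auto
          thus ?thesis by simp
        qed
        finally have "h (k, Q) + 2 * emeasure lborel (\<Union>p\<in>\<P>0. V \<inter> snd p) \<le> ennreal V0 + ennreal V0"
          unfolding h_def using True Qm by (intro add_mono) auto
        also have "\<dots> = 2 * emeasure lborel (V \<inter> Q)"
          using True Qm by (simp add: Int_absorb1 mult_2)
        finally show ?thesis .
      next
        case False
        have PQ: "snd p \<subseteq> Q" if "p \<in> \<P>0" for p using \<P>(2)[of "fst p" "snd p"] \<P>0(2) that by auto
        have "emeasure lborel (\<Union>p\<in>\<P>0. V \<inter> snd p) \<le> emeasure lborel (V \<inter> Q)"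
          using V Qb PQ by (intro emeasure_mono) auto
        thus ?thesis using False by (simp add: h_def mult_left_mono)
      qed
      finally show ?thesis unfolding h_def .
    qed
    have Z'b: "Z' \<in> sets borel"
      unfolding Z'_def using Zb \<P>0(1) \<P>(1) Pb by (intro sets.Un sets.finite_UN sets.countable_UN'') auto
    have Z'm: "emeasure lborel Z' \<le> ennreal ((3/4) ^ Suc N * V0)"
    proof -
      have b1: "(\<Union>p\<in>\<P>0. Z p) \<in> sets lborel" using Zb \<P>0(1) by auto
      have b2: "(\<Union>p\<in>\<P>-\<P>0. snd p) \<in> sets lborel" using Pb \<P>(1) by (auto intro!: sets.countable_UN'')
      have "emeasure lborel Z' \<le> emeasure lborel (\<Union>p\<in>\<P>0. Z p) + emeasure lborel (\<Union>p\<in>\<P>-\<P>0. snd p)"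
        unfolding Z'_def by (rule emeasure_subadditive[OF b1 b2])
      also have "\<dots> \<le> (\<Sum>p\<in>\<P>0. emeasure lborel (Z p)) + ennreal ((3/4) ^ Suc N / 3 * V0)"
        using Zb \<P>0 by (intro add_mono emeasure_subadditive_finite) auto
      also have "(\<Sum>p\<in>\<P>0. emeasure lborel (Z p)) \<le> (\<Sum>p\<in>\<P>0. ennreal ((3/4) ^ N) * emeasure lborel (UNIV \<inter> snd p))"
      proof (rule sum_mono)
        fix p assume "p \<in> \<P>0"
        hence "emeasure lborel (snd p) = ennreal ((2 powi (fst p)) ^ n)" using volP \<P>0(2) by blast
        thus "emeasure lborel (Z p) \<le> ennreal ((3/4) ^ N) * emeasure lborel (UNIV \<inter> snd p)"
          using Zm[OF \<open>p \<in> \<P>0\<close>] by (simp add: ennreal_mult)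
      qed
      also have "\<dots> = ennreal ((3/4) ^ N) * emeasure lborel (\<Union>p\<in>\<P>0. UNIV \<inter> snd p)"
        using sum\<P>0[of UNIV] by (simp only: sum_distrib_left[symmetric] sets.top space_borel[symmetric])
      also have "\<dots> \<le> ennreal ((3/4) ^ N) * ennreal (1/2 * V0)"
      proof (rule mult_left_mono)
        have "(\<Union>p\<in>\<P>. snd p) \<in> sets borel" using Pb \<P>(1) by (intro sets.countable_UN'') auto
        hence "emeasure lborel (\<Union>p\<in>\<P>0. UNIV \<inter> snd p) \<le> emeasure lborel (\<Union>p\<in>\<P>. snd p)"
          using \<P>0(2) by (intro emeasure_mono) auto
        thus "emeasure lborel (\<Union>p\<in>\<P>0. UNIV \<inter> snd p) \<le> ennreal (1/2 * V0)" using \<P>(4) by (rule order_trans)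
      qed simp
      also have "\<dots> = ennreal ((3/4) ^ N * (1/2 * V0))" using V0 by (intro ennreal_mult[symmetric]) auto
      also have "\<dots> + ennreal ((3/4) ^ Suc N / 3 * V0) = ennreal ((3/4) ^ N * (1/2 * V0) + (3/4) ^ Suc N / 3 * V0)"
        using V0 by (intro ennreal_plus[symmetric]) auto
      also have "(3/4) ^ N * (1/2 * V0) + (3/4) ^ Suc N / 3 * V0 = (3/4) ^ Suc N * V0" by (simp add: algebra_simps)
      finally show ?thesis by (simp add: add_right_mono)
    qed
    have "AE y in lborel. \<forall>p\<in>\<P>0. y \<in> snd p \<and> y \<notin> Z p \<longrightarrow>
        norm (U (localize f (star (fst p) (snd p))) y) + C1 * star_mean f p \<le> 2 * C1 * (\<Sum>p\<in>F p. star_mean f p * indicator (snd p) y)"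
      by (intro AE_finite_allI \<P>0(1) Fdom)
    with \<P>(5) have dom: "AE y in lborel. y \<in> Q \<and> y \<notin> Z' \<longrightarrow>
        norm (U (localize f (star k Q)) y) + C1 * star_mean f (k, Q) \<le> 2 * C1 * (\<Sum>p\<in>F'. star_mean f p * indicator (snd p) y)"
    proof eventually_elim
      case (elim y)
      define h where "h = (\<lambda>p. star_mean f p * indicator (snd p) y)"
      have h0: "h p \<ge> 0" for p unfolding h_def using star_mean_nonneg[of f "fst p" "snd p"] by simp
      show ?case
      proof
        assume y: "y \<in> Q \<and> y \<notin> Z'"
        have hQ: "h (k, Q) = star_mean f (k, Q)" using y by (simp add: h_def)
        show "norm (U (localize f (star k Q)) y) + C1 * star_mean f (k, Q) \<le> 2 * C1 * (\<Sum>p\<in>F'. star_mean f p * indicator (snd p) y)"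
        proof (cases "\<exists>p\<in>\<P>. y \<in> snd p")
          case False
          hence "norm (U (localize f (star k Q)) y) \<le> C1 * star_mean f (k, Q)" using elim(1) y by blast
          hence "norm (U (localize f (star k Q)) y) + C1 * star_mean f (k, Q) \<le> 2 * C1 * h (k, Q)" unfolding hQ by simp
          also have "\<dots> \<le> 2 * C1 * sum h F'"
            using C1 h0 F'fin by (intro mult_left_mono member_le_sum) (auto simp: F'_def)
          finally show ?thesis by (simp add: h_def)
        next
          case True
          then obtain p where p: "p \<in> \<P>" "y \<in> snd p" by blast
          have p0: "p \<in> \<P>0" using p y by (auto simp: Z'_def)
          have yZ: "y \<notin> Z p" using p0 y by (auto simp: Z'_def)
          have "norm (U (localize f (star k Q)) y) \<le> norm (U (localize f (star (fst p) (snd p))) y) + C1 * star_mean f (k, Q) + C1 * star_mean f p"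
            using elim(1) y p by (metis (no_types, lifting) case_prodD prod.collapse)
          moreover have "norm (U (localize f (star (fst p) (snd p))) y) + C1 * star_mean f p \<le> 2 * C1 * sum h (F p)"
            using elim(2) p0 p(2) yZ unfolding h_def by blast
          ultimately have "norm (U (localize f (star k Q)) y) + C1 * star_mean f (k, Q) \<le> 2 * C1 * (h (k, Q) + sum h (F p))"
            unfolding hQ by (simp add: algebra_simps)
          also have "h (k, Q) + sum h (F p) = sum h (insert (k, Q) (F p))"
            using Ffin[OF p0] kQ[OF p0] by simp
          also have "\<dots> \<le> sum h F'"
            using F'fin p0 h0 by (intro sum_mono2) (auto simp: F'_def)
          finally show ?thesis using C1 by (simp add: h_def)
        qed
      qed
    qed
    show ?case
      unfolding Q_def[symmetric] V0_def[symmetric]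
    proof (rule exI[of _ F'], rule exI[of _ Z'], intro conjI)
      show "\<forall>(l, P)\<in>F'. l \<le> k \<and> (\<exists>z. P = dcube s l z)" using lev by blast
    qed (rule F'fin Z'b Z'm dom | (rule ballI, rule car, assumption))+
  qed
  show ?thesis
  proof (rule exI[of _ "2 * C1"], intro conjI allI impI)
    fix f :: "'m \<Rightarrow> real^'n \<Rightarrow> complex" and s k x N
    assume f: "\<forall>j. bbs (f j)"
    have fb: "bbs (f j)" for j using f by blast
    have "\<exists>F Z. finite F \<and> (\<forall>(l, P)\<in>F. l \<le> k \<and> (\<exists>z. P = dcube s l z)) \<and>
      (\<forall>V\<in>sets borel. (\<Sum>p\<in>F. if snd p \<subseteq> V then emeasure lborel (snd p) else 0) \<le> 2 * emeasure lborel (V \<inter> dcube s k x)) \<and>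
      Z \<in> sets borel \<and> emeasure lborel Z \<le> ennreal ((3/4) ^ N * (2 powi k) ^ n) \<and>
      (AE y in lborel. y \<in> dcube s k x \<and> y \<notin> Z \<longrightarrow>
        norm (U (localize f (star k (dcube s k x))) y) + C1 * star_mean f (k, dcube s k x) \<le> 2 * C1 * (\<Sum>p\<in>F. star_mean f p * indicator (snd p) y))"
      by (rule main[OF fb])
    then obtain F Z where raw: "finite F \<and> (\<forall>(l, P)\<in>F. l \<le> k \<and> (\<exists>z. P = dcube s l z)) \<and>
      (\<forall>V\<in>sets borel. (\<Sum>p\<in>F. if snd p \<subseteq> V then emeasure lborel (snd p) else 0) \<le> 2 * emeasure lborel (V \<inter> dcube s k x)) \<and>
      Z \<in> sets borel \<and> emeasure lborel Z \<le> ennreal ((3/4) ^ N * (2 powi k) ^ n) \<and>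
      (AE y in lborel. y \<in> dcube s k x \<and> y \<notin> Z \<longrightarrow>
        norm (U (localize f (star k (dcube s k x))) y) + C1 * star_mean f (k, dcube s k x) \<le> 2 * C1 * (\<Sum>p\<in>F. star_mean f p * indicator (snd p) y))"
      by (elim exE) (rule that)
    note t1 = conjunct2[OF raw]
    note t2 = conjunct2[OF t1]
    note t3 = conjunct2[OF t2]
    note t4 = conjunct2[OF t3]
    note FZ = conjunct1[OF raw] conjunct1[OF t1] conjunct1[OF t2] conjunct1[OF t3] conjunct1[OF t4] conjunct2[OF t4]
    have "0 \<le> C1 * star_mean f (k, dcube s k x)" using C1 star_mean_nonneg[of f k "dcube s k x"] by simp
    with FZ(6) have "AE y in lborel. y \<in> dcube s k x \<and> y \<notin> Z \<longrightarrow>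
        norm (U (localize f (star k (dcube s k x))) y) \<le> 2 * C1 * (\<Sum>p\<in>F. star_mean f p * indicator (snd p) y)"
      by (auto elim!: eventually_mono)
    with FZ(1-5) show "\<exists>F Z. finite F \<and> (\<forall>(l, P)\<in>F. l \<le> k \<and> (\<exists>z. P = dcube s l z)) \<and>
      (\<forall>V\<in>sets borel. (\<Sum>p\<in>F. if snd p \<subseteq> V then emeasure lborel (snd p) else 0) \<le> 2 * emeasure lborel (V \<inter> dcube s k x)) \<and>
      Z \<in> sets borel \<and> emeasure lborel Z \<le> ennreal ((3/4) ^ N * (2 powi k) ^ CARD('n)) \<and>
      (AE y in lborel. y \<in> dcube s k x \<and> y \<notin> Z \<longrightarrow>
        norm (U (localize f (star k (dcube s k x))) y) \<le> 2 * C1 * (\<Sum>p\<in>F. star_mean f p * indicator (snd p) y))"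
      unfolding n_def by (intro exI[of _ F] exI[of _ Z] conjI)
  qed (use C1 in simp)
qed

end

section \<open>Shifted grids and sparse families\<close>

lemma not_three_dvd_two_power: "\<not> (3::int) dvd 2 ^ d"
proof
  assume "(3::int) dvd 2 ^ d"
  hence "(3::int) dvd 2" by (rule prime_dvd_power_int[rotated]) simp
  thus False by simp
qed

text \<open>
  If \<open>S\<close> met a cell boundary in both grids, two numbers \<open>2\<^sup>l a\<close> and \<open>2\<^sup>l b + 2\<^sup>K / 3\<close> would be closer than
  \<open>2\<^sup>l / 3\<close>. Multiplied by \<open>3 / 2\<^sup>l\<close> this says that the integers \<open>3 (a - b)\<close> and \<open>2\<^sup>K\<^sup>-\<^sup>l\<close> differ by less than one, but three does
  not divide a power of two. The
  shift by \<open>2\<^sup>K / 3\<close> serves all levels \<open>l \<le> K\<close> at once, which is why \<open>K\<close> is a fixed top level.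
\<close>

lemma one_third_trick_real:
  fixes S :: "real set"
  assumes lK: "l \<le> K" and S: "\<And>y y'. y \<in> S \<Longrightarrow> y' \<in> S \<Longrightarrow> y - y' \<le> 2 powi l / 3"
  shows "(\<forall>y\<in>S. \<forall>y'\<in>S. \<lfloor>(y - 0) / 2 powi l\<rfloor> = \<lfloor>(y' - 0) / 2 powi l\<rfloor>) \<or>
         (\<forall>y\<in>S. \<forall>y'\<in>S. \<lfloor>(y - 2 powi K / 3) / 2 powi l\<rfloor> = \<lfloor>(y' - 2 powi K / 3) / 2 powi l\<rfloor>)"
proof (rule ccontr)
  assume no: "\<not> ?thesis"
  have p: "(2::real) powi l > 0" by simp
  have sep: "\<exists>y1\<in>S. \<exists>y2\<in>S. \<exists>m::int. y1 < t + 2 powi l * m \<and> t + 2 powi l * m \<le> y2"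
    if ex: "\<exists>y\<in>S. \<exists>y'\<in>S. \<lfloor>(y - t) / 2 powi l\<rfloor> \<noteq> \<lfloor>(y' - t) / 2 powi l\<rfloor>" for t
  proof -
    have "\<exists>y1\<in>S. \<exists>y2\<in>S. \<lfloor>(y1 - t) / 2 powi l\<rfloor> < \<lfloor>(y2 - t) / 2 powi l\<rfloor>"
      using ex by (metis linorder_neqE)
    then obtain y1 y2 where y: "y1 \<in> S" "y2 \<in> S" "\<lfloor>(y1 - t) / 2 powi l\<rfloor> < \<lfloor>(y2 - t) / 2 powi l\<rfloor>" by blast
    define m where "m = \<lfloor>(y2 - t) / 2 powi l\<rfloor>"
    have "(y1 - t) / 2 powi l < m" using y(3) unfolding m_def by (simp add: floor_less_iff)
    hence 1: "y1 < t + 2 powi l * m" using p by (simp add: field_simps)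
    have "m \<le> (y2 - t) / 2 powi l" unfolding m_def by simp
    hence 2: "t + 2 powi l * m \<le> y2" using p by (simp add: field_simps)
    show ?thesis using y(1,2) 1 2 by blast
  qed
  obtain y1 y2 and m :: int where y: "y1 \<in> S" "y2 \<in> S" "y1 < 0 + 2 powi l * m" "0 + 2 powi l * m \<le> y2"
    using sep[of 0] no by blast
  obtain z1 z2 and m' :: int where z: "z1 \<in> S" "z2 \<in> S" "z1 < 2 powi K / 3 + 2 powi l * m'" "2 powi K / 3 + 2 powi l * m' \<le> z2"
    using sep[of "2 powi K / 3"] no by blast
  define d where "d = nat (K - l)"
  have K: "(2::real) powi K = 2 powi l * 2 ^ d"
  proof -
    have "K = l + int d" using lK by (simp add: d_def)
    thus ?thesis by (simp add: power_int_add)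
  qed
  have "2 powi l * m - (2 powi K / 3 + 2 powi l * m') < 2 powi l / 3"
    using y(4) z(3) S[OF y(2) z(1)] by linarith
  hence "2 powi l * (3 * real_of_int m - 2 ^ d - 3 * real_of_int m') < 2 powi l * 1"
    unfolding K by (simp add: field_simps)
  hence 1: "3 * real_of_int m - 2 ^ d - 3 * real_of_int m' < 1" using p by (simp only: mult_less_cancel_left_pos)
  have "(2 powi K / 3 + 2 powi l * m') - 2 powi l * m < 2 powi l / 3"
    using y(3) z(4) S[OF z(2) y(1)] by linarith
  hence "2 powi l * (2 ^ d + 3 * real_of_int m' - 3 * real_of_int m) < 2 powi l * 1"
    unfolding K by (simp add: field_simps)
  hence 2: "2 ^ d + 3 * real_of_int m' - 3 * real_of_int m < 1" using p by (simp only: mult_less_cancel_left_pos)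
  have "real_of_int (3 * m - 2 ^ d - 3 * m') < real_of_int 1" "real_of_int (2 ^ d + 3 * m' - 3 * m) < real_of_int 1"
    using 1 2 by simp_all
  hence "3 * m - 2 ^ d - 3 * m' < 1" "2 ^ d + 3 * m' - 3 * m < 1" by (simp_all only: of_int_less_iff)
  moreover define c :: int where "c = 2 ^ d"
  ultimately have "3 * m - c - 3 * m' < 1" "c + 3 * m' - 3 * m < 1" by simp_all
  hence "c = 3 * (m - m')" by presburger
  hence "2 ^ d = 3 * (m - m')" by (simp add: c_def)
  thus False using not_three_dvd_two_power[of d] by simp
qed

text \<open>
  The set \<open>B\<close> holds the coordinates that are shifted, giving \<open>2\<^sup>n\<close> grids.
\<close>

definition third_shift :: "int \<Rightarrow> 'n set \<Rightarrow> real^'n::finite" where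
  "third_shift K B = (\<chi> i. if i \<in> B then 2 powi K / 3 else 0)"

text \<open>
  The side of \<open>P*\<close> is \<open>(4 n + 1) 2\<^sup>l\<close>, which is at most a third of \<open>2\<^sup>l\<^sup>+\<^sup>\<kappa>\<close>. The one-third trick is applied
  in each coordinate separately.
\<close>

lemma star_in_third_grid:
  fixes s :: "real^'n::finite"
  assumes lK: "l + int \<kappa> \<le> K" and \<kappa>: "3 * (4 * real CARD('n) + 1) \<le> 2 ^ \<kappa>"
  shows "\<exists>B w. star l (dcube s l z) \<subseteq> dcube (third_shift K B) (l + int \<kappa>) w"
proof -
  let ?S = "star l (dcube s l z)"
  have diff: "y $ i - y' $ i \<le> 2 powi (l + int \<kappa>) / 3" if yy: "y \<in> ?S" "y' \<in> ?S" for y y' i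
  proof -
    obtain a where a: "a \<in> dcube s l z" "\<bar>y $ i - a $ i\<bar> < 2 * real CARD('n) * 2 powi l" using yy by (auto simp: star_def)
    obtain a' where a': "a' \<in> dcube s l z" "\<bar>y' $ i - a' $ i\<bar> < 2 * real CARD('n) * 2 powi l" using yy by (auto simp: star_def)
    have "\<bar>a $ i - a' $ i\<bar> < 2 powi l" by (rule dcube_component_dist[OF a(1) a'(1)])
    hence "y $ i - y' $ i \<le> (4 * real CARD('n) + 1) * 2 powi l" using a(2) a'(2) by (simp add: algebra_simps abs_less_iff)
    also have "\<dots> \<le> (2 ^ \<kappa> / 3) * 2 powi l" using \<kappa> by (intro mult_right_mono) auto
    also have "\<dots> = 2 powi (l + int \<kappa>) / 3" by (simp add: power_int_add)
    finally show ?thesis .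
  qed
  define B where "B = {i. \<not> (\<forall>y\<in>?S. \<forall>y'\<in>?S. \<lfloor>(y $ i - 0) / 2 powi (l + int \<kappa>)\<rfloor> = \<lfloor>(y' $ i - 0) / 2 powi (l + int \<kappa>)\<rfloor>)}"
  have "\<lfloor>(y $ i - third_shift K B $ i) / 2 powi (l + int \<kappa>)\<rfloor> = \<lfloor>(y' $ i - third_shift K B $ i) / 2 powi (l + int \<kappa>)\<rfloor>"
    if "y \<in> ?S" "y' \<in> ?S" for y y' i
  proof (cases "i \<in> B")
    case False
    hence "\<forall>y\<in>?S. \<forall>y'\<in>?S. \<lfloor>(y $ i - 0) / 2 powi (l + int \<kappa>)\<rfloor> = \<lfloor>(y' $ i - 0) / 2 powi (l + int \<kappa>)\<rfloor>"
      unfolding B_def by blast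
    hence "\<lfloor>(y $ i - 0) / 2 powi (l + int \<kappa>)\<rfloor> = \<lfloor>(y' $ i - 0) / 2 powi (l + int \<kappa>)\<rfloor>" using that by blast
    moreover have "third_shift K B $ i = 0" using False by (simp add: third_shift_def)
    ultimately show ?thesis by simp
  next
    case True
    have "(\<forall>y\<in>(\<lambda>y. y $ i) ` ?S. \<forall>y'\<in>(\<lambda>y. y $ i) ` ?S. \<lfloor>(y - 0) / 2 powi (l + int \<kappa>)\<rfloor> = \<lfloor>(y' - 0) / 2 powi (l + int \<kappa>)\<rfloor>) \<or>
         (\<forall>y\<in>(\<lambda>y. y $ i) ` ?S. \<forall>y'\<in>(\<lambda>y. y $ i) ` ?S. \<lfloor>(y - 2 powi K / 3) / 2 powi (l + int \<kappa>)\<rfloor> = \<lfloor>(y' - 2 powi K / 3) / 2 powi (l + int \<kappa>)\<rfloor>)"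
      by (rule one_third_trick_real[OF lK]) (use diff in auto)
    hence "\<forall>y\<in>(\<lambda>y. y $ i) ` ?S. \<forall>y'\<in>(\<lambda>y. y $ i) ` ?S. \<lfloor>(y - 2 powi K / 3) / 2 powi (l + int \<kappa>)\<rfloor> = \<lfloor>(y' - 2 powi K / 3) / 2 powi (l + int \<kappa>)\<rfloor>"
      using True unfolding B_def by blast
    hence "\<lfloor>(y $ i - 2 powi K / 3) / 2 powi (l + int \<kappa>)\<rfloor> = \<lfloor>(y' $ i - 2 powi K / 3) / 2 powi (l + int \<kappa>)\<rfloor>" using that by blast
    moreover have "third_shift K B $ i = 2 powi K / 3" using True by (simp add: third_shift_def)
    ultimately show ?thesis by (simp only:)
  qed
  moreover have "z \<in> ?S" using star_superset[of "dcube s l z" l] by auto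
  ultimately have "?S \<subseteq> dcube (third_shift K B) (l + int \<kappa>) z" unfolding dcube_def by blast
  thus ?thesis by blast
qed

definition depth :: "'a set set \<Rightarrow> 'a set \<Rightarrow> nat" where
  "depth \<G> G = card {H \<in> \<G>. G \<subset> H}"

lemma depth_strict:
  assumes "finite \<G>" "H \<in> \<G>" "G \<subset> H" shows "depth \<G> H < depth \<G> G"
  unfolding depth_def
proof (rule psubset_card_mono)
  show "finite {H \<in> \<G>. G \<subset> H}" using assms by simp
  show "{K \<in> \<G>. H \<subset> K} \<subset> {K \<in> \<G>. G \<subset> K}"
  proof (rule psubsetI)
    show "{K \<in> \<G>. H \<subset> K} \<subseteq> {K \<in> \<G>. G \<subset> K}"
    proof
      fix K assume "K \<in> {K \<in> \<G>. H \<subset> K}"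
      thus "K \<in> {K \<in> \<G>. G \<subset> K}" using psubset_trans[OF assms(3), of K] by simp
    qed
    show "{K \<in> \<G>. H \<subset> K} \<noteq> {K \<in> \<G>. G \<subset> K}"
    proof
      assume eq: "{K \<in> \<G>. H \<subset> K} = {K \<in> \<G>. G \<subset> K}"
      have "H \<in> {K \<in> \<G>. G \<subset> K}" using assms(2,3) by simp
      hence "H \<in> {K \<in> \<G>. H \<subset> K}" unfolding eq .
      thus False by simp
    qed
  qed
qed

context
  fixes \<G> :: "(real^'n::finite) set set" and D :: "(real^'n) set set" and Lam :: nat
  assumes fin: "finite \<G>" and sub: "\<G> \<subseteq> D" and D: "dyadic_grid D"
    and carleson: "\<And>G0. G0 \<in> \<G> \<Longrightarrow> (\<Sum>G\<in>\<G>. if G \<subseteq> G0 then emeasure lborel G else 0) \<le> ennreal (real Lam) * emeasure lborel G0"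
    and Lam: "Lam > 0"
begin

lemma nested: "G \<in> \<G> \<Longrightarrow> H \<in> \<G> \<Longrightarrow> G \<inter> H \<noteq> {} \<Longrightarrow> G \<subseteq> H \<or> H \<subset> G"
proof -
  assume G: "G \<in> \<G>" "H \<in> \<G>" "G \<inter> H \<noteq> {}"
  note d = D[unfolded dyadic_grid_def, THEN conjunct2, THEN conjunct1]
  have "G \<inter> H \<in> {G, H, {}}" using bspec[OF bspec[OF d subsetD[OF sub G(1)]] subsetD[OF sub G(2)]] .
  hence "G \<inter> H = G \<or> G \<inter> H = H" using G(3) by simp
  thus ?thesis
  proof
    assume "G \<inter> H = G"
    thus ?thesis by (simp add: Int_absorb2 inf.absorb_iff1)
  next
    assume "G \<inter> H = H"
    hence "H \<subseteq> G" by (simp add: inf.absorb_iff2)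
    thus ?thesis by (cases "H = G") auto
  qed
qed

lemma grid_cube: "G \<in> \<G> \<Longrightarrow> G \<in> sets borel \<and> G \<noteq> {}"
proof -
  assume "G \<in> \<G>"
  note d = D[unfolded dyadic_grid_def, THEN conjunct1]
  obtain a k where ak: "G = cube a (2 powi k)" using bspec[OF d subsetD[OF sub \<open>G \<in> \<G>\<close>]] by blast
  have "a \<in> cube a (2 powi k)" by (simp add: cube_def)
  thus ?thesis using ak cube_measure(1)[of "2 powi k" a] by auto
qed

text \<open>
  The strict supersets of \<open>G\<close> form a chain, so their depths are exactly \<open>0, \<dots>, depth G - 1\<close>.
\<close>

lemma ancestor_at_depth:
  assumes G: "G \<in> \<G>" and e: "e \<le> depth \<G> G"
  shows "\<exists>H\<in>\<G>. G \<subseteq> H \<and> depth \<G> H = e"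
proof (cases "e = depth \<G> G")
  case True thus ?thesis using G by blast
next
  case False
  define A where "A = {H \<in> \<G>. G \<subset> H}"
  have Ae: "card A = depth \<G> G" by (simp add: A_def depth_def)
  have finA: "finite A" using fin by (simp add: A_def)
  have inj: "inj_on (depth \<G>) A"
  proof (rule inj_onI)
    fix H H' assume H: "H \<in> A" "H' \<in> A" "depth \<G> H = depth \<G> H'"
    have "H \<inter> H' \<noteq> {}" using H grid_cube[OF G] by (auto simp: A_def)
    hence "H \<subseteq> H' \<or> H' \<subset> H" using H nested by (auto simp: A_def)
    moreover have "\<not> H' \<subset> H" using depth_strict[OF fin, of H H'] H by (auto simp: A_def)
    moreover have "\<not> H \<subset> H'" using depth_strict[OF fin, of H' H] H by (auto simp: A_def)
    ultimately show "H = H'" by blast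
  qed
  have sub': "depth \<G> ` A \<subseteq> {..<depth \<G> G}" using depth_strict[OF fin] by (auto simp: A_def)
  have "depth \<G> ` A = {..<depth \<G> G}"
    by (rule card_subset_eq[OF _ sub']) (auto simp: card_image[OF inj] Ae)
  hence "e \<in> depth \<G> ` A" using e False by auto
  thus ?thesis by (auto simp: A_def)
qed

text \<open>
  Every \<open>2 Lam\<close>-th generation, starting with generation \<open>i\<close>.
\<close>

definition "layer i k = {G \<in> \<G>. depth \<G> G = k * (2 * Lam) + i}"

text \<open>
  Between a cube \<open>G0\<close> of one layer and a point covered by the next layer there are at least \<open>2 Lam\<close> nested members of the
  family inside \<open>G0\<close>. The Carleson condition bounds the integral of the counting function over \<open>G0\<close> by
  \<open>Lam \<bar>G0\<bar>\<close>, so by Chebyshev's inequality the next layer fills at most half of \<open>G0\<close>.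
\<close>

lemma layer_sparse: "sparse_family (layer i)"
  unfolding sparse_family_def
proof (intro conjI allI ballI)
  fix k
  show "disjoint (layer i k)"
    unfolding disjoint_def
  proof (intro ballI impI)
    fix G H assume GH: "G \<in> layer i k" "H \<in> layer i k" "G \<noteq> H"
    show "G \<inter> H = {}"
    proof (rule ccontr)
      assume "G \<inter> H \<noteq> {}"
      hence "G \<subset> H \<or> H \<subset> G" using nested[of G H] GH by (auto simp: layer_def)
      thus False using depth_strict[OF fin, of H G] depth_strict[OF fin, of G H] GH by (auto simp: layer_def)
    qed
  qed
  show "\<Union>(layer i (Suc k)) \<subseteq> \<Union>(layer i k)"
  proof
    fix y assume "y \<in> \<Union>(layer i (Suc k))"
    then obtain G where G: "G \<in> \<G>" "depth \<G> G = Suc k * (2 * Lam) + i" "y \<in> G" by (auto simp: layer_def)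
    obtain H where "H \<in> \<G>" "G \<subseteq> H" "depth \<G> H = k * (2 * Lam) + i"
      using ancestor_at_depth[OF G(1), of "k * (2 * Lam) + i"] G(2) by auto
    thus "y \<in> \<Union>(layer i k)" using G(3) by (auto simp: layer_def)
  qed
  fix G0 assume G0: "G0 \<in> layer i k"
  hence G0': "G0 \<in> \<G>" "depth \<G> G0 = k * (2 * Lam) + i" by (auto simp: layer_def)
  define e where "e = k * (2 * Lam) + i"
  define \<Omega> where "\<Omega> = \<Union>(layer i (Suc k)) \<inter> G0"
  have \<Omega>b: "\<Omega> \<in> sets borel"
  proof -
    have "finite (layer i (Suc k))" using fin by (simp add: layer_def)
    hence "\<Union>(layer i (Suc k)) \<in> sets borel" using grid_cube by (intro sets.finite_Union) (auto simp: layer_def)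
    thus ?thesis unfolding \<Omega>_def using grid_cube[OF G0'(1)] by auto
  qed
  \<comment> \<open>The ancestors of a cube of the next layer at the \<open>2 Lam\<close> depths in between all lie inside \<open>G0\<close>.\<close>
  have count: "real (2 * Lam) \<le> (\<Sum>H\<in>\<G>. if H \<subseteq> G0 then indicator H y else 0)" if y: "y \<in> \<Omega>" for y
  proof -
    obtain G where G: "G \<in> \<G>" "depth \<G> G = Suc k * (2 * Lam) + i" "y \<in> G" "y \<in> G0" using y by (auto simp: layer_def \<Omega>_def)
    have "\<forall>j. \<exists>H. j < 2 * Lam \<longrightarrow> H \<in> \<G> \<and> G \<subseteq> H \<and> depth \<G> H = e + j"
    proof
      fix j
      show "\<exists>H. j < 2 * Lam \<longrightarrow> H \<in> \<G> \<and> G \<subseteq> H \<and> depth \<G> H = e + j"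
      proof (cases "j < 2 * Lam")
        case True
        hence "e + j \<le> depth \<G> G" using G(2) by (simp add: e_def)
        from ancestor_at_depth[OF G(1) this] show ?thesis by blast
      qed simp
    qed
    from choice[OF this] obtain h where h: "\<And>j. j < 2 * Lam \<Longrightarrow> h j \<in> \<G> \<and> G \<subseteq> h j \<and> depth \<G> (h j) = e + j" by blast
    have hG0: "h j \<subseteq> G0" if "j < 2 * Lam" for j
    proof -
      have "h j \<inter> G0 \<noteq> {}" using h[OF that] G(3,4) by blast
      hence "h j \<subseteq> G0 \<or> G0 \<subset> h j" using nested h[OF that] G0'(1) by blast
      moreover have "\<not> G0 \<subset> h j" using depth_strict[OF fin, of "h j" G0] h[OF that] G0'(2) by (auto simp: e_def)
      ultimately show ?thesis by blast
    qed
    have inj: "inj_on h {..<2 * Lam}"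
    proof (rule inj_onI)
      fix a b assume ab: "a \<in> {..<2 * Lam}" "b \<in> {..<2 * Lam}" "h a = h b"
      have "depth \<G> (h a) = e + a" using conjunct2[OF conjunct2[OF h]] ab(1) by (simp only: lessThan_iff)
      moreover have "depth \<G> (h b) = e + b" using conjunct2[OF conjunct2[OF h]] ab(2) by (simp only: lessThan_iff)
      ultimately show "a = b" using arg_cong[OF ab(3), of "depth \<G>"] by linarith
    qed
    define \<phi> :: "(real^'n) set \<Rightarrow> real" where "\<phi> = (\<lambda>H. if H \<subseteq> G0 then indicator H y else 0)"
    have \<phi>1: "\<phi> (h j) = 1" if "j < 2 * Lam" for j
    proof -
      have "y \<in> h j" using conjunct1[OF conjunct2[OF h[OF that]]] G(3) by (rule subsetD)
      thus ?thesis unfolding \<phi>_def by (simp only: hG0[OF that] if_True indicator_simps)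
    qed
    have "real (2 * Lam) = (\<Sum>j<2 * Lam. 1)" by simp
    also have "\<dots> = (\<Sum>j<2 * Lam. \<phi> (h j))" by (rule sum.cong[OF refl]) (simp only: \<phi>1 lessThan_iff)
    also have "\<dots> = sum \<phi> (h ` {..<2 * Lam})" by (simp only: sum.reindex[OF inj] o_def)
    also have "\<dots> \<le> sum \<phi> \<G>"
    proof (rule sum_mono2[OF fin])
      show "h ` {..<2 * Lam} \<subseteq> \<G>"
        using conjunct1[OF h] by (intro image_subsetI) (simp only: lessThan_iff)
      show "0 \<le> \<phi> H" for H by (simp add: \<phi>_def)
    qed
    also have "sum \<phi> \<G> = (\<Sum>H\<in>\<G>. if H \<subseteq> G0 then indicator H y else 0)" by (simp only: \<phi>_def)
    finally show ?thesis .
  qed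
  have "ennreal (real (2 * Lam)) * emeasure lborel \<Omega> = (\<integral>\<^sup>+y. ennreal (real (2 * Lam)) * indicator \<Omega> y \<partial>lborel)"
    using \<Omega>b by (simp add: nn_integral_cmult)
  also have "\<dots> \<le> (\<integral>\<^sup>+y. (\<Sum>H\<in>\<G>. if H \<subseteq> G0 then indicator H y else 0) \<partial>lborel)"
  proof (rule nn_integral_mono)
    fix y
    show "ennreal (real (2 * Lam)) * indicator \<Omega> y \<le> (\<Sum>H\<in>\<G>. if H \<subseteq> G0 then indicator H y else 0)"
    proof (cases "y \<in> \<Omega>")
      case True
      have "ennreal (real (2 * Lam)) \<le> ennreal (\<Sum>H\<in>\<G>. if H \<subseteq> G0 then indicator H y else 0)"
        by (rule ennreal_leI[OF count[OF True]])
      also have "\<dots> = (\<Sum>H\<in>\<G>. ennreal (if H \<subseteq> G0 then indicator H y else 0))" by (subst sum_ennreal) auto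
      also have "\<dots> = (\<Sum>H\<in>\<G>. if H \<subseteq> G0 then indicator H y else 0)"
        by (intro sum.cong refl) (auto simp: indicator_def)
      finally show ?thesis using True by simp
    qed simp
  qed
  also have "\<dots> = (\<Sum>H\<in>\<G>. if H \<subseteq> G0 then emeasure lborel H else 0)"
  proof (subst nn_integral_sum)
    show "(\<lambda>y. if H \<subseteq> G0 then indicator H y else (0::ennreal)) \<in> borel_measurable lborel" if "H \<in> \<G>" for H
      using grid_cube[OF that] by (cases "H \<subseteq> G0") auto
    show "(\<Sum>H\<in>\<G>. \<integral>\<^sup>+y. (if H \<subseteq> G0 then indicator H y else 0) \<partial>lborel) = (\<Sum>H\<in>\<G>. if H \<subseteq> G0 then emeasure lborel H else 0)"
      using grid_cube by (intro sum.cong refl) auto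
  qed
  also have "\<dots> \<le> ennreal (real Lam) * emeasure lborel G0" by (rule carleson[OF G0'(1)])
  finally have "ennreal (real Lam) * (2 * emeasure lborel \<Omega>) \<le> ennreal (real Lam) * emeasure lborel G0"
    by (simp add: ennreal_mult mult_ac)
  hence "2 * emeasure lborel \<Omega> \<le> emeasure lborel G0" using Lam by (subst (asm) ennreal_mult_le_mult_iff) auto
  hence "emeasure lborel \<Omega> \<le> emeasure lborel G0 / 2"
    using divide_right_mono_ennreal[of "2 * emeasure lborel \<Omega>" "emeasure lborel G0" 2] ennreal_mult_divide_eq[of 2 "emeasure lborel \<Omega>"]
    by (simp add: mult.commute)
  thus "emeasure lebesgue (\<Union>(layer i (Suc k)) \<inter> G0) \<le> emeasure lebesgue G0 / 2"
    using emeasure_lebesgue_borel[OF \<Omega>b] emeasure_lebesgue_borel[of G0] grid_cube[OF G0'(1)] unfolding \<Omega>_def by simp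
qed

text \<open>
  Each cube belongs to exactly one layer, determined by its depth modulo \<open>2 Lam\<close>.
\<close>

lemma sum_sparse_operators:
  fixes g :: "'m::finite \<Rightarrow> real^'n \<Rightarrow> ennreal"
  shows "(\<Sum>G\<in>\<G>. (\<Prod>i\<in>UNIV. average G (g i)) * indicator G x) = (\<Sum>i<2 * Lam. sparse_operator (layer i) g x)"
proof -
  define N where "N = 2 * Lam"
  have N: "N > 0" using Lam by (simp add: N_def)
  define h where "h = (\<lambda>G. (\<Prod>i\<in>UNIV. average G (g i)) * indicator G x)"
  have op: "sparse_operator (layer i) g x = (\<Sum>G\<in>{G\<in>\<G>. depth \<G> G mod N = i}. h G)" if i: "i < N" for i
  proof -
    have eq: "Sigma UNIV (layer i) = (\<lambda>G. (depth \<G> G div N, G)) ` {G\<in>\<G>. depth \<G> G mod N = i}"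
    proof (intro set_eqI iffI)
      fix kG assume "kG \<in> Sigma UNIV (layer i)"
      then obtain k G where kG: "kG = (k, G)" "G \<in> \<G>" "depth \<G> G = k * N + i" by (auto simp: layer_def N_def)
      have "depth \<G> G div N = k" "depth \<G> G mod N = i" using i kG(3) by simp_all
      thus "kG \<in> (\<lambda>G. (depth \<G> G div N, G)) ` {G\<in>\<G>. depth \<G> G mod N = i}" using kG by force
    next
      fix kG assume "kG \<in> (\<lambda>G. (depth \<G> G div N, G)) ` {G\<in>\<G>. depth \<G> G mod N = i}"
      then obtain G where G: "G \<in> \<G>" "depth \<G> G mod N = i" "kG = (depth \<G> G div N, G)" by auto
      have "depth \<G> G = depth \<G> G div N * N + i" using G(2) div_mult_mod_eq[of "depth \<G> G" N] by simp
      thus "kG \<in> Sigma UNIV (layer i)" using G by (auto simp: layer_def N_def)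
    qed
    have inj: "inj_on (\<lambda>G. (depth \<G> G div N, G)) {G\<in>\<G>. depth \<G> G mod N = i}" by (auto simp: inj_on_def)
    have "sparse_operator (layer i) g x = (\<Sum>\<^sub>\<infinity>(k, Q)\<in>Sigma UNIV (layer i). h Q)"
      by (simp add: sparse_operator_def h_def)
    also have "\<dots> = (\<Sum>(k, Q)\<in>Sigma UNIV (layer i). h Q)" unfolding eq using fin by (intro infsum_finite) auto
    also have "\<dots> = (\<Sum>G\<in>{G\<in>\<G>. depth \<G> G mod N = i}. h G)" unfolding eq by (subst sum.reindex[OF inj]) simp
    finally show ?thesis .
  qed
  have "sum h \<G> = (\<Sum>i<N. \<Sum>G\<in>{G\<in>\<G>. depth \<G> G mod N = i}. h G)"
    by (rule sum.group[symmetric]) (use fin N in auto)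
  also have "\<dots> = (\<Sum>i<N. sparse_operator (layer i) g x)" using op by (intro sum.cong) auto
  finally show ?thesis by (simp add: h_def N_def)
qed

lemma layer_operator_measurable: "sparse_operator (layer i) g \<in> borel_measurable borel"
proof -
  have inj: "inj_on snd (Sigma UNIV (layer i))" using Lam by (auto simp: inj_on_def layer_def)
  have "snd ` Sigma UNIV (layer i) \<subseteq> \<G>" by (auto simp: layer_def)
  hence "finite (Sigma UNIV (layer i))" using finite_subset[OF _ fin] finite_imageD[OF _ inj] by blast
  hence "sparse_operator (layer i) g = (\<lambda>x. \<Sum>kQ\<in>Sigma UNIV (layer i). (\<Prod>j\<in>UNIV. average (snd kQ) (g j)) * indicator (snd kQ) x)"
    by (intro ext) (simp add: sparse_operator_def case_prod_beta)
  moreover have "(\<lambda>x. \<Sum>kQ\<in>Sigma UNIV (layer i). (\<Prod>j\<in>UNIV. average (snd kQ) (g j)) * indicator (snd kQ) x) \<in> borel_measurable borel"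
  proof (rule borel_measurable_sum)
    fix kQ assume "kQ \<in> Sigma UNIV (layer i)"
    hence "snd kQ \<in> sets borel" using grid_cube[of "snd kQ"] by (auto simp: layer_def)
    thus "(\<lambda>x. (\<Prod>j\<in>UNIV. average (snd kQ) (g j)) * indicator (snd kQ) x) \<in> borel_measurable borel" by measurable
  qed
  ultimately show ?thesis by simp
qed

lemma layer_subset: "layer i k \<subseteq> D"
  using sub by (auto simp: layer_def)

end

section \<open>Domination by sparse operators\<close>

text \<open>
  Enlarge the dilate of each cube \<open>P\<close> to a cube \<open>R\<close> of a shifted grid. As \<open>\<bar>R\<bar> = 2\<^sup>\<kappa>\<^sup>n \<bar>P\<bar>\<close> and \<open>P \<subseteq> R\<close>, the packing bound
  passes to the family of the \<open>R\<close> in each grid, with constant \<open>Lam = 2 2\<^sup>\<kappa>\<^sup>n\<close>, and means over \<open>P*\<close> are at most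
  \<open>2\<^sup>\<kappa>\<^sup>n\<close> times means over \<open>R\<close>. Several \<open>P\<close> may share one \<open>R\<close>, but not two that contain the same point.
\<close>

lemma sparse_bound_of_local_family:
  fixes f :: "'m::finite \<Rightarrow> real^'n::finite \<Rightarrow> complex" and F :: "(int \<times> (real^'n) set) set"
  assumes \<kappa>: "3 * (4 * real CARD('n) + 1) \<le> 2 ^ \<kappa>" and f: "\<And>j. bbs (f j)" and fin: "finite F"
    and lev: "\<And>l P. (l, P) \<in> F \<Longrightarrow> l \<le> k \<and> (\<exists>z. P = dcube s l z)"
    and car: "\<And>V. V \<in> sets borel \<Longrightarrow> (\<Sum>p\<in>F. if snd p \<subseteq> V then emeasure lborel (snd p) else 0) \<le> 2 * emeasure lborel V"
  shows "\<exists>S. (\<forall>B i. sparse_family (S B i)) \<and> (\<forall>B i l. S B i l \<subseteq> dgrid (third_shift (k + int \<kappa>) B)) \<and>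
    (\<forall>B i. sparse_operator (S B i) (\<lambda>j x. ennreal (norm (f j x))) \<in> borel_measurable borel) \<and>
    (\<forall>y. ennreal (\<Sum>p\<in>F. star_mean f p * indicator (snd p) y) \<le>
       ennreal (2 ^ (\<kappa> * CARD('n))) ^ CARD('m) *
       (\<Sum>B\<in>(UNIV :: 'n set set). \<Sum>i<(4 * 2 ^ (\<kappa> * CARD('n)) :: nat). sparse_operator (S B i) (\<lambda>j x. ennreal (norm (f j x))) y))"
proof -
  define n where "n = CARD('n)"
  define c :: real where "c = 2 ^ (\<kappa> * n)"
  have c: "c > 0" by (simp add: c_def)
  define K where "K = k + int \<kappa>"
  define g where "g = (\<lambda>j x. ennreal (norm (f j x)))"
  have "\<forall>p. \<exists>Bw. p \<in> F \<longrightarrow> star (fst p) (snd p) \<subseteq> dcube (third_shift K (fst Bw)) (fst p + int \<kappa>) (snd Bw)"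
  proof
    fix p
    show "\<exists>Bw. p \<in> F \<longrightarrow> star (fst p) (snd p) \<subseteq> dcube (third_shift K (fst Bw)) (fst p + int \<kappa>) (snd Bw)"
    proof (cases "p \<in> F")
      case True
      obtain z where z: "snd p = dcube s (fst p) z" "fst p \<le> k" using lev[of "fst p" "snd p"] True by auto
      obtain B w where "star (fst p) (dcube s (fst p) z) \<subseteq> dcube (third_shift K B) (fst p + int \<kappa>) w"
        using star_in_third_grid[of "fst p" \<kappa> K s z] \<kappa> z(2) by (auto simp: K_def)
      thus ?thesis using z(1) by (intro exI[of _ "(B, w)"]) simp
    qed simp
  qed
  from choice[OF this] obtain Bw where
    Bw: "\<And>p. p \<in> F \<Longrightarrow> star (fst p) (snd p) \<subseteq> dcube (third_shift K (fst (Bw p))) (fst p + int \<kappa>) (snd (Bw p))" by blast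
  define R where "R p = dcube (third_shift K (fst (Bw p))) (fst p + int \<kappa>) (snd (Bw p))" for p
  have PR: "snd p \<subseteq> R p" if "p \<in> F" for p
    using Bw[OF that] star_superset[of "snd p" "fst p"] by (auto simp: R_def)
  have Rb: "R p \<in> sets borel" for p unfolding R_def by (rule dcube_measure(1))
  have Rm: "emeasure lborel (R p) = ennreal (c * (2 powi (fst p)) ^ n)" for p
  proof -
    have "((2::real) powi (fst p + int \<kappa>)) ^ n = c * (2 powi (fst p)) ^ n"
      by (simp add: power_int_add c_def power_mult power_mult_distrib)
    thus ?thesis unfolding R_def dcube_measure(2) n_def[symmetric] by simp
  qed
  have Rm': "emeasure lborel (R p) = ennreal c * emeasure lborel (snd p)" if pF: "p \<in> F" for p
  proof -
    obtain z where z: "snd p = dcube s (fst p) z" using lev[of "fst p" "snd p"] pF by auto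
    show ?thesis unfolding Rm unfolding z dcube_measure(2) n_def[symmetric] using c by (simp add: ennreal_mult)
  qed
  define Lam :: nat where "Lam = 2 * 2 ^ (\<kappa> * n)"
  have Lam: "Lam > 0" by (simp add: Lam_def)
  have Lam_c: "real Lam = c * 2" by (simp add: Lam_def c_def)
  define FB where "FB B = {p \<in> F. fst (Bw p) = B}" for B
  have finFB: "finite (FB B)" for B using fin by (simp add: FB_def)
  have FBF: "FB B \<subseteq> F" for B by (auto simp: FB_def)
  define G where "G B = R ` FB B" for B
  have finG: "finite (G B)" for B unfolding G_def using finFB by (rule finite_imageI)
  have subG: "G B \<subseteq> dgrid (third_shift K B)" for B by (auto simp: G_def FB_def R_def dgrid_def)
  have carG: "(\<Sum>H\<in>G B. if H \<subseteq> G0 then emeasure lborel H else 0) \<le> ennreal (real Lam) * emeasure lborel G0"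
    if G0: "G0 \<in> G B" for B G0
  proof -
    have G0b: "G0 \<in> sets borel" using G0 Rb by (auto simp: G_def)
    have "(\<Sum>H\<in>G B. if H \<subseteq> G0 then emeasure lborel H else 0) \<le> sum ((\<lambda>H. if H \<subseteq> G0 then emeasure lborel H else 0) \<circ> R) (FB B)"
      unfolding G_def by (rule sum_image_le[OF finFB]) simp
    also have "\<dots> \<le> (\<Sum>p\<in>FB B. ennreal c * (if snd p \<subseteq> G0 then emeasure lborel (snd p) else 0))"
    proof (rule sum_mono)
      fix p assume "p \<in> FB B"
      hence p: "p \<in> F" using FBF by blast
      show "((\<lambda>H. if H \<subseteq> G0 then emeasure lborel H else 0) \<circ> R) p \<le> ennreal c * (if snd p \<subseteq> G0 then emeasure lborel (snd p) else 0)"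
      proof (cases "R p \<subseteq> G0")
        case True
        hence "snd p \<subseteq> G0" using PR[OF p] by blast
        thus ?thesis using True Rm'[OF p] by simp
      qed simp
    qed
    also have "\<dots> \<le> (\<Sum>p\<in>F. ennreal c * (if snd p \<subseteq> G0 then emeasure lborel (snd p) else 0))"
      by (rule sum_mono2[OF fin FBF]) simp
    also have "\<dots> = ennreal c * (\<Sum>p\<in>F. if snd p \<subseteq> G0 then emeasure lborel (snd p) else 0)" by (rule sum_distrib_left[symmetric])
    also have "\<dots> \<le> ennreal c * (2 * emeasure lborel G0)" by (rule mult_left_mono[OF car[OF G0b]]) simp
    also have "\<dots> = ennreal (real Lam) * emeasure lborel G0" unfolding Lam_c using c by (simp add: ennreal_mult mult.assoc)
    finally show ?thesis .
  qed
  note ctx = finG subG dyadic_grid_dgrid carG Lam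
  define S where "S B i = layer (G B) Lam i" for B i
  have avg: "ennreal (star_mean f p) \<le> ennreal c ^ CARD('m) * (\<Prod>j\<in>UNIV. average (R p) (g j))" if p: "p \<in> F" for p
  proof -
    define L :: real where "L = (2 powi (fst p)) ^ n"
    have L: "L > 0" by (simp add: L_def)
    have one: "ennreal ((LINT y|lborel. norm (f j y) * indicator (star (fst p) (snd p)) y) / L) \<le> ennreal c * average (R p) (g j)" for j
    proof -
      define a where "a = (LINT y|lborel. norm (f j y) * indicator (star (fst p) (snd p)) y)"
      have a0: "a \<ge> 0" unfolding a_def by (intro Bochner_Integration.integral_nonneg) simp
      have [measurable]: "f j \<in> borel_measurable borel" by (rule bbsD(1)[OF f])
      have "integrable lborel (\<lambda>y. norm (f j y) * indicator (star (fst p) (snd p)) y)"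
        by (rule bbs_mass_integrable[OF f borel_open[OF star_open]])
      hence "ennreal a = (\<integral>\<^sup>+y. ennreal (norm (f j y) * indicator (star (fst p) (snd p)) y) \<partial>lborel)"
        unfolding a_def by (intro nn_integral_eq_integral[symmetric]) simp_all
      also have "\<dots> \<le> (\<integral>\<^sup>+y. g j y * indicator (R p) y \<partial>lborel)"
        using Bw[OF p] by (intro nn_integral_mono) (auto simp: g_def R_def indicator_def)
      also have "\<dots> = (\<integral>\<^sup>+y\<in>R p. g j y \<partial>lebesgue)" by (simp add: nn_integral_completion)
      finally have a: "ennreal a \<le> (\<integral>\<^sup>+y\<in>R p. g j y \<partial>lebesgue)" .
      have "ennreal (a / L) = ennreal (c * (a / (c * L)))" using c by simp
      also have "\<dots> = ennreal c * ennreal (a / (c * L))" using c by (intro ennreal_mult') simp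
      also have "ennreal (a / (c * L)) = ennreal a / ennreal (c * L)"
        using a0 c L by (intro divide_ennreal[symmetric]) simp_all
      also have "\<dots> \<le> average (R p) (g j)"
        unfolding average_def emeasure_lebesgue_borel[OF Rb] Rm L_def[symmetric] by (rule divide_right_mono_ennreal[OF a])
      finally show ?thesis by (simp add: a_def mult_left_mono)
    qed
    have "ennreal (star_mean f p) = (\<Prod>j\<in>UNIV. ennreal ((LINT y|lborel. norm (f j y) * indicator (star (fst p) (snd p)) y) / L))"
      unfolding star_mean_def case_prod_beta L_def n_def
      by (intro prod_ennreal[symmetric] divide_nonneg_nonneg Bochner_Integration.integral_nonneg) simp_all
    also have "\<dots> \<le> (\<Prod>j\<in>(UNIV::'m set). ennreal c * average (R p) (g j))" by (rule prod_mono_ennreal[OF one])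
    also have "\<dots> = ennreal c ^ CARD('m) * (\<Prod>j\<in>UNIV. average (R p) (g j))" by (simp add: prod.distrib)
    finally show ?thesis .
  qed
  have pt: "ennreal (\<Sum>p\<in>F. star_mean f p * indicator (snd p) y) \<le>
      ennreal c ^ CARD('m) * (\<Sum>B\<in>UNIV. \<Sum>i<2 * Lam. sparse_operator (S B i) g y)" for y
  proof -
    define h where "h H = (\<Prod>j\<in>UNIV. average H (g j)) * indicator H y" for H
    have nn: "star_mean f p \<ge> 0" for p using star_mean_nonneg[of f "fst p" "snd p"] by simp
    have group: "(\<Sum>p\<in>FB B. (\<Prod>j\<in>UNIV. average (R p) (g j)) * indicator (snd p) y) \<le> (\<Sum>i<2 * Lam. sparse_operator (S B i) g y)" for B
    proof -
      define A where "A = {p \<in> FB B. y \<in> snd p}"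
      \<comment> \<open>The level of \<open>P\<close> can be read off from \<open>R\<close>, and a point lies in one cube of each level.\<close>
      have inj: "inj_on R A"
      proof (rule inj_onI)
        fix p p' assume pp: "p \<in> A" "p' \<in> A" "R p = R p'"
        have l: "fst p = fst p'" using dcube_level_unique[OF pp(3)[unfolded R_def]] by simp
        obtain z where z: "snd p = dcube s (fst p) z" using lev[of "fst p" "snd p"] pp(1) by (auto simp: A_def FB_def)
        obtain z' where z': "snd p' = dcube s (fst p') z'" using lev[of "fst p'" "snd p'"] pp(2) by (auto simp: A_def FB_def)
        have "y \<in> snd p" "y \<in> snd p'" using pp by (auto simp: A_def)
        hence "dcube s (fst p) y = snd p" "dcube s (fst p') y = snd p'" unfolding z z' by (simp_all add: dcube_eq)
        hence "snd p = snd p'" using l by simp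
        thus "p = p'" using l by (rule prod_eqI[rotated])
      qed
      have "(\<Sum>p\<in>FB B. (\<Prod>j\<in>UNIV. average (R p) (g j)) * indicator (snd p) y) = (\<Sum>p\<in>A. (\<Prod>j\<in>UNIV. average (R p) (g j)) * indicator (snd p) y)"
        unfolding A_def using finFB by (intro sum.mono_neutral_right) auto
      also have "\<dots> = (\<Sum>p\<in>A. h (R p))"
      proof (rule sum.cong[OF refl])
        fix p assume "p \<in> A"
        hence "y \<in> snd p" "y \<in> R p" using PR[of p] by (auto simp: A_def FB_def)
        thus "(\<Prod>j\<in>UNIV. average (R p) (g j)) * indicator (snd p) y = h (R p)" by (simp add: h_def)
      qed
      also have "\<dots> = sum h (R ` A)" by (simp add: sum.reindex[OF inj])
      also have "\<dots> \<le> sum h (G B)" by (rule sum_mono2[OF finG]) (auto simp: A_def G_def)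
      also have "\<dots> = (\<Sum>i<2 * Lam. sparse_operator (S B i) g y)"
        unfolding h_def S_def by (rule sum_sparse_operators[OF ctx])
      finally show ?thesis .
    qed
    have "ennreal (\<Sum>p\<in>F. star_mean f p * indicator (snd p) y) = (\<Sum>p\<in>F. ennreal (star_mean f p * indicator (snd p) y))"
      using nn by (intro sum_ennreal[symmetric]) simp
    also have "\<dots> \<le> (\<Sum>p\<in>F. ennreal c ^ CARD('m) * ((\<Prod>j\<in>UNIV. average (R p) (g j)) * indicator (snd p) y))"
    proof (rule sum_mono)
      fix p assume p: "p \<in> F"
      show "ennreal (star_mean f p * indicator (snd p) y) \<le> ennreal c ^ CARD('m) * ((\<Prod>j\<in>UNIV. average (R p) (g j)) * indicator (snd p) y)"
        using avg[OF p] by (cases "y \<in> snd p") auto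
    qed
    also have "\<dots> = ennreal c ^ CARD('m) * (\<Sum>p\<in>F. (\<Prod>j\<in>UNIV. average (R p) (g j)) * indicator (snd p) y)"
      by (rule sum_distrib_left[symmetric])
    also have "(\<Sum>p\<in>F. (\<Prod>j\<in>UNIV. average (R p) (g j)) * indicator (snd p) y) =
       (\<Sum>B\<in>UNIV. \<Sum>p\<in>FB B. (\<Prod>j\<in>UNIV. average (R p) (g j)) * indicator (snd p) y)"
      unfolding FB_def by (rule sum.group[symmetric]) (use fin in auto)
    also have "ennreal c ^ CARD('m) * (\<Sum>B\<in>UNIV. \<Sum>p\<in>FB B. (\<Prod>j\<in>UNIV. average (R p) (g j)) * indicator (snd p) y) \<le>
       ennreal c ^ CARD('m) * (\<Sum>B\<in>UNIV. \<Sum>i<2 * Lam. sparse_operator (S B i) g y)"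
      by (intro mult_left_mono sum_mono group) simp
    finally show ?thesis .
  qed
  have L4: "2 * Lam = 4 * 2 ^ (\<kappa> * n)" by (simp add: Lam_def)
  show ?thesis
    unfolding n_def[symmetric] c_def[symmetric] g_def[symmetric] L4[symmetric] K_def[symmetric]
  proof (intro exI[of _ S] conjI allI)
    fix B i
    show "sparse_family (S B i)" unfolding S_def by (rule layer_sparse[OF ctx])
    show "S B i l \<subseteq> dgrid (third_shift K B)" for l unfolding S_def by (rule layer_subset[OF ctx])
    show "sparse_operator (S B i) g \<in> borel_measurable borel" unfolding S_def by (rule layer_operator_measurable[OF ctx])
  qed (rule pt)
qed

section \<open>Banach function norms\<close>

definition sparse_sup :: "((real^'n::finite \<Rightarrow> ennreal) \<Rightarrow> ennreal) \<Rightarrow> ('m::finite \<Rightarrow> real^'n \<Rightarrow> ennreal) \<Rightarrow> ennreal" where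
  "sparse_sup X g = (SUP D\<in>{D. dyadic_grid D}. SUP S\<in>{S. sparse_family S \<and> (\<forall>k. S k \<subseteq> D)}. X (sparse_operator S g))"

lemma sparse_sup_upper:
  assumes "dyadic_grid D" "sparse_family S" "\<And>k. S k \<subseteq> D"
  shows "X (sparse_operator S g) \<le> sparse_sup X g"
  unfolding sparse_sup_def
  by (rule SUP_upper2[of D]) (use assms in \<open>auto intro!: SUP_upper2[of S]\<close>)

text \<open>
  The axioms used here: the norm of the zero function, homogeneity, subadditivity, monotonicity and the Fatou property.
\<close>

lemma banach_function_normD:
  assumes "banach_function_norm M X"
  shows "f \<in> borel_measurable M \<Longrightarrow> (AE x in M. f x = 0) \<Longrightarrow> X f = 0"
    and "f \<in> borel_measurable M \<Longrightarrow> 0 \<le> a \<Longrightarrow> X (\<lambda>x. ennreal a * f x) = ennreal a * X f"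
    and "f \<in> borel_measurable M \<Longrightarrow> g \<in> borel_measurable M \<Longrightarrow> X (\<lambda>x. f x + g x) \<le> X f + X g"
    and "f \<in> borel_measurable M \<Longrightarrow> g \<in> borel_measurable M \<Longrightarrow> AE x in M. g x \<le> f x \<Longrightarrow> X g \<le> X f"
    and "(\<And>k. F k \<in> borel_measurable M) \<Longrightarrow> f \<in> borel_measurable M \<Longrightarrow>
      AE x in M. incseq (\<lambda>k. F k x) \<and> (\<lambda>k. F k x) \<longlonglongrightarrow> f x \<Longrightarrow> (\<lambda>k. X (F k)) \<longlonglongrightarrow> X f"
proof -
  note t0 = assms[unfolded banach_function_norm_def]
  note t1 = conjunct2[OF t0]
  note t2 = conjunct2[OF t1]
  note t3 = conjunct2[OF t2]
  note t4 = conjunct2[OF t3]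
  show "f \<in> borel_measurable M \<Longrightarrow> (AE x in M. f x = 0) \<Longrightarrow> X f = 0" using conjunct1[OF t0] by simp
  show "f \<in> borel_measurable M \<Longrightarrow> 0 \<le> a \<Longrightarrow> X (\<lambda>x. ennreal a * f x) = ennreal a * X f" using conjunct1[OF t1] by simp
  show "f \<in> borel_measurable M \<Longrightarrow> g \<in> borel_measurable M \<Longrightarrow> X (\<lambda>x. f x + g x) \<le> X f + X g" using conjunct1[OF t2] by simp
  show "f \<in> borel_measurable M \<Longrightarrow> g \<in> borel_measurable M \<Longrightarrow> AE x in M. g x \<le> f x \<Longrightarrow> X g \<le> X f" using conjunct1[OF t3] by simp
  assume a: "\<And>k. F k \<in> borel_measurable M" "f \<in> borel_measurable M" "AE x in M. incseq (\<lambda>k. F k x) \<and> (\<lambda>k. F k x) \<longlonglongrightarrow> f x"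
  from spec[OF spec[OF conjunct1[OF t4], of F], of f] a show "(\<lambda>k. X (F k)) \<longlonglongrightarrow> X f" by simp
qed

lemma banach_function_norm_sum:
  assumes X: "banach_function_norm M X" and G: "\<And>i. i \<in> I \<Longrightarrow> G i \<in> borel_measurable M"
  shows "X (\<lambda>x. \<Sum>i\<in>I. G i x) \<le> (\<Sum>i\<in>I. X (G i))"
  using G
proof (induction I rule: infinite_finite_induct)
  case (insert i I)
  have "X (\<lambda>x. \<Sum>i\<in>insert i I. G i x) = X (\<lambda>x. G i x + (\<Sum>i\<in>I. G i x))" using insert by simp
  also have "\<dots> \<le> X (G i) + X (\<lambda>x. \<Sum>i\<in>I. G i x)"
    by (rule banach_function_normD(3)[OF X]) (use insert.prems in auto)
  also have "\<dots> \<le> X (G i) + (\<Sum>i\<in>I. X (G i))" using insert by (intro add_left_mono) auto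
  finally show ?case using insert by simp
qed (use banach_function_normD(1)[OF X, of "\<lambda>x. 0"] in auto)

text \<open>
  A Lebesgue measurable function agrees almost everywhere with a Borel one, which is truncated so as to respect the
  bound and the support.
\<close>

lemma bounded_compactly_supported_borel_version:
  fixes f :: "real^'n::finite \<Rightarrow> complex"
  assumes "bounded_compactly_supported f"
  shows "\<exists>g. bbs g \<and> (AE x in lborel. f x = g x)"
proof -
  note a = assms[unfolded bounded_compactly_supported_def]
  have fm: "f \<in> borel_measurable lebesgue" using a by blast
  obtain M where M: "\<And>x. norm (f x) \<le> M" using a by (auto simp: bounded_iff)
  have "bounded {x. f x \<noteq> 0}" using a bounded_subset[OF compact_imp_bounded closure_subset] by blast
  then obtain b where b: "{x. f x \<noteq> 0} \<subseteq> cbox (-b) b" using bounded_subset_cbox_symmetric by blast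
  have "(\<lambda>x. Re (f x)) \<in> borel_measurable lebesgue" "(\<lambda>x. Im (f x)) \<in> borel_measurable lebesgue"
    using fm by measurable
  from this[THEN completion_ex_borel_measurable_real] obtain u v where
    uv: "u \<in> borel_measurable lborel" "AE x in lborel. Re (f x) = u x" "v \<in> borel_measurable lborel" "AE x in lborel. Im (f x) = v x" by blast
  have [measurable]: "u \<in> borel_measurable borel" "v \<in> borel_measurable borel" using uv by simp_all
  define w where "w = (\<lambda>x. complex_of_real (u x) + \<i> * complex_of_real (v x))"
  have wm [measurable]: "w \<in> borel_measurable borel" unfolding w_def by measurable
  define g where "g x = (if norm (w x) \<le> M \<and> x \<in> cbox (-b) b then w x else 0)" for x
  have gm: "g \<in> borel_measurable borel" unfolding g_def by measurable
  have M0: "0 \<le> M" using M[of 0] norm_ge_zero[of "f 0"] by linarith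
  have "bbs g" by (rule bbsI[where M = M and a = "-b" and b = b, OF gm]) (use M0 in \<open>auto simp: g_def\<close>)
  moreover have "AE x in lborel. f x = g x"
    using uv(2,4)
  proof eventually_elim
    case (elim x)
    hence "f x = w x" by (simp add: w_def complex_eq_iff)
    moreover have "x \<in> cbox (-b) b" if "f x \<noteq> 0" using b that by blast
    ultimately show "f x = g x" using M[of x] by (auto simp: g_def)
  qed
  ultimately show ?thesis by blast
qed

context CZ_operator
begin

lemma U_bbs_measurable: "(\<And>j. bbs (f j)) \<Longrightarrow> (\<lambda>y. ennreal (norm (U f y))) \<in> borel_measurable lebesgue"
proof -
  assume f: "\<And>j. bbs (f j)"
  have [measurable]: "U f \<in> borel_measurable lebesgue" by (rule U_measurable) (rule bbs_Lp(1)[OF f q_pos])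
  show ?thesis by measurable
qed

text \<open>
  The pointwise domination on one cube, taken in norm. The number of sparse operators, \<open>2\<^sup>n 4 2\<^sup>\<kappa>\<^sup>n\<close>, enters the
  constant through the triangle inequality.
\<close>

lemma local_norm_bound:
  "\<exists>c\<ge>0. \<forall>X (f :: 'm \<Rightarrow> real^'n \<Rightarrow> complex) s k x e. banach_function_norm lebesgue X \<longrightarrow> (\<forall>j. bbs (f j)) \<longrightarrow> e > 0 \<longrightarrow>
    (\<exists>Z. Z \<in> sets borel \<and> emeasure lborel Z \<le> ennreal e \<and>
      X (\<lambda>y. ennreal (norm (U (localize f (star k (dcube s k x))) y)) * indicator (dcube s k x - Z) y)
        \<le> ennreal c * sparse_sup X (\<lambda>j x. ennreal (norm (f j x))))"
proof -
  from local_sparse_domination obtain C where C: "C \<ge> 0" and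
    raw0: "\<forall>(f :: 'm \<Rightarrow> real^'n \<Rightarrow> complex) s k x N. (\<forall>j. bbs (f j)) \<longrightarrow>
    (\<exists>F Z. finite F \<and> (\<forall>(l, P)\<in>F. l \<le> k \<and> (\<exists>z. P = dcube s l z)) \<and>
      (\<forall>V\<in>sets borel. (\<Sum>p\<in>F. if snd p \<subseteq> V then emeasure lborel (snd p) else 0) \<le> 2 * emeasure lborel (V \<inter> dcube s k x)) \<and>
      Z \<in> sets borel \<and> emeasure lborel Z \<le> ennreal ((3/4) ^ N * (2 powi k) ^ CARD('n)) \<and>
      (AE y in lborel. y \<in> dcube s k x \<and> y \<notin> Z \<longrightarrow>
        norm (U (localize f (star k (dcube s k x))) y) \<le> C * (\<Sum>p\<in>F. star_mean f p * indicator (snd p) y)))"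
    by (elim exE conjE) (rule that)
  obtain \<kappa> where \<kappa>: "3 * (4 * real CARD('n) + 1) \<le> 2 ^ \<kappa>"
    using real_arch_pow[of 2 "3 * (4 * real CARD('n) + 1)"] by (auto simp del: dimn_eq intro: less_imp_le)
  define c1 :: real where "c1 = (2 ^ (\<kappa> * CARD('n))) ^ CARD('m)"
  define L :: nat where "L = 4 * 2 ^ (\<kappa> * CARD('n))"
  define c where "c = C * c1 * (real CARD('n set) * real L)"
  have c1: "c1 \<ge> 0" by (simp add: c1_def)
  show ?thesis
  proof (rule exI[of _ c], intro conjI allI impI)
    show "0 \<le> c" using C c1 by (simp add: c_def)
    fix X :: "(real^'n \<Rightarrow> ennreal) \<Rightarrow> ennreal" and f :: "'m \<Rightarrow> real^'n \<Rightarrow> complex" and s x :: "real^'n" and k :: int and e :: real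
    assume X: "banach_function_norm (lebesgue :: (real^'n) measure) X" and fb: "\<forall>j. bbs (f j)" and e: "e > 0"
    have f: "bbs (f j)" for j using fb by blast
    define Q where "Q = dcube s k x"
    define W where "W = localize f (star k Q)"
    define g where "g = (\<lambda>j x. ennreal (norm (f j x)))"
    define v :: real where "v = (2 powi k) ^ CARD('n)"
    have v: "v > 0" by (simp add: v_def)
    obtain N where "(3/4::real) ^ N < e / v" using real_arch_pow_inv[of "e / v" "3/4"] e v by auto
    hence N: "(3/4) ^ N * v \<le> e" using v by (simp add: field_simps)
    from mp[OF spec[OF spec[OF spec[OF spec[OF spec[OF raw0, of f], of s], of k], of x], of N] fb] obtain F Z where
      raw: "finite F \<and> (\<forall>(l, P)\<in>F. l \<le> k \<and> (\<exists>z. P = dcube s l z)) \<and>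
      (\<forall>V\<in>sets borel. (\<Sum>p\<in>F. if snd p \<subseteq> V then emeasure lborel (snd p) else 0) \<le> 2 * emeasure lborel (V \<inter> Q)) \<and>
      Z \<in> sets borel \<and> emeasure lborel Z \<le> ennreal ((3/4) ^ N * v) \<and>
      (AE y in lborel. y \<in> Q \<and> y \<notin> Z \<longrightarrow>
        norm (U W y) \<le> C * (\<Sum>p\<in>F. star_mean f p * indicator (snd p) y))"
      unfolding Q_def[symmetric] W_def[symmetric] v_def[symmetric] by (elim exE) (rule that)
    note t1 = conjunct2[OF raw]
    note t2 = conjunct2[OF t1]
    note t3 = conjunct2[OF t2]
    note t4 = conjunct2[OF t3]
    note Zb = conjunct1[OF t3] and Zm = conjunct1[OF t4] and dom = conjunct2[OF t4]
    have lev: "l \<le> k \<and> (\<exists>z. P = dcube s l z)" if "(l, P) \<in> F" for l P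
      using bspec[OF conjunct1[OF t1] that] by simp
    have car: "(\<Sum>p\<in>F. if snd p \<subseteq> V then emeasure lborel (snd p) else 0) \<le> 2 * emeasure lborel V" if V: "V \<in> sets borel" for V
    proof -
      have "emeasure lborel (V \<inter> Q) \<le> emeasure lborel V" using V by (intro emeasure_mono) auto
      from order_trans[OF bspec[OF conjunct1[OF t2] V] mult_left_mono[OF this]] show ?thesis by simp
    qed
    have "\<exists>S. (\<forall>B i. sparse_family (S B i)) \<and> (\<forall>B i l. S B i l \<subseteq> dgrid (third_shift (k + int \<kappa>) B)) \<and>
        (\<forall>B i. sparse_operator (S B i) g \<in> borel_measurable borel) \<and>
        (\<forall>y. ennreal (\<Sum>p\<in>F. star_mean f p * indicator (snd p) y) \<le>
          ennreal (2 ^ (\<kappa> * CARD('n))) ^ CARD('m) * (\<Sum>B\<in>(UNIV :: 'n set set). \<Sum>i<L. sparse_operator (S B i) g y))"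
      unfolding g_def L_def by (rule sparse_bound_of_local_family[OF \<kappa> f conjunct1[OF raw] lev car])
    then obtain S where
      S: "\<forall>B i. sparse_family (S B i)" "\<forall>B i l. S B i l \<subseteq> dgrid (third_shift (k + int \<kappa>) B)"
        "\<forall>B i. sparse_operator (S B i) g \<in> borel_measurable borel"
        "\<forall>y. ennreal (\<Sum>p\<in>F. star_mean f p * indicator (snd p) y) \<le>
          ennreal (2 ^ (\<kappa> * CARD('n))) ^ CARD('m) * (\<Sum>B\<in>(UNIV :: 'n set set). \<Sum>i<L. sparse_operator (S B i) g y)"
      by (elim exE conjE) (rule that)
    have Sm: "sparse_operator (S B i) g \<in> borel_measurable lebesgue" for B i
      using S(3) by (auto intro!: measurable_completion)
    have Sm': "(\<lambda>y. \<Sum>i<L. sparse_operator (S B i) g y) \<in> borel_measurable lebesgue" for B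
      by (intro borel_measurable_sum Sm)
    have c1e: "ennreal (2 ^ (\<kappa> * CARD('n))) ^ CARD('m) = ennreal c1" unfolding c1_def by (rule ennreal_power) simp
    have Wb: "bbs (W j)" for j
      unfolding W_def localize_def using bbs_mult_indicator[OF f[of j] borel_open[OF star_open[of k Q]]] by simp
    have Qb: "Q \<in> sets borel" unfolding Q_def by (rule dcube_measure(1))
    have QZ: "Q - Z \<in> sets lebesgue" using Qb Zb by (intro sets.Diff) (auto intro: sets_completionI_sets)
    have Um: "(\<lambda>y. ennreal (norm (U W y)) * indicator (Q - Z) y) \<in> borel_measurable lebesgue"
      by (intro borel_measurable_times_ennreal U_bbs_measurable Wb borel_measurable_indicator QZ)
    have "X (\<lambda>y. ennreal (norm (U W y)) * indicator (Q - Z) y) \<le> X (\<lambda>y. ennreal (C * c1) * (\<Sum>B\<in>UNIV. \<Sum>i<L. sparse_operator (S B i) g y))"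
    proof (rule banach_function_normD(4)[OF X _ Um])
      show "(\<lambda>y. ennreal (C * c1) * (\<Sum>B\<in>UNIV. \<Sum>i<L. sparse_operator (S B i) g y)) \<in> borel_measurable lebesgue"
        by (intro borel_measurable_times_ennreal borel_measurable_const borel_measurable_sum Sm)
      show "AE y in lebesgue. ennreal (norm (U W y)) * indicator (Q - Z) y \<le> ennreal (C * c1) * (\<Sum>B\<in>UNIV. \<Sum>i<L. sparse_operator (S B i) g y)"
        unfolding AE_completion_iff using dom
      proof eventually_elim
        case (elim y)
        show ?case
        proof (cases "y \<in> Q - Z")
          case True
          have "ennreal (norm (U W y)) \<le> ennreal (C * (\<Sum>p\<in>F. star_mean f p * indicator (snd p) y))"
            using elim True by (intro ennreal_leI) simp
          also have "\<dots> = ennreal C * ennreal (\<Sum>p\<in>F. star_mean f p * indicator (snd p) y)"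
            using C by (rule ennreal_mult')
          also have "\<dots> \<le> ennreal C * (ennreal c1 * (\<Sum>B\<in>UNIV. \<Sum>i<L. sparse_operator (S B i) g y))"
            using spec[OF S(4), of y] unfolding c1e by (rule mult_left_mono) simp
          also have "\<dots> = ennreal (C * c1) * (\<Sum>B\<in>UNIV. \<Sum>i<L. sparse_operator (S B i) g y)"
            using C c1 by (simp add: ennreal_mult mult.assoc)
          finally show ?thesis using True by simp
        qed simp
      qed
    qed
    also have "\<dots> = ennreal (C * c1) * X (\<lambda>y. \<Sum>B\<in>UNIV. \<Sum>i<L. sparse_operator (S B i) g y)"
      by (rule banach_function_normD(2)[OF X]) (use C c1 in \<open>auto intro!: borel_measurable_sum Sm\<close>)
    also have "\<dots> \<le> ennreal (C * c1) * (\<Sum>B\<in>(UNIV::'n set set). \<Sum>i<L. sparse_sup X g)"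
    proof (rule mult_left_mono)
      have "X (\<lambda>y. \<Sum>B\<in>UNIV. \<Sum>i<L. sparse_operator (S B i) g y) \<le> (\<Sum>B\<in>UNIV. X (\<lambda>y. \<Sum>i<L. sparse_operator (S B i) g y))"
        by (rule banach_function_norm_sum[OF X Sm'])
      also have "\<dots> \<le> (\<Sum>B\<in>UNIV. \<Sum>i<L. X (sparse_operator (S B i) g))"
        by (intro sum_mono banach_function_norm_sum[OF X Sm])
      also have "\<dots> \<le> (\<Sum>B\<in>(UNIV::'n set set). \<Sum>i<L. sparse_sup X g)"
      proof (intro sum_mono)
        fix B :: "'n set" and i assume "i \<in> {..<L}"
        show "X (sparse_operator (S B i) g) \<le> sparse_sup X g"
          by (rule sparse_sup_upper[OF dyadic_grid_dgrid[of "third_shift (k + int \<kappa>) B"]]) (simp_all only: S(1,2))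
      qed
      finally show "X (\<lambda>y. \<Sum>B\<in>UNIV. \<Sum>i<L. sparse_operator (S B i) g y) \<le> (\<Sum>B\<in>(UNIV::'n set set). \<Sum>i<L. sparse_sup X g)" .
    qed simp
    also have "(\<Sum>B\<in>(UNIV::'n set set). \<Sum>i<L. sparse_sup X g) = ennreal (real CARD('n set) * real L) * sparse_sup X g"
      by (simp add: ennreal_mult ennreal_of_nat_eq_real_of_nat mult.assoc del: dimn_eq)
    also have "ennreal (C * c1) * (ennreal (real CARD('n set) * real L) * sparse_sup X g) = ennreal c * sparse_sup X g"
      unfolding c_def using C c1 by (simp add: ennreal_mult mult.assoc)
    finally have "X (\<lambda>y. ennreal (norm (U W y)) * indicator (Q - Z) y) \<le> ennreal c * sparse_sup X g" .
    moreover have "emeasure lborel Z \<le> ennreal e" using order_trans[OF Zm ennreal_leI[OF N]] .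
    ultimately show "\<exists>Z. Z \<in> sets borel \<and> emeasure lborel Z \<le> ennreal e \<and>
      X (\<lambda>y. ennreal (norm (U (localize f (star k (dcube s k x))) y)) * indicator (dcube s k x - Z) y)
        \<le> ennreal c * sparse_sup X (\<lambda>j x. ennreal (norm (f j x)))"
      unfolding Q_def[symmetric] W_def[symmetric] g_def[symmetric] using Zb by (intro exI[of _ Z] conjI)
  qed
qed

end

section \<open>Exhaustion and the sparse bound\<close>

text \<open>
  The lattice is shifted so that the dyadic cube of side \<open>2\<^sup>N\<^sup>+\<^sup>1\<close> at the origin is centred there; cubes of one
  fixed dyadic grid need not exhaust the space.
\<close>

definition centred_cube :: "nat \<Rightarrow> (real^'n::finite) set" where
  "centred_cube N = dcube (\<chi> i. - (2 ^ N)) (int N + 1) 0"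

lemma centred_cube_iff:
  fixes y :: "real^'n::finite"
  shows "y \<in> centred_cube N \<longleftrightarrow> (\<forall>i. - (2 ^ N) \<le> y $ i \<and> y $ i < 2 ^ N)"
proof -
  have p: "(2::real) powi (int N + 1) = 2 * 2 ^ N" by (simp add: power_int_add)
  have z: "\<lfloor>(0 + 2 ^ N) / (2 * 2 ^ N) :: real\<rfloor> = 0" by (simp add: floor_eq_iff)
  have "\<lfloor>(t + 2 ^ N) / (2 * 2 ^ N) :: real\<rfloor> = 0 \<longleftrightarrow> - (2 ^ N) \<le> t \<and> t < 2 ^ N" for t :: real
    by (auto simp: floor_eq_iff field_simps)
  thus ?thesis unfolding centred_cube_def dcube_def p using z by simp
qed

lemma centred_cube_mono: "M \<le> N \<Longrightarrow> centred_cube M \<subseteq> (centred_cube N :: (real^'n::finite) set)"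
proof
  fix y :: "real^'n" assume MN: "M \<le> N" and y: "y \<in> centred_cube M"
  have p: "(2::real) ^ M \<le> 2 ^ N" using MN by (intro power_increasing) simp_all
  show "y \<in> centred_cube N" unfolding centred_cube_iff
  proof
    fix i
    have "- (2 ^ M) \<le> y $ i \<and> y $ i < 2 ^ M" using y unfolding centred_cube_iff by blast
    thus "- (2 ^ N) \<le> y $ i \<and> y $ i < 2 ^ N" using p by linarith
  qed
qed

lemma bounded_subset_centred_cube:
  assumes "bounded (B :: (real^'n::finite) set)" shows "\<exists>N. B \<subseteq> centred_cube N"
proof -
  obtain r where r: "\<And>y. y \<in> B \<Longrightarrow> norm y \<le> r" using assms by (auto simp: bounded_iff)
  obtain N where N: "r < 2 ^ N" using real_arch_pow[of 2 r] by auto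
  have "y \<in> centred_cube N" if "y \<in> B" for y
    unfolding centred_cube_iff
  proof
    fix i
    have "\<bar>y $ i\<bar> \<le> norm y" by (rule component_le_norm_cart)
    thus "- (2 ^ N) \<le> y $ i \<and> y $ i < 2 ^ N" using r[OF that] N by linarith
  qed
  thus ?thesis by blast
qed

context CZ_operator
begin

text \<open>
  On the centred cubes, which contain the support of \<open>f\<close> eventually, the localization is vacuous. The exceptional sets are chosen
  summable, so by Borel--Cantelli almost every point leaves them, and the truncations increase to \<open>\<bar>U f\<bar>\<close>.
\<close>

lemma sparse_norm_bound:
  "\<exists>c\<ge>0. \<forall>X (f :: 'm \<Rightarrow> real^'n \<Rightarrow> complex). banach_function_norm lebesgue X \<longrightarrow> (\<forall>j. bbs (f j)) \<longrightarrow>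
      X (\<lambda>y. ennreal (norm (U f y))) \<le> ennreal c * sparse_sup X (\<lambda>j x. ennreal (norm (f j x)))"
proof -
  from local_norm_bound obtain c where c: "c \<ge> 0" and
    loc: "\<forall>X (f :: 'm \<Rightarrow> real^'n \<Rightarrow> complex) s k x e. banach_function_norm lebesgue X \<longrightarrow> (\<forall>j. bbs (f j)) \<longrightarrow> e > 0 \<longrightarrow>
    (\<exists>Z. Z \<in> sets borel \<and> emeasure lborel Z \<le> ennreal e \<and>
      X (\<lambda>y. ennreal (norm (U (localize f (star k (dcube s k x))) y)) * indicator (dcube s k x - Z) y)
        \<le> ennreal c * sparse_sup X (\<lambda>j x. ennreal (norm (f j x))))"
    by (elim exE conjE) (rule that)
  show ?thesis
  proof (rule exI[of _ c], intro conjI allI impI)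
    fix X :: "(real^'n \<Rightarrow> ennreal) \<Rightarrow> ennreal" and f :: "'m \<Rightarrow> real^'n \<Rightarrow> complex"
    assume X: "banach_function_norm lebesgue X" and fb: "\<forall>j. bbs (f j)"
    define Y where "Y = ennreal c * sparse_sup X (\<lambda>j x. ennreal (norm (f j x)))"
    define Q :: "nat \<Rightarrow> (real^'n) set" where "Q = centred_cube"
    have Q: "Q N = dcube (\<chi> i. - (2 ^ N)) (int N + 1) 0" for N unfolding Q_def centred_cube_def ..
    have "bounded {x. f j x \<noteq> 0}" for j using fb by (simp add: bbs_def)
    hence "bounded (\<Union>j. {x. f j x \<noteq> 0})" by (intro bounded_UN) auto
    then obtain N0 where N0: "(\<Union>j. {x. f j x \<noteq> 0}) \<subseteq> Q N0" unfolding Q_def using bounded_subset_centred_cube by blast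
    have "\<forall>N. \<exists>Z. Z \<in> sets borel \<and> emeasure lborel Z \<le> ennreal ((1/2) ^ N) \<and>
        X (\<lambda>y. ennreal (norm (U f y)) * indicator (Q (N + N0) - Z) y) \<le> Y"
    proof
      fix N
      define R where "R = star (int (N + N0) + 1) (Q (N + N0))"
      have "localize f R = f"
      proof (intro HOL.ext)
        fix j y
        have "y \<in> R" if "f j y \<noteq> 0"
        proof -
          have "y \<in> Q N0" using N0 that by blast
          hence "y \<in> Q (N + N0)" using centred_cube_mono[of N0 "N + N0"] unfolding Q_def by auto
          thus ?thesis unfolding R_def using star_superset by blast
        qed
        thus "localize f R j y = f j y" by (cases "f j y = 0") (auto simp: localize_def)
      qed
      moreover have "\<exists>Z. Z \<in> sets borel \<and> emeasure lborel Z \<le> ennreal ((1/2) ^ N) \<and>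
        X (\<lambda>y. ennreal (norm (U (localize f R) y)) * indicator (Q (N + N0) - Z) y) \<le> Y"
        unfolding R_def Q Y_def by (rule loc[rule_format, OF X]) (use fb in auto)
      ultimately show "\<exists>Z. Z \<in> sets borel \<and> emeasure lborel Z \<le> ennreal ((1/2) ^ N) \<and>
        X (\<lambda>y. ennreal (norm (U f y)) * indicator (Q (N + N0) - Z) y) \<le> Y" by simp
    qed
    from choice[OF this] obtain Z where Z: "\<And>N. Z N \<in> sets borel" "\<And>N. emeasure lborel (Z N) \<le> ennreal ((1/2) ^ N)"
      "\<And>N. X (\<lambda>y. ennreal (norm (U f y)) * indicator (Q (N + N0) - Z N) y) \<le> Y" by blast
    have Zfin: "emeasure lborel (Z N) < \<infinity>" for N using Z(2)[of N] by (auto intro: le_less_trans simp del: ennreal_power)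
    have "summable (\<lambda>N. measure lborel (Z N))"
    proof (rule summable_comparison_test'[of "\<lambda>N. (1/2::real) ^ N" 0])
      show "norm (measure lborel (Z N)) \<le> (1/2) ^ N" for N
        using Z(2)[of N] by (simp add: measure_def enn2real_leI del: ennreal_power)
    qed (rule summable_geometric, simp)
    from borel_cantelli_AE1[OF _ Zfin this] Z(1)
    have bc: "AE y in lborel. eventually (\<lambda>N. y \<in> space lborel - Z N) sequentially" by simp
    \<comment> \<open>Removing all later exceptional sets as well makes the truncations monotone.\<close>
    define W where "W k = Q (k + N0) - (\<Union>i. Z (i + k))" for k
    define F where "F k y = ennreal (norm (U f y)) * indicator (W k) y" for k y
    have Qb: "Q N \<in> sets borel" for N unfolding Q by (rule dcube_measure(1))
    have Wm: "W k \<in> sets lebesgue" for k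
    proof -
      have "W k \<in> sets borel" unfolding W_def using Qb Z(1) by (intro sets.Diff sets.countable_UN) auto
      thus ?thesis by (auto intro: sets_completionI_sets)
    qed
    have QZm: "Q (k + N0) - Z k \<in> sets lebesgue" for k
      using Qb Z(1) by (intro sets.Diff) (auto intro: sets_completionI_sets)
    have Um: "(\<lambda>y. ennreal (norm (U f y))) \<in> borel_measurable lebesgue" using U_bbs_measurable[of f] fb by blast
    have Fm: "F k \<in> borel_measurable lebesgue" for k
      unfolding F_def by (intro borel_measurable_times_ennreal Um borel_measurable_indicator Wm)
    have Winc: "W k \<subseteq> W l" if kl: "k \<le> l" for k l
    proof -
      have "Q (k + N0) \<subseteq> Q (l + N0)" unfolding Q_def by (rule centred_cube_mono) (use kl in simp)
      moreover have "(\<Union>i. Z (i + l)) \<subseteq> (\<Union>i. Z (i + k))"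
      proof
        fix y assume "y \<in> (\<Union>i. Z (i + l))"
        then obtain i where "y \<in> Z (i + l)" by blast
        hence "y \<in> Z ((i + (l - k)) + k)" using kl by simp
        thus "y \<in> (\<Union>i. Z (i + k))" by blast
      qed
      ultimately show ?thesis unfolding W_def by blast
    qed
    have conv: "AE y in lebesgue. incseq (\<lambda>k. F k y) \<and> (\<lambda>k. F k y) \<longlonglongrightarrow> ennreal (norm (U f y))"
      unfolding AE_completion_iff using bc
    proof eventually_elim
      case (elim y)
      have inc: "incseq (\<lambda>k. F k y)"
        unfolding incseq_def F_def using Winc by (auto simp: indicator_def)
      obtain N1 where N1: "\<And>N. N \<ge> N1 \<Longrightarrow> y \<notin> Z N" using elim by (auto simp: eventually_sequentially)
      obtain N2 where "{y} \<subseteq> Q N2" unfolding Q_def using bounded_subset_centred_cube[of "{y}"] by auto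
      hence N2: "y \<in> Q N2" by simp
      have "F k y = ennreal (norm (U f y))" if k: "k \<ge> max N1 N2" for k
      proof -
        have "y \<in> Q (k + N0)" using N2 centred_cube_mono[of N2 "k + N0"] k unfolding Q_def by auto
        moreover have "y \<notin> Z (i + k)" for i using N1[of "i + k"] k by simp
        ultimately show ?thesis by (simp add: F_def W_def)
      qed
      hence "eventually (\<lambda>k. F k y = ennreal (norm (U f y))) sequentially"
        unfolding eventually_sequentially by blast
      hence "(\<lambda>k. F k y) \<longlonglongrightarrow> ennreal (norm (U f y))" by (rule tendsto_eventually)
      with inc show ?case by blast
    qed
    have lim: "(\<lambda>k. X (F k)) \<longlonglongrightarrow> X (\<lambda>y. ennreal (norm (U f y)))"
      by (rule banach_function_normD(5)[OF X Fm Um conv])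
    have "X (F k) \<le> Y" for k
    proof (rule order_trans[OF _ Z(3)[of k]], rule banach_function_normD(4)[OF X])
      show "(\<lambda>y. ennreal (norm (U f y)) * indicator (Q (k + N0) - Z k) y) \<in> borel_measurable lebesgue"
        by (intro borel_measurable_times_ennreal Um borel_measurable_indicator QZm)
      have "W k \<subseteq> Q (k + N0) - Z k"
      proof
        fix y assume y: "y \<in> W k"
        hence "y \<notin> Z (0 + k)" unfolding W_def by blast
        thus "y \<in> Q (k + N0) - Z k" using y by (simp add: W_def)
      qed
      thus "AE y in lebesgue. F k y \<le> ennreal (norm (U f y)) * indicator (Q (k + N0) - Z k) y"
        unfolding F_def by (intro AE_I2 mult_left_mono) (auto simp: indicator_def)
    qed (rule Fm)
    thus "X (\<lambda>y. ennreal (norm (U f y))) \<le> ennreal c * sparse_sup X (\<lambda>j x. ennreal (norm (f j x)))"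
      unfolding Y_def[symmetric] by (intro LIMSEQ_le_const2[OF lim]) auto
  qed (rule c)
qed

end

text \<open>
  Sparse operators see the functions only through their averages, so Borel versions may be used.
\<close>

lemma average_cong_AE: "AE x in lborel. g x = h x \<Longrightarrow> average Q g = average Q h"
  unfolding average_def nn_integral_completion
  by (intro arg_cong2[where f = "(/)"] nn_integral_cong_AE refl) (auto elim: eventually_mono)

theorem theorem1p4:
  fixes T :: "('m::finite \<Rightarrow> real^'n::finite \<Rightarrow> complex) \<Rightarrow> (real^'n \<Rightarrow> complex) \<Rightarrow> complex"
  assumes "multilinear_CZ_operator T"
  shows "\<exists>c::real. 0 \<le> c \<and>
    (\<forall>U X f. bounded_extension T U \<and>
       banach_function_norm (lebesgue :: (real^'n) measure) X \<and>
       (\<forall>i. bounded_compactly_supported (f i)) \<longrightarrow>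
       X (\<lambda>x. ennreal (norm (U f x)))
         \<le> ennreal c *
            (SUP D\<in>{D. dyadic_grid D}. SUP S\<in>{S. sparse_family S \<and> (\<forall>k. S k \<subseteq> D)}.
               X (sparse_operator S (\<lambda>i x. ennreal (norm (f i x))))))"
proof -
  obtain U0 q where q: "\<And>j. 1 \<le> q j" and U0: "bounded_extension_at q T U0"
    using assms unfolding multilinear_CZ_operator_def bounded_extension_def by blast
  obtain K where CZ: "CZ_kernel K" and hk: "has_kernel T K"
    using assms unfolding multilinear_CZ_operator_def by blast
  obtain A \<epsilon> where A: "A > 0" "\<epsilon> > 0" and kb: "\<And>y k l. y $ k \<noteq> y $ l \<Longrightarrow>
        norm (K y) \<le> A / kernel_dist y ^ (CARD('m) * CARD('n)) \<and>
        (\<forall>j y'. norm (y $ j - y') \<le> 1/2 * Max (range (\<lambda>k. norm (y $ j - y $ k))) \<longrightarrow>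
           norm (K y - K (\<chi> k. if k = j then y' else y $ k))
             \<le> A * norm (y $ j - y') powr \<epsilon> /
                kernel_dist y powr (real (CARD('m) * CARD('n)) + \<epsilon>))"
    using CZ unfolding CZ_kernel_def by blast
  have op: "CZ_operator q T U0 K A \<epsilon> (real CARD('m)) (real CARD('n))"
  proof unfold_locales
    show "norm (K y) \<le> A / kernel_dist y ^ (CARD('m) * CARD('n))" if "y $ k \<noteq> y $ l" for y k l
      using conjunct1[OF kb[OF that]] .
    show "norm (K y - K (\<chi> k. if k = j then y' else y $ k))
             \<le> A * norm (y $ j - y') powr \<epsilon> / kernel_dist y powr (real (CARD('m) * CARD('n)) + \<epsilon>)"
      if "y $ k \<noteq> y $ l" "norm (y $ j - y') \<le> 1/2 * Max (range (\<lambda>k. norm (y $ j - y $ k)))" for y k l j y'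
      using mp[OF spec[OF spec[OF conjunct2[OF kb[OF that(1)]]]] that(2)] .
  qed (rule refl A q U0 hk)+
  from CZ_operator.sparse_norm_bound[OF op] obtain c where c: "c \<ge> 0" and
    bd: "\<forall>X (f :: 'm \<Rightarrow> real^'n \<Rightarrow> complex). banach_function_norm lebesgue X \<longrightarrow> (\<forall>j. bbs (f j)) \<longrightarrow>
      X (\<lambda>y. ennreal (norm (U0 f y))) \<le> ennreal c * sparse_sup X (\<lambda>j x. ennreal (norm (f j x)))"
    by (elim exE conjE) (rule that)
  show ?thesis
    unfolding sparse_sup_def[symmetric]
  proof (rule exI[of _ c], intro conjI allI impI)
    fix U and X :: "(real^'n \<Rightarrow> ennreal) \<Rightarrow> ennreal" and f :: "'m \<Rightarrow> real^'n \<Rightarrow> complex"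
    assume h: "bounded_extension T U \<and> banach_function_norm (lebesgue :: (real^'n) measure) X \<and>
       (\<forall>i. bounded_compactly_supported (f i))"
    note X = conjunct1[OF conjunct2[OF h]]
    obtain q' where q': "\<And>j. 1 \<le> q' j" "bounded_extension_at q' T U"
      using conjunct1[OF h] unfolding bounded_extension_def by blast
    interpret E: bounded_multilinear_extension q' T U by unfold_locales (rule q')+
    interpret E0: bounded_multilinear_extension q T U0 by unfold_locales (rule q U0)+
    have "\<forall>j. \<exists>g. bbs g \<and> (AE x in lborel. f j x = g x)"
      using conjunct2[OF conjunct2[OF h]] bounded_compactly_supported_borel_version by blast
    from choice[OF this] obtain g where g: "\<And>j. bbs (g j)" "\<And>j. AE x in lborel. f j x = g j x" by blast
    have fm: "f j \<in> borel_measurable lebesgue" for j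
      using conjunct2[OF conjunct2[OF h]] by (simp add: bounded_compactly_supported_def)
    have gLp: "g j \<in> Lp_space (q' j)" for j by (rule bbs_Lp(1)[OF g(1) E.q_pos])
    have fLp: "f j \<in> Lp_space (q' j)" for j
    proof -
      have [measurable]: "f j \<in> borel_measurable lebesgue" "g j \<in> borel_measurable lebesgue"
        using fm gLp by (auto simp: Lp_space_def)
      have "AE x in lebesgue. norm (f j x) powr q' j = norm (g j x) powr q' j"
        unfolding AE_completion_iff using g(2)[of j] by eventually_elim simp
      hence "integrable lebesgue (\<lambda>x. norm (f j x) powr q' j) \<longleftrightarrow> integrable lebesgue (\<lambda>x. norm (g j x) powr q' j)"
        by (intro integrable_cong_AE) measurable
      thus ?thesis using gLp[of j] fm by (simp add: Lp_space_def)
    qed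
    have "AE x in lborel. U f x = U g x" by (rule E.U_cong_AE[OF fLp gLp g(2)])
    moreover have "AE x in lborel. U g x = U0 g x"
      by (rule bounded_extension_unique[OF E.bounded_multilinear_extension_axioms E0.bounded_multilinear_extension_axioms g(1)])
    ultimately have eq: "AE x in lebesgue. ennreal (norm (U f x)) \<le> ennreal (norm (U0 g x))"
      unfolding AE_completion_iff by eventually_elim simp
    have "U f \<in> borel_measurable lebesgue" "U0 g \<in> borel_measurable lebesgue"
      by (rule E.U_measurable[OF fLp], rule E0.U_measurable[OF bbs_Lp(1)[OF g(1) E0.q_pos]])
    hence m: "(\<lambda>x. ennreal (norm (U f x))) \<in> borel_measurable lebesgue" "(\<lambda>x. ennreal (norm (U0 g x))) \<in> borel_measurable lebesgue"
      by measurable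
    have avg: "average Q (\<lambda>x. ennreal (norm (f j x))) = average Q (\<lambda>x. ennreal (norm (g j x)))" for Q j
      by (rule average_cong_AE) (use g(2)[of j] in \<open>auto elim: eventually_mono\<close>)
    have "sparse_operator S (\<lambda>j x. ennreal (norm (f j x))) = sparse_operator S (\<lambda>j x. ennreal (norm (g j x)))" for S
      unfolding sparse_operator_def avg ..
    hence sup: "sparse_sup X (\<lambda>j x. ennreal (norm (f j x))) = sparse_sup X (\<lambda>j x. ennreal (norm (g j x)))"
      unfolding sparse_sup_def by simp
    have "X (\<lambda>x. ennreal (norm (U f x))) \<le> X (\<lambda>x. ennreal (norm (U0 g x)))"
      by (rule banach_function_normD(4)[OF X m(2) m(1) eq])
    also have "\<dots> \<le> ennreal c * sparse_sup X (\<lambda>j x. ennreal (norm (g j x)))"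
      using bd[rule_format, OF X] g(1) by blast
    finally show "X (\<lambda>x. ennreal (norm (U f x))) \<le> ennreal c * sparse_sup X (\<lambda>j x. ennreal (norm (f j x)))"
      unfolding sup .
  qed (rule c)
qed

end
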